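(* Let $H$ be the fundamental group of a compact special cube complex. There exist a finite-index subgroup $R$ of a right-angled Artin group and a finite-order, coarse-median preserving automorphism $\varphi\in\mathrm{Aut}(R)$ such that $\mathrm{Fix}(\varphi)\cong H$.
   Context: **RAAGs.** For a finite simplicial graph $\Gamma$, the right-angled Artin group $A_\Gamma$ is generated by the vertices of $\Gamma$, with relations saying that adjacent vertices commute. $\mathrm{Fix}(\varphi)=\{g:\varphi(g)=g\}$. **Special cube complexes.** A non-positively curved cube complex $Q$ is special if it admits a locally isometric immersion into the Salvetti complex of a right-angled Artin group. Equivalently: its hyperplanes are embedded (no hyperplane contains both mid-cubes of a square) and 2-sided; no hyperplane directly self-osculates (is dual to two distinct edges that, when oriented consistently across the hyperplane, both start or both end at a common vertex); and no two hyperplanes inter-osculate (both intersect each other and are dual to edges that share a vertex without spanning a square). **Coarse-median preserving automorphisms.** Let $R$ be a finite-index subgroup of $A_\Gamma$. The universal cover of the Salvetti complex of $A_\Gamma$ is a CAT(0) cube complex with vertex set identified with $A_\Gamma$; let $m:A_\Gamma^3\to A_\Gamma$ be the median operator on its vertex set. Choose a map $p:A_\Gamma\to R$ moving points a uniformly bounded distance (in a word metric on $A_\Gamma$) and set $\mu(x,y,z)=p(m(x,y,z))$ for $x,y,z\in R$. An automorphism $\varphi\in\mathrm{Aut}(R)$ is coarse-median preserving if, for a word metric $d$ on $R$ (with respect to a finite generating set), $\sup_{x,y,z\in R} d\big(\varphi(\mu(x,y,z)),\mu(\varphi(x),\varphi(y),\varphi(z))\big)<\infty$. This does not depend on the choices.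 *)

theory Defs
  imports
    "HOL-Analysis.Analysis"
    "HOL-Combinatorics.Permutations"
    "HOL-Algebra.Coset"
    "HOL-Algebra.Bij"
    "HOL-Algebra.Generated_Groups"
begin

section \<open>Groups given by presentations; right-angled Artin groups\<close>

text \<open>A letter \<open>(x, True)\<close> stands for the generator \<open>x\<close>, and \<open>(x, False)\<close> for its inverse.\<close>

type_synonym 'g group_word = "('g \<times> bool) list"

abbreviation words :: "'g set \<Rightarrow> 'g group_word set"
  where "words X \<equiv> lists (X \<times> UNIV)"

inductive word_eq :: "'g set \<Rightarrow> ('g group_word \<times> 'g group_word) set \<Rightarrow>
    'g group_word \<Rightarrow> 'g group_word \<Rightarrow> bool"
  for X :: "'g set" and Rel :: "('g group_word \<times> 'g group_word) set"
where
  refl: "w \<in> words X \<Longrightarrow> word_eq X Rel w w"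
| sym: "word_eq X Rel u w \<Longrightarrow> word_eq X Rel w u"
| trans: "word_eq X Rel u v \<Longrightarrow> word_eq X Rel v w \<Longrightarrow> word_eq X Rel u w"
| cancel: "u \<in> words X \<Longrightarrow> w \<in> words X \<Longrightarrow> x \<in> X \<Longrightarrow>
    word_eq X Rel (u @ [(x, b), (x, \<not> b)] @ w) (u @ w)"
| relator: "u \<in> words X \<Longrightarrow> w \<in> words X \<Longrightarrow> (r, s) \<in> Rel \<Longrightarrow>
    r \<in> words X \<Longrightarrow> s \<in> words X \<Longrightarrow> word_eq X Rel (u @ r @ w) (u @ s @ w)"

definition presented_group ::
    "'g set \<Rightarrow> ('g group_word \<times> 'g group_word) set \<Rightarrow> 'g group_word set monoid"
  where "presented_group X Rel =
    \<lparr>carrier = words X // {(u, w). word_eq X Rel u w},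
     mult = (\<lambda>A B. \<Union>u\<in>A. \<Union>w\<in>B. {v. word_eq X Rel (u @ w) v}),
     one = {v. word_eq X Rel [] v}\<rparr>"

definition finite_simplicial_graph :: "'v set \<Rightarrow> 'v set set \<Rightarrow> bool"
  where "finite_simplicial_graph V E \<longleftrightarrow>
    finite V \<and> E \<subseteq> {{a, b} | a b. a \<in> V \<and> b \<in> V \<and> a \<noteq> b}"

definition raag :: "'v set \<Rightarrow> 'v set set \<Rightarrow> 'v group_word set monoid"
  where "raag V E = presented_group V
    {([(a, True), (b, True)], [(b, True), (a, True)]) | a b. {a, b} \<in> E}"

definition raag_generators :: "'v set \<Rightarrow> 'v set set \<Rightarrow> 'v group_word set set"
  where "raag_generators V E =
    {A \<in> carrier (raag V E). \<exists>v\<in>V. [(v, True)] \<in> A}"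

section \<open>Word metrics, medians and coarse-median preserving automorphisms\<close>

definition word_length :: "('a, 'b) monoid_scheme \<Rightarrow> 'a set \<Rightarrow> 'a \<Rightarrow> nat"
  where "word_length G T g =
    (LEAST n. \<exists>xs. length xs = n \<and> set xs \<subseteq> T \<union> m_inv G ` T \<and>
       foldr (mult G) xs (one G) = g)"

definition word_dist :: "('a, 'b) monoid_scheme \<Rightarrow> 'a set \<Rightarrow> 'a \<Rightarrow> 'a \<Rightarrow> nat"
  where "word_dist G T x y = word_length G T (inv\<^bsub>G\<^esub> x \<otimes>\<^bsub>G\<^esub> y)"

text \<open>
  The 1-skeleton of the universal cover of the Salvetti complex is the Cayley graph of the group
  with respect to the vertices of the graph. The median of three vertices of a CAT(0) cube complex
  is the unique vertex lying on combinatorial geodesics between each two of them.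
\<close>

definition raag_dist ::
    "'v set \<Rightarrow> 'v set set \<Rightarrow> 'v group_word set \<Rightarrow> 'v group_word set \<Rightarrow> nat"
  where "raag_dist V E = word_dist (raag V E) (raag_generators V E)"

definition raag_interval ::
    "'v set \<Rightarrow> 'v set set \<Rightarrow> 'v group_word set \<Rightarrow> 'v group_word set \<Rightarrow> 'v group_word set set"
  where "raag_interval V E x y =
    {z \<in> carrier (raag V E). raag_dist V E x z + raag_dist V E z y = raag_dist V E x y}"

definition raag_median ::
    "'v set \<Rightarrow> 'v set set \<Rightarrow> 'v group_word set \<Rightarrow> 'v group_word set \<Rightarrow> 'v group_word set
      \<Rightarrow> 'v group_word set"
  where "raag_median V E x y z =
    (THE m. m \<in> raag_interval V E x y \<inter> raag_interval V E y z \<inter> raag_interval V E x z)"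

definition finite_generating_set :: "('a, 'b) monoid_scheme \<Rightarrow> 'a set \<Rightarrow> bool"
  where "finite_generating_set G T \<longleftrightarrow>
    finite T \<and> T \<subseteq> carrier G \<and> generate G T = carrier G"

definition coarse_median_preserving ::
    "'v set \<Rightarrow> 'v set set \<Rightarrow> 'v group_word set set \<Rightarrow>
     ('v group_word set \<Rightarrow> 'v group_word set) \<Rightarrow> bool"
  where "coarse_median_preserving V E R \<phi> \<longleftrightarrow>
    (\<exists>p U T.
       finite_generating_set (raag V E) U \<and>
       p \<in> carrier (raag V E) \<rightarrow> R \<and>
       (\<exists>B. \<forall>x\<in>carrier (raag V E). word_dist (raag V E) U x (p x) \<le> B) \<and>
       finite_generating_set (raag V E\<lparr>carrier := R\<rparr>) T \<and>
       (let \<mu> = (\<lambda>x y z. p (raag_median V E x y z)) in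
         \<exists>B. \<forall>x\<in>R. \<forall>y\<in>R. \<forall>z\<in>R.
           word_dist (raag V E\<lparr>carrier := R\<rparr>) T (\<phi> (\<mu> x y z)) (\<mu> (\<phi> x) (\<phi> y) (\<phi> z)) \<le> B))"

definition fixed_points :: "('a, 'b) monoid_scheme \<Rightarrow> ('a \<Rightarrow> 'a) \<Rightarrow> 'a set"
  where "fixed_points G \<phi> = {g \<in> carrier G. \<phi> g = g}"

section \<open>The fundamental group\<close>

definition loops_at :: "'a::topological_space set \<Rightarrow> 'a \<Rightarrow> (real \<Rightarrow> 'a) set"
  where "loops_at Q x =
    {g. path g \<and> path_image g \<subseteq> Q \<and> pathstart g = x \<and> pathfinish g = x}"

definition fundamental_group :: "'a::topological_space set \<Rightarrow> 'a \<Rightarrow> (real \<Rightarrow> 'a) set monoid"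
  where "fundamental_group Q x =
    \<lparr>carrier = loops_at Q x // {(f, g). homotopic_paths Q f g},
     mult = (\<lambda>A B. \<Union>f\<in>A. \<Union>g\<in>B. {h. homotopic_paths Q (f +++ g) h}),
     one = {h. homotopic_paths Q (\<lambda>_. x) h}\<rparr>"

section \<open>Cube complexes\<close>

text \<open>The unit \<open>n\<close>-cube; coordinates from \<open>n\<close> on are set to zero.\<close>

definition cube :: "nat \<Rightarrow> (nat \<Rightarrow> real) set"
  where "cube n = {x. (\<forall>i<n. 0 \<le> x i \<and> x i \<le> 1) \<and> (\<forall>i\<ge>n. x i = 0)}"

definition open_cube :: "nat \<Rightarrow> (nat \<Rightarrow> real) set"
  where "open_cube n = {x. (\<forall>i<n. 0 < x i \<and> x i < 1) \<and> (\<forall>i\<ge>n. x i = 0)}"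

definition cube_vertices :: "nat \<Rightarrow> (nat \<Rightarrow> real) set"
  where "cube_vertices n = {x. (\<forall>i<n. x i \<in> {0, 1}) \<and> (\<forall>i\<ge>n. x i = 0)}"

text \<open>The isometries of the \<open>n\<close>-cube: permutations of the coordinates combined with reflections.\<close>

definition cube_isometries :: "nat \<Rightarrow> ((nat \<Rightarrow> real) \<Rightarrow> nat \<Rightarrow> real) set"
  where "cube_isometries n =
    {(\<lambda>x j. if j \<in> F then 1 - x (\<pi> j) else x (\<pi> j)) | \<pi> F. \<pi> permutes {..<n} \<and> F \<subseteq> {..<n}}"

text \<open>The embedding of the \<open>n\<close>-cube as the codimension-one face \<open>x i = \<delta>\<close> of the \<open>(n+1)\<close>-cube.\<close>

definition face_embedding :: "nat \<Rightarrow> real \<Rightarrow> (nat \<Rightarrow> real) \<Rightarrow> nat \<Rightarrow> real"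
  where "face_embedding i \<delta> x = (\<lambda>j. if j < i then x j else if j = i then \<delta> else x (j - 1))"

text \<open>
  A cube complex is a space \<open>Q\<close> obtained from a disjoint union of unit cubes, indexed by \<open>C\<close>, by
  gluing along isometries of faces. The characteristic map \<open>\<kappa> c\<close> of a cube need only be injective on
  the open cube (distinct faces of one cube may be identified with each other, as in a torus).
\<close>

locale cube_complex =
  fixes Q :: "'a::topological_space set"
    and C :: "'c set"
    and cdim :: "'c \<Rightarrow> nat"
    and \<kappa> :: "'c \<Rightarrow> (nat \<Rightarrow> real) \<Rightarrow> 'a"
  assumes quotient:
      "quotient_map (sum_topology (\<lambda>c. top_of_set (cube (cdim c))) C) (top_of_set Q)
         (\<lambda>(c, x). \<kappa> c x)"
    and open_cubes_partition:
      "bij_betw (\<lambda>(c, x). \<kappa> c x) (SIGMA c:C. open_cube (cdim c)) Q"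
    and faces:
      "c \<in> C \<Longrightarrow> i < cdim c \<Longrightarrow> \<delta> \<in> {0, 1} \<Longrightarrow>
         \<exists>c'\<in>C. \<exists>\<sigma>\<in>cube_isometries (cdim c'). cdim c = Suc (cdim c') \<and>
           (\<forall>x\<in>cube (cdim c'). \<kappa> c (face_embedding i \<delta> x) = \<kappa> c' (\<sigma> x))"
begin

text \<open>The pair \<open>(e, \<delta>)\<close> is the edge \<open>e\<close> traversed from its endpoint \<open>\<delta>\<close> to its endpoint \<open>1 - \<delta>\<close>.\<close>

definition oriented_edges :: "('c \<times> real) set"
  where "oriented_edges = {e \<in> C. cdim e = 1} \<times> {0, 1}"

definition edge_point :: "'c \<times> real \<Rightarrow> real \<Rightarrow> 'a"
  where "edge_point a t = \<kappa> (fst a) ((\<lambda>_. 0)(0 := \<bar>snd a - t\<bar>))"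

definition edge_start :: "'c \<times> real \<Rightarrow> 'a"
  where "edge_start a = edge_point a 0"

definition edge_end :: "'c \<times> real \<Rightarrow> 'a"
  where "edge_end a = edge_point a 1"

definition edge_reverse :: "'c \<times> real \<Rightarrow> 'c \<times> real"
  where "edge_reverse a = (fst a, 1 - snd a)"

definition corners :: "('c \<times> (nat \<Rightarrow> real)) set"
  where "corners = (SIGMA c:C. cube_vertices (cdim c))"

text \<open>\<open>a\<close> is the edge of the cube \<open>c\<close> leaving its vertex \<open>v\<close> in the \<open>i\<close>-th direction.\<close>

definition edge_at :: "'c \<Rightarrow> (nat \<Rightarrow> real) \<Rightarrow> nat \<Rightarrow> 'c \<times> real \<Rightarrow> bool"
  where "edge_at c v i a \<longleftrightarrow> a \<in> oriented_edges \<and>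
    (\<forall>t\<in>{0..1}. \<kappa> c (v(i := \<bar>v i - t\<bar>)) = edge_point a t)"

subsection \<open>Links\<close>

text \<open>
  The link of a point \<open>q\<close> that is a vertex has a vertex for every oriented edge starting at \<open>q\<close>, and
  an \<open>n - 1\<close>-simplex for every corner at \<open>q\<close> of an \<open>n\<close>-cube, with the following vertices.
\<close>

definition corner_link :: "'c \<Rightarrow> (nat \<Rightarrow> real) \<Rightarrow> ('c \<times> real) set"
  where "corner_link c v = {a. \<exists>i<cdim c. edge_at c v i a}"

definition spans_square :: "'c \<times> real \<Rightarrow> 'c \<times> real \<Rightarrow> bool"
  where "spans_square a b \<longleftrightarrow>
    (\<exists>(c, v)\<in>corners. \<exists>i<2. \<exists>j<2. cdim c = 2 \<and> i \<noteq> j \<and> edge_at c v i a \<and> edge_at c v j b)"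

subsection \<open>Hyperplanes\<close>

definition opposite_in_square :: "'c \<times> real \<Rightarrow> 'c \<times> real \<Rightarrow> bool"
  where "opposite_in_square a b \<longleftrightarrow>
    (\<exists>(c, v)\<in>corners. \<exists>i<2. \<exists>j<2. cdim c = 2 \<and> i \<noteq> j \<and>
       edge_at c v i a \<and> edge_at c (v(j := 1 - v j)) i b)"

text \<open>Parallel edges are dual to the same hyperplane, and consistently oriented across it.\<close>

definition parallel :: "'c \<times> real \<Rightarrow> 'c \<times> real \<Rightarrow> bool"
  where "parallel = opposite_in_square\<^sup>*\<^sup>*"

text \<open>A hyperplane is represented by the set of (unoriented) edges dual to it.\<close>

definition hyperplane_of :: "'c \<times> real \<Rightarrow> 'c set"
  where "hyperplane_of a = {fst b | b. parallel a b}"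

definition hyperplanes :: "'c set set"
  where "hyperplanes = hyperplane_of ` oriented_edges"

definition hyperplanes_cross :: "'c set \<Rightarrow> 'c set \<Rightarrow> bool"
  where "hyperplanes_cross h k \<longleftrightarrow>
    (\<exists>a b. spans_square a b \<and> fst a \<in> h \<and> fst b \<in> k)"

definition two_sided :: "'c set \<Rightarrow> bool"
  where "two_sided h \<longleftrightarrow>
    (\<forall>a\<in>oriented_edges. fst a \<in> h \<longrightarrow> \<not> parallel a (edge_reverse a))"

definition directly_self_osculates :: "'c set \<Rightarrow> bool"
  where "directly_self_osculates h \<longleftrightarrow>
    (\<exists>a\<in>oriented_edges. \<exists>b\<in>oriented_edges. fst a \<in> h \<and> fst b \<in> h \<and> parallel a b \<and>
       fst a \<noteq> fst b \<and> (edge_start a = edge_start b \<or> edge_end a = edge_end b))"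

text \<open>
  The pair of edges is considered together with the ends at which they meet: if one of them is a
  loop, every coincidence of ends has to be filled by a corner of a square.
\<close>

definition inter_osculate :: "'c set \<Rightarrow> 'c set \<Rightarrow> bool"
  where "inter_osculate h k \<longleftrightarrow> hyperplanes_cross h k \<and>
    (\<exists>a\<in>oriented_edges. \<exists>b\<in>oriented_edges. fst a \<in> h \<and> fst b \<in> k \<and>
       edge_start a = edge_start b \<and> \<not> spans_square a b)"

end

text \<open>Non-positive curvature: the link of every vertex is a flag simplicial complex.\<close>

locale npc_cube_complex = cube_complex +
  assumes link_simplices_nondegenerate:
      "(c, v) \<in> corners \<Longrightarrow> card (corner_link c v) = cdim c"
    and link_simplices_determined:
      "(c, v) \<in> corners \<Longrightarrow> (c', v') \<in> corners \<Longrightarrow> cdim c > 0 \<Longrightarrow> cdim c' > 0 \<Longrightarrow>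
         corner_link c v = corner_link c' v' \<Longrightarrow> c = c' \<and> v = v'"
    and link_flag:
      "A \<subseteq> {a \<in> oriented_edges. edge_start a = q} \<Longrightarrow> finite A \<Longrightarrow> A \<noteq> {} \<Longrightarrow>
         (\<forall>a\<in>A. \<forall>b\<in>A. a \<noteq> b \<longrightarrow> spans_square a b) \<Longrightarrow>
         \<exists>(c, v)\<in>corners. corner_link c v = A"

locale special_cube_complex = npc_cube_complex +
  assumes hyperplanes_embedded: "h \<in> hyperplanes \<Longrightarrow> \<not> hyperplanes_cross h h"
    and hyperplanes_two_sided: "h \<in> hyperplanes \<Longrightarrow> two_sided h"
    and no_direct_self_osculation: "h \<in> hyperplanes \<Longrightarrow> \<not> directly_self_osculates h"
    and no_inter_osculation:
      "h \<in> hyperplanes \<Longrightarrow> k \<in> hyperplanes \<Longrightarrow> h \<noteq> k \<Longrightarrow> \<not> inter_osculate h k"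

end

theory Submission imports Defs begin

text \<open>
  Label every oriented edge of the cube complex by the hyperplane it crosses. Speciality makes this a
  deterministic labelled graph: each hyperplane acts on the vertices by a partial injection, and
  partial injections of crossing hyperplanes commute. Take two generators for every hyperplane,
  commuting with those of the crossing hyperplanes. The first acts by the permutation that closes
  every maximal chain of the partial injection to a cycle, the second exchanges the two ends of each
  chain. Let \<open>R\<close> be the stabiliser of a base vertex. At every vertex there is a permutation of
  order dividing 6 of the four letters over a hyperplane that fixes precisely the letters of actual
  edges, and preserves the target of every letter; rewriting a word letter by letter along its run
  gives an automorphism of \<open>R\<close>. It extends to an isometry of the Cayley graph, so it preserves
  medians exactly. Its fixed points are represented by reduced words that are rewritten to themselves,
  that is, by closed edge paths.

  It remains to identify closed edge paths up to commutations and cancellations of letters with the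
  fundamental group. Commutations are homotopies across squares. Every path is homotopic to an edge path
  because points have neighbourhoods that contract within cubes. Conversely, a path that is
  sampled finely has a holonomy in the group, namely the product of the hyperplanes that it crosses,
  and this is invariant under homotopy.
\<close>

section \<open>Words and presented groups\<close>

text \<open>Closing the partial injections to permutations already embeds the labels of closed edge
  paths in \<open>R\<close>, but added edges are then indistinguishable from actual ones. An
  automorphism that keeps the states must move each added letter to another letter with the same
  source and target. An added loop can be inverted, but in general the edge that closes a chain is
  alone in its position. This is what the second generator is for: at either end of a non-cyclic
  chain, its two letters and the closing letter lead to the same vertex, and three letters are
  permuted without fixed point only by a 3-cycle. Cycles of length 2 and 3 give the order 6. The
  generator of a letter is never replaced by an adjacent one; hence an element is fixed only if each
  letter of a reduced word is. A second obstacle is topological: \<open>Q\<close> carries a quotient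
  topology, so everything continuous is defined cube by cube and must respect the identifications of
  faces. For the holonomy this dictates functions of a hyperplane coordinate that agree at 0 and
  1.\<close>

definition linv :: "'g \<times> bool \<Rightarrow> 'g \<times> bool"
  where "linv a = (fst a, \<not> snd a)"

definition winv :: "'g group_word \<Rightarrow> 'g group_word"
  where "winv w = rev (map linv w)"

lemma linv_simps [simp]: "linv (linv a) = a" "fst (linv a) = fst a" "snd (linv a) = (\<not> snd a)"
    "linv (x, b) = (x, \<not> b)" "linv a \<noteq> a"
  by (auto simp: linv_def prod_eq_iff)

lemma winv_simps [simp]: "winv [] = []" "winv (a # w) = winv w @ [linv a]"
    "winv (u @ w) = winv w @ winv u" "winv (winv w) = w" "length (winv w) = length w"
  by (auto simp: winv_def rev_map comp_def)

lemma letter_in_iff [simp]: "a \<in> X \<times> (UNIV :: bool set) \<longleftrightarrow> fst a \<in> X"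
  by (cases a) auto

lemma in_words_iff [simp]: "w \<in> words X \<longleftrightarrow> (\<forall>a\<in>set w. fst a \<in> X)"
  by (auto simp: in_lists_conv_set)

declare ball_Un [simp]

lemma set_winv [simp]: "set (winv w) = linv ` set w"
  by (simp add: winv_def)

lemma winv_in_words: "winv w \<in> words X \<longleftrightarrow> w \<in> words X"
  by auto

lemma word_eq_reflI [simp]: "\<forall>a\<in>set w. fst a \<in> X \<Longrightarrow> word_eq X Rel w w"
  by (rule word_eq.refl) simp

context
  fixes X :: "'g set" and Rel :: "('g group_word \<times> 'g group_word) set"
begin

lemma word_eq_in_words: "word_eq X Rel u w \<Longrightarrow> u \<in> words X \<and> w \<in> words X"
  by (induction rule: word_eq.induct) auto

lemma word_eq_append_right:
  "word_eq X Rel u w \<Longrightarrow> v \<in> words X \<Longrightarrow> word_eq X Rel (u @ v) (w @ v)"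
proof (induction rule: word_eq.induct)
  case (refl w)
  then show ?case by (intro word_eq.refl) simp
next
  case (cancel u w x b)
  then show ?case using word_eq.cancel[of u X "w @ v" x Rel b] by simp
next
  case (relator u w r s)
  then show ?case using word_eq.relator[of u X "w @ v" r s Rel] by simp
qed (auto intro: word_eq.sym word_eq.trans)

lemma word_eq_append_left:
  "word_eq X Rel u w \<Longrightarrow> v \<in> words X \<Longrightarrow> word_eq X Rel (v @ u) (v @ w)"
proof (induction rule: word_eq.induct)
  case (refl w)
  then show ?case by (intro word_eq.refl) simp
next
  case (cancel u w x b)
  then show ?case using word_eq.cancel[of "v @ u" X w x Rel b] by simp
next
  case (relator u w r s)
  then show ?case using word_eq.relator[of "v @ u" X w r s Rel] by simp
qed (auto intro: word_eq.sym word_eq.trans)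

lemma word_eq_append:
  "word_eq X Rel u w \<Longrightarrow> word_eq X Rel u' w' \<Longrightarrow> word_eq X Rel (u @ u') (w @ w')"
  using word_eq_append_left word_eq_append_right word_eq_in_words word_eq.trans by metis

lemma word_eq_cancel_letter: "fst a \<in> X \<Longrightarrow> word_eq X Rel [a, linv a] []"
  using word_eq.cancel[of "[]" X "[]" "fst a" Rel "snd a"] by (simp add: linv_def)

lemma word_eq_winv_right: "w \<in> words X \<Longrightarrow> word_eq X Rel (w @ winv w) []"
proof (induction w)
  case Nil
  then show ?case by (simp add: word_eq.refl)
next
  case (Cons a w)
  then have "word_eq X Rel ([a] @ (w @ winv w) @ [linv a]) ([a] @ [] @ [linv a])"
    by (intro word_eq_append_left word_eq_append_right) auto
  moreover have "word_eq X Rel [a, linv a] []" using Cons by (intro word_eq_cancel_letter) auto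
  ultimately show ?case by (auto intro: word_eq.trans)
qed

lemma word_eq_winv_left: "w \<in> words X \<Longrightarrow> word_eq X Rel (winv w @ w) []"
  using word_eq_winv_right[of "winv w"] by simp

lemma word_eq_left_cancel:
  assumes "word_eq X Rel (v @ u) (v @ w)" "v \<in> words X" "u \<in> words X" "w \<in> words X"
  shows "word_eq X Rel u w"
proof -
  have "word_eq X Rel ((winv v @ v) @ u) ((winv v @ v) @ w)"
    using word_eq_append_left[OF assms(1), of "winv v"] assms by simp
  moreover have "word_eq X Rel ((winv v @ v) @ u) ([] @ u)" "word_eq X Rel ((winv v @ v) @ w) ([] @ w)"
    using assms by (auto intro!: word_eq_append_right word_eq_winv_left simp del: append_assoc append_Nil)
  ultimately show ?thesis by (metis append_Nil word_eq.sym word_eq.trans)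
qed

lemma word_eq_iff_winv:
  assumes "u \<in> words X" "w \<in> words X"
  shows "word_eq X Rel u w \<longleftrightarrow> word_eq X Rel (winv u @ w) []"
proof
  assume "word_eq X Rel u w"
  then show "word_eq X Rel (winv u @ w) []"
    using word_eq_append_left[of u w "winv u"] word_eq_winv_left[of u] assms
    by (auto intro: word_eq.trans word_eq.sym)
next
  assume "word_eq X Rel (winv u @ w) []"
  then have "word_eq X Rel (winv u @ w) (winv u @ u)"
    using word_eq_winv_left[of u] assms by (auto intro: word_eq.trans word_eq.sym)
  then show "word_eq X Rel u w" using word_eq_left_cancel assms word_eq.sym by (metis winv_in_words)
qed

definition word_class :: "'g group_word \<Rightarrow> 'g group_word set"
  where "word_class w = {v. word_eq X Rel w v}"

lemma word_class_eq_iff: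
  "w \<in> words X \<Longrightarrow> word_class u = word_class w \<longleftrightarrow> word_eq X Rel u w"
proof
  assume "w \<in> words X" "word_class u = word_class w"
  then have "w \<in> word_class u" by (simp add: word_class_def word_eq.refl)
  then show "word_eq X Rel u w" by (simp add: word_class_def)
next
  assume "word_eq X Rel u w"
  then show "word_class u = word_class w"
    unfolding word_class_def by (auto intro: word_eq.trans dest: word_eq.sym)
qed

lemma carrier_presented: "carrier (presented_group X Rel) = word_class ` words X"
  by (auto simp: presented_group_def quotient_def word_class_def)

lemma carrier_presentedE:
  assumes "g \<in> carrier (presented_group X Rel)"
  obtains w where "w \<in> words X" "g = word_class w"
  using assms by (auto simp: carrier_presented)

lemma word_class_in_carrier: "w \<in> words X \<Longrightarrow> word_class w \<in> carrier (presented_group X Rel)"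
  by (auto simp: carrier_presented)

lemma mult_presented:
  assumes "u \<in> words X" "w \<in> words X"
  shows "word_class u \<otimes>\<^bsub>presented_group X Rel\<^esub> word_class w = word_class (u @ w)"
proof -
  have "word_eq X Rel (u' @ w') v \<longleftrightarrow> word_eq X Rel (u @ w) v"
    if "word_eq X Rel u u'" "word_eq X Rel w w'" for u' w' v
    using word_eq_append[OF that] by (meson word_eq.sym word_eq.trans)
  moreover have "u \<in> word_class u" "w \<in> word_class w"
    using assms by (auto simp: word_class_def intro!: word_eq.refl)
  ultimately show ?thesis
    unfolding presented_group_def word_class_def by (simp, blast)
qed

lemma one_presented: "\<one>\<^bsub>presented_group X Rel\<^esub> = word_class []"
  by (simp add: presented_group_def word_class_def)

lemma group_presented: "group (presented_group X Rel)"
proof (rule groupI)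
  let ?G = "presented_group X Rel"
  show "\<one>\<^bsub>?G\<^esub> \<in> carrier ?G" by (simp add: one_presented word_class_in_carrier)
  fix x assume "x \<in> carrier ?G"
  then obtain u where u: "u \<in> words X" "x = word_class u" by (rule carrier_presentedE)
  show "\<one>\<^bsub>?G\<^esub> \<otimes>\<^bsub>?G\<^esub> x = x"
    using mult_presented[of "[]" u] u by (simp add: one_presented)
  have "word_class (winv u) \<otimes>\<^bsub>?G\<^esub> x = \<one>\<^bsub>?G\<^esub>"
    using mult_presented[of "winv u" u] u word_class_eq_iff[of "[]" "winv u @ u"] word_eq_winv_left[of u]
    by (simp add: one_presented)
  then show "\<exists>y\<in>carrier ?G. y \<otimes>\<^bsub>?G\<^esub> x = \<one>\<^bsub>?G\<^esub>"
    using u word_class_in_carrier[of "winv u"] by (metis winv_in_words)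
  fix y assume "y \<in> carrier ?G"
  then obtain v where v: "v \<in> words X" "y = word_class v" by (rule carrier_presentedE)
  show "x \<otimes>\<^bsub>?G\<^esub> y \<in> carrier ?G"
    using mult_presented[of u v] u v word_class_in_carrier[of "u @ v"] by simp
  fix z assume "z \<in> carrier ?G"
  then obtain w where w: "w \<in> words X" "z = word_class w" by (rule carrier_presentedE)
  show "x \<otimes>\<^bsub>?G\<^esub> y \<otimes>\<^bsub>?G\<^esub> z = x \<otimes>\<^bsub>?G\<^esub> (y \<otimes>\<^bsub>?G\<^esub> z)"
    using mult_presented[of u v] mult_presented[of v w] mult_presented[of "u @ v" w]
      mult_presented[of u "v @ w"] u v w by simp
qed

lemma inv_presented:
  assumes "w \<in> words X"
  shows "inv\<^bsub>presented_group X Rel\<^esub> (word_class w) = word_class (winv w)"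
  using assms mult_presented[of "winv w" w] word_class_eq_iff[of "[]" "winv w @ w"] word_eq_winv_left[of w]
    word_class_in_carrier[of w] word_class_in_carrier[of "winv w"]
  by (intro group.inv_equality[OF group_presented]) (simp_all add: one_presented)

end

section \<open>Normal forms for words modulo commutations and cancellations\<close>

section \<open>The word problem in right-angled Artin groups\<close>

definition comm_rel :: "'v set set \<Rightarrow> ('v group_word \<times> 'v group_word) set"
  where "comm_rel E = {([(a, True), (b, True)], [(b, True), (a, True)]) | a b. {a, b} \<in> E}"

lemma raag_eq: "raag V E = presented_group V (comm_rel E)"
  by (simp add: raag_def comm_rel_def)

text \<open>
  A piling holds one stack per generator. A letter is pushed as \<open>Some \<epsilon>\<close> on its own stack and as
  \<open>None\<close> on the stacks of all generators it does not commute with, so that two words have the same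
  piling iff they differ by commutations.
\<close>

type_synonym 'v piling = "'v \<Rightarrow> bool option list"

text \<open>Tops decide cancellation with the last letter of a word, bottoms decide which letters
  can be moved to its front. An empty stack and a \<open>None\<close> entry both read as
  \<open>None\<close>, since neither offers a letter.\<close>

definition top_of :: "'v piling \<Rightarrow> 'v \<Rightarrow> bool option"
  where "top_of p v = (case p v of [] \<Rightarrow> None | x # _ \<Rightarrow> x)"

definition bottom_of :: "'v piling \<Rightarrow> 'v \<Rightarrow> bool option"
  where "bottom_of p v = (if p v = [] then None else last (p v))"

definition push :: "'v set set \<Rightarrow> 'v \<times> bool \<Rightarrow> 'v piling \<Rightarrow> 'v piling"
  where "push E a p = (\<lambda>u. if u = fst a then Some (snd a) # p u
     else if {u, fst a} \<in> E then p u else None # p u)"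

definition pop :: "'v set set \<Rightarrow> 'v \<Rightarrow> 'v piling \<Rightarrow> 'v piling"
  where "pop E v p = (\<lambda>u. if u = v then tl (p u) else if {u, v} \<in> E then p u else tl (p u))"

text \<open>Words are read from left to right, so this is right multiplication by a letter. The
  opposite sign on top of its own stack means that the inverse letter can be commuted to the end of
  the word, where it cancels.\<close>

definition lact :: "'v set set \<Rightarrow> 'v \<times> bool \<Rightarrow> 'v piling \<Rightarrow> 'v piling"
  where "lact E a p = (if top_of p (fst a) = Some (\<not> snd a) then pop E (fst a) p else push E a p)"

lemma pop_push [simp]: "pop E (fst a) (push E a p) = p"
  by (auto simp: pop_def push_def)

lemma top_push: "top_of (push E a p) v = (if v = fst a then Some (snd a)
   else if {v, fst a} \<in> E then top_of p v else None)"
  by (auto simp: push_def top_of_def)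

locale raag_graph =
  fixes V :: "'v set" and E :: "'v set set"
  assumes finite_V: "finite V"
    and edges_sub: "E \<subseteq> {{a, b} | a b. a \<in> V \<and> b \<in> V \<and> a \<noteq> b}"
begin

abbreviation weq (infix "\<triangleq>" 50) where "u \<triangleq> w \<equiv> word_eq V (comm_rel E) u w"

lemma edge_distinct: "{a, b} \<in> E \<Longrightarrow> a \<noteq> b"
  using edges_sub by (fastforce simp: doubleton_eq_iff)

lemma edge_in_V: "{a, b} \<in> E \<Longrightarrow> a \<in> V \<and> b \<in> V"
  using edges_sub by (fastforce simp: doubleton_eq_iff)

lemma pop_invert: 
  assumes "fst a \<in> V" "u \<in> words V" "w \<in> words V"
  shows "u @ [a, linv a] @ w \<triangleq> u @ w"
  using word_eq.cancel[of u V w "fst a" "comm_rel E" "snd a"] assms by (simp add: linv_def)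

lemma letters_commute:
  assumes "{fst a, fst b} \<in> E"
  shows "[a, b] \<triangleq> [b, a]"
proof -
  have V: "fst a \<in> V" "fst b \<in> V" using edge_in_V[OF assms] by auto
  \<comment> \<open>replacing a letter by its inverse: conjugate the relation by it\<close>
  have flip: "[linv c, d] \<triangleq> [d, linv c]" if "[c, d] \<triangleq> [d, c]" "fst c \<in> V" "fst d \<in> V" for c d
  proof -
    have "[linv c] @ [d, c] @ [linv c] \<triangleq> [linv c] @ [c, d] @ [linv c]"
      using that by (intro word_eq_append_left word_eq_append_right) (auto intro: word_eq.sym)
    moreover have "[linv c, d] @ [c, linv c] @ [] \<triangleq> [linv c, d] @ []"
      using that by (intro pop_invert) auto
    moreover have "[] @ [linv c, linv (linv c)] @ [d, linv c] \<triangleq> [] @ [d, linv c]"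
      using that by (intro pop_invert) auto
    ultimately show ?thesis by (simp, meson word_eq.sym word_eq.trans)
  qed
  have 1: "[(fst a, True), (fst b, True)] \<triangleq> [(fst b, True), (fst a, True)]"
    using word_eq.relator[of "[]" V "[]" "[(fst a, True), (fst b, True)]" "[(fst b, True), (fst a, True)]" "comm_rel E"]
      assms V by (auto simp: comm_rel_def)
  have 2: "[(fst a, \<epsilon>), (fst b, True)] \<triangleq> [(fst b, True), (fst a, \<epsilon>)]" for \<epsilon>
    using 1 flip[OF 1] V by (cases \<epsilon>) auto
  have "[(fst b, \<delta>), (fst a, \<epsilon>)] \<triangleq> [(fst a, \<epsilon>), (fst b, \<delta>)]" for \<epsilon> \<delta>
    using 2[of \<epsilon>] flip[OF word_eq.sym[OF 2[of \<epsilon>]]] V by (cases \<delta>) (auto intro: word_eq.sym)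
  from word_eq.sym[OF this[of "snd b" "snd a"]] show ?thesis by simp
qed

subsection \<open>Pilings\<close>

text \<open>These are the pilings built without cancellation. \<open>pop\<close> removes an entry
  from every non-commuting stack, which undoes a push only if those entries are the markers of the
  same letter; validity guarantees this.\<close>

inductive valid :: "'v piling \<Rightarrow> bool" where
  valid_empty: "valid (\<lambda>_. [])"
| valid_push: "valid p \<Longrightarrow> fst a \<in> V \<Longrightarrow> top_of p (fst a) \<noteq> Some (\<not> snd a) \<Longrightarrow> valid (push E a p)"

lemma push_commute:
  assumes "{fst a, fst b} \<in> E" shows "push E a (push E b p) = push E b (push E a p)"
proof -
  have "{fst b, fst a} \<in> E" "fst a \<noteq> fst b" using assms edge_distinct by (auto simp: insert_commute)
  with assms show ?thesis by (auto simp: push_def fun_eq_iff)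
qed

text \<open>If the last push was not on \<open>v\<close>, it commutes with \<open>v\<close>, as
  otherwise its marker would cover the top. So \<open>push_commute\<close> exchanges it with the
  letter found inductively.\<close>

lemma valid_top:
  assumes "valid p" "top_of p v = Some \<epsilon>"
  shows "\<exists>p'. valid p' \<and> p = push E (v, \<epsilon>) p' \<and> top_of p' v \<noteq> Some (\<not> \<epsilon>)"
  using assms
proof (induction rule: valid.induct)
  case valid_empty
  then show ?case by (simp add: top_of_def)
next
  case (valid_push p a)
  show ?case
  proof (cases "v = fst a")
    case True
    with valid_push show ?thesis by (cases a) (auto simp: top_push)
  next
    case False
    with valid_push.prems have e: "{v, fst a} \<in> E" and "top_of p v = Some \<epsilon>"
      by (auto simp: top_push split: if_splits)
    with valid_push.IH obtain p' where p': "valid p'" "p = push E (v, \<epsilon>) p'" "top_of p' v \<noteq> Some (\<not> \<epsilon>)"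
      by auto
    have e': "{fst a, v} \<in> E" using e by (simp add: insert_commute)
    have "top_of p' (fst a) = top_of p (fst a)" using p' False e' by (simp add: top_push)
    then have "valid (push E a p')" using valid_push.hyps p' by (auto intro: valid.valid_push)
    moreover have "push E a p = push E (v, \<epsilon>) (push E a p')"
      using push_commute[of a "(v, \<epsilon>)" p'] e' p' by simp
    moreover have "top_of (push E a p') v \<noteq> Some (\<not> \<epsilon>)" using p' False e by (simp add: top_push)
    ultimately show ?thesis by blast
  qed
qed

lemma valid_lact: "valid p \<Longrightarrow> fst a \<in> V \<Longrightarrow> valid (lact E a p)"
  using valid_top[of p "fst a" "\<not> snd a"] pop_push[of E "(fst a, \<not> snd a)"]
  by (auto simp: lact_def intro: valid_push)

lemma lact_inverse: assumes "valid p" shows "lact E (linv a) (lact E a p) = p"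
proof (cases "top_of p (fst a) = Some (\<not> snd a)")
  case True
  then obtain p' where "valid p'" "p = push E (linv a) p'" "top_of p' (fst a) \<noteq> Some (snd a)"
    using valid_top[OF assms True] by (auto simp: linv_def)
  then show ?thesis using pop_push[of E "linv a" p'] True by (simp add: lact_def)
next
  case False
  then show ?thesis by (simp add: lact_def top_push)
qed

text \<open>A letter does not touch the stacks of commuting generators, so whether one of the two
  letters cancels does not depend on the other. Each of the four cases then reduces to
  \<open>push_commute\<close>.\<close>

lemma lact_commute:
  assumes "valid p" "{fst a, fst b} \<in> E"
  shows "lact E a (lact E b p) = lact E b (lact E a p)"
proof -
  have e: "{fst b, fst a} \<in> E" "fst a \<noteq> fst b" using assms edge_distinct by (auto simp: insert_commute)
  have top1: "top_of (lact E c q) v = top_of q v" if "{v, fst c} \<in> E" for c v q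
    using that edge_distinct[OF that] by (auto simp: lact_def top_of_def pop_def push_def)
  show ?thesis
  proof (cases "top_of p (fst a) = Some (\<not> snd a)")
    case a: True
    then obtain q where q: "valid q" "p = push E (linv a) q" "top_of q (fst a) \<noteq> Some (snd a)"
      using valid_top[OF assms(1) a] by (auto simp: linv_def)
    have aq: "lact E a p = q" using a q(2) pop_push[of E "linv a" q] by (simp add: lact_def)
    show ?thesis
    proof (cases "top_of p (fst b) = Some (\<not> snd b)")
      case b: True
      then have "top_of q (fst b) = Some (\<not> snd b)" using q e by (simp add: top_push)
      then obtain r where r: "valid r" "q = push E (linv b) r"
        using valid_top[OF q(1)] by (auto simp: linv_def)
      have "p = push E (linv b) (push E (linv a) r)" using q r push_commute[of "linv a" "linv b" r] assms(2) by simp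
      then have "lact E b p = push E (linv a) r"
        using b pop_push[of E "linv b" "push E (linv a) r"] by (simp add: lact_def)
      moreover have "lact E b q = r"
        using r pop_push[of E "linv b" r] by (simp add: lact_def top_push)
      moreover have "lact E a (push E (linv a) r) = r"
        using pop_push[of E "linv a" r] by (simp add: lact_def top_push)
      ultimately show ?thesis using aq by simp
    next
      case b: False
      then have "lact E b p = push E (linv a) (push E b q)"
        using q push_commute[of "linv a" b q] assms(2) by (simp add: lact_def)
      then have "lact E a (lact E b p) = push E b q"
        using pop_push[of E "linv a" "push E b q"] by (simp add: lact_def top_push)
      moreover have "top_of q (fst b) = top_of p (fst b)" using q e by (simp add: top_push)
      ultimately show ?thesis using aq b by (simp add: lact_def)
    qed
  next
    case a: False
    then have ap: "lact E a p = push E a p" by (simp add: lact_def)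
    have ab: "top_of (lact E b p) (fst a) \<noteq> Some (\<not> snd a)" using a top1 assms(2) by simp
    show ?thesis
    proof (cases "top_of p (fst b) = Some (\<not> snd b)")
      case b: True
      then obtain q where q: "valid q" "p = push E (linv b) q"
        using valid_top[OF assms(1) b] by (auto simp: linv_def)
      have bq: "lact E b p = q" using b q(2) pop_push[of E "linv b" q] by (simp add: lact_def)
      have "push E a p = push E (linv b) (push E a q)" using q push_commute[of a "linv b" q] assms(2) by simp
      then have "lact E b (push E a p) = push E a q"
        using pop_push[of E "linv b" "push E a q"] by (simp add: lact_def top_push)
      moreover have "lact E a q = push E a q" using ab bq by (simp add: lact_def)
      ultimately show ?thesis using ap bq by simp
    next
      case b: False
      then have "lact E b p = push E b p" by (simp add: lact_def)
      moreover have "lact E b (push E a p) = push E b (push E a p)" using b e by (simp add: lact_def top_push)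
      moreover have "lact E a (push E b p) = push E a (push E b p)" using a e by (simp add: lact_def top_push insert_commute)
      ultimately show ?thesis using ap push_commute assms(2) by simp
    qed
  qed
qed

definition piling :: "'v group_word \<Rightarrow> 'v piling"
  where "piling w = fold (lact E) w (\<lambda>_. [])"

lemma piling_Nil [simp]: "piling [] = (\<lambda>_. [])"
  by (simp add: piling_def)

lemma piling_snoc [simp]: "piling (w @ [a]) = lact E a (piling w)"
  by (simp add: piling_def)

lemma valid_fold: "w \<in> words V \<Longrightarrow> valid p \<Longrightarrow> valid (fold (lact E) w p)"
  by (induction w arbitrary: p) (auto intro!: valid_lact)

lemma valid_piling: "w \<in> words V \<Longrightarrow> valid (piling w)"
  by (simp add: piling_def valid_fold valid_empty)

text \<open>The defining relations hold for the action by \<open>lact_inverse\<close> and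
  \<open>lact_commute\<close>. Hence pilings are invariants of group elements and not merely of
  words up to commutation.\<close>

lemma word_eq_fold: "u \<triangleq> w \<Longrightarrow> valid p \<Longrightarrow> fold (lact E) u p = fold (lact E) w p"
proof (induction arbitrary: p rule: word_eq.induct)
  case (cancel u w x b)
  then have "valid (fold (lact E) u p)" by (simp add: valid_fold)
  from lact_inverse[OF this, of "(x, b)"] show ?case by simp
next
  case (relator u w r s)
  then have "valid (fold (lact E) u p)" by (simp add: valid_fold)
  then show ?case using relator lact_commute[of "fold (lact E) u p"] 
    by (auto simp: comm_rel_def insert_commute)
qed auto

lemma word_eq_piling: "u \<triangleq> w \<Longrightarrow> piling u = piling w"
  by (simp add: piling_def word_eq_fold valid_empty)

text \<open>Each letter contributes one signed entry; the \<open>None\<close> entries are its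
  markers on other stacks and must not be counted.\<close>

definition psize :: "'v piling \<Rightarrow> nat"
  where "psize p = (\<Sum>v\<in>V. length (filter (\<lambda>x. x \<noteq> None) (p v)))"

lemma psize_push: "fst a \<in> V \<Longrightarrow> psize (push E a p) = Suc (psize p)"
proof -
  assume a: "fst a \<in> V"
  have "length (filter (\<lambda>x. x \<noteq> None) (push E a p v))
      = length (filter (\<lambda>x. x \<noteq> None) (p v)) + (if v = fst a then 1 else 0)" for v
    by (auto simp: push_def)
  then show ?thesis using a finite_V by (simp add: psize_def sum.distrib)
qed

lemma psize_lact:
  assumes "valid p" "fst a \<in> V"
  shows "if top_of p (fst a) = Some (\<not> snd a) then psize p = Suc (psize (lact E a p))
    else psize (lact E a p) = Suc (psize p)"
  using valid_top[OF assms(1), of "fst a" "\<not> snd a"] psize_push assms pop_push[of E "linv a"]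
  by (auto simp: lact_def linv_def psize_push)

text \<open>Taken from the piling, this length is invariant under \<open>word_eq\<close> by
  construction; \<open>glen_cls\<close> identifies it with the word length of the group.\<close>

definition wlen :: "'v group_word \<Rightarrow> nat" where "wlen w = psize (piling w)"

definition reduced :: "'v group_word \<Rightarrow> bool" where "reduced w \<longleftrightarrow> wlen w = length w"

lemma wlen_Nil [simp]: "wlen [] = 0" by (simp add: wlen_def psize_def)

lemma reduced_Nil [simp]: "reduced []" by (simp add: reduced_def)

lemma wlen_cong: "u \<triangleq> w \<Longrightarrow> wlen u = wlen w"
  by (simp add: wlen_def word_eq_piling)

lemma wlen_snoc:
  assumes "w \<in> words V" "fst a \<in> V"
  shows "if top_of (piling w) (fst a) = Some (\<not> snd a) then wlen w = Suc (wlen (w @ [a]))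
    else wlen (w @ [a]) = Suc (wlen w)"
  using psize_lact[OF valid_piling[OF assms(1)] assms(2)] by (simp add: wlen_def)

lemma wlen_append_le: "u \<in> words V \<Longrightarrow> w \<in> words V \<Longrightarrow> wlen (u @ w) \<le> wlen u + length w"
proof (induction w rule: rev_induct)
  case (snoc a w)
  then show ?case using wlen_snoc[of "u @ w" a] by (auto split: if_splits)
qed simp

lemma wlen_le_length: "w \<in> words V \<Longrightarrow> wlen w \<le> length w"
  using wlen_append_le[of "[]" w] by simp

lemma reduced_append_left:
  assumes "reduced (u @ w)" "u \<in> words V" "w \<in> words V" shows "reduced u"
  using assms wlen_append_le[of u w] wlen_le_length[of u] by (simp add: reduced_def)

lemma reduced_snoc:
  assumes "w \<in> words V" "fst a \<in> V"
  shows "reduced (w @ [a]) \<longleftrightarrow> reduced w \<and> top_of (piling w) (fst a) \<noteq> Some (\<not> snd a)"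
  using wlen_snoc[OF assms] wlen_le_length[OF assms(1)] by (auto simp: reduced_def split: if_splits)

lemma piling_reduced_snoc:
  "w \<in> words V \<Longrightarrow> fst a \<in> V \<Longrightarrow> reduced (w @ [a]) \<Longrightarrow> piling (w @ [a]) = push E a (piling w)"
  by (simp add: reduced_snoc lact_def)

subsection \<open>Rewriting by commutations and cancellations\<close>

text \<open>There is no insertion of cancelling pairs. This matters for edge paths: a swap or
  deletion in the label of an edge path can be carried out on the path itself, whereas an inserted
  letter need not belong to any edge at the vertex reached.\<close>

inductive rstep :: "'v group_word \<Rightarrow> 'v group_word \<Rightarrow> bool" where
  swap: "u \<in> words V \<Longrightarrow> w \<in> words V \<Longrightarrow> {fst a, fst b} \<in> E \<Longrightarrow> rstep (u @ [a, b] @ w) (u @ [b, a] @ w)"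
| del: "u \<in> words V \<Longrightarrow> w \<in> words V \<Longrightarrow> fst a \<in> V \<Longrightarrow> rstep (u @ [a, linv a] @ w) (u @ w)"

lemma rstep_word_eq: "rstep u w \<Longrightarrow> u \<triangleq> w"
proof (induction rule: rstep.induct)
  case (swap u w a b)
  then show ?case by (intro word_eq_append_left word_eq_append_right letters_commute)
next
  case (del u w a)
  then show ?case by (intro pop_invert)
qed

lemma rsteps_word_eq: "rstep\<^sup>*\<^sup>* u w \<Longrightarrow> u \<in> words V \<Longrightarrow> u \<triangleq> w"
  by (induction rule: rtranclp_induct) (auto intro: word_eq.trans rstep_word_eq)

lemma rstep_append: "rstep u w \<Longrightarrow> v \<in> words V \<Longrightarrow> rstep (u @ v) (w @ v)"
proof (induction rule: rstep.induct)
  case (swap u w a b)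
  then show ?case using rstep.swap[of u "w @ v" a b] by simp
next
  case (del u w a)
  then show ?case using rstep.del[of u "w @ v" a] by simp
qed

lemma rsteps_append: "rstep\<^sup>*\<^sup>* u w \<Longrightarrow> v \<in> words V \<Longrightarrow> rstep\<^sup>*\<^sup>* (u @ v) (w @ v)"
proof (induction rule: rtranclp_induct)
  case (step y z)
  then show ?case using rstep_append[of y z v] by (meson rtranclp.rtrancl_into_rtrancl)
qed simp

text \<open>The word form of \<open>valid_top\<close>: all letters after the last occurrence of
  \<open>v\<close> commute with it, since any other would hide the sign under a marker.\<close>

lemma top_to_end:
  assumes "w \<in> words V" "reduced w" "top_of (piling w) v = Some \<epsilon>"
  shows "\<exists>w'\<in>words V. rstep\<^sup>*\<^sup>* w (w' @ [(v, \<epsilon>)]) \<and> length w = Suc (length w') \<and> v \<in> V"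
  using assms
proof (induction w rule: rev_induct)
  case Nil
  then show ?case by (simp add: top_of_def)
next
  case (snoc b u)
  have r: "reduced u" "piling (u @ [b]) = push E b (piling u)"
    using snoc.prems piling_reduced_snoc[of u b] reduced_snoc[of u b] by auto
  show ?case
  proof (cases "v = fst b")
    case True
    then have "b = (v, \<epsilon>)" using snoc.prems r(2) by (simp add: top_push prod_eq_iff del: piling_snoc)
    then show ?thesis using snoc.prems by (intro bexI[of _ u]) auto
  next
    case False
    then have e: "{v, fst b} \<in> E" and "top_of (piling u) v = Some \<epsilon>"
      using snoc.prems r(2) by (auto simp: top_push simp del: piling_snoc split: if_splits)
    then obtain w' where w': "w' \<in> words V" "rstep\<^sup>*\<^sup>* u (w' @ [(v, \<epsilon>)])" "length u = Suc (length w')" "v \<in> V"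
      using snoc r by auto
    have "rstep\<^sup>*\<^sup>* (u @ [b]) ((w' @ [(v, \<epsilon>)]) @ [b])" using rsteps_append[OF w'(2), of "[b]"] snoc.prems by simp
    moreover have "rstep (w' @ [(v, \<epsilon>), b] @ []) (w' @ [b, (v, \<epsilon>)] @ [])"
      by (rule rstep.swap) (use w' e in auto)
    ultimately have "rstep\<^sup>*\<^sup>* (u @ [b]) ((w' @ [b]) @ [(v, \<epsilon>)])" by simp
    moreover have "w' @ [b] \<in> words V" using w' snoc.prems by simp
    ultimately show ?thesis using w' by (intro bexI[of _ "w' @ [b]"]) auto
  qed
qed

text \<open>If an appended letter destroys reducedness, its inverse is on top of its stack, can be
  swapped to the end of the reduced word, and is deleted together with it.\<close>

lemma exists_reduced:
  assumes "w \<in> words V"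
  shows "\<exists>w'. rstep\<^sup>*\<^sup>* w w' \<and> reduced w' \<and> w' \<in> words V"
  using assms
proof (induction w rule: rev_induct)
  case Nil
  then show ?case by (intro exI[of _ "[]"]) auto
next
  case (snoc a w)
  then obtain u where u: "rstep\<^sup>*\<^sup>* w u" "reduced u" "u \<in> words V" by auto
  have a: "fst a \<in> V" using snoc.prems by auto
  have wu: "rstep\<^sup>*\<^sup>* (w @ [a]) (u @ [a])" using rsteps_append[OF u(1), of "[a]"] a by simp
  show ?case
  proof (cases "reduced (u @ [a])")
    case True
    then show ?thesis using wu u a by (intro exI[of _ "u @ [a]"]) auto
  next
    case False
    then have "top_of (piling u) (fst a) = Some (\<not> snd a)" using reduced_snoc u a by blast
    then obtain x where x: "x \<in> words V" "rstep\<^sup>*\<^sup>* u (x @ [linv a])" "length u = Suc (length x)"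
      using top_to_end[OF u(3,2), of "fst a" "\<not> snd a"] by (auto simp: linv_def)
    have "rstep\<^sup>*\<^sup>* (u @ [a]) ((x @ [linv a]) @ [a])" using rsteps_append[OF x(2), of "[a]"] a by simp
    moreover have "rstep (x @ [linv a, linv (linv a)] @ []) (x @ [])" by (rule rstep.del) (use x a in auto)
    ultimately have "rstep\<^sup>*\<^sup>* (u @ [a]) x" by simp
    then have "rstep\<^sup>*\<^sup>* (w @ [a]) x" using wu by simp
    have "u \<triangleq> x @ [linv a]" using rsteps_word_eq x u by blast
    then have "wlen (x @ [linv a]) = length u" using wlen_cong u by (simp add: reduced_def)
    then have "reduced (x @ [linv a])" using x by (simp add: reduced_def)
    then have "reduced x" using reduced_append_left[of x "[linv a]"] x a by simp
    then show ?thesis using \<open>rstep\<^sup>*\<^sup>* (w @ [a]) x\<close> x by blast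
  qed
qed

lemma obtain_reduced:
  assumes "w \<in> words V"
  obtains w' where "w \<triangleq> w'" "reduced w'" "w' \<in> words V" "length w' = wlen w"
  using exists_reduced[OF assms] rsteps_word_eq assms wlen_cong reduced_def by metis

lemma trivial_piling_rsteps:
  assumes "w \<in> words V" "piling w = (\<lambda>_. [])"
  shows "rstep\<^sup>*\<^sup>* w []"
proof -
  obtain u where u: "rstep\<^sup>*\<^sup>* w u" "reduced u" "u \<in> words V" using exists_reduced[OF assms(1)] by blast
  then have "piling u = (\<lambda>_. [])" using rsteps_word_eq word_eq_piling assms by metis
  then have "u = []" using u by (simp add: reduced_def wlen_def psize_def)
  with u show ?thesis by simp
qed

text \<open>The solution of the word problem in the form needed for homotopies: swaps and deletions
  alone shrink a trivial word to nothing.\<close>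

lemma trivial_word_rsteps:
  assumes "w \<triangleq> []" shows "rstep\<^sup>*\<^sup>* w []"
  using trivial_piling_rsteps[of w] word_eq_piling[OF assms] word_eq_in_words[OF assms] by simp

end

section \<open>First letters of elements, or half-spaces of the Cayley graph\<close>

context raag_graph
begin

subsection \<open>First letters\<close>

lemma reduced_cong: "u \<triangleq> w \<Longrightarrow> length u = length w \<Longrightarrow> reduced u \<longleftrightarrow> reduced w"
  using wlen_cong by (simp add: reduced_def)

lemma wlen_append: "u \<in> words V \<Longrightarrow> w \<in> words V \<Longrightarrow> wlen (u @ w) \<le> wlen u + wlen w"
proof -
  assume uw: "u \<in> words V" "w \<in> words V"
  obtain w' where w': "w \<triangleq> w'" "w' \<in> words V" "length w' = wlen w" using obtain_reduced[OF uw(2)] by blast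
  then have "wlen (u @ w) = wlen (u @ w')" using uw by (intro wlen_cong word_eq_append_left) auto
  then show ?thesis using wlen_append_le[OF uw(1) w'(2)] w' by simp
qed

lemma reduced_append_right:
  assumes "reduced (u @ w)" "u \<in> words V" "w \<in> words V" shows "reduced w"
  using assms wlen_append[of u w] wlen_le_length[of u] wlen_le_length[of w] by (simp add: reduced_def)

lemma wlen_winv_le: "w \<in> words V \<Longrightarrow> wlen (winv w) \<le> wlen w"
proof -
  assume w: "w \<in> words V"
  obtain w' where w': "w \<triangleq> w'" "w' \<in> words V" "length w' = wlen w" using obtain_reduced[OF w] by blast
  have "winv w \<triangleq> winv w'"
  proof -
    have "winv w @ w' \<triangleq> []" using w w' word_eq_iff_winv by blast
    then have "winv (winv w) @ winv w' \<triangleq> [] \<longleftrightarrow> winv w \<triangleq> winv w'"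
      using word_eq_iff_winv[of "winv w" V "winv w'"] w w' by simp
    moreover have "w @ winv w' \<triangleq> w' @ winv w'" using w' by (intro word_eq_append_right) auto
    moreover have "w' @ winv w' \<triangleq> []" using w' by (intro word_eq_winv_right)
    ultimately show ?thesis by (auto intro: word_eq.trans)
  qed
  then show ?thesis using wlen_cong wlen_le_length[of "winv w'"] w' by simp
qed

lemma wlen_winv [simp]: "w \<in> words V \<Longrightarrow> wlen (winv w) = wlen w"
  using wlen_winv_le[of w] wlen_winv_le[of "winv w"] by simp

lemma bottom_push: "p v \<noteq> [] \<Longrightarrow> bottom_of (push E a p) v = bottom_of p v"
  by (auto simp: bottom_of_def push_def)

lemma empty_stack_commutes:
  assumes "w \<in> words V" "reduced w" "piling w v = []" "l \<in> set w" shows "{fst l, v} \<in> E"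
  using assms
proof (induction w rule: rev_induct)
  case (snoc b w)
  have r: "reduced w" "piling (w @ [b]) = push E b (piling w)"
    using snoc.prems piling_reduced_snoc[of w b] reduced_snoc[of w b] by auto
  have e: "{v, fst b} \<in> E" "piling w v = []"
    using snoc.prems(3) unfolding r(2) by (auto simp: push_def split: if_splits)
  show ?case using snoc e r(1) by (auto simp: insert_commute)
qed simp

lemma letter_commutes_word:
  assumes "w \<in> words V" "fst a \<in> V" "\<And>l. l \<in> set w \<Longrightarrow> {fst l, fst a} \<in> E"
  shows "w @ [a] \<triangleq> [a] @ w"
  using assms
proof (induction w)
  case (Cons b w)
  have "[b] @ (w @ [a]) \<triangleq> [b] @ ([a] @ w)" using Cons by (intro word_eq_append_left) auto
  moreover have "[b, a] @ w \<triangleq> [a, b] @ w" using Cons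
    by (intro word_eq_append_right letters_commute) auto
  ultimately show ?case by (auto intro: word_eq.trans)
qed (auto intro: word_eq.refl)

text \<open>A non-empty stack keeps its bottom under pushes. So the sign at the bottom comes from a
  letter pushed onto an empty stack, and by \<open>empty_stack_commutes\<close> everything before
  that letter commutes with it.\<close>

lemma bottom_first_reduced:
  assumes "w \<in> words V" "reduced w" "bottom_of (piling w) (fst a) = Some (snd a)" "fst a \<in> V"
  shows "\<exists>w'\<in>words V. w \<triangleq> a # w' \<and> length w = Suc (length w')"
  using assms
proof (induction w rule: rev_induct)
  case Nil
  then show ?case by (simp add: bottom_of_def)
next
  case (snoc b u)
  have u: "u \<in> words V" "fst b \<in> V" using snoc.prems by auto
  have r: "reduced u" "piling (u @ [b]) = push E b (piling u)"
    using snoc.prems piling_reduced_snoc[of u b] reduced_snoc[of u b] by auto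
  show ?case
  proof (cases "piling u (fst a) = []")
    case True
    then have "b = a" using snoc.prems(3) unfolding r(2)
      by (auto simp: push_def bottom_of_def prod_eq_iff split: if_splits)
    moreover have "u @ [a] \<triangleq> [a] @ u"
      by (rule letter_commutes_word) (use True u r empty_stack_commutes snoc.prems in auto)
    ultimately show ?thesis using u by (intro bexI[of _ u]) auto
  next
    case False
    then have "bottom_of (piling u) (fst a) = Some (snd a)"
      using snoc.prems(3) bottom_push unfolding r(2) by simp
    then obtain u' where u': "u' \<in> words V" "u \<triangleq> a # u'" "length u = Suc (length u')"
      using snoc.IH u r snoc.prems(4) by blast
    have "u @ [b] \<triangleq> (a # u') @ [b]" using u' u by (intro word_eq_append_right) auto
    then show ?thesis using u' u by (intro bexI[of _ "u' @ [b]"]) auto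
  qed
qed

lemma bottom_of_reduced_Cons:
  assumes "w \<in> words V" "fst a \<in> V" "reduced (a # w)"
  shows "bottom_of (piling (a # w)) (fst a) = Some (snd a) \<and> piling (a # w) (fst a) \<noteq> []"
  using assms
proof (induction w rule: rev_induct)
  case Nil
  then show ?case by (simp add: piling_def lact_def top_of_def push_def bottom_of_def)
next
  case (snoc b w)
  have r: "reduced (a # w)" "piling ((a # w) @ [b]) = push E b (piling (a # w))"
    using snoc.prems piling_reduced_snoc[of "a # w" b] reduced_snoc[of "a # w" b] by auto
  then have "bottom_of (piling (a # w)) (fst a) = Some (snd a) \<and> piling (a # w) (fst a) \<noteq> []"
    using snoc by auto
  then show ?case using r(2) bottom_push[of "piling (a # w)" "fst a" b] by (auto simp: push_def)
qed

text \<open>Geometrically, the element lies beyond the wall that separates the identity from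
  \<open>a\<close> in the Cayley graph. Half-spaces are described by this predicate
  throughout.\<close>

definition starts :: "'v \<times> bool \<Rightarrow> 'v group_word \<Rightarrow> bool"
  where "starts a w \<longleftrightarrow> wlen (linv a # w) < wlen w"

lemma starts_cong: "u \<triangleq> w \<Longrightarrow> fst a \<in> V \<Longrightarrow> starts a u \<longleftrightarrow> starts a w"
  using word_eq_append_left[of V _ u w "[linv a]"] wlen_cong[of u w] wlen_cong[of "linv a # u" "linv a # w"]
  by (simp add: starts_def)

lemma cancel_linv: "w \<in> words V \<Longrightarrow> fst a \<in> V \<Longrightarrow> linv a # a # w \<triangleq> w"
  using pop_invert[of "linv a" "[]" w] by simp

text \<open>Proved as a cycle. A bottom entry can be moved to the front; a factorisation of full
  length is shortened by \<open>linv a\<close>; and putting \<open>a\<close> back before the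
  shortened reduced word gives a reduced word, whose bottom is known from
  \<open>bottom_of_reduced_Cons\<close>.\<close>

lemma starts_iff:
  assumes "w \<in> words V" "fst a \<in> V"
  shows "starts a w \<longleftrightarrow> (\<exists>w'\<in>words V. w \<triangleq> a # w' \<and> wlen w = Suc (wlen w'))" (is ?A)
    and "starts a w \<longleftrightarrow> bottom_of (piling w) (fst a) = Some (snd a)" (is ?B)
proof -
  obtain u where u: "w \<triangleq> u" "reduced u" "u \<in> words V" "length u = wlen w"
    using obtain_reduced[OF assms(1)] by blast
  have 1: "\<exists>w'\<in>words V. w \<triangleq> a # w' \<and> wlen w = Suc (wlen w')"
    if b: "bottom_of (piling w) (fst a) = Some (snd a)"
  proof -
    obtain w' where w': "w' \<in> words V" "u \<triangleq> a # w'" "length u = Suc (length w')"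
      using bottom_first_reduced[of u a] u b assms word_eq_piling by metis
    then have r: "reduced (a # w')" using u reduced_cong[of u "a # w'"] by simp
    then have "reduced w'" using reduced_append_right[of "[a]" w'] w' assms by simp
    then show ?thesis using u w' by (intro bexI[of _ w']) (auto simp: reduced_def intro: word_eq.trans)
  qed
  have 2: "starts a w" if "\<exists>w'\<in>words V. w \<triangleq> a # w' \<and> wlen w = Suc (wlen w')"
  proof -
    from that obtain w' where w': "w' \<in> words V" "w \<triangleq> a # w'" "wlen w = Suc (wlen w')" by blast
    have "[linv a] @ w \<triangleq> [linv a] @ (a # w')" using w' assms by (intro word_eq_append_left) auto
    then have "linv a # w \<triangleq> w'" using cancel_linv[of w' a] w' assms by (auto intro: word_eq.trans)
    then show ?thesis using w' wlen_cong by (simp add: starts_def)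
  qed
  have 3: "bottom_of (piling w) (fst a) = Some (snd a)" if s: "starts a w"
  proof -
    obtain v where v: "linv a # w \<triangleq> v" "reduced v" "v \<in> words V" "length v = wlen (linv a # w)"
      using obtain_reduced[of "linv a # w"] assms by auto
    have "[a] @ (linv a # w) \<triangleq> [a] @ v" using v assms by (intro word_eq_append_left) auto
    moreover have "[] @ [a, linv a] @ w \<triangleq> [] @ w" using assms by (intro pop_invert) auto
    ultimately have w: "w \<triangleq> a # v" by (auto intro: word_eq.sym word_eq.trans)
    then have "wlen (a # v) = wlen w" by (simp add: wlen_cong)
    moreover have "wlen (a # v) \<le> Suc (length v)" using wlen_le_length[of "a # v"] v assms by simp
    ultimately have "reduced (a # v)" using s v by (simp add: reduced_def starts_def)
    then show ?thesis using bottom_of_reduced_Cons[of v a] v assms word_eq_piling[OF w] by simp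
  qed
  show ?A ?B using 1 2 3 by blast+
qed

text \<open>The wall of \<open>a\<close> is crossed only by edges labelled \<open>a\<close>, at
  vertices that commute with \<open>a\<close>. Popping never creates a new bottom, and pushing
  creates one only on an empty stack, in which case all letters of a reduced word commute with
  \<open>a\<close>.\<close>

lemma starts_snoc:
  assumes "w \<in> words V" "fst a \<in> V" "fst b \<in> V" "\<not> starts a w" "starts a (w @ [b])"
  shows "b = a \<and> w @ [a] \<triangleq> [a] @ w"
proof -
  let ?p = "piling w" 
  have 1: "bottom_of ?p (fst a) \<noteq> Some (snd a)" "bottom_of (lact E b ?p) (fst a) = Some (snd a)"
    using starts_iff(2)[of w a] starts_iff(2)[of "w @ [b]" a] assms by auto
  have tl: "bottom_of (pop E c ?p) v \<noteq> bottom_of ?p v \<Longrightarrow> bottom_of (pop E c ?p) v = None" for c v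
    by (cases "?p v") (auto simp: bottom_of_def pop_def split: if_splits)
  have "lact E b ?p = push E b ?p" using 1 tl[of "fst b" "fst a"] by (auto simp: lact_def)
  with 1 have e: "?p (fst a) = []" "b = a"
    using bottom_push[of ?p "fst a" b] by (auto simp: push_def bottom_of_def prod_eq_iff split: if_splits)
  obtain u where u: "w \<triangleq> u" "reduced u" "u \<in> words V" using obtain_reduced[OF assms(1)] by blast
  have "u @ [a] \<triangleq> [a] @ u"
    by (rule letter_commutes_word)
      (use u assms e empty_stack_commutes[of u "fst a"] word_eq_piling[OF u(1)] in auto)
  moreover have "w @ [a] \<triangleq> u @ [a]" "[a] @ w \<triangleq> [a] @ u"
    using u assms by (auto intro!: word_eq_append_left[where v = "[a]", simplified] word_eq_append_right)
  ultimately show ?thesis using e by (meson word_eq.sym word_eq.trans)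
qed

lemma top_append_reduced:
  assumes "u \<in> words V" "w \<in> words V" "reduced (u @ w)"
  shows "(\<forall>l\<in>set w. {fst l, v} \<in> E) \<and> top_of (piling (u @ w)) v = top_of (piling u) v
    \<or> top_of (piling (u @ w)) v = top_of (piling w) v"
  using assms(2,3)
proof (induction w rule: rev_induct)
  case (snoc b w)
  have V: "w \<in> words V" "fst b \<in> V" using snoc.prems by auto
  have r: "reduced (u @ w)" "piling (u @ w @ [b]) = push E b (piling (u @ w))"
    using snoc.prems piling_reduced_snoc[of "u @ w" b] reduced_snoc[of "u @ w" b] assms(1) V by auto
  have "reduced (w @ [b])" using reduced_append_right[of u "w @ [b]"] snoc.prems assms(1) by simp
  then have r': "piling (w @ [b]) = push E b (piling w)" using piling_reduced_snoc V by blast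
  show ?case using snoc.IH[OF V(1) r(1)] unfolding r(2) r'
    by (auto simp: top_push insert_commute)
qed simp

text \<open>If appending \<open>b\<close> to \<open>winv u @ w\<close> cancelled against
  \<open>winv u\<close>, all of \<open>w\<close> would commute with \<open>b\<close>. Then
  \<open>b\<close> would be a first letter of \<open>w @ [b]\<close> and, since its inverse can be
  moved to the end of \<open>winv u\<close>, also of \<open>u\<close>.\<close>

lemma wlen_winv_append:
  assumes u: "u \<in> words V" and w: "w \<in> words V"
    and no: "\<And>a. fst a \<in> V \<Longrightarrow> \<not> (starts a u \<and> starts a w)"
  shows "wlen (winv u @ w) = wlen u + wlen w"
proof -
  have key: "reduced (winv u @ w)"
    if "reduced u" "reduced w" and u: "u \<in> words V" and w: "w \<in> words V"
      and no: "\<And>a. fst a \<in> V \<Longrightarrow> \<not> (starts a u \<and> starts a w)" for u w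
    using that(2) w no
  proof (induction w rule: rev_induct)
    case Nil
    then show ?case using \<open>reduced u\<close> u by (simp add: reduced_def)
  next
    case (snoc b w)
    have V: "w \<in> words V" "fst b \<in> V" using snoc.prems by auto
    have rw: "reduced w" "top_of (piling w) (fst b) \<noteq> Some (\<not> snd b)"
      using snoc.prems(1) reduced_snoc V by auto
    have "\<not> starts a w" if a: "fst a \<in> V" "starts a u" for a
    proof
      assume "starts a w"
      then obtain w' where w': "w' \<in> words V" "w \<triangleq> a # w'" "wlen w = Suc (wlen w')"
        using starts_iff(1)[of w a] V a by blast
      have "linv a # w \<triangleq> w'"
        using word_eq_append_left[OF w'(2), of "[linv a]"] cancel_linv[of w' a] w' a
        by (auto intro: word_eq.trans)
      then have "linv a # w @ [b] \<triangleq> w' @ [b]" using word_eq_append_right[of _ _ "linv a # w" w' "[b]"] V by simp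
      then have "wlen (linv a # w @ [b]) \<le> Suc (wlen w')"
        using wlen_cong wlen_append[of w' "[b]"] wlen_le_length[of "[b]"] w' V by fastforce
      then have "starts a (w @ [b])" using snoc.prems(1) rw(1) w' by (simp add: starts_def reduced_def)
      then show False using snoc.prems(3) a by blast
    qed
    then have IH: "reduced (winv u @ w)" using snoc.IH rw V by blast
    show ?case
    proof (rule ccontr)
      assume "\<not> reduced (winv u @ w @ [b])"
      then have t: "top_of (piling (winv u @ w)) (fst b) = Some (\<not> snd b)"
        using reduced_snoc[of "winv u @ w" b] IH u V by auto
      then have c: "\<And>l. l \<in> set w \<Longrightarrow> {fst l, fst b} \<in> E" "top_of (piling (winv u)) (fst b) = Some (\<not> snd b)"
        using top_append_reduced[of "winv u" w "fst b"] IH u V rw by auto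
      have "reduced (winv u)" using \<open>reduced u\<close> u by (simp add: reduced_def)
      then obtain x where x: "x \<in> words V" "winv u \<triangleq> x @ [linv b]" "length u = Suc (length x)"
        using top_to_end[OF _ _ c(2)] rsteps_word_eq[of "winv u"] u by (auto simp: linv_def)
      have "winv u @ [b] \<triangleq> x @ [linv b, b] @ []"
        using word_eq_append_right[OF x(2), of "[b]"] V by simp
      moreover have "x @ [linv b, linv (linv b)] @ [] \<triangleq> x @ []" using x V by (intro pop_invert) auto
      ultimately have "winv u @ [b] \<triangleq> x" by (auto intro: word_eq.trans)
      then have "wlen (winv (winv u @ [b])) = wlen x" using wlen_cong u V wlen_winv[of "winv u @ [b]"] by simp
      then have 1: "starts b u" using wlen_le_length[of x] x \<open>reduced u\<close> by (simp add: starts_def reduced_def)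
      have "w @ [b] \<triangleq> [b] @ w" by (rule letter_commutes_word) (use c V in auto)
      then have "starts b (w @ [b])"
        using starts_iff(1)[of "w @ [b]" b] snoc.prems(1) rw V by (auto simp: reduced_def intro!: bexI[of _ w])
      then show False using 1 snoc.prems(3) V by blast
    qed
  qed
  obtain u' where u': "u \<triangleq> u'" "reduced u'" "u' \<in> words V" "length u' = wlen u" using obtain_reduced[OF u] by blast
  obtain w' where w': "w \<triangleq> w'" "reduced w'" "w' \<in> words V" "length w' = wlen w" using obtain_reduced[OF w] by blast
  have "reduced (winv u' @ w')"
    by (rule key) (use u' w' no starts_cong in blast)+
  moreover have "winv u @ w \<triangleq> winv u' @ w'"
  proof -
    have "winv u' @ u \<triangleq> []" using word_eq.sym[OF u'(1)] word_eq_iff_winv u u' by blast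
    then have "winv u' @ u @ winv u \<triangleq> winv u" using word_eq_append_right[of _ _ "winv u' @ u" "[]" "winv u"] u by simp
    moreover have "winv u' @ u @ winv u \<triangleq> winv u' @ []" using u u' by (intro word_eq_append_left word_eq_winv_right) auto
    ultimately have "winv u \<triangleq> winv u'" by (simp, meson word_eq.sym word_eq.trans)
    then show ?thesis using w'(1) by (rule word_eq_append)
  qed
  ultimately show ?thesis using wlen_cong u' w' by (simp add: reduced_def)
qed

subsection \<open>The Cayley graph\<close>

abbreviation "G \<equiv> raag V E"
abbreviation "cls \<equiv> word_class V (comm_rel E)"
abbreviation "gens \<equiv> raag_generators V E"
abbreviation "glen \<equiv> word_length G gens"

lemma group_raag: "group G" by (simp add: raag_eq group_presented)

lemma carrier_raag: "carrier G = cls ` words V" by (simp add: raag_eq carrier_presented)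

lemma cls_in_carrier: "w \<in> words V \<Longrightarrow> cls w \<in> carrier G" by (simp add: carrier_raag)

lemma cls_mult: "u \<in> words V \<Longrightarrow> w \<in> words V \<Longrightarrow> cls u \<otimes>\<^bsub>G\<^esub> cls w = cls (u @ w)"
  by (simp add: raag_eq mult_presented)

lemma cls_one: "\<one>\<^bsub>G\<^esub> = cls []" by (simp add: raag_eq one_presented)

lemma cls_inv: "w \<in> words V \<Longrightarrow> inv\<^bsub>G\<^esub> (cls w) = cls (winv w)"
  by (simp add: raag_eq inv_presented)

lemma cls_eq_iff: "w \<in> words V \<Longrightarrow> cls u = cls w \<longleftrightarrow> u \<triangleq> w" by (rule word_class_eq_iff)

lemma gens_eq: "gens = {cls [(v, True)] | v. v \<in> V}"
proof -
  have "A = cls [(v, True)]" if A: "A \<in> carrier G" and "v \<in> V" "[(v, True)] \<in> A" for A v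
  proof -
    obtain w where "w \<in> words V" "A = cls w" using A by (auto simp: carrier_raag)
    then have "w \<triangleq> [(v, True)]" using that by (simp add: word_class_def)
    then show ?thesis using \<open>A = cls w\<close> cls_eq_iff that by simp
  qed
  moreover have "[(v, True)] \<in> cls [(v, True)]" if "v \<in> V" for v
    using that by (simp add: word_class_def word_eq.refl)
  ultimately show ?thesis unfolding raag_generators_def by (fastforce intro!: cls_in_carrier)
qed

lemma gens_carrier: "gens \<subseteq> carrier G" by (auto simp: raag_generators_def)

lemma finite_gens: "finite gens" using finite_V by (simp add: gens_eq)

definition letters :: "'v group_word set set" where "letters = {cls [a] | a. fst a \<in> V}"

lemma cls_in_letters: "fst a \<in> V \<Longrightarrow> cls [a] \<in> letters"
  unfolding letters_def by blast

lemma letters_eq: "gens \<union> m_inv G ` gens = {cls [a] | a. fst a \<in> V}"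
proof -
  have "inv\<^bsub>G\<^esub> (cls [(v, True)]) = cls [(v, False)]" if "v \<in> V" for v
    using that by (simp add: cls_inv)
  moreover have "cls [a] = cls [(fst a, True)] \<or> cls [a] = cls [(fst a, False)]" for a :: "'v \<times> bool"
    by (cases a; cases "snd a") auto
  ultimately show ?thesis unfolding gens_eq by (auto simp: image_iff; metis fst_conv)
qed

lemma foldr_letters: "w \<in> words V \<Longrightarrow> foldr (mult G) (map (\<lambda>a. cls [a]) w) \<one>\<^bsub>G\<^esub> = cls w"
proof (induction w)
  case (Cons a w)
  then show ?case using cls_mult[of "[a]" w] by simp
qed (simp add: cls_one)

text \<open>A reduced representative attains the minimum; conversely, any product of letters with
  this value is a word of the class and so at least as long.\<close>

lemma glen_cls: assumes "w \<in> words V" shows "glen (cls w) = wlen w"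
proof -
  have iff: "(\<exists>xs. length xs = n \<and> set xs \<subseteq> {cls [a] | a. fst a \<in> V} \<and> foldr (mult G) xs \<one>\<^bsub>G\<^esub> = cls w)
    \<longleftrightarrow> (\<exists>u\<in>words V. length u = n \<and> u \<triangleq> w)" (is "?L \<longleftrightarrow> ?R") for n
  proof
    assume ?L
    then obtain xs where xs: "length xs = n" "set xs \<subseteq> {cls [a] | a. fst a \<in> V}" "foldr (mult G) xs \<one>\<^bsub>G\<^esub> = cls w" by blast
    from xs(2) have "\<exists>u\<in>words V. xs = map (\<lambda>a. cls [a]) u"
    proof (induction xs)
      case (Cons x xs)
      from Cons.prems obtain a where "x = cls [a]" "fst a \<in> V" by auto
      moreover from Cons obtain u where "u \<in> words V" "xs = map (\<lambda>a. cls [a]) u" by auto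
      ultimately show ?case by (intro bexI[of _ "a # u"]) auto
    qed (auto intro!: bexI[of _ "[]"])
    then obtain u where "u \<in> words V" "xs = map (\<lambda>a. cls [a]) u" by blast
    then show ?R using xs foldr_letters cls_eq_iff[OF assms] by (intro bexI[of _ u]) auto
  next
    assume ?R
    then obtain u where u: "u \<in> words V" "length u = n" "u \<triangleq> w" by blast
    from u(1) have "set (map (\<lambda>a. cls [a]) u) \<subseteq> letters" by (auto intro: cls_in_letters)
    with u show ?L using foldr_letters[of u] cls_eq_iff[OF assms]
      unfolding letters_def[symmetric] by (intro exI[of _ "map (\<lambda>a. cls [a]) u"]) auto
  qed
  obtain u where "w \<triangleq> u" "u \<in> words V" "length u = wlen w" using obtain_reduced[OF assms] by blast
  then have "\<exists>u\<in>words V. length u = wlen w \<and> u \<triangleq> w" using word_eq.sym by blast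
  moreover have "wlen w \<le> length u" if "u \<in> words V" "u \<triangleq> w" for u
    using wlen_le_length[OF that(1)] wlen_cong[OF that(2)] by simp
  ultimately show ?thesis unfolding word_length_def letters_eq iff
    by (intro Least_equality) blast+
qed


lemma glen_one: "glen \<one>\<^bsub>G\<^esub> = 0" by (simp add: cls_one glen_cls)

lemma glen_inv: "x \<in> carrier G \<Longrightarrow> glen (inv\<^bsub>G\<^esub> x) = glen x"
  by (auto simp: carrier_raag cls_inv glen_cls)

lemma glen_mult: "x \<in> carrier G \<Longrightarrow> y \<in> carrier G \<Longrightarrow> glen (x \<otimes>\<^bsub>G\<^esub> y) \<le> glen x + glen y"
  using wlen_append by (auto simp: carrier_raag cls_mult glen_cls)

lemma letters_carrier: "s \<in> letters \<Longrightarrow> s \<in> carrier G"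
  by (auto simp: letters_def intro!: cls_in_carrier)

definition gstarts :: "'v group_word set \<Rightarrow> 'v group_word set \<Rightarrow> bool"
  where "gstarts s x \<longleftrightarrow> glen (inv\<^bsub>G\<^esub> s \<otimes>\<^bsub>G\<^esub> x) < glen x"

lemma gstarts_cls: "w \<in> words V \<Longrightarrow> fst a \<in> V \<Longrightarrow> gstarts (cls [a]) (cls w) \<longleftrightarrow> starts a w"
  using cls_mult[of "[linv a]" w] glen_cls[of "linv a # w"] by (simp add: gstarts_def starts_def cls_inv glen_cls)

lemma first_letter:
  assumes "x \<in> carrier G" "x \<noteq> \<one>\<^bsub>G\<^esub>"
  shows "\<exists>s\<in>letters. \<exists>x'\<in>carrier G. x = s \<otimes>\<^bsub>G\<^esub> x' \<and> glen x = Suc (glen x') \<and> gstarts s x"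
proof -
  obtain w where w: "w \<in> words V" "x = cls w" using assms(1) by (auto simp: carrier_raag)
  obtain u where u: "w \<triangleq> u" "reduced u" "u \<in> words V" "length u = wlen w" using obtain_reduced[OF w(1)] by blast
  have xu: "x = cls u" using w u cls_eq_iff by simp
  then have "u \<noteq> []" using assms cls_one by auto
  then obtain a v where a: "u = a # v" by (cases u) auto
  have V: "fst a \<in> V" "v \<in> words V" using u a by auto
  have "reduced v" using reduced_append_right[of "[a]" v] u(2) a V by simp
  have "x = cls [a] \<otimes>\<^bsub>G\<^esub> cls v" using xu a V cls_mult[of "[a]" v] by simp
  moreover have "glen x = Suc (glen (cls v))"
    using xu u(2,3) \<open>reduced v\<close> V a glen_cls[of u] glen_cls[of v] by (simp add: reduced_def)
  moreover have "gstarts (cls [a]) x"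
    using gstarts_cls[OF u(3) V(1)] starts_iff(1)[OF u(3) V(1)] xu u(2) a V \<open>reduced v\<close>
    by (auto simp: reduced_def intro!: bexI[of _ v])
  moreover have "cls [a] \<in> letters" "cls v \<in> carrier G" using V by (auto intro!: cls_in_carrier cls_in_letters)
  ultimately show ?thesis by blast
qed

lemma glen_eq_0: "x \<in> carrier G \<Longrightarrow> glen x = 0 \<Longrightarrow> x = \<one>\<^bsub>G\<^esub>"
  using first_letter[of x] by auto

lemma gstarts_mult_letter:
  assumes "p \<in> carrier G" "s \<in> letters" "t \<in> letters" "\<not> gstarts s p" "gstarts s (p \<otimes>\<^bsub>G\<^esub> t)"
  shows "t = s \<and> p \<otimes>\<^bsub>G\<^esub> s = s \<otimes>\<^bsub>G\<^esub> p"
proof -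
  obtain w where w: "w \<in> words V" "p = cls w" using assms(1) by (auto simp: carrier_raag)
  obtain a where a: "fst a \<in> V" "s = cls [a]" using assms(2) by (auto simp: letters_def)
  obtain b where b: "fst b \<in> V" "t = cls [b]" using assms(3) by (auto simp: letters_def)
  have "b = a \<and> w @ [a] \<triangleq> [a] @ w"
    using assms(4,5) starts_snoc[OF w(1) a(1) b(1)] gstarts_cls[OF w(1) a(1)] gstarts_cls[of "w @ [b]" a]
      cls_mult[of w "[b]"] w a b by simp
  then show ?thesis using a b w cls_mult[of w "[a]"] cls_mult[of "[a]" w] cls_eq_iff[of "[a] @ w" "w @ [a]"] by simp
qed

lemma glen_no_common_start:
  assumes "x \<in> carrier G" "y \<in> carrier G" "\<And>s. s \<in> letters \<Longrightarrow> \<not> (gstarts s x \<and> gstarts s y)"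
  shows "glen (inv\<^bsub>G\<^esub> x \<otimes>\<^bsub>G\<^esub> y) = glen x + glen y"
proof -
  obtain u where u: "u \<in> words V" "x = cls u" using assms(1) by (auto simp: carrier_raag)
  obtain w where w: "w \<in> words V" "y = cls w" using assms(2) by (auto simp: carrier_raag)
  have "\<not> (starts a u \<and> starts a w)" if "fst a \<in> V" for a
    using assms(3)[of "cls [a]"] gstarts_cls[OF u(1) that] gstarts_cls[OF w(1) that] u w cls_in_letters[OF that]
    by auto
  then have "wlen (winv u @ w) = wlen u + wlen w" using wlen_winv_append[OF u(1) w(1)] by blast
  then show ?thesis using u w glen_cls[of "winv u @ w"] by (simp add: cls_inv cls_mult glen_cls)
qed

end

section \<open>Walls and medians in the Cayley graph\<close>

context raag_graph
begin

subsection \<open>Medians\<close>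

context
begin

interpretation G: group G by (rule group_raag)

lemma gstarts_glen:
  assumes "s \<in> letters" "x \<in> carrier G" "gstarts s x"
  shows "glen x = Suc (glen (inv\<^bsub>G\<^esub> s \<otimes>\<^bsub>G\<^esub> x))"
proof -
  have s: "s \<in> carrier G" using assms letters_carrier by blast
  obtain a where "fst a \<in> V" "s = cls [a]" using assms by (auto simp: letters_def)
  then have "glen s \<le> 1" using wlen_le_length[of "[a]"] glen_cls[of "[a]"] by simp
  have "x = s \<otimes>\<^bsub>G\<^esub> (inv\<^bsub>G\<^esub> s \<otimes>\<^bsub>G\<^esub> x)" using s assms by (simp add: G.m_assoc[symmetric])
  then have "glen x \<le> glen s + glen (inv\<^bsub>G\<^esub> s \<otimes>\<^bsub>G\<^esub> x)" using glen_mult s assms by (metis G.inv_closed G.m_closed)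
  then show ?thesis using \<open>glen s \<le> 1\<close> assms(3) by (simp add: gstarts_def)
qed

abbreviation "gdist \<equiv> raag_dist V E"

lemma gdist_eq: "gdist x y = glen (inv\<^bsub>G\<^esub> x \<otimes>\<^bsub>G\<^esub> y)"
  by (simp add: raag_dist_def word_dist_def)

lemma gdist_left: "g \<in> carrier G \<Longrightarrow> x \<in> carrier G \<Longrightarrow> y \<in> carrier G \<Longrightarrow>
    gdist (g \<otimes>\<^bsub>G\<^esub> x) (g \<otimes>\<^bsub>G\<^esub> y) = gdist x y"
  by (simp add: gdist_eq G.inv_mult_group G.m_assoc) (simp add: G.m_assoc[symmetric])

lemma gdist_one: "x \<in> carrier G \<Longrightarrow> gdist \<one>\<^bsub>G\<^esub> x = glen x"
  by (simp add: gdist_eq)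

lemma gdist_sym: "x \<in> carrier G \<Longrightarrow> y \<in> carrier G \<Longrightarrow> gdist x y = gdist y x"
  using glen_inv[of "inv\<^bsub>G\<^esub> x \<otimes>\<^bsub>G\<^esub> y"] by (simp add: gdist_eq G.inv_mult_group)

lemma gdist_triangle:
  assumes "x \<in> carrier G" "y \<in> carrier G" "z \<in> carrier G"
  shows "gdist x z \<le> gdist x y + gdist y z"
proof -
  have "inv\<^bsub>G\<^esub> x \<otimes>\<^bsub>G\<^esub> z = (inv\<^bsub>G\<^esub> x \<otimes>\<^bsub>G\<^esub> y) \<otimes>\<^bsub>G\<^esub> (inv\<^bsub>G\<^esub> y \<otimes>\<^bsub>G\<^esub> z)"
    using assms by (simp add: G.m_assoc) (simp add: G.m_assoc[symmetric])
  then show ?thesis using glen_mult assms by (simp add: gdist_eq)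
qed

text \<open>Follow a geodesic word of \<open>y\<close> from \<open>a\<close>. The first step into
  the half-space of \<open>s\<close> must be labelled \<open>s\<close> at a vertex commuting with
  \<open>s\<close>, by \<open>gstarts_mult_letter\<close>; \<open>p\<close> and \<open>r\<close> are
  the pieces before and after it.\<close>

lemma letter_into_halfspace:
  assumes "a \<in> carrier G" "s \<in> letters" "y \<in> carrier G" "\<not> gstarts s a" "gstarts s (a \<otimes>\<^bsub>G\<^esub> y)"
  shows "\<exists>p\<in>carrier G. \<exists>r\<in>carrier G. y = p \<otimes>\<^bsub>G\<^esub> s \<otimes>\<^bsub>G\<^esub> r \<and> glen y = Suc (glen p + glen r) \<and>
    (a \<otimes>\<^bsub>G\<^esub> p) \<otimes>\<^bsub>G\<^esub> s = s \<otimes>\<^bsub>G\<^esub> (a \<otimes>\<^bsub>G\<^esub> p)"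
  using assms
proof (induction "glen y" arbitrary: a y)
  case 0
  then show ?case using glen_eq_0[of y] by simp
next
  case (Suc n)
  then have "y \<noteq> \<one>\<^bsub>G\<^esub>" by (auto simp: glen_one)
  then obtain t y' where t: "t \<in> letters" "y' \<in> carrier G" "y = t \<otimes>\<^bsub>G\<^esub> y'" "glen y = Suc (glen y')"
    using first_letter Suc.prems by blast
  have c: "t \<in> carrier G" "s \<in> carrier G" using t Suc.prems letters_carrier by auto
  show ?case
  proof (cases "gstarts s (a \<otimes>\<^bsub>G\<^esub> t)")
    case True
    then have "t = s \<and> a \<otimes>\<^bsub>G\<^esub> s = s \<otimes>\<^bsub>G\<^esub> a" using gstarts_mult_letter Suc.prems t by blast
    then show ?thesis using t Suc.prems c
      by (intro bexI[of _ "\<one>\<^bsub>G\<^esub>"] bexI[of _ y']) (auto simp: glen_one)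
  next
    case False
    have "gstarts s ((a \<otimes>\<^bsub>G\<^esub> t) \<otimes>\<^bsub>G\<^esub> y')" using Suc.prems t c by (simp add: G.m_assoc)
    then obtain p r where pr: "p \<in> carrier G" "r \<in> carrier G" "y' = p \<otimes>\<^bsub>G\<^esub> s \<otimes>\<^bsub>G\<^esub> r" "glen y' = Suc (glen p + glen r)"
      "(a \<otimes>\<^bsub>G\<^esub> t \<otimes>\<^bsub>G\<^esub> p) \<otimes>\<^bsub>G\<^esub> s = s \<otimes>\<^bsub>G\<^esub> (a \<otimes>\<^bsub>G\<^esub> t \<otimes>\<^bsub>G\<^esub> p)"
      using Suc.hyps(1)[of y' "a \<otimes>\<^bsub>G\<^esub> t"] Suc.hyps(2) Suc.prems t c False by auto
    have y: "y = (t \<otimes>\<^bsub>G\<^esub> p) \<otimes>\<^bsub>G\<^esub> s \<otimes>\<^bsub>G\<^esub> r" using t pr c by (simp add: G.m_assoc)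
    have "glen s \<le> 1"
    proof -
      obtain b where "fst b \<in> V" "s = cls [b]" using Suc.prems by (auto simp: letters_def)
      then show ?thesis using wlen_le_length[of "[b]"] glen_cls[of "[b]"] by simp
    qed
    have "glen t \<le> 1"
    proof -
      obtain b where "fst b \<in> V" "t = cls [b]" using t by (auto simp: letters_def)
      then show ?thesis using wlen_le_length[of "[b]"] glen_cls[of "[b]"] by simp
    qed
    then have "glen (t \<otimes>\<^bsub>G\<^esub> p) \<le> Suc (glen p)" using glen_mult[of t p] c pr by simp
    moreover have "glen y \<le> glen (t \<otimes>\<^bsub>G\<^esub> p) + glen s + glen r"
      using glen_mult[of "t \<otimes>\<^bsub>G\<^esub> p \<otimes>\<^bsub>G\<^esub> s" r] glen_mult[of "t \<otimes>\<^bsub>G\<^esub> p" s] y c pr by simp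
    ultimately have "glen y = Suc (glen (t \<otimes>\<^bsub>G\<^esub> p) + glen r)" using t pr \<open>glen s \<le> 1\<close> by simp
    then show ?thesis using y pr c Suc.prems
      by (intro bexI[of _ "t \<otimes>\<^bsub>G\<^esub> p"] bexI[of _ r]) (auto simp: G.m_assoc)
  qed
qed

text \<open>A geodesic crossing the wall of \<open>s\<close> twice could be shortened by deleting both crossings.\<close>

lemma halfspace_convex:
  assumes "a \<in> carrier G" "b \<in> carrier G" "n \<in> carrier G" "s \<in> letters"
    and "\<not> gstarts s a" "\<not> gstarts s b" and geo: "gdist a n + gdist n b = gdist a b"
  shows "\<not> gstarts s n"
proof
  assume n: "gstarts s n"
  have s: "s \<in> carrier G" using assms letters_carrier by auto
  have "gstarts s (a \<otimes>\<^bsub>G\<^esub> (inv\<^bsub>G\<^esub> a \<otimes>\<^bsub>G\<^esub> n))" "gstarts s (b \<otimes>\<^bsub>G\<^esub> (inv\<^bsub>G\<^esub> b \<otimes>\<^bsub>G\<^esub> n))"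
    using n assms by (simp_all add: G.m_assoc[symmetric])
  from letter_into_halfspace[OF assms(1,4) _ assms(5) this(1)] letter_into_halfspace[OF assms(2,4) _ assms(6) this(2)] assms
  obtain p r q t where
    p: "p \<in> carrier G" "r \<in> carrier G" "inv\<^bsub>G\<^esub> a \<otimes>\<^bsub>G\<^esub> n = p \<otimes>\<^bsub>G\<^esub> s \<otimes>\<^bsub>G\<^esub> r"
      "glen (inv\<^bsub>G\<^esub> a \<otimes>\<^bsub>G\<^esub> n) = Suc (glen p + glen r)"
      "(a \<otimes>\<^bsub>G\<^esub> p) \<otimes>\<^bsub>G\<^esub> s = s \<otimes>\<^bsub>G\<^esub> (a \<otimes>\<^bsub>G\<^esub> p)" and
    q: "q \<in> carrier G" "t \<in> carrier G" "inv\<^bsub>G\<^esub> b \<otimes>\<^bsub>G\<^esub> n = q \<otimes>\<^bsub>G\<^esub> s \<otimes>\<^bsub>G\<^esub> t"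
      "glen (inv\<^bsub>G\<^esub> b \<otimes>\<^bsub>G\<^esub> n) = Suc (glen q + glen t)"
      "(b \<otimes>\<^bsub>G\<^esub> q) \<otimes>\<^bsub>G\<^esub> s = s \<otimes>\<^bsub>G\<^esub> (b \<otimes>\<^bsub>G\<^esub> q)"
    by auto
  have "n = a \<otimes>\<^bsub>G\<^esub> (inv\<^bsub>G\<^esub> a \<otimes>\<^bsub>G\<^esub> n)" using assms by (simp add: G.m_assoc[symmetric])
  also have "\<dots> = (a \<otimes>\<^bsub>G\<^esub> p \<otimes>\<^bsub>G\<^esub> s) \<otimes>\<^bsub>G\<^esub> r" unfolding p(3) using p(1,2) assms(1) s by (simp add: G.m_assoc)
  also have "\<dots> = (s \<otimes>\<^bsub>G\<^esub> (a \<otimes>\<^bsub>G\<^esub> p)) \<otimes>\<^bsub>G\<^esub> r" unfolding p(5) ..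
  finally have n1: "n = s \<otimes>\<^bsub>G\<^esub> (a \<otimes>\<^bsub>G\<^esub> p \<otimes>\<^bsub>G\<^esub> r)"
    using p(1,2) assms(1,2) s by (simp add: G.m_assoc)
  have "n = b \<otimes>\<^bsub>G\<^esub> (inv\<^bsub>G\<^esub> b \<otimes>\<^bsub>G\<^esub> n)" using assms by (simp add: G.m_assoc[symmetric])
  also have "\<dots> = (b \<otimes>\<^bsub>G\<^esub> q \<otimes>\<^bsub>G\<^esub> s) \<otimes>\<^bsub>G\<^esub> t" unfolding q(3) using q(1,2) assms(2) s by (simp add: G.m_assoc)
  also have "\<dots> = (s \<otimes>\<^bsub>G\<^esub> (b \<otimes>\<^bsub>G\<^esub> q)) \<otimes>\<^bsub>G\<^esub> t" unfolding q(5) ..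
  finally have n2: "n = s \<otimes>\<^bsub>G\<^esub> (b \<otimes>\<^bsub>G\<^esub> q \<otimes>\<^bsub>G\<^esub> t)"
    using q(1,2) assms(1,2) s by (simp add: G.m_assoc)
  have e: "a \<otimes>\<^bsub>G\<^esub> p \<otimes>\<^bsub>G\<^esub> r = b \<otimes>\<^bsub>G\<^esub> q \<otimes>\<^bsub>G\<^esub> t"
    using n1 n2 p(1,2) q(1,2) assms(1,2) s by simp
  \<comment> \<open>The point \<open>?x\<close> is \<open>n\<close> with the front letter
    \<open>s\<close> removed. Both geodesics end there once their crossing letter is deleted, so the
    route from \<open>a\<close> to \<open>b\<close> through it is shorter by two.\<close>
  let ?x = "a \<otimes>\<^bsub>G\<^esub> p \<otimes>\<^bsub>G\<^esub> r"
  have x: "?x \<in> carrier G" using p assms by simp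
  have "inv\<^bsub>G\<^esub> a \<otimes>\<^bsub>G\<^esub> ?x = p \<otimes>\<^bsub>G\<^esub> r" using p assms by (simp add: G.m_assoc) (simp add: G.m_assoc[symmetric])
  then have 1: "gdist a ?x \<le> glen p + glen r" using glen_mult p by (simp add: gdist_eq)
  have "inv\<^bsub>G\<^esub> b \<otimes>\<^bsub>G\<^esub> ?x = q \<otimes>\<^bsub>G\<^esub> t" unfolding e using q assms by (simp add: G.m_assoc) (simp add: G.m_assoc[symmetric])
  then have 2: "gdist b ?x \<le> glen q + glen t" using glen_mult q by (simp add: gdist_eq)
  have "gdist a b \<le> gdist a ?x + gdist b ?x"
    using gdist_triangle[of a ?x b] gdist_sym[of b ?x] assms x by simp
  moreover have "gdist a n = Suc (glen p + glen r)" "gdist n b = Suc (glen q + glen t)"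
    using p q gdist_sym[of n b] assms by (simp_all add: gdist_eq)
  ultimately show False using 1 2 geo by linarith
qed

definition is_median :: "'v group_word set \<Rightarrow> 'v group_word set \<Rightarrow> 'v group_word set \<Rightarrow> 'v group_word set \<Rightarrow> bool"
  where "is_median x y z m \<longleftrightarrow> m \<in> carrier G \<and> gdist x m + gdist m y = gdist x y \<and>
    gdist y m + gdist m z = gdist y z \<and> gdist x m + gdist m z = gdist x z"

text \<open>Take \<open>m\<close> of maximal length among the elements on geodesics from the
  identity to both \<open>x\<close> and \<open>y\<close>. A common first letter of the remainders
  would extend \<open>m\<close>, so there is none, and \<open>glen_no_common_start\<close> puts
  \<open>m\<close> on a geodesic from \<open>x\<close> to \<open>y\<close>.\<close>

lemma median_of_one:
  assumes "x \<in> carrier G" "y \<in> carrier G"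
  shows "\<exists>m. is_median \<one>\<^bsub>G\<^esub> x y m"
proof -
  define P where "P m \<longleftrightarrow> m \<in> carrier G \<and> glen m + glen (inv\<^bsub>G\<^esub> m \<otimes>\<^bsub>G\<^esub> x) = glen x \<and>
    glen m + glen (inv\<^bsub>G\<^esub> m \<otimes>\<^bsub>G\<^esub> y) = glen y" for m
  have "P \<one>\<^bsub>G\<^esub>" using assms by (simp add: P_def glen_one)
  moreover have "\<forall>m. P m \<longrightarrow> glen m < Suc (glen x)" by (auto simp: P_def)
  ultimately obtain m where m: "P m" "\<And>m'. P m' \<Longrightarrow> glen m' \<le> glen m"
    using ex_has_greatest_nat[of P "\<one>\<^bsub>G\<^esub>" glen] by blast
  let ?u = "inv\<^bsub>G\<^esub> m \<otimes>\<^bsub>G\<^esub> x" and ?w = "inv\<^bsub>G\<^esub> m \<otimes>\<^bsub>G\<^esub> y"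
  have mc: "m \<in> carrier G" using m by (simp add: P_def)
  have no: "\<not> (gstarts s ?u \<and> gstarts s ?w)" if s: "s \<in> letters" for s
  proof
    assume st: "gstarts s ?u \<and> gstarts s ?w"
    have sc: "s \<in> carrier G" using s letters_carrier by blast
    have shift: "inv\<^bsub>G\<^esub> (m \<otimes>\<^bsub>G\<^esub> s) \<otimes>\<^bsub>G\<^esub> v = inv\<^bsub>G\<^esub> s \<otimes>\<^bsub>G\<^esub> (inv\<^bsub>G\<^esub> m \<otimes>\<^bsub>G\<^esub> v)" if "v \<in> carrier G" for v
      using mc sc that by (simp add: G.inv_mult_group G.m_assoc)
    have lens: "glen ?u = Suc (glen (inv\<^bsub>G\<^esub> (m \<otimes>\<^bsub>G\<^esub> s) \<otimes>\<^bsub>G\<^esub> x))" "glen ?w = Suc (glen (inv\<^bsub>G\<^esub> (m \<otimes>\<^bsub>G\<^esub> s) \<otimes>\<^bsub>G\<^esub> y))"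
      using gstarts_glen[OF s] st mc assms shift by auto
    have tri: "glen v \<le> glen (m \<otimes>\<^bsub>G\<^esub> s) + glen (inv\<^bsub>G\<^esub> (m \<otimes>\<^bsub>G\<^esub> s) \<otimes>\<^bsub>G\<^esub> v)" if "v \<in> carrier G" for v
      using gdist_triangle[of "\<one>\<^bsub>G\<^esub>" "m \<otimes>\<^bsub>G\<^esub> s" v] mc sc that by (simp add: gdist_eq)
    obtain b where "fst b \<in> V" "s = cls [b]" using s by (auto simp: letters_def)
    then have "glen s \<le> 1" using wlen_le_length[of "[b]"] glen_cls[of "[b]"] by simp
    then have le: "glen (m \<otimes>\<^bsub>G\<^esub> s) \<le> Suc (glen m)" using glen_mult[OF mc sc] by simp
    have "P (m \<otimes>\<^bsub>G\<^esub> s) \<and> glen (m \<otimes>\<^bsub>G\<^esub> s) = Suc (glen m)"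
      using m(1) lens tri[OF assms(1)] tri[OF assms(2)] le mc sc unfolding P_def by auto
    then show False using m(2) by fastforce
  qed
  have "inv\<^bsub>G\<^esub> ?u \<otimes>\<^bsub>G\<^esub> ?w = inv\<^bsub>G\<^esub> x \<otimes>\<^bsub>G\<^esub> y"
    using mc assms by (simp add: G.inv_mult_group G.m_assoc) (simp add: G.m_assoc[symmetric])
  then have "glen (inv\<^bsub>G\<^esub> x \<otimes>\<^bsub>G\<^esub> y) = glen ?u + glen ?w"
    using glen_no_common_start[of ?u ?w] no mc assms by simp
  then have "is_median \<one>\<^bsub>G\<^esub> x y m"
    using m(1) mc assms gdist_sym[of x m] gdist_sym[of y m] by (simp add: is_median_def P_def gdist_eq)
  then show ?thesis by blast
qed

lemma median_exists:
  assumes "x \<in> carrier G" "y \<in> carrier G" "z \<in> carrier G"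
  shows "\<exists>m. is_median x y z m"
proof -
  obtain m where m: "is_median \<one>\<^bsub>G\<^esub> (inv\<^bsub>G\<^esub> x \<otimes>\<^bsub>G\<^esub> y) (inv\<^bsub>G\<^esub> x \<otimes>\<^bsub>G\<^esub> z) m"
    using median_of_one assms by (meson G.inv_closed G.m_closed)
  have mc: "m \<in> carrier G" using m by (simp add: is_median_def)
  have x: "x \<otimes>\<^bsub>G\<^esub> \<one>\<^bsub>G\<^esub> = x" "x \<otimes>\<^bsub>G\<^esub> (inv\<^bsub>G\<^esub> x \<otimes>\<^bsub>G\<^esub> v) = v" if "v \<in> carrier G" for v
    using that assms by (simp_all add: G.m_assoc[symmetric])
  have "is_median x y z (x \<otimes>\<^bsub>G\<^esub> m)"
    using m gdist_left[of x "\<one>\<^bsub>G\<^esub>" m] gdist_left[of x m "inv\<^bsub>G\<^esub> x \<otimes>\<^bsub>G\<^esub> y"] gdist_left[of x m "inv\<^bsub>G\<^esub> x \<otimes>\<^bsub>G\<^esub> z"]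
      gdist_left[of x "inv\<^bsub>G\<^esub> x \<otimes>\<^bsub>G\<^esub> y" m] gdist_left[of x "inv\<^bsub>G\<^esub> x \<otimes>\<^bsub>G\<^esub> y" "inv\<^bsub>G\<^esub> x \<otimes>\<^bsub>G\<^esub> z"]
      gdist_left[of x "\<one>\<^bsub>G\<^esub>" "inv\<^bsub>G\<^esub> x \<otimes>\<^bsub>G\<^esub> y"] gdist_left[of x "\<one>\<^bsub>G\<^esub>" "inv\<^bsub>G\<^esub> x \<otimes>\<^bsub>G\<^esub> z"] assms mc
    by (simp add: is_median_def x)
  then show ?thesis by blast
qed

text \<open>A letter \<open>s\<close> leading from \<open>m\<close> towards \<open>m'\<close>
  defines a wall. As \<open>m\<close> lies between any two of the three points, at most one of them
  is beyond the wall; as \<open>m'\<close> is beyond it and the near side is convex, at most one is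
  on the near side. Three points cannot satisfy both.\<close>

lemma median_unique:
  assumes xyz: "x \<in> carrier G" "y \<in> carrier G" "z \<in> carrier G"
    and m: "is_median x y z m" and m': "is_median x y z m'"
  shows "m' = m"
proof (rule ccontr)
  assume "m' \<noteq> m"
  have mc: "m \<in> carrier G" "m' \<in> carrier G" using m m' by (auto simp: is_median_def)
  define t where "t v = inv\<^bsub>G\<^esub> m \<otimes>\<^bsub>G\<^esub> v" for v
  have tc: "t v \<in> carrier G" if "v \<in> carrier G" for v using that mc by (simp add: t_def)
  have td: "gdist (t u) (t v) = gdist u v" if "u \<in> carrier G" "v \<in> carrier G" for u v
    using gdist_left that mc by (simp add: t_def)
  have tm: "t m = \<one>\<^bsub>G\<^esub>" using mc by (simp add: t_def)
  have "t m' \<noteq> \<one>\<^bsub>G\<^esub>" using \<open>m' \<noteq> m\<close> mc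
    by (metis G.inv_closed G.inv_equality G.inv_inv t_def)
  then obtain s where s: "s \<in> letters" "gstarts s (t m')" using first_letter tc mc by blast
  have one: "\<not> (gstarts s (t u) \<and> gstarts s (t v))"
    if uv: "u \<in> carrier G" "v \<in> carrier G" "gdist u m + gdist m v = gdist u v" for u v
  proof
    assume st: "gstarts s (t u) \<and> gstarts s (t v)"
    have sc: "s \<in> carrier G" using s letters_carrier by auto
    have "gdist u v = gdist (inv\<^bsub>G\<^esub> s \<otimes>\<^bsub>G\<^esub> t u) (inv\<^bsub>G\<^esub> s \<otimes>\<^bsub>G\<^esub> t v)"
      using uv tc td sc gdist_left by simp
    also have "\<dots> \<le> glen (inv\<^bsub>G\<^esub> s \<otimes>\<^bsub>G\<^esub> t u) + glen (inv\<^bsub>G\<^esub> s \<otimes>\<^bsub>G\<^esub> t v)"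
      using gdist_triangle[of "inv\<^bsub>G\<^esub> s \<otimes>\<^bsub>G\<^esub> t u" "\<one>\<^bsub>G\<^esub>" "inv\<^bsub>G\<^esub> s \<otimes>\<^bsub>G\<^esub> t v"] uv tc sc
        gdist_sym[of "inv\<^bsub>G\<^esub> s \<otimes>\<^bsub>G\<^esub> t u" "\<one>\<^bsub>G\<^esub>"] by (simp add: gdist_one)
    also have "\<dots> < glen (t u) + glen (t v)" using st by (auto simp: gstarts_def)
    finally have lt: "gdist u v < glen (t u) + glen (t v)" .
    have "glen (t u) = gdist m u" "glen (t v) = gdist m v"
      using uv td[OF mc(1)] tm gdist_one tc by metis+
    then show False using lt uv gdist_sym[of m u] mc by simp
  qed
  have two: "gstarts s (t u) \<or> gstarts s (t v)"
    if "u \<in> carrier G" "v \<in> carrier G" "gdist u m' + gdist m' v = gdist u v" for u v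
    using halfspace_convex[of "t u" "t v" "t m'" s] s td tc mc that by auto
  have sym: "gdist z m + gdist m y = gdist z y" "gdist z m + gdist m x = gdist z x"
    using m gdist_sym xyz mc by (auto simp: is_median_def)
  show False
    using one[of x y] one[of y z] one[of x z] two[of x y] two[of y z] two[of x z] m m' xyz
    by (auto simp: is_median_def)
qed

lemma raag_median_eq:
  assumes "x \<in> carrier G" "y \<in> carrier G" "z \<in> carrier G" "is_median x y z m"
  shows "raag_median V E x y z = m"
proof -
  have "m' \<in> raag_interval V E x y \<inter> raag_interval V E y z \<inter> raag_interval V E x z \<longleftrightarrow> is_median x y z m'" for m'
    by (auto simp: raag_interval_def is_median_def)
  then show ?thesis unfolding raag_median_def using assms median_unique by (simp add: the_equality)
qed

text \<open>The median is characterised by distance equations, which pass to the images; uniqueness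
  then identifies the image of the median.\<close>

lemma raag_median_isometry:
  assumes f: "f ` carrier G \<subseteq> carrier G"
    and d: "\<And>x y. x \<in> carrier G \<Longrightarrow> y \<in> carrier G \<Longrightarrow> gdist (f x) (f y) = gdist x y"
    and xyz: "x \<in> carrier G" "y \<in> carrier G" "z \<in> carrier G"
  shows "raag_median V E x y z \<in> carrier G"
    and "raag_median V E (f x) (f y) (f z) = f (raag_median V E x y z)"
proof -
  obtain m where m: "is_median x y z m" using median_exists xyz by blast
  then have mc: "m \<in> carrier G" and e: "raag_median V E x y z = m" using raag_median_eq xyz by (auto simp: is_median_def)
  then show "raag_median V E x y z \<in> carrier G" by simp
  have "is_median (f x) (f y) (f z) (f m)" using m f xyz mc by (auto simp: is_median_def d)
  then show "raag_median V E (f x) (f y) (f z) = f (raag_median V E x y z)"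
    using raag_median_eq[of "f x" "f y" "f z" "f m"] f xyz e by auto
qed

end
end

section \<open>Letter-by-letter rewriting and the automorphisms it induces\<close>

section \<open>Automorphisms induced by finite automata\<close>

text \<open>
  A finite set of states is acted on by the group, and every state permutes the letters, compatibly
  with inverses and commutations. Rewriting words letter by letter then is an isometry of the Cayley
  graph; on the stabiliser of a state it is an automorphism.
\<close>

locale automaton = raag_graph V E for V :: "'v set" and E +
  fixes X :: "'x set" and base :: 'x
    and step :: "'x \<Rightarrow> 'v \<times> bool \<Rightarrow> 'x" and subst :: "'x \<Rightarrow> 'v \<times> bool \<Rightarrow> 'v \<times> bool" and N :: nat
  assumes finite_X: "finite X" and base: "base \<in> X" and N: "N > 0"
    and step_X: "x \<in> X \<Longrightarrow> fst a \<in> V \<Longrightarrow> step x a \<in> X"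
    and step_linv: "x \<in> X \<Longrightarrow> fst a \<in> V \<Longrightarrow> step (step x a) (linv a) = x"
    and step_comm: "x \<in> X \<Longrightarrow> {fst a, fst b} \<in> E \<Longrightarrow> step (step x a) b = step (step x b) a"
    and subst_V: "x \<in> X \<Longrightarrow> fst a \<in> V \<Longrightarrow> fst (subst x a) \<in> V"
    and step_subst: "x \<in> X \<Longrightarrow> fst a \<in> V \<Longrightarrow> step x (subst x a) = step x a"
    and subst_linv: "x \<in> X \<Longrightarrow> fst a \<in> V \<Longrightarrow> subst (step x a) (linv a) = linv (subst x a)"
    and subst_comm: "x \<in> X \<Longrightarrow> {fst a, fst b} \<in> E \<Longrightarrow> subst (step x b) a = subst x a"
    and subst_edge: "x \<in> X \<Longrightarrow> {fst a, fst b} \<in> E \<Longrightarrow> {fst (subst x a), fst (subst x b)} \<in> E"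
    and subst_nonadjacent: "x \<in> X \<Longrightarrow> fst a \<in> V \<Longrightarrow> {fst a, fst (subst x a)} \<notin> E"
    and subst_order: "x \<in> X \<Longrightarrow> fst a \<in> V \<Longrightarrow> (subst x ^^ N) a = a"
begin

definition run :: "'x \<Rightarrow> 'v group_word \<Rightarrow> 'x" where "run x w = fold (\<lambda>a y. step y a) w x"

fun trans :: "'x \<Rightarrow> 'v group_word \<Rightarrow> 'v group_word" where
  "trans x [] = []"
| "trans x (a # w) = subst x a # trans (step x a) w"

lemma run_simps [simp]: "run x [] = x" "run x (a # w) = run (step x a) w" "run x (u @ w) = run (run x u) w"
  by (simp_all add: run_def)

lemma trans_append [simp]: "trans x (u @ w) = trans x u @ trans (run x u) w"
  by (induction u arbitrary: x) auto

lemma length_trans [simp]: "length (trans x w) = length w"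
  by (induction w arbitrary: x) auto

lemma run_X [simp]: "x \<in> X \<Longrightarrow> w \<in> words V \<Longrightarrow> run x w \<in> X"
  by (induction w arbitrary: x) (auto simp: step_X)

lemma trans_words: "x \<in> X \<Longrightarrow> w \<in> words V \<Longrightarrow> trans x w \<in> words V"
proof (induction w arbitrary: x)
  case (Cons a w)
  then show ?case using Cons.IH[of "step x a"] subst_V[of x a] step_X[of x a] by simp
qed simp

lemma trans_words' [simp]:
  "x \<in> X \<Longrightarrow> \<forall>a\<in>set w. fst a \<in> V \<Longrightarrow> (\<forall>a\<in>set (trans x w). fst a \<in> V) = True"
  using trans_words[of x w] by simp

lemma run_trans [simp]: "x \<in> X \<Longrightarrow> \<forall>a\<in>set w. fst a \<in> V \<Longrightarrow> run x (trans x w) = run x w"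
proof (induction w arbitrary: x)
  case (Cons a w)
  then show ?case using Cons.IH[of "step x a"] step_X[of x a] step_subst[of x a] by simp
qed simp

text \<open>Relations are preserved in place: \<open>subst_linv\<close> sends a cancelling pair to a
  cancelling pair, \<open>subst_comm\<close> and \<open>subst_edge\<close> send a commutation to a
  commutation, and both sides leave the automaton in the same state for the rest of the
  word.\<close>

lemma word_eq_run_trans: "u \<triangleq> w \<Longrightarrow> x \<in> X \<Longrightarrow> run x u = run x w \<and> trans x u \<triangleq> trans x w"
proof (induction arbitrary: x rule: word_eq.induct)
  case (refl w)
  then show ?case using word_eq.refl[OF trans_words] by blast
next
  case (cancel u w c b)
  define a where "a = (c, b)"
  have a: "fst a \<in> V" "linv a = (c, \<not> b)" using cancel by (auto simp: a_def)
  let ?y = "run x u"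
  have y: "?y \<in> X" using cancel by simp
  have "trans x u @ [subst ?y a, linv (subst ?y a)] @ trans ?y w \<triangleq> trans x u @ trans ?y w"
    using cancel.hyps cancel.prems y a
    by (intro pop_invert subst_V trans_words) auto
  then show ?case unfolding a_def[symmetric] a(2)[symmetric]
    using step_linv[OF y a(1)] subst_linv[OF y a(1)] by simp
next
  case (relator u w r s)
  from relator obtain a b where ab: "r = [(a, True), (b, True)]" "s = [(b, True), (a, True)]" "{a, b} \<in> E"
    by (auto simp: comm_rel_def)
  let ?y = "run x u"
  have y: "?y \<in> X" using relator by simp
  let ?a = "(a, True)" and ?b = "(b, True)"
  have e: "{fst ?a, fst ?b} \<in> E" "{fst ?b, fst ?a} \<in> E" using ab by (auto simp: insert_commute)
  have V: "a \<in> V" "b \<in> V" using edge_in_V ab by auto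
  let ?z = "step (step ?y ?a) ?b"
  have z: "?z \<in> X" using y V by (simp add: step_X)
  have "trans x u @ [subst ?y ?a, subst ?y ?b] @ trans ?z w \<triangleq> trans x u @ [subst ?y ?b, subst ?y ?a] @ trans ?z w"
    using subst_edge[OF y e(1)] trans_words relator z
    by (intro word_eq_append_left word_eq_append_right letters_commute) auto
  then show ?case using ab step_comm[OF y e(1)] subst_comm[OF y e(1)] subst_comm[OF y e(2)] by simp
qed (auto intro: word_eq.sym word_eq.trans)

lemma wlen_trans_le: assumes "x \<in> X" "w \<in> words V" shows "wlen (trans x w) \<le> wlen w"
proof -
  obtain u where u: "w \<triangleq> u" "u \<in> words V" "length u = wlen w" using obtain_reduced[OF assms(2)] by blast
  have "wlen (trans x w) = wlen (trans x u)" using wlen_cong word_eq_run_trans[OF u(1) assms(1)] by simp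
  also have "\<dots> \<le> wlen w" using wlen_le_length[OF trans_words[OF assms(1) u(2)]] u by simp
  finally show ?thesis .
qed

lemma trans_funpow:
  "x \<in> X \<Longrightarrow> w \<in> words V \<Longrightarrow> (trans x ^^ k) w \<in> words V \<and> run x ((trans x ^^ k) w) = run x w"
proof (induction k)
  case (Suc k)
  then show ?case using trans_words[of x "(trans x ^^ k) w"] run_trans[of x "(trans x ^^ k) w"] by simp
qed simp

lemma subst_funpow:
  "x \<in> X \<Longrightarrow> fst a \<in> V \<Longrightarrow> fst ((subst x ^^ k) a) \<in> V \<and> step x ((subst x ^^ k) a) = step x a"
proof (induction k)
  case (Suc k)
  then show ?case using subst_V[of x "(subst x ^^ k) a"] step_subst[of x "(subst x ^^ k) a"] by simp
qed simp

lemma trans_funpow_Cons: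
  "x \<in> X \<Longrightarrow> fst a \<in> V \<Longrightarrow> (trans x ^^ k) (a # w) = (subst x ^^ k) a # (trans (step x a) ^^ k) w"
proof (induction k)
  case (Suc k)
  then show ?case using subst_funpow[of x a k] by simp
qed simp

lemma trans_order: "x \<in> X \<Longrightarrow> w \<in> words V \<Longrightarrow> (trans x ^^ N) w = w"
proof (induction w arbitrary: x)
  case Nil
  have "(trans x ^^ k) [] = []" for k by (induction k) auto
  then show ?case .
next
  case (Cons a w)
  then show ?case by (simp add: trans_funpow_Cons subst_order step_X)
qed

text \<open>Rewriting keeps the number of letters, so it cannot increase the length of an element.
  Since \<open>N\<close>-fold rewriting is the identity, it cannot decrease it either.\<close>

lemma wlen_trans: assumes "x \<in> X" "w \<in> words V" shows "wlen (trans x w) = wlen w"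
proof (rule antisym)
  show "wlen (trans x w) \<le> wlen w" using wlen_trans_le assms by blast
  have "wlen ((trans x ^^ Suc k) w) \<le> wlen (trans x w)" for k
  proof (induction k)
    case (Suc k)
    then show ?case using wlen_trans_le[OF assms(1), of "(trans x ^^ Suc k) w"] trans_funpow[OF assms, of "Suc k"] by auto
  qed simp
  from this[of "N - 1"] show "wlen w \<le> wlen (trans x w)" using N trans_order[OF assms] by simp
qed

subsection \<open>The induced map on the group\<close>

definition word_of :: "'v group_word set \<Rightarrow> 'v group_word"
  where "word_of g = (SOME w. w \<in> words V \<and> g = cls w)"

lemma word_of: assumes "g \<in> carrier G" shows "word_of g \<in> words V" "cls (word_of g) = g"
proof -
  have "\<exists>w. w \<in> words V \<and> g = cls w" using assms carrier_raag by blast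
  from someI_ex[OF this] show "word_of g \<in> words V" "cls (word_of g) = g" by (auto simp: word_of_def)
qed

lemma word_of_cls: "w \<in> words V \<Longrightarrow> word_of (cls w) \<triangleq> w"
  using word_of[of "cls w"] cls_in_carrier cls_eq_iff by blast

definition state :: "'v group_word set \<Rightarrow> 'x" where "state g = run base (word_of g)"

text \<open>Defined on the whole group, although multiplicativity is only established for left
  factors in \<open>R\<close>: medians of elements of \<open>R\<close> may lie outside
  \<open>R\<close>.\<close>

definition gmap :: "'v group_word set \<Rightarrow> 'v group_word set" where "gmap g = cls (trans base (word_of g))"

lemma state_cls: "w \<in> words V \<Longrightarrow> state (cls w) = run base w"
  using word_eq_run_trans[OF word_of_cls base] by (simp add: state_def)

lemma gmap_cls: "w \<in> words V \<Longrightarrow> gmap (cls w) = cls (trans base w)"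
  unfolding gmap_def using cls_eq_iff[OF trans_words[OF base]] word_eq_run_trans[OF word_of_cls base] by blast

definition R where "R = {g \<in> carrier G. state g = base}"

lemma cls_in_R: "w \<in> words V \<Longrightarrow> cls w \<in> R \<longleftrightarrow> run base w = base"
  by (simp add: R_def state_cls cls_in_carrier)

lemma R_eq: "R = {cls w | w. w \<in> words V \<and> run base w = base}"
  by (auto simp: R_def carrier_raag state_cls)

lemma run_winv: "x \<in> X \<Longrightarrow> w \<in> words V \<Longrightarrow> run (run x w) (winv w) = x"
  using word_eq_run_trans[OF word_eq_winv_right[of w]] by simp

lemma state_X: "g \<in> carrier G \<Longrightarrow> state g \<in> X"
  using word_of base by (simp add: state_def)

interpretation G: group G by (rule group_raag)

lemma subgroup_R: "subgroup R G"
proof (rule G.subgroupI)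
  show "R \<subseteq> carrier G" by (auto simp: R_def)
  show "R \<noteq> {}" using cls_in_R[of "[]"] by auto
  fix g assume "g \<in> R"
  then obtain u where u: "u \<in> words V" "g = cls u" "run base u = base" by (auto simp: R_eq)
  then show "inv\<^bsub>G\<^esub> g \<in> R" using cls_in_R[of "winv u"] run_winv[OF base, of u] by (simp add: cls_inv)
  fix h assume "h \<in> R"
  then obtain w where "w \<in> words V" "h = cls w" "run base w = base" by (auto simp: R_eq)
  then show "g \<otimes>\<^bsub>G\<^esub> h \<in> R" using u cls_in_R[of "u @ w"] by (simp add: cls_mult)
qed

interpretation R: subgroup R G by (rule subgroup_R)

text \<open>The coset of an element is determined by the state to which it leads, and there are
  finitely many states.\<close>

lemma finite_rcosets_R: "finite (rcosets\<^bsub>G\<^esub> R)"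
proof -
  have "R #>\<^bsub>G\<^esub> g = R #>\<^bsub>G\<^esub> h" if gh: "g \<in> carrier G" "h \<in> carrier G" "state g = state h" for g h
  proof -
    obtain u w where uw: "u \<in> words V" "g = cls u" "w \<in> words V" "h = cls w" using gh by (auto simp: carrier_raag)
    then have "run base (w @ winv u) = base" using gh run_winv[OF base, of u] by (simp add: state_cls)
    then have "h \<otimes>\<^bsub>G\<^esub> inv\<^bsub>G\<^esub> g \<in> R" using cls_in_R[of "w @ winv u"] uw by (simp add: cls_inv cls_mult)
    then have "h \<in> R #>\<^bsub>G\<^esub> g"
      using gh R.rcos_module[OF group_raag] by blast
    then show ?thesis using G.repr_independence[of h R g] gh subgroup_R by simp
  qed
  then have "\<exists>c. \<forall>g\<in>carrier G. R #>\<^bsub>G\<^esub> g = c (state g)"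
    by (intro exI[of _ "\<lambda>x. R #>\<^bsub>G\<^esub> (SOME g. g \<in> carrier G \<and> state g = x)"] ballI) (metis (mono_tags, lifting) someI_ex)
  then obtain c where "\<forall>g\<in>carrier G. R #>\<^bsub>G\<^esub> g = c (state g)" by blast
  then have "rcosets\<^bsub>G\<^esub> R \<subseteq> c ` X" using state_X by (auto simp: RCOSETS_def)
  then show ?thesis using finite_X finite_surj by blast
qed

lemma gmap_carrier: "g \<in> carrier G \<Longrightarrow> gmap g \<in> carrier G"
  using trans_words[OF base] by (auto simp: carrier_raag gmap_cls)

lemma state_gmap: "g \<in> carrier G \<Longrightarrow> state (gmap g) = state g"
  using trans_words[OF base] base by (auto simp: carrier_raag gmap_cls state_cls)

text \<open>A word of \<open>g\<close> returns to \<open>base\<close>, so the word of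
  \<open>h\<close> after it is rewritten as if it stood alone.\<close>

lemma gmap_mult:
  assumes "g \<in> R" "h \<in> carrier G" shows "gmap (g \<otimes>\<^bsub>G\<^esub> h) = gmap g \<otimes>\<^bsub>G\<^esub> gmap h"
proof -
  obtain u where u: "u \<in> words V" "g = cls u" "run base u = base" using assms by (auto simp: R_eq)
  obtain w where w: "w \<in> words V" "h = cls w" using assms by (auto simp: carrier_raag)
  show ?thesis using u w gmap_cls[of "u @ w"] base
    by (simp add: cls_mult gmap_cls)
qed

lemma gmap_funpow: "w \<in> words V \<Longrightarrow> (gmap ^^ k) (cls w) = cls ((trans base ^^ k) w)"
proof (induction k)
  case (Suc k)
  then show ?case using gmap_cls trans_funpow[OF base Suc.prems, of k] by simp
qed simp

lemma gmap_order: "g \<in> carrier G \<Longrightarrow> (gmap ^^ N) g = g"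
  using trans_order[OF base] by (auto simp: carrier_raag gmap_funpow)

text \<open>The word leading from \<open>g\<close> to \<open>h\<close> is rewritten from the state
  of \<open>g\<close>. This is why \<open>wlen_trans\<close> was proved for every state and not only
  for \<open>base\<close>.\<close>

lemma gmap_isometry:
  assumes "g \<in> carrier G" "h \<in> carrier G" shows "gdist (gmap g) (gmap h) = gdist g h"
proof -
  obtain u w where uw: "u \<in> words V" "g = cls u" "w \<in> words V" "h = cls w" using assms by (auto simp: carrier_raag)
  let ?x = "run base u" and ?v = "winv u @ w"
  have x: "?x \<in> X" using base uw by simp
  have v: "?v \<in> words V" using uw by simp
  have "u @ ?v \<triangleq> [] @ w" unfolding append_assoc[symmetric]
    using uw by (intro word_eq_append_right word_eq_winv_right) auto
  then have e: "trans base u @ trans ?x ?v \<triangleq> trans base w" using word_eq_run_trans[OF _ base] by fastforce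
  have tw: "trans base u \<in> words V" "trans ?x ?v \<in> words V" "trans base w \<in> words V"
    using trans_words base x uw v by blast+
  have "winv (trans base u) @ (trans base u @ trans ?x ?v) \<triangleq> winv (trans base u) @ trans base w"
    using e tw by (intro word_eq_append_left) auto
  moreover have "(winv (trans base u) @ trans base u) @ trans ?x ?v \<triangleq> [] @ trans ?x ?v"
    using tw by (intro word_eq_append_right word_eq_winv_left) auto
  ultimately have "wlen (winv (trans base u) @ trans base w) = wlen (trans ?x ?v)"
    using wlen_cong by (metis append_Nil append_assoc)
  also have "\<dots> = wlen ?v" using wlen_trans x v by blast
  finally show ?thesis
    using uw tw glen_cls[of ?v] glen_cls[of "winv (trans base u) @ trans base w"]
    by (simp add: gdist_eq gmap_cls cls_inv cls_mult)
qed

abbreviation "GR \<equiv> raag V E\<lparr>carrier := R\<rparr>"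

definition \<phi> where "\<phi> = restrict gmap R"

lemma gmap_R: "g \<in> R \<Longrightarrow> gmap g \<in> R"
  using gmap_carrier[of g] state_gmap[of g] unfolding R_def by simp

lemma gmap_funpow_R: "g \<in> R \<Longrightarrow> (gmap ^^ k) g \<in> R"
  by (induction k) (auto intro: gmap_R)

lemma bij_gmap_R: "bij_betw gmap R R"
proof (rule bij_betw_byWitness[where f' = "gmap ^^ (N - 1)"])
  obtain k where k: "N = Suc k" using N by (cases N) auto
  have order: "(gmap ^^ N) a = a" if "a \<in> R" for a using gmap_order that R.mem_carrier by blast
  show "\<forall>a\<in>R. (gmap ^^ (N - 1)) (gmap a) = a"
    using order unfolding k by (simp add: funpow_swap1)
  show "\<forall>a'\<in>R. gmap ((gmap ^^ (N - 1)) a') = a'"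
    using order unfolding k by simp
qed (use gmap_R gmap_funpow_R in auto)

lemma \<phi>_auto: "\<phi> \<in> auto GR"
proof -
  have "\<phi> \<in> hom GR GR" using gmap_R gmap_mult by (auto simp: hom_def \<phi>_def)
  moreover have "bij_betw \<phi> R R" using bij_gmap_R bij_betw_cong[of R \<phi> gmap R] by (simp add: \<phi>_def)
  ultimately show ?thesis by (auto simp: auto_def Bij_def \<phi>_def)
qed

lemma \<phi>_pow: "\<phi> [^]\<^bsub>AutoGroup GR\<^esub> (k::nat) = restrict (gmap ^^ k) R"
proof (induction k)
  case 0
  show ?case by (auto simp: AutoGroup_def BijGroup_def restrict_def)
next
  case (Suc k)
  have GR: "group GR" using subgroup_R G.subgroup_imp_group by blast
  have B: "restrict (gmap ^^ k) R \<in> Bij R" "\<phi> \<in> Bij R"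
  proof -
    have "\<phi> [^]\<^bsub>AutoGroup GR\<^esub> k \<in> carrier (AutoGroup GR)"
      using \<phi>_auto group.AutoGroup[OF GR] by (intro monoid.nat_pow_closed group.is_monoid) (auto simp: AutoGroup_def)
    then have "\<phi> [^]\<^bsub>AutoGroup GR\<^esub> k \<in> auto GR" by (simp add: AutoGroup_def)
    moreover have "f \<in> Bij R" if "f \<in> auto GR" for f using that by (simp add: auto_def)
    ultimately show "restrict (gmap ^^ k) R \<in> Bij R" "\<phi> \<in> Bij R"
      using Suc \<phi>_auto by metis+
  qed
  have "\<phi> [^]\<^bsub>AutoGroup GR\<^esub> Suc k = restrict (gmap ^^ k) R \<otimes>\<^bsub>AutoGroup GR\<^esub> \<phi>"
    using Suc by (simp only: monoid.nat_pow_Suc[OF group.is_monoid[OF group.AutoGroup[OF GR]]])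
  also have "\<dots> = compose R (restrict (gmap ^^ k) R) \<phi>"
    using B by (simp add: AutoGroup_def BijGroup_def)
  also have "\<dots> = restrict (gmap ^^ Suc k) R"
    using gmap_R by (auto simp: compose_def \<phi>_def fun_eq_iff funpow_swap1)
  finally show ?case .
qed

lemma \<phi>_finite_order: "\<phi> [^]\<^bsub>AutoGroup GR\<^esub> N = \<one>\<^bsub>AutoGroup GR\<^esub>"
proof -
  have "\<one>\<^bsub>AutoGroup GR\<^esub> = (\<lambda>x\<in>R. x)" by (simp add: AutoGroup_def BijGroup_def)
  moreover have "restrict (gmap ^^ N) R = (\<lambda>x\<in>R. x)"
    by (rule restrict_ext) (use gmap_order R.mem_carrier in blast)
  ultimately show ?thesis using \<phi>_pow by metis
qed

subsection \<open>Coarse medians\<close>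

text \<open>The empty word at \<open>base\<close> makes \<open>retr\<close> the identity on
  \<open>R\<close>; the induction in \<open>generate_T\<close> relies on this at its start and in
  its conclusion.\<close>

definition homeward :: "'x \<Rightarrow> 'v group_word"
  where "homeward x = (if x = base then [] else SOME w. w \<in> words V \<and> run x w = base)"

lemma homeward: assumes "u \<in> words V" shows "homeward (run base u) \<in> words V" "run (run base u) (homeward (run base u)) = base"
proof -
  have "\<exists>w. w \<in> words V \<and> run (run base u) w = base"
    using run_winv[OF base assms] assms by (intro exI[of _ "winv u"]) simp
  from someI_ex[OF this] show "homeward (run base u) \<in> words V" "run (run base u) (homeward (run base u)) = base"
    by (auto simp: homeward_def)
qed

definition B :: nat where "B = Max ((\<lambda>x. length (homeward x)) ` X)"

lemma length_homeward: "x \<in> X \<Longrightarrow> length (homeward x) \<le> B"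
  unfolding B_def using finite_X by (intro Max_ge) auto

definition retr :: "'v group_word set \<Rightarrow> 'v group_word set"
  where "retr g = g \<otimes>\<^bsub>G\<^esub> cls (homeward (state g))"

lemma retr_cls: "w \<in> words V \<Longrightarrow> retr (cls w) = cls (w @ homeward (run base w))"
  using homeward by (simp add: retr_def state_cls cls_mult)

lemma retr_R: "g \<in> carrier G \<Longrightarrow> retr g \<in> R"
  using homeward retr_cls cls_in_R by (fastforce simp: carrier_raag)

lemma retr_close: assumes "g \<in> carrier G" shows "gdist g (retr g) \<le> B"
proof -
  obtain w where w: "w \<in> words V" "g = cls w" using assms by (auto simp: carrier_raag)
  have "inv\<^bsub>G\<^esub> g \<otimes>\<^bsub>G\<^esub> retr g = cls (homeward (state g))"
    using assms w homeward[of w] by (simp add: retr_def state_cls cls_in_carrier G.m_assoc[symmetric])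
  then have "gdist g (retr g) = wlen (homeward (state g))"
    using w homeward[of w] by (simp add: gdist_eq glen_cls state_cls)
  also have "\<dots> \<le> length (homeward (state g))" using w homeward[of w] by (simp add: wlen_le_length state_cls)
  also have "\<dots> \<le> B" using state_X assms length_homeward by blast
  finally show ?thesis .
qed

text \<open>The bound \<open>2 * B + 1\<close> is the distance to which \<open>retr\<close> can
  spread two adjacent vertices. It also covers the error term in
  \<open>\<phi>_coarse_median_preserving\<close>, which therefore has word length at most 1.\<close>

definition T where "T = {r \<in> R. glen r \<le> 2 * B + 1}"

lemma finite_T: "finite T"
proof -
  have "g \<in> cls ` {w. set w \<subseteq> V \<times> UNIV \<and> length w \<le> 2 * B + 1}" if "g \<in> T" for g
  proof -
    from that obtain w where w: "w \<in> words V" "g = cls w" "wlen w \<le> 2 * B + 1" by (auto simp: T_def R_eq glen_cls)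
    obtain u where "w \<triangleq> u" "u \<in> words V" "length u = wlen w" using obtain_reduced[OF w(1)] by blast
    then show ?thesis using w cls_eq_iff by (intro image_eqI[of _ _ u]) auto
  qed
  moreover have "finite (cls ` {w. set w \<subseteq> V \<times> (UNIV::bool set) \<and> length w \<le> 2 * B + 1})"
    using finite_V by (intro finite_imageI finite_lists_length_le) auto
  ultimately show ?thesis by (meson finite_subset subsetI)
qed

text \<open>Retract a path of the Cayley graph from the identity to an element of \<open>R\<close>:
  the result is a sequence in \<open>R\<close> with the same ends, whose successive quotients lie in
  \<open>T\<close>.\<close>

lemma generate_T: "generate GR T = R"
proof
  have GR: "group GR" using subgroup_R G.subgroup_imp_group by blast
  show "generate GR T \<subseteq> R" using group.generate_incl[OF GR, of T] by (auto simp: T_def)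
  have p: "retr (cls w) \<in> generate GR T" if "w \<in> words V" for w
    using that
  proof (induction w rule: rev_induct)
    case Nil
    have "retr (cls []) = \<one>\<^bsub>GR\<^esub>" using retr_cls[of "[]"] by (simp add: homeward_def cls_one)
    then show ?case using generate.one[of GR T] by simp
  next
    case (snoc a w)
    then have w: "w \<in> words V" "fst a \<in> V" by auto
    let ?g = "cls w" and ?h = "cls (w @ [a])"
    have c: "?g \<in> carrier G" "?h \<in> carrier G"
      using w cls_in_carrier[of w] cls_in_carrier[of "w @ [a]"] by simp_all
    then have r: "retr ?g \<in> R" "retr ?h \<in> R" "retr ?g \<in> carrier G" "retr ?h \<in> carrier G" using retr_R R.mem_carrier by auto
    have "?h = ?g \<otimes>\<^bsub>G\<^esub> cls [a]" "cls [a] \<in> carrier G"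
      using w cls_mult[of w "[a]"] cls_in_carrier[of "[a]"] by simp_all
    then have "inv\<^bsub>G\<^esub> ?g \<otimes>\<^bsub>G\<^esub> ?h = cls [a]"
      using c G.inv_solve_left by metis
    then have "gdist ?g ?h \<le> 1" using wlen_le_length[of "[a]"] w by (simp add: gdist_eq glen_cls)
    then have "gdist (retr ?g) (retr ?h) \<le> 2 * B + 1"
      using gdist_triangle[of "retr ?g" ?g "retr ?h"] gdist_triangle[of ?g ?h "retr ?h"]
        gdist_sym[of "retr ?g" ?g] retr_close[of ?g] retr_close[of ?h] c r by simp
    then have "inv\<^bsub>G\<^esub> (retr ?g) \<otimes>\<^bsub>G\<^esub> retr ?h \<in> T" using r by (simp add: T_def gdist_eq)
    then have "retr ?g \<otimes>\<^bsub>GR\<^esub> (inv\<^bsub>G\<^esub> (retr ?g) \<otimes>\<^bsub>G\<^esub> retr ?h) \<in> generate GR T"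
      using generate.eng[OF snoc.IH[OF w(1)] generate.incl[of _ T GR]] by blast
    then show ?case using r by (simp add: G.m_assoc[symmetric])
  qed
  show "R \<subseteq> generate GR T"
  proof
    fix g assume "g \<in> R"
    then obtain w where w: "w \<in> words V" "g = cls w" "run base w = base" by (auto simp: R_eq)
    then have "retr g = g" using retr_cls[of w] by (simp add: homeward_def)
    then show "g \<in> generate GR T" using p[of w] w by simp
  qed
qed

lemma generate_gens: "generate G gens = carrier G"
proof
  show "generate G gens \<subseteq> carrier G" using G.generate_incl gens_carrier by blast
  have "cls w \<in> generate G gens" if "w \<in> words V" for w
    using that
  proof (induction w rule: list.induct)
    case Nil
    then show ?case using generate.one[of G gens] by (simp add: cls_one)
  next
    case (Cons a w)
    have aV: "fst a \<in> V" using Cons.prems by simp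
    have "cls [a] \<in> gens \<union> m_inv G ` gens" 
      unfolding letters_eq letters_def[symmetric] using aV by (rule cls_in_letters)
    then have "cls [a] \<in> generate G gens" by (auto intro: generate.incl generate.inv)
    then have "cls [a] \<otimes>\<^bsub>G\<^esub> cls w \<in> generate G gens" using Cons by (intro generate.eng) auto
    then show ?case using Cons.prems cls_mult[of "[a]" w] by simp
  qed
  then show "carrier G \<subseteq> generate G gens" by (auto simp: carrier_raag)
qed

text \<open>The only defect is that \<open>retr\<close> need not commute with \<open>gmap\<close>.
  Both composites stay within \<open>B\<close> of the image of the median, so they differ by an
  element of \<open>T\<close>.\<close>

lemma \<phi>_coarse_median_preserving: "coarse_median_preserving V E R \<phi>"
proof -
  have GR: "group GR" using subgroup_R G.subgroup_imp_group by blast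
  have "word_dist GR T (\<phi> (retr (raag_median V E x y z))) (retr (raag_median V E (\<phi> x) (\<phi> y) (\<phi> z))) \<le> 1"
    if xyz: "x \<in> R" "y \<in> R" "z \<in> R" for x y z
  proof -
    have c: "x \<in> carrier G" "y \<in> carrier G" "z \<in> carrier G" using xyz R.mem_carrier by auto
    let ?m = "raag_median V E x y z"
    have m: "?m \<in> carrier G" "raag_median V E (\<phi> x) (\<phi> y) (\<phi> z) = gmap ?m"
      using raag_median_isometry[of gmap x y z] gmap_carrier gmap_isometry c xyz by (auto simp: \<phi>_def)
    let ?u = "gmap (retr ?m)" and ?v = "retr (gmap ?m)"
    have rm: "retr ?m \<in> R" "retr ?m \<in> carrier G" using retr_R m R.mem_carrier by auto
    have uv: "?u \<in> R" "?v \<in> R" "?u \<in> carrier G" "?v \<in> carrier G"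
      using rm m gmap_R retr_R gmap_carrier R.mem_carrier by auto
    have "gdist ?u ?v \<le> gdist ?u (gmap ?m) + gdist (gmap ?m) ?v" using gdist_triangle uv m gmap_carrier by blast
    moreover have "gdist ?u (gmap ?m) \<le> B"
      using gmap_isometry[OF rm(2) m(1)] retr_close[OF m(1)] gdist_sym[OF rm(2) m(1)] by simp
    ultimately have "gdist ?u ?v \<le> 2 * B + 1" using retr_close[OF gmap_carrier[OF m(1)]] by simp
    then have t: "inv\<^bsub>G\<^esub> ?u \<otimes>\<^bsub>G\<^esub> ?v \<in> T" using uv by (simp add: T_def gdist_eq)
    have "inv\<^bsub>GR\<^esub> ?u = inv\<^bsub>G\<^esub> ?u" using G.m_inv_consistent[OF subgroup_R uv(1)] .
    then have "word_dist GR T ?u ?v = word_length GR T (inv\<^bsub>G\<^esub> ?u \<otimes>\<^bsub>G\<^esub> ?v)" by (simp add: word_dist_def)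
    also have "\<dots> \<le> 1"
      unfolding word_length_def
      by (rule Least_le) (use t uv in \<open>auto intro!: exI[of _ "[inv\<^bsub>G\<^esub> ?u \<otimes>\<^bsub>G\<^esub> ?v]"]\<close>)
    finally show ?thesis using m rm by (simp add: \<phi>_def)
  qed
  moreover have "finite_generating_set G gens" using finite_gens gens_carrier generate_gens by (simp add: finite_generating_set_def)
  moreover have "finite_generating_set GR T" using finite_T generate_T by (auto simp: finite_generating_set_def T_def)
  moreover have "retr \<in> carrier G \<rightarrow> R" using retr_R by auto
  moreover have "\<forall>x\<in>carrier G. word_dist G gens x (retr x) \<le> B" using retr_close by (simp add: raag_dist_def)
  ultimately show ?thesis unfolding coarse_median_preserving_def Let_def by blast
qed

subsection \<open>Fixed points\<close>

text \<open>Compare last letters. The stack of \<open>a\<close> shows its sign on top; a replacement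
  on a different generator, non-adjacent by \<open>subst_nonadjacent\<close>, would have put a
  marker there. So the last letter is unchanged and can be popped from both pilings.\<close>

lemma same_piling_trans:
  assumes "w \<in> words V" "x \<in> X" "reduced w" "piling (trans x w) = piling w"
  shows "trans x w = w"
  using assms
proof (induction w rule: rev_induct)
  case (snoc a w)
  have V: "w \<in> words V" "fst a \<in> V" using snoc.prems by auto
  let ?b = "subst (run x w) a"
  have x: "run x w \<in> X" using V snoc.prems by simp
  have bV: "fst ?b \<in> V" using subst_V x V by blast
  have tw: "trans x w \<in> words V" using trans_words V snoc.prems by blast
  have t: "trans x (w @ [a]) = trans x w @ [?b]" by simp
  have "reduced (trans x w @ [?b])"
    using snoc.prems wlen_trans[of x "w @ [a]"] t by (simp add: reduced_def)
  then have 1: "piling (trans x w @ [?b]) = push E ?b (piling (trans x w))" using piling_reduced_snoc tw bV by blast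
  have 2: "piling (w @ [a]) = push E a (piling w)" using piling_reduced_snoc V snoc.prems by blast
  have e: "push E ?b (piling (trans x w)) = push E a (piling w)" using 1 2 snoc.prems t by simp
  have na: "{fst a, fst ?b} \<notin> E" using subst_nonadjacent x V by blast
  have "top_of (push E ?b (piling (trans x w))) (fst a) = Some (snd a)" using e by (simp add: top_push)
  then have "fst ?b = fst a \<and> snd ?b = snd a" using na by (auto simp: top_push split: if_splits)
  then have b: "?b = a" by (simp add: prod_eq_iff)
  then have "piling (trans x w) = piling w" using e pop_push by metis
  moreover have "reduced w" using snoc.prems reduced_snoc V by blast
  ultimately show ?case using snoc.IH V snoc.prems(2) b by simp
qed simp

lemma fixed_points_\<phi>:
  "fixed_points GR \<phi> = {cls w | w. w \<in> words V \<and> run base w = base \<and> trans base w = w}" (is "_ = ?S")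
proof
  show "fixed_points GR \<phi> \<subseteq> ?S"
  proof
    fix g assume "g \<in> fixed_points GR \<phi>"
    then have gR: "g \<in> R" and "\<phi> g = g" unfolding fixed_points_def by auto
    then have g: "gmap g = g" using restrict_apply'[OF gR, of gmap] unfolding \<phi>_def by metis
    from gR obtain u where u: "u \<in> words V" "g = cls u" "run base u = base" by (auto simp: R_eq)
    obtain w where w: "u \<triangleq> w" "reduced w" "w \<in> words V" using obtain_reduced[OF u(1)] by blast
    then have gw: "g = cls w" "run base w = base" using u cls_eq_iff word_eq_run_trans[OF w(1) base] by auto
    then have "cls (trans base w) = cls w" using g gmap_cls[OF w(3)] gw by metis
    then have "piling (trans base w) = piling w" using cls_eq_iff w word_eq_piling by blast
    then have "trans base w = w" using same_piling_trans w base by blast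
    then show "g \<in> ?S" using gw w by blast
  qed
  show "?S \<subseteq> fixed_points GR \<phi>"
  proof
    fix g assume "g \<in> ?S"
    then obtain w where w: "w \<in> words V" "g = cls w" "run base w = base" "trans base w = w" by blast
    have "g \<in> R" using cls_in_R w by blast
    moreover have "gmap g = g" using gmap_cls[OF w(1)] w by metis
    ultimately show "g \<in> fixed_points GR \<phi>" by (simp add: fixed_points_def \<phi>_def)
  qed
qed

end

section \<open>Canonical completion of commuting partial injections\<close>

section \<open>Completing partial actions\<close>

text \<open>Each of the \<open>n\<close> labels is a partial injection of the vertices, and
  \<open>E0\<close> lists the crossing labels. The assumption \<open>pst_comm\<close> says that
  edges with crossing labels at a common vertex span a square, which reflects the absence of
  inter-osculation.\<close>

locale partial_action =
  fixes X :: "'x set" and n :: nat and E0 :: "nat set set" and pst :: "'x \<Rightarrow> nat \<times> bool \<Rightarrow> 'x option"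
  assumes finite_X: "finite X"
    and E0_sub: "E0 \<subseteq> {{a, b} | a b. a \<in> {..<n} \<and> b \<in> {..<n} \<and> a \<noteq> b}"
    and pst_in: "pst x l = Some y \<Longrightarrow> x \<in> X \<and> y \<in> X \<and> fst l < n"
    and pst_inv: "pst x l = Some y \<Longrightarrow> pst y (linv l) = Some x"
    and pst_comm: "{fst l, fst m} \<in> E0 \<Longrightarrow> pst x l = Some y \<Longrightarrow> pst x m = Some z \<Longrightarrow>
       \<exists>t. pst y m = Some t \<and> pst z l = Some t"
begin

lemma pst_inv_iff: "pst x l = Some y \<longleftrightarrow> pst y (linv l) = Some x"
  using pst_inv[of x l y] pst_inv[of y "linv l" x] by auto

lemma pst_inj: "pst x l = Some z \<Longrightarrow> pst y l = Some z \<Longrightarrow> x = y"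
  using pst_inv[of x l z] pst_inv[of y l z] by simp

definition arrows :: "nat \<Rightarrow> ('x \<times> 'x) set" where "arrows h = {(x, y). pst x (h, True) = Some y}"

lemma arrows_iff: "(x, y) \<in> arrows h \<longleftrightarrow> pst x (h, True) = Some y" "(x, y) \<in> arrows h \<longleftrightarrow> pst y (h, False) = Some x"
  using pst_inv_iff[of x "(h, True)" y] by (auto simp: arrows_def)

lemma arrows_X: "(x, y) \<in> (arrows h)\<^sup>* \<Longrightarrow> y \<in> X \<Longrightarrow> x \<in> X"
  by (induction rule: converse_rtrancl_induct) (auto simp: arrows_def dest: pst_in)

lemma single_valued_arrows: "single_valued (arrows h)" "single_valued ((arrows h)\<inverse>)"
  using pst_inj by (auto simp: single_valued_def arrows_def)

definition is_root :: "nat \<Rightarrow> 'x \<Rightarrow> 'x \<Rightarrow> bool"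
  where "is_root h x z \<longleftrightarrow> (z, x) \<in> (arrows h)\<^sup>* \<and> pst z (h, False) = None"

lemma is_root_unique: assumes "is_root h x z" "is_root h x z'" shows "z = z'"
proof -
  have *: "u = v" if "(u, v) \<in> (arrows h)\<^sup>*" "pst v (h, False) = None" for u v
    using that arrows_iff(2) by (metis option.distinct(1) rtranclE)
  have "(x, z) \<in> ((arrows h)\<inverse>)\<^sup>*" "(x, z') \<in> ((arrows h)\<inverse>)\<^sup>*"
    using assms by (auto simp: is_root_def rtrancl_converse)
  then have "(z, z') \<in> ((arrows h)\<inverse>)\<^sup>* \<or> (z', z) \<in> ((arrows h)\<inverse>)\<^sup>*"
    using single_valued_confluent[OF single_valued_arrows(2)] by blast
  then show ?thesis using * assms by (auto simp: is_root_def rtrancl_converse)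
qed

text \<open>
  If all points before \<open>x\<close> had a predecessor, then taking predecessors would be a permutation of this
  finite set, so \<open>x\<close> would be a predecessor.
\<close>

lemma is_root_exists: assumes "x \<in> X" "pst x (h, True) = None" shows "\<exists>z. is_root h x z"
proof (rule ccontr)
  assume no: "\<nexists>z. is_root h x z"
  define S where "S = {z. (z, x) \<in> (arrows h)\<^sup>*}"
  have "finite S" using finite_X arrows_X assms by (auto simp: S_def intro!: finite_subset[of _ X])
  define f where "f z = the (pst z (h, False))" for z
  have f: "pst z (h, False) = Some (f z)" if "z \<in> S" for z
    using no that by (auto simp: S_def f_def is_root_def)
  have "f ` S \<subseteq> S"
  proof clarify
    fix z assume z: "z \<in> S"
    then have "(f z, z) \<in> arrows h" using f arrows_iff(2) by blast
    then show "f z \<in> S" using z by (auto simp: S_def)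
  qed
  moreover have "inj_on f S" by (rule inj_onI) (metis f pst_inj)
  ultimately have "f ` S = S" using \<open>finite S\<close> by (simp add: endo_inj_surj)
  moreover have "x \<in> S" by (simp add: S_def)
  ultimately obtain z where "z \<in> S" "x = f z" by blast
  then have "pst x (h, True) = Some z" using f arrows_iff by metis
  then show False using assms by simp
qed

definition sig :: "nat \<Rightarrow> 'x \<Rightarrow> 'x"
  where "sig h x = (case pst x (h, True) of Some y \<Rightarrow> y | None \<Rightarrow> (THE z. is_root h x z))"

lemma sig_Some [simp]: "pst x (h, True) = Some y \<Longrightarrow> sig h x = y"
  by (simp add: sig_def)

lemma sig_root: "pst x (h, True) = None \<Longrightarrow> is_root h x z \<Longrightarrow> sig h x = z"
  by (auto simp: sig_def intro: is_root_unique)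

lemma sig_is_root: "x \<in> X \<Longrightarrow> pst x (h, True) = None \<Longrightarrow> is_root h x (sig h x)"
  using is_root_exists sig_root by metis

lemma sig_X: "x \<in> X \<Longrightarrow> sig h x \<in> X"
  using sig_is_root[of x h] pst_in by (cases "pst x (h, True)") (auto simp: is_root_def dest: arrows_X)

text \<open>A root has no predecessor, so a closing step never ends where an actual step does. Two
  ends with the same root lie on one forward chain, and neither can be continued, so they
  coincide.\<close>

lemma inj_sig: "inj_on (sig h) X"
proof (rule inj_onI)
  fix x y assume xy: "x \<in> X" "y \<in> X" "sig h x = sig h y"
  have *: "\<not> (pst x (h, True) = Some z \<and> pst y (h, True) = None)" if "x \<in> X" "y \<in> X" "sig h x = sig h y" for x y z
  proof
    assume a: "pst x (h, True) = Some z \<and> pst y (h, True) = None"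
    then have "is_root h y z" using sig_is_root[of y h] that by auto
    then show False using a pst_inv[of x "(h, True)" z] by (auto simp: is_root_def)
  qed
  show "x = y"
  proof (cases "pst x (h, True)")
    case (Some z)
    moreover from Some *[OF xy] obtain z' where "pst y (h, True) = Some z'" by fastforce
    ultimately show ?thesis using xy pst_inj[of x "(h, True)" z y] by simp
  next
    case None
    then have y: "pst y (h, True) = None" using *[of y x] xy by fastforce
    have "(sig h x, x) \<in> (arrows h)\<^sup>*" "(sig h x, y) \<in> (arrows h)\<^sup>*"
      using sig_is_root[OF xy(1) None] sig_is_root[OF xy(2) y] xy(3) by (auto simp: is_root_def)
    then have "(x, y) \<in> (arrows h)\<^sup>* \<or> (y, x) \<in> (arrows h)\<^sup>*"
      using single_valued_confluent[OF single_valued_arrows(1)] by blast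
    then show ?thesis using None y by (auto simp: arrows_def elim: converse_rtranclE)
  qed
qed

lemma bij_sig: "bij_betw (sig h) X X"
  using inj_sig sig_X endo_inj_surj[OF finite_X, of "sig h"] by (simp add: bij_betw_def image_subset_iff)

definition isig :: "nat \<Rightarrow> 'x \<Rightarrow> 'x" where "isig h = inv_into X (sig h)"

lemma isig_X: "x \<in> X \<Longrightarrow> isig h x \<in> X"
  using bij_sig[of h] by (auto simp: isig_def bij_betw_def intro: inv_into_into)

lemma sig_isig [simp]: "x \<in> X \<Longrightarrow> sig h (isig h x) = x" "x \<in> X \<Longrightarrow> isig h (sig h x) = x"
  using bij_sig[of h] by (auto simp: isig_def bij_betw_def f_inv_into_f)

lemma isig_Some: "pst x (h, False) = Some y \<Longrightarrow> isig h x = y"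
  using pst_inv[of x "(h, False)" y] pst_in[of x "(h, False)" y] sig_isig(2)[of y h] by fastforce

abbreviation "has_out h x \<equiv> pst x (h, True) \<noteq> None"
abbreviation "has_in h x \<equiv> pst x (h, False) \<noteq> None"

lemma sig_end: assumes "x \<in> X" "\<not> has_out h x" "has_in h x" shows "has_out h (sig h x) \<and> \<not> has_in h (sig h x)"
proof -
  have r: "is_root h x (sig h x)" using sig_is_root assms by blast
  then have "sig h x \<noteq> x" using assms by (auto simp: is_root_def)
  then obtain y where "(sig h x, y) \<in> arrows h" using r by (auto simp: is_root_def elim: converse_rtranclE)
  then show ?thesis using r by (auto simp: is_root_def arrows_def)
qed

lemma isig_start: assumes "x \<in> X" "has_out h x" "\<not> has_in h x" shows "\<not> has_out h (isig h x) \<and> has_in h (isig h x)"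
proof -
  let ?y = "isig h x"
  have y: "?y \<in> X" "sig h ?y = x" using assms isig_X by auto
  have no: "\<not> has_out h ?y"
  proof
    assume "has_out h ?y"
    then have "pst ?y (h, True) = Some x" using y by auto
    then show False using pst_inv assms by fastforce
  qed
  then have "is_root h ?y x" using sig_is_root[of ?y h] y by simp
  then have "(x, ?y) \<in> (arrows h)\<^sup>*" by (simp add: is_root_def)
  moreover have "x \<noteq> ?y" using no assms by auto
  ultimately obtain z where "(z, ?y) \<in> arrows h" by (metis rtranclE)
  then show ?thesis using no by (auto simp: arrows_iff(2))
qed

lemma sig_isolated: "x \<in> X \<Longrightarrow> \<not> has_out h x \<Longrightarrow> \<not> has_in h x \<Longrightarrow> sig h x = x \<and> isig h x = x"
proof -
  assume a: "x \<in> X" "\<not> has_out h x" "\<not> has_in h x"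
  then have "sig h x = x" using sig_root[of x h x] by (auto simp: is_root_def)
  then show ?thesis using sig_isig(2)[OF a(1), of h] by simp
qed

text \<open>The second generator of a pair exchanges the two ends of every maximal chain that is not a cycle.\<close>

definition swp :: "nat \<Rightarrow> 'x \<Rightarrow> 'x"
  where "swp h x = (if has_out h x \<and> \<not> has_in h x then isig h x
     else if \<not> has_out h x \<and> has_in h x then sig h x else x)"

lemma swp_X: "x \<in> X \<Longrightarrow> swp h x \<in> X"
  by (simp add: swp_def sig_X isig_X)

lemma swp_swp: "x \<in> X \<Longrightarrow> swp h (swp h x) = x"
  using sig_end[of x h] isig_start[of x h] by (auto simp: swp_def)

subsection \<open>Commuting generators\<close>

text \<open>Apply \<open>pst_comm\<close> at \<open>x\<close>, and at \<open>y\<close> along the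
  reversed edge: moving along a commuting label neither creates nor destroys edges.\<close>

lemma status_comm:
  assumes "{fst l, fst m} \<in> E0" "pst x l = Some y" shows "pst x m = None \<longleftrightarrow> pst y m = None"
proof -
  have "{fst (linv l), fst m} \<in> E0" "pst y (linv l) = Some x" using assms pst_inv by auto
  from pst_comm[OF this] pst_comm[OF assms] show ?thesis by fastforce
qed

lemma chain_comm:
  assumes "{h, fst l} \<in> E0" "(z, x) \<in> (arrows h)\<^sup>*" "pst x l = Some x'"
  shows "\<exists>z'. pst z l = Some z' \<and> (z', x') \<in> (arrows h)\<^sup>*"
  using assms(2)
proof (induction rule: converse_rtrancl_induct)
  case base
  then show ?case using assms by auto
next
  case (step z y)
  then obtain y' where y': "pst y l = Some y'" "(y', x') \<in> (arrows h)\<^sup>*" by auto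
  have "pst y (h, False) = Some z" using step arrows_iff by blast
  then obtain t where "pst z l = Some t" "pst y' (h, False) = Some t"
    using pst_comm[of "(h, False)" l y z y'] assms y' by auto
  then show ?case using y' arrows_iff by (meson converse_rtrancl_into_rtrancl)
qed

text \<open>Adjacent squares carry a whole chain along \<open>l\<close>, and
  \<open>status_comm\<close> carries its beginning to a beginning. So the closing step commutes with
  \<open>l\<close> just as the actual steps do.\<close>

lemma sig_pst:
  assumes e: "{h, fst l} \<in> E0" and x: "pst x l = Some x'"
  shows "pst (sig h x) l = Some (sig h x')"
proof (cases "pst x (h, True)")
  case (Some y)
  then show ?thesis using pst_comm[of "(h, True)" l x y x'] assms by auto
next
  case None
  have X: "x \<in> X" using x pst_in by blast
  have e': "{fst l, h} \<in> E0" using e by (simp add: insert_commute)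
  have none: "pst x' (h, True) = None" using status_comm[of l "(h, True)" x x'] None e' x by simp
  have r: "is_root h x (sig h x)" using sig_is_root X None by blast
  then obtain z' where z': "pst (sig h x) l = Some z'" "(z', x') \<in> (arrows h)\<^sup>*"
    using chain_comm[OF e _ x] by (auto simp: is_root_def)
  then have "is_root h x' z'"
    using status_comm[of l "(h, False)" "sig h x" z'] e' r by (auto simp: is_root_def)
  then show ?thesis using z' sig_root none by blast
qed

definition symmetry :: "nat \<Rightarrow> ('x \<Rightarrow> 'x) \<Rightarrow> bool"
  where "symmetry k f \<longleftrightarrow> bij_betw f X X \<and>
    (\<forall>x\<in>X. \<forall>l. fst l = k \<longrightarrow> pst (f x) l = map_option f (pst x l))"

lemma symmetryD: "symmetry k f \<Longrightarrow> x \<in> X \<Longrightarrow> fst l = k \<Longrightarrow> pst (f x) l = map_option f (pst x l)"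
  unfolding symmetry_def by blast

text \<open>Finiteness yields the converse direction: \<open>f\<close> injects the set where
  \<open>l\<close> is defined into itself, hence onto, so points where \<open>l\<close> is undefined
  go to such points.\<close>

lemma symmetryI:
  assumes f: "bij_betw f X X" and p: "\<And>x y l. fst l = k \<Longrightarrow> pst x l = Some y \<Longrightarrow> pst (f x) l = Some (f y)"
  shows "symmetry k f"
proof -
  have "pst (f x) l = map_option f (pst x l)" if x: "x \<in> X" "fst l = k" for x l
  proof (cases "pst x l")
    case None
    define D where "D = {x \<in> X. pst x l \<noteq> None}"
    have "f ` D \<subseteq> D" using p x bij_betwE[OF f] by (fastforce simp: D_def)
    moreover have "inj_on f D" using f by (auto simp: D_def bij_betw_def intro: inj_on_subset)
    moreover have "finite D" using finite_X by (simp add: D_def)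
    ultimately have "f ` D = D" by (simp add: endo_inj_surj)
    moreover have "x \<notin> D" using None by (simp add: D_def)
    moreover have "D \<subseteq> X" by (auto simp: D_def)
    ultimately have "f x \<notin> D" using x f by (metis bij_betw_imp_inj_on inj_on_image_mem_iff)
    then show ?thesis using None x bij_betwE[OF f] by (auto simp: D_def)
  qed (use p x in auto)
  then show ?thesis using f by (simp add: symmetry_def)
qed

lemma symmetry_sig: "{h, k} \<in> E0 \<Longrightarrow> symmetry k (sig h)"
  by (rule symmetryI[OF bij_sig]) (use sig_pst in auto)

lemma symmetry_inv:
  assumes "symmetry k f" "\<And>x. x \<in> X \<Longrightarrow> g x \<in> X" "\<And>x. x \<in> X \<Longrightarrow> f (g x) = x" "\<And>x. x \<in> X \<Longrightarrow> g (f x) = x"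
  shows "symmetry k g"
proof (rule symmetryI)
  show "bij_betw g X X" using assms by (intro bij_betw_byWitness[where f' = f]) (auto simp: symmetry_def bij_betw_def)
  fix x y l assume l: "fst l = k" "pst x l = Some y"
  then have X: "x \<in> X" "y \<in> X" using pst_in by auto
  have "pst (f (g x)) l = map_option f (pst (g x) l)" using assms(1) assms(2)[OF X(1)] l(1) unfolding symmetry_def by blast
  then have "map_option f (pst (g x) l) = Some y" using l X assms by simp
  then obtain z where z: "pst (g x) l = Some z" "f z = y" by auto
  then have "z = g y" using assms(4)[of z] pst_in by metis
  then show "pst (g x) l = Some (g y)" using z by simp
qed

lemma symmetry_isig: "{h, k} \<in> E0 \<Longrightarrow> symmetry k (isig h)"
  using symmetry_inv[OF symmetry_sig] isig_X by auto

lemma symmetry_swp: assumes "{h, k} \<in> E0" shows "symmetry k (swp h)"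
proof (rule symmetryI)
  show "bij_betw (swp h) X X" using swp_swp swp_X by (intro bij_betw_byWitness[where f' = "swp h"]) auto
  fix x y l assume l: "fst l = k" "pst x l = Some y"
  have "{fst l, fst (h, b)} \<in> E0" for b using assms l by (simp add: insert_commute)
  then have s: "pst x (h, b) = None \<longleftrightarrow> pst y (h, b) = None" for b using status_comm[of l "(h, b)" x y] l by simp
  have X: "x \<in> X" using l pst_in by blast
  have "pst (sig h x) l = Some (sig h y)" "pst (isig h x) l = Some (isig h y)"
    using symmetryD[OF symmetry_sig[OF assms] X l(1)] symmetryD[OF symmetry_isig[OF assms] X l(1)] l by auto
  then show "pst (swp h x) l = Some (swp h y)" using s l by (simp add: swp_def)
qed

lemma symmetry_chain:
  assumes "symmetry k f" "(z, x) \<in> (arrows k)\<^sup>*" "x \<in> X" shows "(f z, f x) \<in> (arrows k)\<^sup>*"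
  using assms(2)
proof (induction rule: converse_rtrancl_induct)
  case (step z y)
  then have "pst z (k, True) = Some y" by (simp add: arrows_def)
  then have "pst (f z) (k, True) = Some (f y)" using assms(1) pst_in by (fastforce simp: symmetry_def)
  then show ?case using step by (auto simp: arrows_def intro: converse_rtrancl_into_rtrancl)
qed simp

text \<open>Completion is canonical: \<open>sig\<close>, \<open>isig\<close> and \<open>swp\<close>
  are determined by the chains, so a permutation that respects the chains of \<open>k\<close>
  commutes with them. For the completed generators of a crossing label this upgrades commutation
  with a partial injection to commutation of permutations.\<close>

lemma symmetry_commutes:
  assumes f: "symmetry k f" and x: "x \<in> X"
  shows "f (sig k x) = sig k (f x)" and "f (isig k x) = isig k (f x)" and "f (swp k x) = swp k (f x)"
    and "has_out k (f x) \<longleftrightarrow> has_out k x" "has_in k (f x) \<longleftrightarrow> has_in k x"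
proof -
  have fX: "f y \<in> X" if "y \<in> X" for y using f that bij_betwE by (auto simp: symmetry_def)
  have p: "pst (f y) l = map_option f (pst y l)" if "y \<in> X" "fst l = k" for y l using f that unfolding symmetry_def by blast
  show o: "has_out k (f x) \<longleftrightarrow> has_out k x" and i: "has_in k (f x) \<longleftrightarrow> has_in k x" using p x by auto
  have s: "f (sig k y) = sig k (f y)" if y: "y \<in> X" for y
  proof (cases "pst y (k, True)")
    case (Some z)
    then show ?thesis using p[OF y, of "(k, True)"] by simp
  next
    case None
    have "is_root k y (sig k y)" using sig_is_root None y by blast
    then have "is_root k (f y) (f (sig k y))"
      using symmetry_chain[OF f _ y] p[OF sig_X[OF y], of "(k, False)"] by (simp add: is_root_def)
    moreover have "pst (f y) (k, True) = None" using p[OF y, of "(k, True)"] None by simp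
    ultimately show ?thesis using sig_root by simp
  qed
  show "f (sig k x) = sig k (f x)" using s x by blast
  have "sig k (f (isig k x)) = f x" using s[of "isig k x"] x isig_X by simp
  then show ic: "f (isig k x) = isig k (f x)" using sig_isig(2)[of "f (isig k x)" k] fX isig_X x by simp
  show "f (swp k x) = swp k (f x)" using o i ic s x by (simp add: swp_def)
qed

subsection \<open>The completed automaton\<close>

text \<open>The generators \<open>2 * h\<close> and \<open>2 * h + 1\<close> form the pair over the
  label \<open>h\<close>; division by 2 recovers the label.\<close>

definition V :: "nat set" where "V = {..<2 * n}"
definition E :: "nat set set" where "E = {{u, v} | u v. u \<in> V \<and> v \<in> V \<and> {u div 2, v div 2} \<in> E0}"

definition step :: "'x \<Rightarrow> nat \<times> bool \<Rightarrow> 'x"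
  where "step x a = (let h = fst a div 2 in
    if odd (fst a) then swp h x else if snd a then sig h x else isig h x)"

text \<open>The four cases are: inner point of a chain or point of a cycle, last point, first point,
  isolated point. At the two kinds of end points, the letter of the missing edge and both letters of
  \<open>p\<close> have the same target and form a 3-cycle. In the other cases every letter that is
  not an actual edge is a loop and is inverted.\<close>

definition subst :: "'x \<Rightarrow> nat \<times> bool \<Rightarrow> nat \<times> bool"
  where "subst x a = (let h = fst a div 2; m = 2 * h; p = 2 * h + 1 in
     if has_in h x then
       if has_out h x then if odd (fst a) then linv a else a
       else if a = (m, True) then (p, True) else if a = (p, True) then (p, False)
       else if a = (p, False) then (m, True) else a
     else
       if has_out h x then
         if a = (m, False) then (p, False) else if a = (p, False) then (p, True)
         else if a = (p, True) then (m, False) else a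
       else linv a)"

lemma step_X: "x \<in> X \<Longrightarrow> step x a \<in> X"
  by (simp add: step_def Let_def swp_X sig_X isig_X)

lemma letter_cases:
  fixes a :: "nat \<times> bool"
  obtains h where "a = (2 * h, True)" | h where "a = (2 * h, False)" | h where "a = (2 * h + 1, True)"
    | h where "a = (2 * h + 1, False)"
proof -
  obtain u b where a: "a = (u, b)" by (cases a)
  show thesis by (cases "even u"; cases b) (use a that in \<open>auto elim!: evenE oddE\<close>)
qed

lemma step_simps [simp]: "step x (2 * h, True) = sig h x" "step x (2 * h, False) = isig h x"
    "step x (Suc (2 * h), b) = swp h x"
  by (simp_all add: step_def)

lemma step_linv: "x \<in> X \<Longrightarrow> step (step x a) (linv a) = x"
  by (cases a rule: letter_cases) (simp_all add: swp_swp)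

lemma fst_subst_div: "fst (subst x a) div 2 = fst a div 2"
proof -
  have "odd (fst a) \<Longrightarrow> (fst a - Suc 0) div 2 = fst a div 2" by presburger
  then show ?thesis by (auto simp: subst_def Let_def)
qed

lemma subst_simps [simp]:
  "has_in h x \<Longrightarrow> has_out h x \<Longrightarrow> subst x (2 * h, b) = (2 * h, b)"
  "has_in h x \<Longrightarrow> has_out h x \<Longrightarrow> subst x (Suc (2 * h), b) = (Suc (2 * h), \<not> b)"
  "has_in h x \<Longrightarrow> \<not> has_out h x \<Longrightarrow> subst x (2 * h, b) = (if b then (Suc (2 * h), True) else (2 * h, False))"
  "has_in h x \<Longrightarrow> \<not> has_out h x \<Longrightarrow> subst x (Suc (2 * h), b) = (if b then (Suc (2 * h), False) else (2 * h, True))"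
  "\<not> has_in h x \<Longrightarrow> has_out h x \<Longrightarrow> subst x (2 * h, b) = (if b then (2 * h, True) else (Suc (2 * h), False))"
  "\<not> has_in h x \<Longrightarrow> has_out h x \<Longrightarrow> subst x (Suc (2 * h), b) = (if b then (2 * h, False) else (Suc (2 * h), True))"
  "\<not> has_in h x \<Longrightarrow> \<not> has_out h x \<Longrightarrow> subst x (2 * h, b) = (2 * h, \<not> b)"
  "\<not> has_in h x \<Longrightarrow> \<not> has_out h x \<Longrightarrow> subst x (Suc (2 * h), b) = (Suc (2 * h), \<not> b)"
  by (auto simp: subst_def Let_def; presburger)+

lemma step_subst: assumes "x \<in> X" shows "step x (subst x a) = step x a"
proof (cases a rule: letter_cases)
  case (1 h)
  then show ?thesis using assms sig_isolated[of x h]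
    by (cases "has_in h x"; cases "has_out h x") (auto simp: swp_def simp del: not_None_eq)
next
  case (2 h)
  then show ?thesis using assms sig_isolated[of x h]
    by (cases "has_in h x"; cases "has_out h x") (auto simp: swp_def simp del: not_None_eq)
next
  case (3 h)
  then show ?thesis using assms sig_isolated[of x h]
    by (cases "has_in h x"; cases "has_out h x") (auto simp: swp_def simp del: not_None_eq)
next
  case (4 h)
  then show ?thesis using assms sig_isolated[of x h]
    by (cases "has_in h x"; cases "has_out h x") (auto simp: swp_def simp del: not_None_eq)
qed

text \<open>The letters of a 3-cycle lead to the other end of the chain, so the 3-cycle there has to
  be the transport of the first one under \<open>linv\<close>. This dictates the senses of rotation
  in \<open>subst\<close>.\<close>

lemma subst_linv: assumes x: "x \<in> X" shows "subst (step x a) (linv a) = linv (subst x a)"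
proof -
  have so: "has_in h (sig h x)" if "has_out h x" for h
    using that pst_inv[of x "(h, True)"] by auto
  have ii: "has_out h (isig h x)" if "has_in h x" for h
    using that pst_inv[of x "(h, False)"] isig_Some[of x h] by auto
  note facts = so ii sig_end[OF x] isig_start[OF x] sig_isolated[OF x]
  show ?thesis
  proof (cases a rule: letter_cases)
    case (1 h)
    then show ?thesis using facts[of h]
      by (cases "has_in h x"; cases "has_out h x"; cases "has_out h (sig h x)") (simp_all del: not_None_eq)
  next
    case (2 h)
    then show ?thesis using facts[of h]
      by (cases "has_in h x"; cases "has_out h x"; cases "has_in h (isig h x)") (simp_all del: not_None_eq)
  next
    case (3 h)
    then show ?thesis using facts[of h]
      by (cases "has_in h x"; cases "has_out h x") (simp_all add: swp_def del: not_None_eq)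
  next
    case (4 h)
    then show ?thesis using facts[of h]
      by (cases "has_in h x"; cases "has_out h x") (simp_all add: swp_def del: not_None_eq)
  qed
qed

text \<open>All orbits have length 1, 2 or 3.\<close>

lemma subst_order: "(subst x ^^ 6) a = a"
proof -
  have [simp]: "(subst x ^^ 6) b = subst x (subst x (subst x (subst x (subst x (subst x b)))))" for b
    by (simp add: numeral_eq_Suc)
  show ?thesis
  proof (cases a rule: letter_cases)
    case (1 h)
    then show ?thesis by (cases "has_in h x"; cases "has_out h x") (simp_all del: not_None_eq)
  next
    case (2 h)
    then show ?thesis by (cases "has_in h x"; cases "has_out h x") (simp_all del: not_None_eq)
  next
    case (3 h)
    then show ?thesis by (cases "has_in h x"; cases "has_out h x") (simp_all del: not_None_eq)
  next
    case (4 h)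
    then show ?thesis by (cases "has_in h x"; cases "has_out h x") (simp_all del: not_None_eq)
  qed
qed

lemma subst_cong:
  assumes "\<And>b. pst x (fst a div 2, b) = None \<longleftrightarrow> pst y (fst a div 2, b) = None"
  shows "subst x a = subst y a"
  unfolding subst_def Let_def assms ..

lemma symmetry_step: "{fst a div 2, k} \<in> E0 \<Longrightarrow> symmetry k (\<lambda>x. step x a)"
  using symmetry_sig[of "fst a div 2" k] symmetry_isig[of "fst a div 2" k] symmetry_swp[of "fst a div 2" k]
  by (cases "odd (fst a)"; cases "snd a") (simp_all add: step_def Let_def)

lemma E_iff: "{u, v} \<in> E \<longleftrightarrow> u \<in> V \<and> v \<in> V \<and> {u div 2, v div 2} \<in> E0"
  by (auto simp: E_def doubleton_eq_iff insert_commute)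

lemma E0_distinct: "{h, k} \<in> E0 \<Longrightarrow> h \<noteq> k" "{h} \<notin> E0"
  using E0_sub by (fastforce simp: doubleton_eq_iff singleton_insert_inj_eq)+

lemma subst_V: "fst a \<in> V \<Longrightarrow> fst (subst x a) \<in> V"
  using fst_subst_div[of x a] unfolding V_def lessThan_iff by presburger

lemma automaton:
  assumes base: "base \<in> X" shows "automaton V E X base step subst 6"
proof
  show "finite V" by (simp add: V_def)
  show "E \<subseteq> {{a, b} |a b. a \<in> V \<and> b \<in> V \<and> a \<noteq> b}"
    using E0_distinct by (fastforce simp: E_def)
  show "finite X" by (rule finite_X)
  show "base \<in> X" by (rule base)
  show "(0::nat) < 6" by simp
  fix x a assume x: "x \<in> X"
  show "step x a \<in> X" by (rule step_X[OF x])
  show "step (step x a) (linv a) = x" by (rule step_linv[OF x])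
  show "step x (subst x a) = step x a" by (rule step_subst[OF x])
  show "subst (step x a) (linv a) = linv (subst x a)" by (rule subst_linv[OF x])
  show "(subst x ^^ 6) a = a" by (rule subst_order)
  show "{fst a, fst (subst x a)} \<notin> E" using E0_distinct by (simp add: E_iff fst_subst_div)
  show "fst (subst x a) \<in> V" if "fst a \<in> V" using that by (rule subst_V)
  fix b :: "nat \<times> bool" assume e: "{fst a, fst b} \<in> E"
  then have e': "{fst a div 2, fst b div 2} \<in> E0" "{fst b div 2, fst a div 2} \<in> E0" "fst a \<in> V" "fst b \<in> V"
    by (auto simp: E_iff insert_commute)
  have s: "symmetry (fst b div 2) (\<lambda>x. step x a)" using symmetry_step e' by blast
  show "step (step x a) b = step (step x b) a"
    using symmetry_commutes[OF s x] by (simp add: step_def[of _ b] Let_def)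
  have s': "symmetry (fst a div 2) (\<lambda>x. step x b)" using symmetry_step e' by blast
  have "pst (step x b) (fst a div 2, c) = None \<longleftrightarrow> pst x (fst a div 2, c) = None" for c
    using symmetry_commutes(4,5)[OF s' x] by (cases c) auto
  then show "subst (step x b) a = subst x a" by (intro subst_cong)
  show "{fst (subst x a), fst (subst x b)} \<in> E"
    using e' fst_subst_div[of x a] fst_subst_div[of x b] by (simp add: E_iff subst_V)
qed

lemma subst_fixed_iff:
  "subst x a = a \<longleftrightarrow> (\<exists>h b y. a = (2 * h, b) \<and> pst x (h, b) = Some y)"
proof -
  have e: "(\<exists>h' b' y. (2 * h, b) = (2 * h', b') \<and> pst x (h', b') = Some y) \<longleftrightarrow> pst x (h, b) \<noteq> None" for h b
    by auto
  have so: "Suc (2 * h) \<noteq> 2 * h'" for h h' :: nat by presburger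
  have o: "\<not> (\<exists>h' b' y. (Suc (2 * h), b) = (2 * h', b') \<and> pst x (h', b') = Some y)" for h b
    by (simp add: so)
  show ?thesis
  proof (cases a rule: letter_cases)
    case (1 h)
    then show ?thesis unfolding 1 e by (cases "has_in h x"; cases "has_out h x") (simp_all del: not_None_eq)
  next
    case (2 h)
    then show ?thesis unfolding 2 e by (cases "has_in h x"; cases "has_out h x") (simp_all del: not_None_eq)
  next
    case (3 h)
    then show ?thesis using o[of h True] by (cases "has_in h x"; cases "has_out h x") (simp_all del: not_None_eq add: so[symmetric])
  next
    case (4 h)
    then show ?thesis using o[of h False] by (cases "has_in h x"; cases "has_out h x") (simp_all del: not_None_eq add: so[symmetric])
  qed
qed

lemma step_pst: "pst x (h, b) = Some y \<Longrightarrow> step x (2 * h, b) = y"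
  by (cases b) (auto simp: isig_Some)

end

section \<open>Combinatorics of faces, edges and squares\<close>

section \<open>Faces of cubes\<close>

text \<open>
  A face of an \<open>n\<close>-cube, parametrised by a \<open>d\<close>-cube, is encoded by telling for each of the \<open>n\<close> coordinates
  whether it is a constant, or a coordinate of the \<open>d\<close>-cube that is possibly reflected.
\<close>

type_synonym face_pattern = "nat \<Rightarrow> (nat \<times> bool) + real"

definition papp :: "nat \<Rightarrow> face_pattern \<Rightarrow> (nat \<Rightarrow> real) \<Rightarrow> nat \<Rightarrow> real"
  where "papp n P x = (\<lambda>j. if j < n then
     (case P j of Inl kf \<Rightarrow> if snd kf then 1 - x (fst kf) else x (fst kf) | Inr \<delta> \<Rightarrow> \<delta>) else 0)"

text \<open>Using every parameter exactly once makes the parametrisation injective and lets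
  \<open>papp_surj\<close> read a preimage off the coordinates.\<close>

definition is_pat :: "nat \<Rightarrow> nat \<Rightarrow> face_pattern \<Rightarrow> bool"
  where "is_pat d n P \<longleftrightarrow> (\<forall>j<n. case P j of Inl kf \<Rightarrow> fst kf < d | Inr \<delta> \<Rightarrow> \<delta> \<in> {0, 1}) \<and>
    (\<forall>k<d. \<exists>j<n. \<exists>f. P j = Inl (k, f)) \<and>
    (\<forall>j<n. \<forall>j'<n. \<forall>k f f'. P j = Inl (k, f) \<and> P j' = Inl (k, f') \<longrightarrow> j = j')"

definition pcomp :: "face_pattern \<Rightarrow> face_pattern \<Rightarrow> face_pattern"
  where "pcomp P Q j = (case P j of
     Inl kf \<Rightarrow> (case Q (fst kf) of Inl kf' \<Rightarrow> Inl (fst kf', snd kf \<noteq> snd kf')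
       | Inr \<delta> \<Rightarrow> Inr (if snd kf then 1 - \<delta> else \<delta>))
   | Inr \<delta> \<Rightarrow> Inr \<delta>)"

lemma is_patD:
  assumes "is_pat d n P"
  shows "j < n \<Longrightarrow> P j = Inl kf \<Longrightarrow> fst kf < d"
    and "j < n \<Longrightarrow> P j = Inr \<delta> \<Longrightarrow> \<delta> = 0 \<or> \<delta> = 1"
    and "k < d \<Longrightarrow> \<exists>j<n. \<exists>f. P j = Inl (k, f)"
    and "j < n \<Longrightarrow> j' < n \<Longrightarrow> P j = Inl (k, f) \<Longrightarrow> P j' = Inl (k, f') \<Longrightarrow> j = j'"
proof -
  show "j < n \<Longrightarrow> P j = Inl kf \<Longrightarrow> fst kf < d" "j < n \<Longrightarrow> P j = Inr \<delta> \<Longrightarrow> \<delta> = 0 \<or> \<delta> = 1"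
    using assms unfolding is_pat_def by fastforce+
  show "k < d \<Longrightarrow> \<exists>j<n. \<exists>f. P j = Inl (k, f)" 
    "j < n \<Longrightarrow> j' < n \<Longrightarrow> P j = Inl (k, f) \<Longrightarrow> P j' = Inl (k, f') \<Longrightarrow> j = j'"
    using assms unfolding is_pat_def by blast+
qed

lemma papp_pcomp:
  assumes "is_pat e n P" shows "papp n (pcomp P Q) x = papp n P (papp e Q x)"
proof
  fix j show "papp n (pcomp P Q) x j = papp n P (papp e Q x) j"
  proof (cases "P j")
    case (Inl kf)
    then show ?thesis using is_patD(1)[OF assms, of j kf] by (cases "Q (fst kf)") (auto simp: papp_def pcomp_def)
  qed (simp add: papp_def pcomp_def)
qed

lemma is_pat_pcomp:
  assumes P: "is_pat e n P" and Q: "is_pat d e Q" shows "is_pat d n (pcomp P Q)"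
  unfolding is_pat_def
proof (intro conjI allI impI)
  fix j assume j: "j < n"
  show "case pcomp P Q j of Inl kf \<Rightarrow> fst kf < d | Inr \<delta> \<Rightarrow> \<delta> \<in> {0, 1}"
  proof (cases "P j")
    case (Inl kf)
    then have k: "fst kf < e" using is_patD(1)[OF P j] by blast
    show ?thesis using Inl is_patD(1,2)[OF Q k] by (cases "Q (fst kf)") (auto simp: pcomp_def)
  next
    case (Inr \<delta>)
    then show ?thesis using is_patD(2)[OF P j] by (auto simp: pcomp_def)
  qed
next
  fix k assume "k < d"
  then obtain l f where l: "l < e" "Q l = Inl (k, f)" using is_patD(3)[OF Q] by blast
  then obtain j g where "j < n" "P j = Inl (l, g)" using is_patD(3)[OF P] by blast
  then show "\<exists>j<n. \<exists>f. pcomp P Q j = Inl (k, f)" using l by (auto simp: pcomp_def intro!: exI[of _ j])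
next
  fix j j' k f f' assume j: "j < n" "j' < n" "pcomp P Q j = Inl (k, f) \<and> pcomp P Q j' = Inl (k, f')"
  obtain kf where kf: "P j = Inl kf" using j by (cases "P j") (auto simp: pcomp_def)
  obtain kf' where kf': "P j' = Inl kf'" using j by (cases "P j'") (auto simp: pcomp_def)
  obtain g where g: "Q (fst kf) = Inl (k, g)" using j kf by (cases "Q (fst kf)") (auto simp: pcomp_def)
  obtain g' where g': "Q (fst kf') = Inl (k, g')" using j kf' by (cases "Q (fst kf')") (auto simp: pcomp_def)
  have "fst kf = fst kf'"
    using is_patD(4)[OF Q is_patD(1)[OF P j(1) kf] is_patD(1)[OF P j(2) kf'] g g'] .
  then show "j = j'" using is_patD(4)[OF P j(1,2)] kf kf' by (metis prod.collapse)
qed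

lemma papp_coordinate:
  assumes "is_pat d n P" "j < n"
  shows "(\<exists>k<d. papp n P x j = x k \<or> papp n P x j = 1 - x k) \<or> papp n P x j = 0 \<or> papp n P x j = 1"
proof (cases "P j")
  case (Inl kf)
  then have "fst kf < d" using is_patD(1)[OF assms] by blast
  then show ?thesis using Inl assms(2) by (auto simp: papp_def)
next
  case (Inr \<delta>)
  then show ?thesis using is_patD(2)[OF assms] assms(2) by (auto simp: papp_def)
qed

lemma papp_outside: "n \<le> j \<Longrightarrow> papp n P x j = 0"
  by (simp add: papp_def)

lemma papp_cube: assumes "is_pat d n P" "x \<in> cube d" shows "papp n P x \<in> cube n"
proof -
  have "0 \<le> papp n P x j \<and> papp n P x j \<le> 1" if "j < n" for j
    using papp_coordinate[OF assms(1) that, of x] assms(2) by (auto simp: cube_def)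
  then show ?thesis by (simp add: cube_def papp_outside)
qed

lemma papp_vertices: assumes "is_pat d n P" "x \<in> cube_vertices d" shows "papp n P x \<in> cube_vertices n"
proof -
  have "papp n P x j \<in> {0, 1}" if "j < n" for j
    using papp_coordinate[OF assms(1) that, of x] assms(2) by (auto simp: cube_vertices_def)
  then show ?thesis by (simp add: cube_vertices_def papp_outside)
qed

lemma papp_surj:
  assumes P: "is_pat d n P" and y: "\<And>j. j \<ge> n \<Longrightarrow> y j = 0" "\<And>j \<delta>. j < n \<Longrightarrow> P j = Inr \<delta> \<Longrightarrow> y j = \<delta>"
  obtains w where "papp n P w = y" "\<And>k. k \<ge> d \<Longrightarrow> w k = 0"
    "\<And>j k f. j < n \<Longrightarrow> P j = Inl (k, f) \<Longrightarrow> w k = (if f then 1 - y j else y j)"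
proof -
  define idx where "idx k = (SOME j. j < n \<and> (\<exists>f. P j = Inl (k, f)))" for k
  have idx: "idx k = j" if "j < n" "P j = Inl (k, f)" for j k f
  proof -
    have "idx k < n \<and> (\<exists>f. P (idx k) = Inl (k, f))"
      unfolding idx_def by (rule someI_ex) (use that in blast)
    then show ?thesis using is_patD(4)[OF P] that by blast
  qed
  define w where "w k = (if k < d then (if \<exists>f. P (idx k) = Inl (k, f) \<and> f then 1 - y (idx k) else y (idx k)) else 0)" for k
  have w: "w k = (if f then 1 - y j else y j)" if "j < n" "P j = Inl (k, f)" for j k f
    using idx[OF that] that is_patD(1)[OF P that] by (auto simp: w_def)
  have "papp n P w = y"
  proof
    fix j show "papp n P w j = y j"
    proof (cases "j < n")
      case True
      then show ?thesis using w[OF True] y(2)[OF True] by (cases "P j") (auto simp: papp_def)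
    qed (simp add: papp_def y(1))
  qed
  then show ?thesis using that[of w] w by (simp add: w_def)
qed

lemma open_cube_sub: "open_cube n \<subseteq> cube n"
  by (auto simp: open_cube_def cube_def less_imp_le)

lemma vertices_sub: "cube_vertices n \<subseteq> cube n"
  by (fastforce simp: cube_vertices_def cube_def)

lemma vertices_flip: "v \<in> cube_vertices n \<Longrightarrow> i < n \<Longrightarrow> v(i := 1 - v i) \<in> cube_vertices n"
  by (auto simp: cube_vertices_def)

lemma vertices_flip': "v \<in> cube_vertices n \<Longrightarrow> i < n \<Longrightarrow> \<bar>v i - 1\<bar> = 1 - v i"
  by (auto simp: cube_vertices_def)

context cube_complex
begin

lemma kappa_inj: "c \<in> C \<Longrightarrow> c' \<in> C \<Longrightarrow> x \<in> open_cube (cdim c) \<Longrightarrow> x' \<in> open_cube (cdim c') \<Longrightarrow>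
    \<kappa> c x = \<kappa> c' x' \<Longrightarrow> c = c' \<and> x = x'"
  using open_cubes_partition by (fastforce simp: bij_betw_def inj_on_def)

lemma kappa_surj: "y \<in> Q \<Longrightarrow> \<exists>c\<in>C. \<exists>x\<in>open_cube (cdim c). y = \<kappa> c x"
  using open_cubes_partition by (fastforce simp: bij_betw_def)

definition is_face :: "'c \<Rightarrow> 'c \<Rightarrow> face_pattern \<Rightarrow> bool"
  where "is_face c d P \<longleftrightarrow> c \<in> C \<and> d \<in> C \<and> is_pat (cdim d) (cdim c) P \<and>
    (\<forall>y\<in>cube (cdim d). \<kappa> c (papp (cdim c) P y) = \<kappa> d y)"

lemma is_face_trans: "is_face c e P \<Longrightarrow> is_face e d R \<Longrightarrow> is_face c d (pcomp P R)"
  unfolding is_face_def using is_pat_pcomp papp_pcomp papp_cube by metis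

lemma is_face_self: "c \<in> C \<Longrightarrow> is_face c c (\<lambda>j. Inl (j, False))"
proof -
  assume "c \<in> C"
  moreover have "papp (cdim c) (\<lambda>j. Inl (j, False)) y = y" if "y \<in> cube (cdim c)" for y
    using that by (auto simp: papp_def cube_def fun_eq_iff)
  moreover have "is_pat (cdim c) (cdim c) (\<lambda>j. Inl (j, False))" by (auto simp: is_pat_def)
  ultimately show ?thesis by (auto simp: is_face_def)
qed

lemma codim_one_face:
  assumes c: "c \<in> C" "i < cdim c" "\<delta> \<in> {0, 1}"
  shows "\<exists>d P. is_face c d P \<and> P i = Inr \<delta> \<and> (\<forall>j<cdim c. j \<noteq> i \<longrightarrow> (\<exists>kf. P j = Inl kf))"
proof -
  obtain d \<sigma> where d: "d \<in> C" "\<sigma> \<in> cube_isometries (cdim d)" "cdim c = Suc (cdim d)"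
    and k: "\<forall>x\<in>cube (cdim d). \<kappa> c (face_embedding i \<delta> x) = \<kappa> d (\<sigma> x)"
    using faces[OF c] by blast
  then obtain \<pi> F where \<sigma>: "\<sigma> = (\<lambda>x j. if j \<in> F then 1 - x (\<pi> j) else x (\<pi> j))"
    and \<pi>: "\<pi> permutes {..<cdim d}" and F: "F \<subseteq> {..<cdim d}"
    by (auto simp: cube_isometries_def)
  define ip where "ip = inv_into UNIV \<pi>"
  have inv: "ip (\<pi> j) = j" "\<pi> (ip j) = j" "ip j < cdim d \<longleftrightarrow> j < cdim d" "\<pi> j < cdim d \<longleftrightarrow> j < cdim d"
    "ip j = ip k \<longleftrightarrow> j = k" for j k
    using permutes_inverses[OF \<pi>, folded ip_def] permutes_in_image[OF \<pi>, of j] permutes_in_image[OF permutes_inv[OF \<pi>, folded ip_def], of j]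
      permutes_inj[OF permutes_inv[OF \<pi>, folded ip_def]] by (auto simp: inj_eq)
  have id: "\<pi> j = j" if "\<not> j < cdim d" for j using permutes_not_in[OF \<pi>] that by simp
  \<comment> \<open>The assumption \<open>faces\<close> reparametrises the smaller cube by
    \<open>\<sigma>\<close>, whereas the pattern must express the face point through
    \<open>y = \<sigma> x\<close>; hence the inverse permutation. Coordinates after \<open>i\<close>
    are shifted by one.\<close>
  define P :: face_pattern where "P j = (if j < i then Inl (ip j, ip j \<in> F) else if j = i then Inr \<delta>
    else Inl (ip (j - 1), ip (j - 1) \<in> F))" for j
  have pat: "is_pat (cdim d) (cdim c) P"
    unfolding is_pat_def
  proof (intro conjI allI impI)
    fix j assume "j < cdim c"
    then show "case P j of Inl kf \<Rightarrow> fst kf < cdim d | Inr \<delta> \<Rightarrow> \<delta> \<in> {0, 1}"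
      using c d inv by (auto simp: P_def)
  next
    fix k assume k: "k < cdim d"
    show "\<exists>j<cdim c. \<exists>f. P j = Inl (k, f)"
    proof (cases "\<pi> k < i")
      case True
      then show ?thesis using inv k d c by (intro exI[of _ "\<pi> k"]) (auto simp: P_def)
    next
      case False
      then show ?thesis using inv[of k] k d c by (intro exI[of _ "Suc (\<pi> k)"]) (auto simp: P_def)
    qed
  next
    fix j j' k f f' assume "j < cdim c" "j' < cdim c" "P j = Inl (k, f) \<and> P j' = Inl (k, f')"
    then show "j = j'" using inv(5) by (auto simp: P_def split: if_splits)
  qed
  have "\<kappa> c (papp (cdim c) P y) = \<kappa> d y" if y: "y \<in> cube (cdim d)" for y
  proof -
    define x where "x k = (if k < cdim d then if ip k \<in> F then 1 - y (ip k) else y (ip k) else 0)" for k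
    have x: "x \<in> cube (cdim d)" using y inv by (auto simp: x_def cube_def)
    have "\<sigma> x = y"
    proof
      fix j show "\<sigma> x j = y j"
        using y F inv[of j] id[of j] by (cases "j < cdim d") (auto simp: \<sigma> x_def cube_def)
    qed
    moreover have "papp (cdim c) P y = face_embedding i \<delta> x"
      using d c by (auto simp: papp_def P_def face_embedding_def x_def fun_eq_iff)
    ultimately show ?thesis using k x by simp
  qed
  then have "is_face c d P" using pat c d by (simp add: is_face_def)
  then show ?thesis by (intro exI[of _ d] exI[of _ P]) (auto simp: P_def)
qed

lemma face_exists:
  assumes "c \<in> C" "finite S" "S \<subseteq> {..<cdim c}" "\<delta> ` S \<subseteq> {0, 1}"
  shows "\<exists>d P. is_face c d P \<and> (\<forall>j<cdim c. if j \<in> S then P j = Inr (\<delta> j) else (\<exists>kf. P j = Inl kf))"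
  using assms(2-4)
proof (induction S rule: finite_induct)
  case empty
  then show ?case using is_face_self[OF assms(1)] by (intro exI[of _ c] exI[of _ "\<lambda>j. Inl (j, False)"]) auto
next
  case (insert i S)
  then obtain d P where dP: "is_face c d P" "\<forall>j<cdim c. if j \<in> S then P j = Inr (\<delta> j) else (\<exists>kf. P j = Inl kf)"
    by auto
  then obtain kf where kf: "P i = Inl kf" using insert by fastforce
  have pat: "is_pat (cdim d) (cdim c) P" using dP by (simp add: is_face_def)
  have i: "i < cdim c" "\<delta> i \<in> {0, 1}" using insert by auto
  have k: "fst kf < cdim d" using is_patD(1)[OF pat i(1) kf] .
  \<comment> \<open>If coordinate \<open>i\<close> is a reflected parameter, it is frozen by giving
    that parameter the reflected value.\<close>
  have "(if snd kf then 1 - \<delta> i else \<delta> i) \<in> {0, 1}" using i by auto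
  then obtain e R where e: "is_face d e R" "R (fst kf) = Inr (if snd kf then 1 - \<delta> i else \<delta> i)"
      "\<forall>j<cdim d. j \<noteq> fst kf \<longrightarrow> (\<exists>kf. R j = Inl kf)"
    using codim_one_face[OF _ k, of "if snd kf then 1 - \<delta> i else \<delta> i"] dP(1) unfolding is_face_def by blast
  have "if j \<in> insert i S then pcomp P R j = Inr (\<delta> j) else (\<exists>kf. pcomp P R j = Inl kf)" if j: "j < cdim c" for j
  proof (cases "j = i")
    case True
    then show ?thesis using kf e by (simp add: pcomp_def)
  next
    case ji: False
    show ?thesis
    proof (cases "j \<in> S")
      case True
      then show ?thesis using dP j by (simp add: pcomp_def)
    next
      case False
      then obtain lg where lg: "P j = Inl lg" using dP j by fastforce
      have "fst lg \<noteq> fst kf" using is_patD(4)[OF pat j i(1), of "fst lg" "snd lg" "snd kf"] lg kf ji by auto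
      then obtain m where "R (fst lg) = Inl m" using e is_patD(1)[OF pat j lg] by blast
      then show ?thesis using False ji lg by (simp add: pcomp_def)
    qed
  qed
  then show ?case using is_face_trans[OF dP(1) e(1)] by (intro exI[of _ e] exI[of _ "pcomp P R"]) blast
qed

text \<open>Freezing exactly the coordinates equal to 0 or 1 leaves all parameters strictly inside.
  With \<open>kappa_inj\<close> this is a normal form for points of \<open>Q\<close>: two
  representatives of one point lead to the same cube and the same parameters, and later
  compatibility statements are reduced to patterns in this way.\<close>

lemma carrier_face:
  assumes "c \<in> C" "z \<in> cube (cdim c)"
  obtains d P w where "is_face c d P" "w \<in> open_cube (cdim d)" "papp (cdim c) P w = z"
    "\<And>j. j < cdim c \<Longrightarrow> (\<exists>kf. P j = Inl kf) \<longleftrightarrow> z j \<notin> {0, 1}"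
proof -
  let ?S = "{j. j < cdim c \<and> z j \<in> {0, 1}}"
  obtain d P where dP: "is_face c d P" "\<forall>j<cdim c. if j \<in> ?S then P j = Inr (z j) else (\<exists>kf. P j = Inl kf)"
    using face_exists[OF assms(1), of ?S z] by auto
  have pat: "is_pat (cdim d) (cdim c) P" using dP by (simp add: is_face_def)
  have z: "z j = 0" if "j \<ge> cdim c" for j using assms that by (simp add: cube_def)
  have z': "z j = \<delta>" if "j < cdim c" "P j = Inr \<delta>" for j \<delta>
  proof -
    have "if j \<in> ?S then P j = Inr (z j) else (\<exists>kf. P j = Inl kf)" using dP(2) that(1) by blast
    then show ?thesis using that(2) by (auto split: if_splits)
  qed
  obtain w where w: "papp (cdim c) P w = z" "\<And>k. k \<ge> cdim d \<Longrightarrow> w k = 0"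
    "\<And>j k f. j < cdim c \<Longrightarrow> P j = Inl (k, f) \<Longrightarrow> w k = (if f then 1 - z j else z j)"
    by (rule papp_surj[OF pat, of z]) (use z z' in auto)
  have "w \<in> open_cube (cdim d)"
  proof -
    have "0 < w k \<and> w k < 1" if kd: "k < cdim d" for k
    proof -
      obtain j f where j: "j < cdim c" "P j = Inl (k, f)" using is_patD(3)[OF pat kd] by blast
      then have "j \<notin> ?S" using dP(2) by fastforce
      then have "0 < z j \<and> z j < 1" using j assms(2) by (fastforce simp: cube_def less_le)
      then show ?thesis using w(3)[OF j] by simp
    qed
    then show ?thesis using w(2) by (simp add: open_cube_def)
  qed
  moreover have "(\<exists>kf. P j = Inl kf) \<longleftrightarrow> z j \<notin> {0, 1}" if "j < cdim c" for j
    using dP(2) that by (cases "j \<in> ?S") fastforce+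
  ultimately show ?thesis using that dP(1) w(1) by blast
qed

section \<open>Edges and squares\<close>

lemma edge_at_face:
  assumes f: "is_face c d P" and w: "w \<in> cube_vertices (cdim d)" and i: "i < cdim c" "P i = Inl (k, f)"
  shows "edge_at c (papp (cdim c) P w) i a \<longleftrightarrow> edge_at d w k a"
proof -
  let ?n = "cdim c" and ?v = "papp (cdim c) P w"
  have pat: "is_pat (cdim d) (cdim c) P" using f by (simp add: is_face_def)
  have k: "k < cdim d" using is_patD(1)[OF pat i] by simp
  have "\<kappa> c (?v(i := \<bar>?v i - t\<bar>)) = \<kappa> d (w(k := \<bar>w k - t\<bar>))" if t: "t \<in> {0..1}" for t
  proof -
    have wk: "w k = 0 \<or> w k = 1" using w k by (auto simp: cube_vertices_def)
    moreover have "w \<in> cube (cdim d)" using w vertices_sub by blast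
    ultimately have y: "w(k := \<bar>w k - t\<bar>) \<in> cube (cdim d)" using t k by (auto simp: cube_def)
    have "?v(i := \<bar>?v i - t\<bar>) = papp ?n P (w(k := \<bar>w k - t\<bar>))"
    proof
      fix j
      show "(?v(i := \<bar>?v i - t\<bar>)) j = papp ?n P (w(k := \<bar>w k - t\<bar>)) j"
      proof (cases "j = i")
        case True
        then show ?thesis using i wk t by (auto simp: papp_def)
      next
        case False
        then have "fst kf \<noteq> k" if "P j = Inl kf" "j < ?n" for kf
          using is_patD(4)[OF pat that(2) i(1), of k "snd kf" f] that i by (cases kf) auto
        then show ?thesis using False by (cases "P j"; cases "j < ?n") (auto simp: papp_def)
      qed
    qed
    then show ?thesis using f y by (simp add: is_face_def)
  qed
  then show ?thesis by (auto simp: edge_at_def)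
qed

lemma edge_at_exists:
  assumes "(c, v) \<in> corners" "i < cdim c" shows "\<exists>a. edge_at c v i a"
proof -
  have c: "c \<in> C" "v \<in> cube_vertices (cdim c)" using assms by (auto simp: corners_def)
  let ?S = "{..<cdim c} - {i}"
  obtain d P where dP: "is_face c d P" "\<forall>j<cdim c. if j \<in> ?S then P j = Inr (v j) else (\<exists>kf. P j = Inl kf)"
    using face_exists[OF c(1), of ?S v] c(2) by (auto simp: cube_vertices_def)
  have pat: "is_pat (cdim d) (cdim c) P" using dP by (simp add: is_face_def)
  obtain k f where kf: "P i = Inl (k, f)" using dP(2) assms(2) by fastforce
  have only: "k' = k" if k': "k' < cdim d" for k'
  proof -
    obtain j g where "j < cdim c" "P j = Inl (k', g)" using is_patD(3)[OF pat k'] by blast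
    then show ?thesis using dP(2) kf by (cases "j = i") fastforce+
  qed
  have "k < cdim d" using is_patD(1)[OF pat assms(2) kf] by simp
  then have "k = 0" "cdim d = 1" using only[of 0] only[of 1] by linarith+
  note d = this
  obtain w where w: "papp (cdim c) P w = v" "\<And>k. k \<ge> cdim d \<Longrightarrow> w k = 0"
    "\<And>j k f. j < cdim c \<Longrightarrow> P j = Inl (k, f) \<Longrightarrow> w k = (if f then 1 - v j else v j)"
    by (rule papp_surj[OF pat, of v])
      (use c dP(2) in \<open>fastforce simp: cube_vertices_def split: if_splits\<close>)+
  have "w 0 \<in> {0, 1}" using w(3)[OF assms(2) kf] c(2) assms(2) d by (auto simp: cube_vertices_def)
  then have wv: "w \<in> cube_vertices (cdim d)" using w(2) d by (auto simp: cube_vertices_def)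
  have "w(0 := s) = (\<lambda>_. 0)(0 := s)" for s using w(2) d by (auto simp: fun_eq_iff)
  moreover have "(d, w 0) \<in> oriented_edges" using d dP(1) \<open>w 0 \<in> {0, 1}\<close> by (auto simp: oriented_edges_def is_face_def)
  ultimately have "edge_at d w 0 (d, w 0)" by (simp add: edge_at_def edge_point_def)
  then show ?thesis using edge_at_face[OF dP(1) wv assms(2) kf] w(1) d by auto
qed

lemma oriented_edgesD: "a \<in> oriented_edges \<Longrightarrow> fst a \<in> C \<and> cdim (fst a) = 1 \<and> (snd a = 0 \<or> snd a = 1)"
  by (auto simp: oriented_edges_def)

text \<open>The parameter 1/3 lies in the open edge but off its centre, so it tells the two
  orientations apart.\<close>

lemma edge_point_inj:
  assumes "a \<in> oriented_edges" "b \<in> oriented_edges" "edge_point a (1/3) = edge_point b (1/3)"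
  shows "a = b"
proof -
  have o: "(\<lambda>_. 0)(0 := \<bar>snd x - 1/3\<bar>) \<in> open_cube (cdim (fst x))" if "x \<in> oriented_edges" for x
    using oriented_edgesD[OF that] by (auto simp: open_cube_def)
  have "fst a = fst b \<and> (\<lambda>_::nat. 0::real)(0 := \<bar>snd a - 1/3\<bar>) = (\<lambda>_. 0)(0 := \<bar>snd b - 1/3\<bar>)"
    using kappa_inj[OF _ _ o[OF assms(1)] o[OF assms(2)]] assms oriented_edgesD by (simp add: edge_point_def)
  then have "fst a = fst b" "\<bar>snd a - 1/3\<bar> = \<bar>snd b - 1/3\<bar>" by (metis fun_upd_same)+
  then show ?thesis using oriented_edgesD[OF assms(1)] oriented_edgesD[OF assms(2)]
    by (auto simp: prod_eq_iff)
qed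

lemma edge_at_unique: "edge_at c v i a \<Longrightarrow> edge_at c v i b \<Longrightarrow> a = b"
  by (rule edge_point_inj) (auto simp: edge_at_def)

lemma edge_at_oriented: "edge_at c v i a \<Longrightarrow> a \<in> oriented_edges" by (simp add: edge_at_def)

lemma edge_reverse_oriented [simp]: "edge_reverse a \<in> oriented_edges \<longleftrightarrow> a \<in> oriented_edges"
  by (cases a) (auto simp: oriented_edges_def edge_reverse_def)

lemma edge_reverse_reverse [simp]: "edge_reverse (edge_reverse a) = a"
  by (simp add: edge_reverse_def)

lemma fst_edge_reverse [simp]: "fst (edge_reverse a) = fst a" by (simp add: edge_reverse_def)

lemma edge_point_reverse:
  "a \<in> oriented_edges \<Longrightarrow> t \<in> {0..1} \<Longrightarrow> edge_point (edge_reverse a) t = edge_point a (1 - t)"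
  using oriented_edgesD[of a] by (auto simp: edge_point_def edge_reverse_def)

lemma edge_start_reverse [simp]: "a \<in> oriented_edges \<Longrightarrow> edge_start (edge_reverse a) = edge_end a"
  and edge_end_reverse [simp]: "a \<in> oriented_edges \<Longrightarrow> edge_end (edge_reverse a) = edge_start a"
  by (simp_all add: edge_start_def edge_end_def edge_point_reverse)

lemma edge_at_endpoints:
  assumes "edge_at c v i a" "v \<in> cube_vertices (cdim c)" "i < cdim c"
  shows "edge_start a = \<kappa> c v" "edge_end a = \<kappa> c (v(i := 1 - v i))"
proof -
  have "v(i := \<bar>v i - 0\<bar>) = v" using assms(2,3) by (auto simp: cube_vertices_def fun_eq_iff)
  moreover have e: "\<kappa> c (v(i := \<bar>v i - t\<bar>)) = edge_point a t" if "t \<in> {0..1}" for t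
    using assms(1) that unfolding edge_at_def by blast
  ultimately show "edge_start a = \<kappa> c v" using e[of 0] by (simp add: edge_start_def)
  show "edge_end a = \<kappa> c (v(i := 1 - v i))"
    using e[of 1] vertices_flip'[OF assms(2,3)] by (simp add: edge_end_def)
qed

lemma edge_at_flip:
  assumes "edge_at c v i a" "v \<in> cube_vertices (cdim c)" "i < cdim c"
  shows "edge_at c (v(i := 1 - v i)) i (edge_reverse a)"
proof -
  have "\<kappa> c (v(i := \<bar>1 - v i - t\<bar>)) = edge_point (edge_reverse a) t" if t: "t \<in> {0..1}" for t
  proof -
    have "\<kappa> c (v(i := \<bar>v i - (1 - t)\<bar>)) = edge_point a (1 - t)" using assms(1) t by (auto simp: edge_at_def)
    moreover have "\<bar>v i - (1 - t)\<bar> = \<bar>1 - v i - t\<bar>" using assms(2,3) t by (auto simp: cube_vertices_def)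
    ultimately show ?thesis using edge_point_reverse[OF edge_at_oriented[OF assms(1)] t] by simp
  qed
  then show ?thesis using edge_at_oriented[OF assms(1)] by (simp add: edge_at_def)
qed

text \<open>Crossing and parallelism are defined by 2-cubes; this provides the 2-cube for a pair of
  directions at a corner of a higher cube.\<close>

lemma square_face:
  assumes c: "(c, v) \<in> corners" "i < cdim c" "j < cdim c" "i \<noteq> j"
  obtains d P w k l where "is_face c d P" "cdim d = 2" "w \<in> cube_vertices 2" "papp (cdim c) P w = v"
    "k < 2" "l < 2" "k \<noteq> l" "\<exists>f. P i = Inl (k, f)" "\<exists>f. P j = Inl (l, f)"
    "papp (cdim c) P (w(l := 1 - w l)) = v(j := 1 - v j)"
proof -
  have cC: "c \<in> C" "v \<in> cube_vertices (cdim c)" using assms by (auto simp: corners_def)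
  let ?S = "{..<cdim c} - {i, j}"
  obtain d P where dP: "is_face c d P" "\<forall>m<cdim c. if m \<in> ?S then P m = Inr (v m) else (\<exists>kf. P m = Inl kf)"
    using face_exists[OF cC(1), of ?S v] cC(2) by (auto simp: cube_vertices_def)
  have pat: "is_pat (cdim d) (cdim c) P" using dP by (simp add: is_face_def)
  obtain k f where kf: "P i = Inl (k, f)" using dP(2) c by fastforce
  obtain l g where lg: "P j = Inl (l, g)" using dP(2) c by fastforce
  have kl: "k < cdim d" "l < cdim d" "k \<noteq> l"
    using is_patD(1)[OF pat c(2) kf] is_patD(1)[OF pat c(3) lg] is_patD(4)[OF pat c(2,3) kf] lg c(4) by auto
  have only: "m = k \<or> m = l" if m: "m < cdim d" for m
  proof -
    obtain j' h where "j' < cdim c" "P j' = Inl (m, h)" using is_patD(3)[OF pat m] by blast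
    then show ?thesis using dP(2) kf lg by (cases "j' = i"; cases "j' = j") fastforce+
  qed
  have d: "cdim d = 2"
  proof -
    have "{..<cdim d} = {k, l}" using only kl by auto
    then have "card {..<cdim d} = card {k, l}" by simp
    then show ?thesis using kl by simp
  qed
  obtain w where w: "papp (cdim c) P w = v" "\<And>k. k \<ge> cdim d \<Longrightarrow> w k = 0"
    "\<And>j k f. j < cdim c \<Longrightarrow> P j = Inl (k, f) \<Longrightarrow> w k = (if f then 1 - v j else v j)"
    by (rule papp_surj[OF pat, of v])
      (use cC dP(2) in \<open>fastforce simp: cube_vertices_def split: if_splits\<close>)+
  have wkl: "w k \<in> {0, 1}" "w l \<in> {0, 1}"
    using w(3)[OF c(2) kf] w(3)[OF c(3) lg] cC(2) c by (auto simp: cube_vertices_def)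
  then have "w \<in> cube_vertices (cdim d)" using w(2) only by (auto simp: cube_vertices_def)
  moreover have "papp (cdim c) P (w(l := 1 - w l)) = v(j := 1 - v j)"
  proof
    fix m
    show "papp (cdim c) P (w(l := 1 - w l)) m = (v(j := 1 - v j)) m"
    proof (cases "m = j")
      case True
      then show ?thesis using w(3)[OF c(3) lg] lg c by (simp add: papp_def)
    next
      case False
      then have "fst kf \<noteq> l" if "P m = Inl kf" "m < cdim c" for kf
        using is_patD(4)[OF pat that(2) c(3), of l "snd kf" g] that lg by (cases kf) auto
      then have "papp (cdim c) P (w(l := 1 - w l)) m = papp (cdim c) P w m"
        by (cases "P m"; cases "m < cdim c") (auto simp: papp_def)
      then show ?thesis using False w(1) by simp
    qed
  qed
  ultimately show ?thesis using that[OF dP(1) d _ w(1)] kl kf lg d by auto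
qed

lemma opposite_edges:
  assumes c: "(c, v) \<in> corners" "i < cdim c" "j < cdim c" "i \<noteq> j"
    and "edge_at c v i a" "edge_at c (v(j := 1 - v j)) i b"
  shows "opposite_in_square a b"
proof -
  obtain d P w k l where f: "is_face c d P" "cdim d = 2" "w \<in> cube_vertices 2" "papp (cdim c) P w = v"
    "k < 2" "l < 2" "k \<noteq> l" "\<exists>f. P i = Inl (k, f)" "\<exists>f. P j = Inl (l, f)"
    "papp (cdim c) P (w(l := 1 - w l)) = v(j := 1 - v j)" by (rule square_face[OF c])
  have "edge_at d w k a" using edge_at_face[OF f(1) _ c(2)] f assms(5) by metis
  moreover have "edge_at d (w(l := 1 - w l)) k b"
    using edge_at_face[OF f(1) _ c(2)] f assms(6) vertices_flip[of w 2 l] by metis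
  moreover have "(d, w) \<in> corners" using f by (auto simp: corners_def is_face_def)
  ultimately show ?thesis unfolding opposite_in_square_def using f by blast
qed

lemma spanning_edges:
  assumes c: "(c, v) \<in> corners" "i < cdim c" "j < cdim c" "i \<noteq> j"
    and "edge_at c v i a" "edge_at c v j b"
  shows "spans_square a b"
proof -
  obtain d P w k l where f: "is_face c d P" "cdim d = 2" "w \<in> cube_vertices 2" "papp (cdim c) P w = v"
    "k < 2" "l < 2" "k \<noteq> l" "\<exists>f. P i = Inl (k, f)" "\<exists>f. P j = Inl (l, f)"
    "papp (cdim c) P (w(l := 1 - w l)) = v(j := 1 - v j)" by (rule square_face[OF c])
  have "edge_at d w k a" using edge_at_face[OF f(1) _ c(2)] f assms(5) by metis
  moreover have "edge_at d w l b" using edge_at_face[OF f(1) _ c(3)] f assms(6) by metis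
  moreover have "(d, w) \<in> corners" using f by (auto simp: corners_def is_face_def)
  ultimately show ?thesis unfolding spans_square_def using f by blast
qed

section \<open>Parallelism\<close>

lemma opposite_in_squareI: "(c, v) \<in> corners \<Longrightarrow> cdim c = 2 \<Longrightarrow> i < 2 \<Longrightarrow> j < 2 \<Longrightarrow> i \<noteq> j \<Longrightarrow>
    edge_at c v i a \<Longrightarrow> edge_at c (v(j := 1 - v j)) i b \<Longrightarrow> opposite_in_square a b"
  unfolding opposite_in_square_def by blast

lemma opposite_sym: "opposite_in_square a b \<Longrightarrow> opposite_in_square b a"
proof -
  assume "opposite_in_square a b"
  then obtain c v i j where *: "(c, v) \<in> corners" "i < 2" "j < 2" "cdim c = 2" "i \<noteq> j" "edge_at c v i a"
    "edge_at c (v(j := 1 - v j)) i b" unfolding opposite_in_square_def by blast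
  let ?w = "v(j := 1 - v j)"
  have "(c, ?w) \<in> corners" using * vertices_flip by (auto simp: corners_def)
  moreover have "?w(j := 1 - ?w j) = v" by (auto simp: fun_eq_iff)
  ultimately show ?thesis using opposite_in_squareI[of c ?w i j b a] * by simp
qed

lemma opposite_reverse: "opposite_in_square a b \<Longrightarrow> opposite_in_square (edge_reverse a) (edge_reverse b)"
proof -
  assume "opposite_in_square a b"
  then obtain c v i j where *: "(c, v) \<in> corners" "i < 2" "j < 2" "cdim c = 2" "i \<noteq> j" "edge_at c v i a"
    "edge_at c (v(j := 1 - v j)) i b" unfolding opposite_in_square_def by blast
  let ?w = "v(i := 1 - v i)"
  have v: "v \<in> cube_vertices (cdim c)" using * by (simp add: corners_def)
  have 1: "(c, ?w) \<in> corners" using * vertices_flip by (auto simp: corners_def)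
  have 2: "edge_at c ?w i (edge_reverse a)" using edge_at_flip[OF *(6) v] * by simp
  have "edge_at c ((v(j := 1 - v j))(i := 1 - (v(j := 1 - v j)) i)) i (edge_reverse b)"
    using edge_at_flip[OF *(7)] vertices_flip[OF v, of j] * by simp
  moreover have "(v(j := 1 - v j))(i := 1 - (v(j := 1 - v j)) i) = ?w(j := 1 - ?w j)" using * by (auto simp: fun_eq_iff)
  ultimately show ?thesis using opposite_in_squareI[OF 1 _ _ _ _ 2, of j] * by simp
qed

lemma opposite_oriented: "opposite_in_square a b \<Longrightarrow> a \<in> oriented_edges \<and> b \<in> oriented_edges"
  by (auto simp: opposite_in_square_def edge_at_def)

lemma parallel_refl [simp]: "parallel a a" by (simp add: parallel_def)

lemma parallel_sym: "parallel a b \<Longrightarrow> parallel b a"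
  unfolding parallel_def by (metis opposite_sym sympD sympI symp_rtranclp)

lemma parallel_trans: "parallel a b \<Longrightarrow> parallel b c \<Longrightarrow> parallel a c"
  unfolding parallel_def by (rule rtranclp_trans)

lemma parallel_reverse: "parallel a b \<Longrightarrow> parallel (edge_reverse a) (edge_reverse b)"
  unfolding parallel_def
  by (induction rule: rtranclp_induct) (auto intro: rtranclp.rtrancl_into_rtrancl opposite_reverse)

lemma parallel_oriented: "parallel a b \<Longrightarrow> a \<in> oriented_edges \<Longrightarrow> b \<in> oriented_edges"
  unfolding parallel_def by (induction rule: rtranclp_induct) (auto dest: opposite_oriented)

lemma same_edge: "a \<in> oriented_edges \<Longrightarrow> b \<in> oriented_edges \<Longrightarrow> fst a = fst b \<Longrightarrow> b = a \<or> b = edge_reverse a"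
  using oriented_edgesD[of a] oriented_edgesD[of b] by (auto simp: edge_reverse_def prod_eq_iff)

lemma mem_hyperplane_of:
  assumes "a \<in> oriented_edges" "b \<in> oriented_edges"
  shows "fst b \<in> hyperplane_of a \<longleftrightarrow> parallel a b \<or> parallel a (edge_reverse b)"
proof
  assume "fst b \<in> hyperplane_of a"
  then obtain b' where b': "parallel a b'" "fst b' = fst b" by (auto simp: hyperplane_of_def)
  then have "b' = b \<or> b' = edge_reverse b" using same_edge parallel_oriented assms by metis
  then show "parallel a b \<or> parallel a (edge_reverse b)" using b' by blast
next
  show "parallel a b \<or> parallel a (edge_reverse b) \<Longrightarrow> fst b \<in> hyperplane_of a"
    unfolding hyperplane_of_def using fst_edge_reverse by (metis (mono_tags, lifting) mem_Collect_eq)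
qed

lemma hyperplane_of_cong: "parallel a b \<Longrightarrow> hyperplane_of a = hyperplane_of b"
  unfolding hyperplane_of_def using parallel_sym parallel_trans by blast

lemma hyperplane_of_reverse: "hyperplane_of (edge_reverse a) = hyperplane_of a"
proof -
  have "hyperplane_of a \<subseteq> hyperplane_of (edge_reverse a)" for a
  proof
    fix x assume "x \<in> hyperplane_of a"
    then obtain b where "parallel a b" "x = fst b" by (auto simp: hyperplane_of_def)
    then have "parallel (edge_reverse a) (edge_reverse b)" "x = fst (edge_reverse b)"
      using parallel_reverse by auto
    then show "x \<in> hyperplane_of (edge_reverse a)" unfolding hyperplane_of_def by blast
  qed
  from this[of a] this[of "edge_reverse a"] show ?thesis by simp
qed

lemma hyperplane_of_eq_iff:
  assumes "a \<in> oriented_edges" "b \<in> oriented_edges"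
  shows "hyperplane_of a = hyperplane_of b \<longleftrightarrow> parallel a b \<or> parallel a (edge_reverse b)"
proof
  assume "hyperplane_of a = hyperplane_of b"
  moreover have "fst b \<in> hyperplane_of b" using mem_hyperplane_of assms by simp
  ultimately show "parallel a b \<or> parallel a (edge_reverse b)" using mem_hyperplane_of assms by blast
qed (use hyperplane_of_cong hyperplane_of_reverse in metis)

text \<open>Flip the coordinates in \<open>D\<close> one at a time; each flip passes to the opposite
  edge of a square.\<close>

lemma parallel_in_cube:
  assumes c: "c \<in> C" and v: "v \<in> cube_vertices (cdim c)" and i: "i < cdim c" and D: "finite D" "D \<subseteq> {..<cdim c} - {i}"
    and a: "edge_at c v i a" and b: "edge_at c (\<lambda>j. if j \<in> D then 1 - v j else v j) i b"
  shows "parallel a b"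
  using D b
proof (induction D arbitrary: b rule: finite_induct)
  case empty
  then have "edge_at c v i b" by simp
  then show ?case using edge_at_unique[OF a] by simp
next
  case (insert k D)
  let ?w = "\<lambda>j. if j \<in> D then 1 - v j else v j"
  have w: "?w \<in> cube_vertices (cdim c)" using v insert by (auto simp: cube_vertices_def)
  then obtain a' where a': "edge_at c ?w i a'" using edge_at_exists c i by (fastforce simp: corners_def)
  then have 1: "parallel a a'" using insert by auto
  have "(\<lambda>j. if j \<in> insert k D then 1 - v j else v j) = ?w(k := 1 - ?w k)" using insert by (auto simp: fun_eq_iff)
  then have "edge_at c (?w(k := 1 - ?w k)) i b" using insert.prems by simp
  then have "opposite_in_square a' b" using opposite_edges[of c ?w i k a' b] a' w c i insert by (auto simp: corners_def)
  then show ?case using 1 by (auto simp: parallel_def intro: rtranclp.rtrancl_into_rtrancl)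
qed

lemma parallel_in_cube':
  assumes c: "c \<in> C" and v: "v \<in> cube_vertices (cdim c)" "v' \<in> cube_vertices (cdim c)" and i: "i < cdim c" "v i = v' i"
    and a: "edge_at c v i a" and b: "edge_at c v' i b"
  shows "parallel a b"
proof -
  define D where "D = {j. v j \<noteq> v' j}"
  have sub: "D \<subseteq> {..<cdim c} - {i}"
    using v i by (auto simp: D_def cube_vertices_def) (metis not_le)
  have e: "v' = (\<lambda>j. if j \<in> D then 1 - v j else v j)"
  proof
    fix j show "v' j = (if j \<in> D then 1 - v j else v j)"
      using v sub by (cases "v j = v' j"; cases "j < cdim c") (fastforce simp: D_def cube_vertices_def)+
  qed
  have fin: "finite D" using finite_subset[OF sub] by simp
  show ?thesis by (rule parallel_in_cube[OF c v(1) i(1) fin sub a b[unfolded e]])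
qed

end

section \<open>From speciality to a deterministic labelling\<close>

section \<open>The labelled graph of a special cube complex\<close>

context cube_complex
begin

definition vertices :: "'a set" where "vertices = {\<kappa> c (\<lambda>_. 0) | c. c \<in> C \<and> cdim c = 0}"

lemma corner_vertex: assumes "c \<in> C" "v \<in> cube_vertices (cdim c)" shows "\<kappa> c v \<in> vertices"
proof -
  obtain d P w where d: "is_face c d P" "w \<in> open_cube (cdim d)" "papp (cdim c) P w = v"
    "\<And>j. j < cdim c \<Longrightarrow> (\<exists>kf. P j = Inl kf) \<longleftrightarrow> v j \<notin> {0, 1}"
    using carrier_face[OF assms(1)] assms(2) vertices_sub by blast
  have "cdim d = 0"
  proof (rule ccontr)
    assume "cdim d \<noteq> 0"
    then obtain j f where "j < cdim c" "P j = Inl (0, f)"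
      using d(1) is_patD(3)[of "cdim d" "cdim c" P 0] by (auto simp: is_face_def)
    then show False using d(4)[of j] assms(2) by (auto simp: cube_vertices_def)
  qed
  moreover from this have "w = (\<lambda>_. 0)" using d(2) by (auto simp: open_cube_def)
  moreover have "\<kappa> c v = \<kappa> d w" using d open_cube_sub unfolding is_face_def by blast
  ultimately show ?thesis using d(1) by (auto simp: vertices_def is_face_def)
qed

lemma edge_start_vertex: "a \<in> oriented_edges \<Longrightarrow> edge_start a \<in> vertices"
  using corner_vertex[of "fst a" "(\<lambda>_. 0)(0 := \<bar>snd a\<bar>)"] oriented_edgesD[of a]
  by (auto simp: edge_start_def edge_point_def cube_vertices_def)

lemma edge_end_vertex: "a \<in> oriented_edges \<Longrightarrow> edge_end a \<in> vertices"
  using edge_start_vertex[of "edge_reverse a"] by simp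

lemma spans_square_sym: "spans_square a b \<Longrightarrow> spans_square b a"
  unfolding spans_square_def by blast

lemma cross_sym: "hyperplanes_cross h k \<Longrightarrow> hyperplanes_cross k h"
  unfolding hyperplanes_cross_def using spans_square_sym by blast

lemma mem_own_hyperplane: "fst a \<in> hyperplane_of a"
  unfolding hyperplane_of_def using parallel_refl by blast

end

locale finite_special_cube_complex = special_cube_complex Q C cdim \<kappa>
  for Q :: "'a::topological_space set" and C :: "'c set" and cdim \<kappa> +
  assumes finite_C: "finite C"
begin

definition nhyp :: nat where "nhyp = card hyperplanes"

definition hyp :: "nat \<Rightarrow> 'c set" where "hyp = (SOME f. bij_betw f {..<nhyp} hyperplanes)"

definition rep :: "nat \<Rightarrow> 'c \<times> real"
  where "rep k = (SOME a. a \<in> oriented_edges \<and> hyperplane_of a = hyp k)"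

text \<open>The sign compares the edge with a chosen representative of its hyperplane; two-sidedness
  is what makes reversal flip it.\<close>

definition lab :: "'c \<times> real \<Rightarrow> nat \<times> bool"
  where "lab a = (let k = inv_into {..<nhyp} hyp (hyperplane_of a) in (k, parallel (rep k) a))"

lemma finite_vertices: "finite vertices"
proof -
  have "vertices \<subseteq> (\<lambda>c. \<kappa> c (\<lambda>_. 0)) ` C" by (auto simp: vertices_def)
  then show ?thesis using finite_C finite_surj by blast
qed

lemma bij_hyp: "bij_betw hyp {..<nhyp} hyperplanes"
proof -
  have "finite oriented_edges" using finite_C by (simp add: oriented_edges_def)
  then have "finite hyperplanes" by (simp add: hyperplanes_def)
  then have "\<exists>f. bij_betw f {..<nhyp} hyperplanes"
    using finite_same_card_bij[of "{..<nhyp}" hyperplanes] by (simp add: nhyp_def)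
  then show ?thesis unfolding hyp_def by (rule someI_ex)
qed

lemma rep: assumes "k < nhyp" shows "rep k \<in> oriented_edges" "hyperplane_of (rep k) = hyp k"
proof -
  have "hyp k \<in> hyperplanes" using bij_hyp assms by (auto simp: bij_betw_def)
  then have "\<exists>a. a \<in> oriented_edges \<and> hyperplane_of a = hyp k" by (auto simp: hyperplanes_def)
  from someI_ex[OF this] show "rep k \<in> oriented_edges" "hyperplane_of (rep k) = hyp k" by (auto simp: rep_def)
qed

lemma lab:
  assumes "a \<in> oriented_edges"
  shows "fst (lab a) < nhyp" "hyp (fst (lab a)) = hyperplane_of a" "snd (lab a) \<longleftrightarrow> parallel (rep (fst (lab a))) a"
proof -
  have h: "hyperplane_of a \<in> hyp ` {..<nhyp}" using bij_hyp assms by (auto simp: bij_betw_def hyperplanes_def)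
  show "fst (lab a) < nhyp" using inv_into_into[OF h] by (simp add: lab_def Let_def)
  show "hyp (fst (lab a)) = hyperplane_of a" using f_inv_into_f[OF h] by (simp add: lab_def Let_def)
  show "snd (lab a) \<longleftrightarrow> parallel (rep (fst (lab a))) a" by (simp add: lab_def Let_def)
qed

lemma lab_parallel_rep:
  assumes "a \<in> oriented_edges"
  shows "parallel (rep (fst (lab a))) (if snd (lab a) then a else edge_reverse a)"
  using hyperplane_of_eq_iff[OF rep(1)[OF lab(1)[OF assms]] assms] rep(2)[OF lab(1)[OF assms]] lab(2,3)[OF assms]
  by auto

lemma not_parallel_reverse: "a \<in> oriented_edges \<Longrightarrow> \<not> parallel a (edge_reverse a)"
  using hyperplanes_two_sided[of "hyperplane_of a"] mem_own_hyperplane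
  by (auto simp: two_sided_def hyperplanes_def)

lemma lab_eq_iff:
  assumes "a \<in> oriented_edges" "b \<in> oriented_edges" shows "lab a = lab b \<longleftrightarrow> parallel a b"
proof
  assume e: "lab a = lab b"
  have "parallel (if snd (lab a) then a else edge_reverse a) (if snd (lab a) then b else edge_reverse b)"
    using parallel_trans[OF parallel_sym[OF lab_parallel_rep[OF assms(1)]]] lab_parallel_rep[OF assms(2)] e by simp
  then show "parallel a b"
    using parallel_reverse[of "edge_reverse a" "edge_reverse b"] by (auto split: if_splits)
next
  assume p: "parallel a b"
  then have "hyperplane_of a = hyperplane_of b" by (rule hyperplane_of_cong)
  moreover have "parallel c a \<longleftrightarrow> parallel c b" for c using p parallel_sym parallel_trans by blast
  ultimately show "lab a = lab b" by (simp add: lab_def)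
qed

lemma lab_reverse: assumes "a \<in> oriented_edges" shows "lab (edge_reverse a) = linv (lab a)"
proof -
  have f: "fst (lab (edge_reverse a)) = fst (lab a)" by (simp add: lab_def Let_def hyperplane_of_reverse)
  have "lab (edge_reverse a) \<noteq> lab a"
    using lab_eq_iff[of "edge_reverse a" a] not_parallel_reverse[of a] assms parallel_sym[of "edge_reverse a" a] by auto
  then have "snd (lab (edge_reverse a)) \<noteq> snd (lab a)" using f by (simp add: prod_eq_iff)
  then show ?thesis using f by (simp add: prod_eq_iff)
qed

definition E0 :: "nat set set"
  where "E0 = {{i, j} | i j. i < nhyp \<and> j < nhyp \<and> hyperplanes_cross (hyp i) (hyp j)}"

lemma E0_iff: "{i, j} \<in> E0 \<longleftrightarrow> i < nhyp \<and> j < nhyp \<and> hyperplanes_cross (hyp i) (hyp j)"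
  using cross_sym by (auto simp: E0_def doubleton_eq_iff)

lemma hyp_hyperplane: "i < nhyp \<Longrightarrow> hyp i \<in> hyperplanes"
  using bij_hyp by (auto simp: bij_betw_def)

lemma E0_sub: "E0 \<subseteq> {{a, b} | a b. a \<in> {..<nhyp} \<and> b \<in> {..<nhyp} \<and> a \<noteq> b}"
  using hyperplanes_embedded hyp_hyperplane by (fastforce simp: E0_def)

lemma spans_square_E0:
  assumes "spans_square a b" shows "{fst (lab a), fst (lab b)} \<in> E0"
proof -
  have o: "a \<in> oriented_edges" "b \<in> oriented_edges"
    using assms edge_at_oriented unfolding spans_square_def by blast+
  then have "hyperplanes_cross (hyp (fst (lab a))) (hyp (fst (lab b)))"
    unfolding hyperplanes_cross_def using assms lab(2) mem_own_hyperplane by metis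
  then show ?thesis using lab(1) o by (simp add: E0_iff)
qed

definition edge_with :: "'a \<Rightarrow> nat \<times> bool \<Rightarrow> 'c \<times> real \<Rightarrow> bool"
  where "edge_with x l a \<longleftrightarrow> a \<in> oriented_edges \<and> edge_start a = x \<and> lab a = l"

text \<open>Two different edges would directly self-osculate. The same edge in its two orientations,
  which may share a start if it is a loop, is excluded by two-sidedness.\<close>

lemma edge_with_unique: assumes "edge_with x l a" "edge_with x l b" shows "a = b"
proof (rule ccontr)
  assume "a \<noteq> b"
  have o: "a \<in> oriented_edges" "b \<in> oriented_edges" "edge_start a = edge_start b" and l: "lab a = lab b"
    using assms by (auto simp: edge_with_def)
  then have p: "parallel a b" using lab_eq_iff by simp
  have "fst a \<noteq> fst b"
    using same_edge[OF o(1,2)] \<open>a \<noteq> b\<close> p not_parallel_reverse o by metis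
  moreover have "fst a \<in> hyperplane_of a" "fst b \<in> hyperplane_of a"
    using mem_own_hyperplane[of a] mem_own_hyperplane[of b] hyperplane_of_cong[OF p] by auto
  ultimately have "directly_self_osculates (hyperplane_of a)"
    unfolding directly_self_osculates_def using o p by blast
  then show False using no_direct_self_osculation o by (auto simp: hyperplanes_def)
qed

lemma edge_with_reverse: "edge_with x l a \<Longrightarrow> edge_with (edge_end a) (linv l) (edge_reverse a)"
  by (auto simp: edge_with_def lab_reverse)

definition pst :: "'a \<Rightarrow> nat \<times> bool \<Rightarrow> 'a option"
  where "pst x l = (if \<exists>a. edge_with x l a then Some (edge_end (THE a. edge_with x l a)) else None)"

lemma pst_iff: "pst x l = Some y \<longleftrightarrow> (\<exists>a. edge_with x l a \<and> edge_end a = y)"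
proof (cases "\<exists>a. edge_with x l a")
  case True
  then obtain a where a: "edge_with x l a" by blast
  then have "(THE a. edge_with x l a) = a" using edge_with_unique by blast
  then have "pst x l = Some (edge_end a)" unfolding pst_def using True by simp
  moreover have "(\<exists>b. edge_with x l b \<and> edge_end b = y) \<longleftrightarrow> edge_end a = y"
    using a edge_with_unique by blast
  ultimately show ?thesis by simp
next
  case False
  then show ?thesis unfolding pst_def by simp
qed

text \<open>Crossing labels belong to different hyperplanes by embeddedness, so the absence of
  inter-osculation provides a square at the common start; its opposite sides are parallel and carry
  equal labels.\<close>

lemma complete_square:
  assumes a: "edge_with x l a" and b: "edge_with x m b" and e: "{fst l, fst m} \<in> E0"
  obtains c v i j a' b' where "(c, v) \<in> corners" "cdim c = 2" "i < 2" "j < 2" "i \<noteq> j" "edge_at c v i a" "edge_at c v j b"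
    "edge_at c (v(j := 1 - v j)) i a'" "edge_at c (v(i := 1 - v i)) j b'"
    "edge_with (edge_end b) l a'" "edge_with (edge_end a) m b'" "edge_end a' = edge_end b'"
proof -
  have o: "a \<in> oriented_edges" "b \<in> oriented_edges" "lab a = l" "lab b = m" "edge_start a = x" "edge_start b = x"
    using a b by (auto simp: edge_with_def)
  have h: "hyp (fst l) = hyperplane_of a" "hyp (fst m) = hyperplane_of b" "fst l < nhyp" "fst m < nhyp"
    using lab[OF o(1)] lab[OF o(2)] o(3,4) by auto
  have "fst l \<noteq> fst m" using e E0_sub by (fastforce simp: doubleton_eq_iff)
  then have ne: "hyperplane_of a \<noteq> hyperplane_of b"
    using bij_hyp h by (auto simp: bij_betw_def inj_on_def)
  have "hyperplanes_cross (hyperplane_of a) (hyperplane_of b)" using e h by (simp add: E0_iff)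
  moreover have "\<not> inter_osculate (hyperplane_of a) (hyperplane_of b)"
    using no_inter_osculation[OF _ _ ne] o by (simp add: hyperplanes_def)
  moreover have "edge_start a = edge_start b" using o by simp
  ultimately have "spans_square a b"
    unfolding inter_osculate_def using o(1,2) mem_own_hyperplane by blast
  then obtain c v i j where c: "(c, v) \<in> corners" "cdim c = 2" "i < 2" "j < 2" "i \<noteq> j" "edge_at c v i a" "edge_at c v j b"
    unfolding spans_square_def by blast
  have v: "v \<in> cube_vertices (cdim c)" "c \<in> C" using c by (auto simp: corners_def)
  let ?vj = "v(j := 1 - v j)" and ?vi = "v(i := 1 - v i)"
  have w: "?vj \<in> cube_vertices (cdim c)" "?vi \<in> cube_vertices (cdim c)" using vertices_flip v c by auto
  obtain a' where a': "edge_at c ?vj i a'" using edge_at_exists[of c ?vj i] w v c by (auto simp: corners_def)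
  obtain b' where b': "edge_at c ?vi j b'" using edge_at_exists[of c ?vi j] w v c by (auto simp: corners_def)
  have "opposite_in_square a a'" "opposite_in_square b b'"
    using opposite_in_squareI[OF c(1,2,3,4,5,6) a'] opposite_in_squareI[OF c(1,2,4,3) c(5)[symmetric] c(7) b'] .
  then have "parallel a a'" "parallel b b'" by (auto simp: parallel_def)
  then have l: "lab a' = l" "lab b' = m"
    using lab_eq_iff[OF o(1) edge_at_oriented[OF a']] lab_eq_iff[OF o(2) edge_at_oriented[OF b']] o by auto
  have "edge_start a' = edge_end b"
    using edge_at_endpoints[OF a' w(1)] edge_at_endpoints[OF c(7) v(1)] c by simp
  moreover have "edge_start b' = edge_end a"
    using edge_at_endpoints[OF b' w(2)] edge_at_endpoints[OF c(6) v(1)] c by simp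
  moreover have "?vj(i := 1 - ?vj i) = ?vi(j := 1 - ?vi j)" using c by (auto simp: fun_eq_iff)
  then have "edge_end a' = edge_end b'"
    using edge_at_endpoints(2)[OF a' w(1)] edge_at_endpoints(2)[OF b' w(2)] c by simp
  ultimately show ?thesis
    using that[OF c a' b'] edge_at_oriented a' b' l by (auto simp: edge_with_def)
qed

sublocale pa: partial_action vertices nhyp E0 pst
proof
  show "finite vertices" by (rule finite_vertices)
  show "E0 \<subseteq> {{a, b} |a b. a \<in> {..<nhyp} \<and> b \<in> {..<nhyp} \<and> a \<noteq> b}" by (rule E0_sub)
  fix x l y assume p: "pst x l = Some y"
  then obtain a where a: "edge_with x l a" "edge_end a = y" by (auto simp: pst_iff)
  then show "x \<in> vertices \<and> y \<in> vertices \<and> fst l < nhyp"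
    using edge_start_vertex[of a] edge_end_vertex[of a] lab(1)[of a] by (auto simp: edge_with_def)
  show "pst y (linv l) = Some x"
    unfolding pst_iff using edge_with_reverse[OF a(1)] a edge_end_reverse[of a] edge_with_def by metis
  fix m z assume "{fst l, fst m} \<in> E0" "pst x m = Some z"
  then obtain b where b: "edge_with x m b" "edge_end b = z" "{fst l, fst m} \<in> E0" by (auto simp: pst_iff)
  then show "\<exists>t. pst y m = Some t \<and> pst z l = Some t"
    using complete_square[OF a(1) b(1,3)] a b pst_iff by metis
qed

end

section \<open>Homotopy calculus for paths in an arbitrary topological space\<close>

section \<open>Homotopies of paths\<close>

lemma path_eq_compose_linepath: "p \<circ> linepath 0 1 = p"
  by (simp add: linepath_def fun_eq_iff)

text \<open>The unit and inverse laws below are laws for segments in the parameter interval, pushed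
  forward along \<open>p\<close>.\<close>

lemma homotopic_paths_compose_unit:
  fixes p :: "real \<Rightarrow> 'a::topological_space"
  assumes "path p" "path_image p \<subseteq> S" "homotopic_paths {0..1} f g"
  shows "homotopic_paths S (p \<circ> f) (p \<circ> g)"
  by (rule homotopic_paths_continuous_image[OF assms(3)])
    (use assms(1,2) in \<open>auto simp: path_def path_image_def\<close>)

lemma homotopic_paths_const_right:
  fixes p :: "real \<Rightarrow> 'a::topological_space"
  assumes "path p" "path_image p \<subseteq> S" "x = pathfinish p"
  shows "homotopic_paths S (p +++ (\<lambda>_. x)) p"
proof -
  have "homotopic_paths {0..1::real} (linepath 0 1 +++ linepath 1 1) (linepath 0 1)"
    using homotopic_paths_rid[of "linepath 0 (1::real)" "{0..1}"] by (simp add: closed_segment_eq_real_ivl)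
  from homotopic_paths_compose_unit[OF assms(1,2) this]
  have "homotopic_paths S ((p \<circ> linepath 0 1) +++ (p \<circ> linepath 1 1)) (p \<circ> linepath 0 1)"
    by (simp only: path_compose_join)
  moreover have "p \<circ> linepath 1 1 = (\<lambda>_. x)" using assms(3) by (simp add: pathfinish_def linepath_def fun_eq_iff algebra_simps)
  ultimately show ?thesis by (simp only: path_eq_compose_linepath)
qed

lemma homotopic_paths_const_left:
  fixes p :: "real \<Rightarrow> 'a::topological_space"
  assumes "path p" "path_image p \<subseteq> S" "x = pathstart p"
  shows "homotopic_paths S ((\<lambda>_. x) +++ p) p"
proof -
  have "homotopic_paths {0..1::real} (linepath 0 0 +++ linepath 0 1) (linepath 0 1)"
    using homotopic_paths_lid[of "linepath 0 (1::real)" "{0..1}"] by (simp add: closed_segment_eq_real_ivl)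
  from homotopic_paths_compose_unit[OF assms(1,2) this]
  have "homotopic_paths S ((p \<circ> linepath 0 0) +++ (p \<circ> linepath 0 1)) (p \<circ> linepath 0 1)"
    by (simp only: path_compose_join)
  moreover have "p \<circ> linepath 0 0 = (\<lambda>_. x)" using assms(3) by (simp add: pathstart_def linepath_def fun_eq_iff)
  ultimately show ?thesis by (simp only: path_eq_compose_linepath)
qed

lemma homotopic_paths_inv_right:
  fixes p :: "real \<Rightarrow> 'a::topological_space"
  assumes "path p" "path_image p \<subseteq> S"
  shows "homotopic_paths S (p +++ reversepath p) (\<lambda>_. pathstart p)"
proof -
  have "homotopic_paths {0..1::real} (linepath 0 1 +++ reversepath (linepath 0 1)) (linepath 0 0)"
    using homotopic_paths_rinv[of "linepath 0 (1::real)" "{0..1}"] by (simp add: closed_segment_eq_real_ivl)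
  from homotopic_paths_compose_unit[OF assms this]
  have "homotopic_paths S ((p \<circ> linepath 0 1) +++ reversepath (p \<circ> linepath 0 1)) (p \<circ> linepath 0 0)"
    by (simp only: path_compose_join path_compose_reversepath)
  moreover have "p \<circ> linepath 0 0 = (\<lambda>_. pathstart p)" by (simp add: pathstart_def linepath_def fun_eq_iff)
  ultimately show ?thesis by (simp only: path_eq_compose_linepath)
qed

lemma homotopic_paths_inv_left:
  fixes p :: "real \<Rightarrow> 'a::topological_space"
  assumes "path p" "path_image p \<subseteq> S"
  shows "homotopic_paths S (reversepath p +++ p) (\<lambda>_. pathfinish p)"
  using homotopic_paths_inv_right[of "reversepath p" S] assms by simp

lemma homotopic_paths_pointwise:
  fixes p :: "real \<Rightarrow> 'a::topological_space"
  assumes "path p" "path_image p \<subseteq> S" "\<And>t. t \<in> {0..1} \<Longrightarrow> q t = p t"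
  shows "homotopic_paths S p q"
  using homotopic_paths_eq[of p S q] assms by simp

definition path_from :: "'a::topological_space set \<Rightarrow> 'a \<Rightarrow> 'a \<Rightarrow> (real \<Rightarrow> 'a) \<Rightarrow> bool"
  where "path_from S x y p \<longleftrightarrow> path p \<and> path_image p \<subseteq> S \<and> pathstart p = x \<and> pathfinish p = y"

lemma path_fromD: "path_from S x y p \<Longrightarrow> path p" "path_from S x y p \<Longrightarrow> path_image p \<subseteq> S"
    "path_from S x y p \<Longrightarrow> pathstart p = x" "path_from S x y p \<Longrightarrow> pathfinish p = y"
  by (simp_all add: path_from_def)

lemma path_from_join: "path_from S x y p \<Longrightarrow> path_from S y z q \<Longrightarrow> path_from S x z (p +++ q)"
  by (auto simp: path_from_def path_image_join)

lemma path_from_reverse: "path_from S x y p \<Longrightarrow> path_from S y x (reversepath p)"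
  by (auto simp: path_from_def)

lemma path_from_const: "x \<in> S \<Longrightarrow> path_from S x x (\<lambda>_. x)"
  by (auto simp: path_from_def path_def pathstart_def pathfinish_def path_image_def)

lemma path_from_homotopic: "homotopic_paths S p q \<Longrightarrow> path_from S x y p \<Longrightarrow> path_from S x y q"
  using homotopic_paths_imp_path homotopic_paths_imp_subset homotopic_paths_imp_pathstart
    homotopic_paths_imp_pathfinish unfolding path_from_def by metis

lemma homotopic_paths_reflI: "path_from S x y p \<Longrightarrow> homotopic_paths S p p"
  by (simp add: path_from_def)

lemma homotopic_paths_join_from:
  "homotopic_paths S p p' \<Longrightarrow> homotopic_paths S q q' \<Longrightarrow> path_from S x y p \<Longrightarrow> path_from S y z q \<Longrightarrow>
    homotopic_paths S (p +++ q) (p' +++ q')"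
  by (rule homotopic_paths_join) (auto simp: path_from_def)

lemma homotopic_paths_assoc_from:
  "path_from S x y p \<Longrightarrow> path_from S y z q \<Longrightarrow> path_from S z w r \<Longrightarrow>
    homotopic_paths S (p +++ (q +++ r)) ((p +++ q) +++ r)"
  by (rule homotopic_paths_assoc) (auto simp: path_from_def)

lemma homotopic_paths_cancel_middle:
  assumes p: "path_from S x y p" and q: "path_from S z y q" and r: "path_from S y w r"
  shows "homotopic_paths S ((p +++ reversepath q) +++ (q +++ r)) (p +++ r)"
proof -
  note rq = path_from_reverse[OF q]
  have "homotopic_paths S ((p +++ reversepath q) +++ (q +++ r)) (p +++ (reversepath q +++ (q +++ r)))"
    using homotopic_paths_assoc_from[OF p rq path_from_join[OF q r]] by (rule homotopic_paths_sym)
  moreover have "homotopic_paths S (reversepath q +++ (q +++ r)) r"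
  proof -
    have "homotopic_paths S (reversepath q +++ q) (\<lambda>_. y)"
      using homotopic_paths_inv_left[of q S] q by (simp add: path_from_def)
    then have "homotopic_paths S ((reversepath q +++ q) +++ r) ((\<lambda>_. y) +++ r)"
      using homotopic_paths_join_from[OF _ homotopic_paths_reflI[OF r] path_from_join[OF rq q] r] by blast
    moreover have "homotopic_paths S ((\<lambda>_. y) +++ r) r"
      using homotopic_paths_const_left[of r S y] r by (auto simp: path_from_def)
    ultimately show ?thesis
      using homotopic_paths_assoc_from[OF rq q r] by (meson homotopic_paths_trans)
  qed
  then have "homotopic_paths S (p +++ (reversepath q +++ (q +++ r))) (p +++ r)"
    using homotopic_paths_join_from[OF homotopic_paths_reflI[OF p] _ p path_from_join[OF rq path_from_join[OF q r]]] by blast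
  ultimately show ?thesis by (rule homotopic_paths_trans)
qed

lemma homotopic_paths_splice:
  assumes A: "path_from S a x A" and E: "path_from S x y E" and B: "path_from S b y B"
    and F: "path_from S y z F" and C: "path_from S c z C"
  shows "homotopic_paths S ((A +++ (E +++ reversepath B)) +++ (B +++ (F +++ reversepath C)))
    (A +++ ((E +++ F) +++ reversepath C))"
proof -
  note rB = path_from_reverse[OF B] and rC = path_from_reverse[OF C]
  note FC = path_from_join[OF F rC] and BFC = path_from_join[OF B path_from_join[OF F rC]]
  have "homotopic_paths S ((A +++ (E +++ reversepath B)) +++ (B +++ (F +++ reversepath C)))
      (((A +++ E) +++ reversepath B) +++ (B +++ (F +++ reversepath C)))"
    by (rule homotopic_paths_join_from[OF homotopic_paths_assoc_from[OF A E rB] homotopic_paths_reflI[OF BFC]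
      path_from_join[OF A path_from_join[OF E rB]] BFC])
  moreover have "homotopic_paths S (((A +++ E) +++ reversepath B) +++ (B +++ (F +++ reversepath C)))
      ((A +++ E) +++ (F +++ reversepath C))"
    by (rule homotopic_paths_cancel_middle[OF path_from_join[OF A E] B FC])
  moreover have "homotopic_paths S ((A +++ E) +++ (F +++ reversepath C)) (A +++ (E +++ (F +++ reversepath C)))"
    by (rule homotopic_paths_sym[OF homotopic_paths_assoc_from[OF A E FC]])
  moreover have "homotopic_paths S (A +++ (E +++ (F +++ reversepath C))) (A +++ ((E +++ F) +++ reversepath C))"
    by (rule homotopic_paths_join_from[OF homotopic_paths_reflI[OF A] homotopic_paths_assoc_from[OF E F rC] A
      path_from_join[OF E FC]])
  ultimately show ?thesis by (meson homotopic_paths_trans)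
qed

text \<open>The square is convex, so its bottom side is homotopic within it to the path along the
  other three sides.\<close>

lemma homotopic_paths_square:
  fixes h :: "real \<times> real \<Rightarrow> 'a::topological_space"
  assumes "continuous_on ({0..1} \<times> {0..1}) h" "h ` ({0..1} \<times> {0..1}) \<subseteq> S"
  shows "homotopic_paths S (\<lambda>s. h (s, 0))
    ((\<lambda>t. h (0, t)) +++ (\<lambda>s. h (s, 1)) +++ reversepath (\<lambda>t. h (1, t)))"
proof -
  let ?K = "{0..1::real} \<times> {0..1::real}"
  let ?l = "linepath (0::real, 0::real)"
  have cv: "convex ?K" by (intro convex_Times) auto
  let ?q = "linepath (0, 0) (0, 1) +++ linepath (0, 1) (1, 1) +++ linepath (1, 1) (1::real, 0::real)"
  have seg: "closed_segment u v \<subseteq> ?K" if "u \<in> ?K" "v \<in> ?K" for u v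
    using that by (intro closed_segment_subset cv)
  have pq: "path_image ?q \<subseteq> ?K" "path_image (?l (1, 0)) \<subseteq> ?K"
    by (intro subset_path_image_join; simp add: seg) (simp add: seg)
  have "homotopic_paths ?K (?l (1, 0)) ?q"
  proof (rule homotopic_paths_linear)
    fix t :: real assume "t \<in> {0..1}"
    then have "?l (1, 0) t \<in> ?K" "?q t \<in> ?K" using pq by (auto simp: path_image_def)
    then show "closed_segment (?l (1, 0) t) (?q t) \<subseteq> ?K" by (intro closed_segment_subset cv)
  qed auto
  from homotopic_paths_continuous_image[OF this assms(1)] assms(2)
  have "homotopic_paths S (h \<circ> ?l (1, 0)) ((h \<circ> linepath (0, 0) (0, 1)) +++ (h \<circ> linepath (0, 1) (1, 1)) +++
    (h \<circ> linepath (1, 1) (1, 0)))"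
    by (simp add: path_compose_join image_subset_iff_funcset)
  moreover have "h \<circ> ?l (1, 0) = (\<lambda>s. h (s, 0))" "h \<circ> linepath (0, 0) (0, 1) = (\<lambda>t. h (0, t))"
    "h \<circ> linepath (0, 1) (1, 1) = (\<lambda>s. h (s, 1))" "h \<circ> linepath (1, 1) (1, 0) = reversepath (\<lambda>t. h (1, t))"
    by (auto simp: linepath_def fun_eq_iff algebra_simps reversepath_def)
  ultimately show ?thesis by simp
qed

section \<open>Paths in a cube\<close>

definition lerp :: "real \<Rightarrow> (nat \<Rightarrow> real) \<Rightarrow> (nat \<Rightarrow> real) \<Rightarrow> nat \<Rightarrow> real"
  where "lerp t x y = (\<lambda>i. (1 - t) * x i + t * y i)"

lemma lerp_01 [simp]: "lerp 0 x y = x" "lerp 1 x y = y" "lerp t x x = x"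
  by (auto simp: lerp_def fun_eq_iff algebra_simps)

lemma lerp_bounds: "0 \<le> t \<Longrightarrow> t \<le> 1 \<Longrightarrow> 0 \<le> a \<Longrightarrow> a \<le> 1 \<Longrightarrow> 0 \<le> b \<Longrightarrow> b \<le> (1::real) \<Longrightarrow>
    0 \<le> (1 - t) * a + t * b \<and> (1 - t) * a + t * b \<le> 1"
  using convex_bound_le[of a 1 b "1 - t" t] by simp

lemma lerp_cube: "0 \<le> t \<Longrightarrow> t \<le> 1 \<Longrightarrow> x \<in> cube n \<Longrightarrow> y \<in> cube n \<Longrightarrow> lerp t x y \<in> cube n"
  using lerp_bounds by (simp add: cube_def lerp_def)

lemma papp_lerp: "is_pat d n P \<Longrightarrow> papp n P (lerp t x y) = lerp t (papp n P x) (papp n P y)"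
proof
  fix j show "papp n P (lerp t x y) j = lerp t (papp n P x) (papp n P y) j"
    by (cases "P j") (auto simp: papp_def lerp_def algebra_simps)
qed

lemma cube_homotopic:
  assumes "path_from (cube n) x y p" "path_from (cube n) x y q"
  shows "homotopic_paths (cube n) p q"
proof -
  let ?h = "\<lambda>z. lerp (fst z) (p (snd z)) (q (snd z))"
  have pq: "continuous_on {0..1} p" "continuous_on {0..1} q" "p ` {0..1} \<subseteq> cube n" "q ` {0..1} \<subseteq> cube n"
    "p 0 = x" "q 0 = x" "p 1 = y" "q 1 = y"
    using assms by (auto simp: path_from_def path_def path_image_def pathstart_def pathfinish_def)
  have "continuous_on ({0..1} \<times> {0..1}) ?h"
  proof (rule continuous_on_coordinatewise_then_product)
    fix i
    have "continuous_on ({0..1} \<times> {0..1}) (\<lambda>z::real \<times> real. p (snd z) i)" "continuous_on ({0..1} \<times> {0..1}) (\<lambda>z::real \<times> real. q (snd z) i)"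
      by (rule continuous_on_compose2[OF continuous_on_product_then_coordinatewise[OF pq(1)] continuous_on_snd[OF continuous_on_id]];
          auto)
        (rule continuous_on_compose2[OF continuous_on_product_then_coordinatewise[OF pq(2)] continuous_on_snd[OF continuous_on_id]];
          auto)
    then show "continuous_on ({0..1} \<times> {0..1}) (\<lambda>z. ?h z i)"
      unfolding lerp_def by (intro continuous_intros)
  qed
  moreover have "?h \<in> {0..1} \<times> {0..1} \<rightarrow> cube n" using pq by (auto intro!: lerp_cube)
  ultimately show ?thesis unfolding homotopic_paths
    using pq by (intro exI[of _ ?h]) (auto simp: pathstart_def pathfinish_def)
qed

lemma lerp_path: assumes "x \<in> cube n" "y \<in> cube n" shows "path_from (cube n) x y (\<lambda>t. lerp t x y)"
proof -
  have "continuous_on {0..1} (\<lambda>t. lerp t x y)"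
    unfolding lerp_def by (intro continuous_on_coordinatewise_then_product continuous_intros)
  then show ?thesis using assms
    by (auto simp: path_from_def path_def path_image_def pathstart_def pathfinish_def intro!: lerp_cube)
qed

context cube_complex
begin

lemma kappa_continuous:
  assumes "c \<in> C" shows "continuous_on (cube (cdim c)) (\<kappa> c)" "\<kappa> c ` cube (cdim c) \<subseteq> Q"
proof -
  have "continuous_map (top_of_set (cube (cdim c))) (sum_topology (\<lambda>c. top_of_set (cube (cdim c))) C) (\<lambda>x. (c, x))"
    using continuous_map_component_injection[OF assms, of "\<lambda>c. top_of_set (cube (cdim c))"] by simp
  from continuous_map_compose[OF this quotient_imp_continuous_map[OF quotient]]
  have "continuous_map (top_of_set (cube (cdim c))) (top_of_set Q) (\<kappa> c)" by (simp add: o_def)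
  then show "continuous_on (cube (cdim c)) (\<kappa> c)" "\<kappa> c ` cube (cdim c) \<subseteq> Q"
    by (auto simp: continuous_map_in_subtopology)
qed

lemma path_from_kappa: "c \<in> C \<Longrightarrow> path_from (cube (cdim c)) x y p \<Longrightarrow> path_from Q (\<kappa> c x) (\<kappa> c y) (\<kappa> c \<circ> p)"
  using kappa_continuous[of c] unfolding path_from_def
  by (auto simp: pathstart_compose pathfinish_compose path_image_compose intro!: path_continuous_image
      intro: continuous_on_subset)

lemma homotopic_kappa:
  assumes "c \<in> C" "path_from (cube (cdim c)) x y p" "path_from (cube (cdim c)) x y q"
  shows "homotopic_paths Q (\<kappa> c \<circ> p) (\<kappa> c \<circ> q)"
  by (rule homotopic_paths_continuous_image[OF cube_homotopic[OF assms(2,3)] kappa_continuous(1)[OF assms(1)]])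
    (use kappa_continuous(2)[OF assms(1)] in auto)

definition centre :: "'c \<Rightarrow> nat \<Rightarrow> real" where "centre c = (\<lambda>i. if i < cdim c then 1/2 else 0)"

lemma centre_open_cube: "centre c \<in> open_cube (cdim c)"
  by (simp add: centre_def open_cube_def)

text \<open>Points of a cube that represent centres have all coordinates among 0, 1/2 and 1, so each
  cube contains finitely many, whatever \<open>A\<close> is. Hence the set of all centres is closed
  and discrete.\<close>

lemma closedin_centres:
  assumes "A \<subseteq> C" shows "closedin (top_of_set Q) ((\<lambda>c. \<kappa> c (centre c)) ` A)"
proof -
  let ?X = "sum_topology (\<lambda>c. top_of_set (cube (cdim c))) C"
  let ?D = "(\<lambda>c. \<kappa> c (centre c)) ` A"
  have DQ: "?D \<subseteq> Q" using kappa_continuous(2) centre_open_cube open_cube_sub assms by blast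
  have "closedin (top_of_set (cube (cdim c))) {x \<in> cube (cdim c). \<kappa> c x \<in> ?D}" if c: "c \<in> C" for c
  proof -
    let ?F = "{x. (\<forall>i. (i \<in> {..<cdim c} \<longrightarrow> x i \<in> {0, 1, 1/2}) \<and> (i \<notin> {..<cdim c} \<longrightarrow> x i = 0))}"
    have "{x \<in> cube (cdim c). \<kappa> c x \<in> ?D} \<subseteq> ?F"
    proof
      fix x assume "x \<in> {x \<in> cube (cdim c). \<kappa> c x \<in> ?D}"
      then obtain c' where x: "x \<in> cube (cdim c)" "c' \<in> A" "\<kappa> c x = \<kappa> c' (centre c')" by auto
      obtain d P w where d: "is_face c d P" "w \<in> open_cube (cdim d)" "papp (cdim c) P w = x"
        using carrier_face[OF c x(1)] by metis
      then have "\<kappa> d w = \<kappa> c' (centre c')" using x open_cube_sub unfolding is_face_def by fastforce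
      then have w: "w = centre d" using kappa_inj[of d c' w "centre c'"] d x assms centre_open_cube
        unfolding is_face_def by blast
      have pat: "is_pat (cdim d) (cdim c) P" using d by (simp add: is_face_def)
      have "x i \<in> {0, 1, 1/2}" if "i < cdim c" for i
        using papp_coordinate[OF pat that, of w] d(3) w by (auto simp: centre_def)
      moreover have "x i = 0" if "\<not> i < cdim c" for i using that papp_outside[of "cdim c" i P w] d(3) by simp
      ultimately show "x \<in> ?F" by simp
    qed
    moreover have "finite ?F" by (rule finite_set_of_finite_funs) auto
    ultimately have "finite {x \<in> cube (cdim c). \<kappa> c x \<in> ?D}" by (rule finite_subset)
    then show ?thesis by (intro closed_subset finite_imp_closed) auto
  qed
  then have "closedin ?X {z \<in> topspace ?X. (\<lambda>(c, x). \<kappa> c x) z \<in> ?D}"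
    by (auto simp: closedin_sum_topology)
  then show ?thesis using quotient DQ unfolding quotient_map_closedin by auto
qed

text \<open>The complements of all centres but one form an open cover in which each centre lies in a
  single member, so a finite subcover must involve every cube.\<close>

lemma finite_cubes: assumes "compact Q" shows "finite C"
proof -
  define pt where "pt c = \<kappa> c (centre c)" for c
  have inj: "inj_on pt C"
    using kappa_inj[OF _ _ centre_open_cube centre_open_cube] by (auto simp: inj_on_def pt_def)
  have ptQ: "pt c \<in> Q" if "c \<in> C" for c
    unfolding pt_def using kappa_continuous(2)[OF that] centre_open_cube open_cube_sub by blast
  define U where "U c = Q - pt ` (C - {c})" for c
  have "openin (top_of_set Q) (U c)" for c
    using openin_diff[OF openin_topspace closedin_centres[of "C - {c}"]] by (simp add: U_def pt_def)
  moreover have "Q \<subseteq> \<Union>(U ` C)"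
  proof
    fix y assume y: "y \<in> Q"
    then obtain c0 where c0: "c0 \<in> C" using kappa_surj by blast
    show "y \<in> \<Union>(U ` C)"
    proof (cases "y \<in> pt ` C")
      case True
      then obtain c where "c \<in> C" "y = pt c" by blast
      then show ?thesis using y inj by (auto simp: U_def inj_on_def intro!: bexI[of _ c])
    qed (use y c0 in \<open>auto simp: U_def\<close>)
  qed
  ultimately obtain D where D: "D \<subseteq> U ` C" "finite D" "Q \<subseteq> \<Union>D"
    using assms[unfolded compact_eq_openin_cover] by (metis imageE)
  then obtain F where F: "F \<subseteq> C" "finite F" "D = U ` F" by (meson finite_subset_image)
  have "C \<subseteq> F"
  proof
    fix c assume c: "c \<in> C"
    then obtain c' where "c' \<in> F" "pt c \<in> U c'" using ptQ D F by blast
    then show "c \<in> F" using c by (auto simp: U_def)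
  qed
  then show ?thesis using F finite_subset by blast
qed

end

context cube_complex
begin

section \<open>Edge paths\<close>

primrec chain :: "('c \<times> real) list \<Rightarrow> 'a \<Rightarrow> 'a \<Rightarrow> bool" where
  "chain [] x y \<longleftrightarrow> x = y"
| "chain (a # as) x y \<longleftrightarrow> a \<in> oriented_edges \<and> edge_start a = x \<and> chain as (edge_end a) y"

primrec epath :: "('c \<times> real) list \<Rightarrow> 'a \<Rightarrow> real \<Rightarrow> 'a" where
  "epath [] x = (\<lambda>_. x)"
| "epath (a # as) x = edge_point a +++ epath as (edge_end a)"

lemma chain_append: "chain (as @ bs) x z \<longleftrightarrow> (\<exists>y. chain as x y \<and> chain bs y z)"
  by (induction as arbitrary: x) auto

lemma path_from_edge: assumes "a \<in> oriented_edges" shows "path_from Q (edge_start a) (edge_end a) (edge_point a)"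
proof -
  let ?l = "\<lambda>t. (\<lambda>_::nat. 0::real)(0 := \<bar>snd a - t\<bar>)"
  note a = oriented_edgesD[OF assms]
  have "continuous_on {0..1} ?l"
  proof (rule continuous_on_coordinatewise_then_product)
    fix i show "continuous_on {0..1} (\<lambda>t. ?l t i)" by (cases "i = 0") (auto intro!: continuous_intros)
  qed
  moreover have "?l t \<in> cube (cdim (fst a))" if "t \<in> {0..1}" for t using a that by (auto simp: cube_def)
  ultimately have "path_from (cube (cdim (fst a))) (?l 0) (?l 1) ?l"
    by (auto simp: path_from_def path_def path_image_def pathstart_def pathfinish_def)
  from path_from_kappa[OF _ this] a
  have "path_from Q (edge_start a) (edge_end a) (\<kappa> (fst a) \<circ> ?l)" by (simp add: edge_start_def edge_end_def edge_point_def)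
  moreover have "\<kappa> (fst a) \<circ> ?l = edge_point a" by (simp add: fun_eq_iff edge_point_def)
  ultimately show ?thesis by simp
qed

lemma edge_ends_in_Q: "a \<in> oriented_edges \<Longrightarrow> edge_start a \<in> Q" "a \<in> oriented_edges \<Longrightarrow> edge_end a \<in> Q"
  using path_from_edge[of a] by (auto simp: path_from_def)

lemma path_from_epath: "chain as x y \<Longrightarrow> x \<in> Q \<Longrightarrow> path_from Q x y (epath as x)"
proof (induction as arbitrary: x)
  case Nil
  then show ?case using path_from_const by simp
next
  case (Cons a as)
  then show ?case using path_from_join[OF path_from_edge[of a], of y "epath as (edge_end a)"] edge_ends_in_Q[of a] by auto
qed

lemma epath_append:
  assumes "chain as x y" "chain bs y z" "x \<in> Q"
  shows "homotopic_paths Q (epath (as @ bs) x) (epath as x +++ epath bs y)"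
  using assms
proof (induction as arbitrary: x)
  case Nil
  then have "path_from Q y z (epath bs y)" using path_from_epath by simp
  then show ?case using homotopic_paths_sym[OF homotopic_paths_const_left[of "epath bs y" Q y]] Nil
    by (simp add: path_from_def)
next
  case (Cons a as)
  have a: "a \<in> oriented_edges" "edge_start a = x" "chain as (edge_end a) y" using Cons.prems by auto
  note pa = path_from_edge[OF a(1)] and q = edge_ends_in_Q[OF a(1)]
  have y: "y \<in> Q" using path_from_epath[OF a(3) q(2)] by (auto simp: path_from_def)
  have ab: "chain (as @ bs) (edge_end a) z" using a(3) Cons.prems by (auto simp: chain_append)
  have "homotopic_paths Q (edge_point a +++ epath (as @ bs) (edge_end a)) (edge_point a +++ (epath as (edge_end a) +++ epath bs y))"
    using homotopic_paths_join_from[OF homotopic_paths_reflI[OF pa] Cons.IH[OF a(3) Cons.prems(2) q(2)] pa path_from_epath[OF ab q(2)]] .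
  moreover have "homotopic_paths Q (edge_point a +++ (epath as (edge_end a) +++ epath bs y)) ((edge_point a +++ epath as (edge_end a)) +++ epath bs y)"
    using homotopic_paths_assoc_from[OF pa path_from_epath[OF a(3) q(2)] path_from_epath[OF Cons.prems(2) y]] .
  ultimately show ?case by (simp, meson homotopic_paths_trans)
qed

lemma epath_single: assumes "a \<in> oriented_edges" shows "homotopic_paths Q (epath [a] x) (edge_point a)"
  using homotopic_paths_const_right[of "edge_point a" Q "edge_end a"] path_from_edge[OF assms]
  by (simp add: path_from_def)

definition rchain :: "('c \<times> real) list \<Rightarrow> ('c \<times> real) list" where "rchain as = rev (map edge_reverse as)"

lemma chain_rchain: "chain as x y \<Longrightarrow> chain (rchain as) y x"
  by (induction as arbitrary: x) (auto simp: rchain_def chain_append)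

lemma edge_at_lerp:
  assumes "edge_at c v i a" "v \<in> cube_vertices (cdim c)" "i < cdim c"
  shows "homotopic_paths Q (edge_point a) (\<kappa> c \<circ> (\<lambda>t. lerp t v (v(i := 1 - v i))))"
proof (rule homotopic_paths_pointwise)
  show "path (edge_point a)" "path_image (edge_point a) \<subseteq> Q"
    using path_from_edge[OF edge_at_oriented[OF assms(1)]] by (auto simp: path_from_def)
  fix t :: real assume t: "t \<in> {0..1}"
  have "lerp t v (v(i := 1 - v i)) = v(i := \<bar>v i - t\<bar>)"
    using assms(2,3) t by (auto simp: lerp_def fun_eq_iff cube_vertices_def algebra_simps)
  then show "(\<kappa> c \<circ> (\<lambda>t. lerp t v (v(i := 1 - v i)))) t = edge_point a t"
    using assms(1) t by (simp add: edge_at_def)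
qed

lemma corner_path_flip:
  assumes c: "c \<in> C" and u: "u \<in> cube_vertices (cdim c)" and D: "finite D" "D \<subseteq> {..<cdim c}"
  shows "\<exists>as m. chain as (\<kappa> c u) (\<kappa> c (\<lambda>j. if j \<in> D then 1 - u j else u j)) \<and>
    path_from (cube (cdim c)) u (\<lambda>j. if j \<in> D then 1 - u j else u j) m \<and>
    homotopic_paths Q (epath as (\<kappa> c u)) (\<kappa> c \<circ> m)"
  using D
proof (induction D rule: finite_induct)
  case empty
  have u': "u \<in> cube (cdim c)" using u vertices_sub by blast
  then have "\<kappa> c u \<in> Q" using kappa_continuous(2)[OF c] by blast
  then show ?case using path_from_const[OF u'] homotopic_paths_reflI[OF path_from_const]
    by (intro exI[of _ "[]"] exI[of _ "\<lambda>_. u"]) (auto simp: o_def)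
next
  case (insert k D)
  let ?w = "\<lambda>j. if j \<in> D then 1 - u j else u j"
  obtain as m where m: "chain as (\<kappa> c u) (\<kappa> c ?w)" "path_from (cube (cdim c)) u ?w m"
    "homotopic_paths Q (epath as (\<kappa> c u)) (\<kappa> c \<circ> m)" using insert by blast
  have w: "?w \<in> cube_vertices (cdim c)" using u insert by (auto simp: cube_vertices_def)
  have k: "k < cdim c" using insert by auto
  let ?w' = "?w(k := 1 - ?w k)"
  have w': "(\<lambda>j. if j \<in> insert k D then 1 - u j else u j) = ?w'" using insert by (auto simp: fun_eq_iff)
  have wv: "?w' \<in> cube_vertices (cdim c)" by (rule vertices_flip[OF w k])
  obtain a where a: "edge_at c ?w k a" using edge_at_exists[of c ?w k] c w k by (auto simp: corners_def)
  note o = edge_at_oriented[OF a] and e = edge_at_endpoints[OF a w k]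
  have ca: "chain [a] (\<kappa> c ?w) (\<kappa> c ?w')" using o e by simp
  have uQ: "\<kappa> c u \<in> Q" using kappa_continuous(2)[OF c] u vertices_sub by blast
  let ?l = "\<lambda>t. lerp t ?w ?w'"
  have l: "path_from (cube (cdim c)) ?w ?w' ?l" using lerp_path w wv vertices_sub by blast
  have 1: "homotopic_paths Q (epath (as @ [a]) (\<kappa> c u)) (epath as (\<kappa> c u) +++ epath [a] (\<kappa> c ?w))"
    using epath_append[OF m(1) ca uQ] .
  have wQ: "\<kappa> c ?w \<in> Q" using kappa_continuous(2)[OF c] w vertices_sub by blast
  have "homotopic_paths Q (epath [a] (\<kappa> c ?w)) (\<kappa> c \<circ> ?l)"
    using homotopic_paths_trans[OF epath_single[OF o] edge_at_lerp[OF a w k]] .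
  then have 2: "homotopic_paths Q (epath as (\<kappa> c u) +++ epath [a] (\<kappa> c ?w)) ((\<kappa> c \<circ> m) +++ (\<kappa> c \<circ> ?l))"
    by (intro homotopic_paths_join_from[OF m(3) _ path_from_epath[OF m(1) uQ] path_from_epath[OF ca wQ]])
  have "homotopic_paths Q (epath (as @ [a]) (\<kappa> c u)) (\<kappa> c \<circ> (m +++ ?l))"
    using homotopic_paths_trans[OF 1 2] by (simp only: path_compose_join)
  moreover have "path_from (cube (cdim c)) u ?w' (m +++ ?l)" using path_from_join[OF m(2) l] .
  moreover have "chain (as @ [a]) (\<kappa> c u) (\<kappa> c ?w')" using m(1) ca chain_append by blast
  ultimately show ?case unfolding w' by blast
qed

lemma corner_path:
  assumes c: "c \<in> C" and u: "u \<in> cube_vertices (cdim c)" "u' \<in> cube_vertices (cdim c)"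
  shows "\<exists>as m. chain as (\<kappa> c u) (\<kappa> c u') \<and> path_from (cube (cdim c)) u u' m \<and>
    homotopic_paths Q (epath as (\<kappa> c u)) (\<kappa> c \<circ> m)"
proof -
  let ?D = "{j. j < cdim c \<and> u j \<noteq> u' j}"
  have "u' = (\<lambda>j. if j \<in> ?D then 1 - u j else u j)"
  proof
    fix j show "u' j = (if j \<in> ?D then 1 - u j else u j)"
      using u by (cases "j < cdim c"; cases "u j = u' j") (fastforce simp: cube_vertices_def)+
  qed
  then show ?thesis using corner_path_flip[OF c u(1), of ?D] by auto
qed

section \<open>Deforming paths to edge paths\<close>

section \<open>Every path is homotopic to an edge path\<close>

definition carrier_of :: "'a \<Rightarrow> 'c \<times> (nat \<Rightarrow> real)"
  where "carrier_of y = (SOME dw. fst dw \<in> C \<and> snd dw \<in> open_cube (cdim (fst dw)) \<and> y = \<kappa> (fst dw) (snd dw))"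

text \<open>The corner is taken in the cube whose interior contains the point, so it depends on the
  point only and adjacent pieces of a path agree on it.\<close>

definition near_vertex :: "'a \<Rightarrow> 'a" where "near_vertex y = \<kappa> (fst (carrier_of y)) (\<lambda>_. 0)"

definition vertex_path :: "'a \<Rightarrow> real \<Rightarrow> 'a"
  where "vertex_path y = \<kappa> (fst (carrier_of y)) \<circ> (\<lambda>t. lerp t (snd (carrier_of y)) (\<lambda>_. 0))"

lemma carrier_of_kappa: assumes "d \<in> C" "w \<in> open_cube (cdim d)" shows "carrier_of (\<kappa> d w) = (d, w)"
proof -
  have "\<exists>dw. fst dw \<in> C \<and> snd dw \<in> open_cube (cdim (fst dw)) \<and> \<kappa> d w = \<kappa> (fst dw) (snd dw)"
    using assms by (intro exI[of _ "(d, w)"]) simp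
  from someI_ex[OF this] have "fst (carrier_of (\<kappa> d w)) \<in> C"
    "snd (carrier_of (\<kappa> d w)) \<in> open_cube (cdim (fst (carrier_of (\<kappa> d w))))"
    "\<kappa> d w = \<kappa> (fst (carrier_of (\<kappa> d w))) (snd (carrier_of (\<kappa> d w)))"
    unfolding carrier_of_def[symmetric] by blast+
  then show ?thesis using kappa_inj[OF assms(1) _ assms(2)] by (metis prod.collapse)
qed

lemma zero_vertex: "(\<lambda>_. 0) \<in> cube_vertices n" by (simp add: cube_vertices_def)

lemma near_vertex_vertex: "y \<in> Q \<Longrightarrow> near_vertex y \<in> vertices"
  using kappa_surj[of y] carrier_of_kappa corner_vertex zero_vertex by (force simp: near_vertex_def)

text \<open>The cube carrying the point is a face of \<open>c\<close>, so its connecting segment is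
  also a straight segment in \<open>c\<close>. Thus everything at points of one closed cube can be
  compared inside that cube.\<close>

lemma vertex_path_in_cube:
  assumes c: "c \<in> C" and z: "z \<in> cube (cdim c)"
  obtains u n where "u \<in> cube_vertices (cdim c)" "near_vertex (\<kappa> c z) = \<kappa> c u"
    "path_from (cube (cdim c)) z u n" "homotopic_paths Q (vertex_path (\<kappa> c z)) (\<kappa> c \<circ> n)"
proof -
  obtain d P w where d: "is_face c d P" "w \<in> open_cube (cdim d)" "papp (cdim c) P w = z"
    using carrier_face[OF c z] by metis
  have dC: "d \<in> C" and pat: "is_pat (cdim d) (cdim c) P" and kd: "\<And>y. y \<in> cube (cdim d) \<Longrightarrow> \<kappa> c (papp (cdim c) P y) = \<kappa> d y"
    using d by (auto simp: is_face_def)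
  have wc: "w \<in> cube (cdim d)" using d open_cube_sub by blast
  have "\<kappa> c z = \<kappa> d w" using kd[OF wc] d by simp
  then have car: "carrier_of (\<kappa> c z) = (d, w)" using carrier_of_kappa[OF dC d(2)] by simp
  let ?u = "papp (cdim c) P (\<lambda>_. 0)"
  let ?n = "\<lambda>t. lerp t z ?u"
  have u: "?u \<in> cube_vertices (cdim c)" using papp_vertices[OF pat zero_vertex] .
  have 0: "(\<lambda>_. 0) \<in> cube (cdim d)" using zero_vertex vertices_sub by blast
  have n: "path_from (cube (cdim c)) z ?u ?n" using lerp_path[OF z] u vertices_sub by blast
  have e: "vertex_path (\<kappa> c z) t = (\<kappa> c \<circ> ?n) t" if "t \<in> {0..1}" for t
    using kd[OF lerp_cube[OF _ _ wc 0], of t] that papp_lerp[OF pat, of t w "\<lambda>_. 0"] d(3)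
    by (simp add: vertex_path_def car)
  have h: "homotopic_paths Q (\<kappa> c \<circ> ?n) (vertex_path (\<kappa> c z))"
    by (rule homotopic_paths_pointwise) (use path_from_kappa[OF c n] e in \<open>auto simp: path_from_def\<close>)
  then show ?thesis using that[OF u _ n] kd[OF 0] homotopic_paths_sym[OF h] by (simp add: near_vertex_def car)
qed

lemma path_from_vertex_path: "y \<in> Q \<Longrightarrow> path_from Q y (near_vertex y) (vertex_path y)"
proof -
  assume "y \<in> Q"
  then obtain c z where z: "c \<in> C" "z \<in> cube (cdim c)" "y = \<kappa> c z" using kappa_surj open_cube_sub by blast
  obtain u n where un: "u \<in> cube_vertices (cdim c)" "near_vertex y = \<kappa> c u"
    "path_from (cube (cdim c)) z u n" "homotopic_paths Q (vertex_path y) (\<kappa> c \<circ> n)"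
    using vertex_path_in_cube[OF z(1,2)] z(3) by metis
  show ?thesis using path_from_homotopic[OF homotopic_paths_sym[OF un(4)] path_from_kappa[OF z(1) un(3)]] un z by simp
qed

text \<open>Endpoints are arbitrary because the pieces of a subdivided path need not start at
  vertices; the connecting paths cancel when pieces are joined.\<close>

definition edgy :: "'a \<Rightarrow> 'a \<Rightarrow> (real \<Rightarrow> 'a) \<Rightarrow> bool"
  where "edgy x y g \<longleftrightarrow> x \<in> Q \<and> y \<in> Q \<and> (\<exists>as. chain as (near_vertex x) (near_vertex y) \<and>
    homotopic_paths Q g (vertex_path x +++ (epath as (near_vertex x) +++ reversepath (vertex_path y))))"

lemma vertex_in_Q: "x \<in> vertices \<Longrightarrow> x \<in> Q"
proof -
  assume "x \<in> vertices"
  then obtain c where c: "c \<in> C" "x = \<kappa> c (\<lambda>_. 0)" by (auto simp: vertices_def)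
  have "(\<lambda>_. 0) \<in> cube (cdim c)" using zero_vertex vertices_sub by blast
  then show ?thesis using kappa_continuous(2)[OF c(1)] c(2) by blast
qed

lemma edgy_homotopic: "homotopic_paths Q g g' \<Longrightarrow> edgy x y g' \<Longrightarrow> edgy x y g"
  unfolding edgy_def using homotopic_paths_trans by blast

lemma edgy_join: assumes "edgy x y g" "edgy y z h" shows "edgy x z (g +++ h)"
proof -
  have Q: "x \<in> Q" "y \<in> Q" "z \<in> Q" using assms by (auto simp: edgy_def)
  note v = path_from_vertex_path[OF Q(1)] path_from_vertex_path[OF Q(2)] path_from_vertex_path[OF Q(3)]
  have nQ: "near_vertex x \<in> Q" "near_vertex y \<in> Q" using v by (auto simp: path_from_def)
  obtain as where as: "chain as (near_vertex x) (near_vertex y)"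
    "homotopic_paths Q g (vertex_path x +++ (epath as (near_vertex x) +++ reversepath (vertex_path y)))"
    using assms(1) by (auto simp: edgy_def)
  obtain bs where bs: "chain bs (near_vertex y) (near_vertex z)"
    "homotopic_paths Q h (vertex_path y +++ (epath bs (near_vertex y) +++ reversepath (vertex_path z)))"
    using assms(2) by (auto simp: edgy_def)
  note pa = path_from_epath[OF as(1) nQ(1)] and pb = path_from_epath[OF bs(1) nQ(2)]
  have ab: "chain (as @ bs) (near_vertex x) (near_vertex z)" using as bs chain_append by blast
  have g: "path_from Q x y g"
    by (rule path_from_homotopic[OF homotopic_paths_sym[OF as(2)]])
      (intro path_from_join[OF v(1)] path_from_join[OF pa] path_from_reverse[OF v(2)])
  have h: "path_from Q y z h"
    by (rule path_from_homotopic[OF homotopic_paths_sym[OF bs(2)]])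
      (intro path_from_join[OF v(2)] path_from_join[OF pb] path_from_reverse[OF v(3)])
  have "homotopic_paths Q (g +++ h) (vertex_path x +++ ((epath as (near_vertex x) +++ epath bs (near_vertex y)) +++ reversepath (vertex_path z)))"
    using homotopic_paths_trans[OF homotopic_paths_join_from[OF as(2) bs(2) g h] homotopic_paths_splice[OF v(1) pa v(2) pb v(3)]] .
  moreover have "homotopic_paths Q (vertex_path x +++ ((epath as (near_vertex x) +++ epath bs (near_vertex y)) +++ reversepath (vertex_path z)))
     (vertex_path x +++ (epath (as @ bs) (near_vertex x) +++ reversepath (vertex_path z)))"
    by (rule homotopic_paths_join_from[OF homotopic_paths_reflI[OF v(1)] homotopic_paths_join_from[OF
          homotopic_paths_sym[OF epath_append[OF as(1) bs(1) nQ(1)]] homotopic_paths_reflI[OF path_from_reverse[OF v(3)]]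
          path_from_join[OF pa pb] path_from_reverse[OF v(3)]] v(1) path_from_join[OF path_from_join[OF pa pb] path_from_reverse[OF v(3)]]])
  ultimately show ?thesis using ab Q unfolding edgy_def by (meson homotopic_paths_trans)
qed

text \<open>The path, the connecting segments and an edge path between the two corners lie in one
  cube, where paths with common endpoints are homotopic.\<close>

lemma edgy_cube:
  assumes c: "c \<in> C" and l: "path_from (cube (cdim c)) z z' l"
  shows "edgy (\<kappa> c z) (\<kappa> c z') (\<kappa> c \<circ> l)"
proof -
  have zc: "z \<in> cube (cdim c)" "z' \<in> cube (cdim c)" using l by (auto simp: path_from_def)
  then have Q: "\<kappa> c z \<in> Q" "\<kappa> c z' \<in> Q" using kappa_continuous(2)[OF c] by blast+
  obtain u n where u: "u \<in> cube_vertices (cdim c)" "near_vertex (\<kappa> c z) = \<kappa> c u"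
    "path_from (cube (cdim c)) z u n" "homotopic_paths Q (vertex_path (\<kappa> c z)) (\<kappa> c \<circ> n)"
    using vertex_path_in_cube[OF c zc(1)] by metis
  obtain u' n' where u': "u' \<in> cube_vertices (cdim c)" "near_vertex (\<kappa> c z') = \<kappa> c u'"
    "path_from (cube (cdim c)) z' u' n'" "homotopic_paths Q (vertex_path (\<kappa> c z')) (\<kappa> c \<circ> n')"
    using vertex_path_in_cube[OF c zc(2)] by metis
  obtain as m where m: "chain as (\<kappa> c u) (\<kappa> c u')" "path_from (cube (cdim c)) u u' m"
    "homotopic_paths Q (epath as (\<kappa> c u)) (\<kappa> c \<circ> m)" using corner_path[OF c u(1) u'(1)] by blast
  have uQ: "\<kappa> c u \<in> Q" using kappa_continuous(2)[OF c] u(1) vertices_sub by blast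
  note rn = path_from_reverse[OF u'(3)]
  have 1: "homotopic_paths Q (\<kappa> c \<circ> l) (\<kappa> c \<circ> (n +++ (m +++ reversepath n')))"
    by (rule homotopic_kappa[OF c l path_from_join[OF u(3) path_from_join[OF m(2) rn]]])
  have rv: "homotopic_paths Q (reversepath (\<kappa> c \<circ> n')) (reversepath (vertex_path (\<kappa> c z')))"
    using homotopic_paths_reversepath homotopic_paths_sym[OF u'(4)] by blast
  note kn = path_from_kappa[OF c u(3)] and km = path_from_kappa[OF c m(2)]
    and kn' = path_from_reverse[OF path_from_kappa[OF c u'(3)]]
  have 2: "homotopic_paths Q ((\<kappa> c \<circ> n) +++ ((\<kappa> c \<circ> m) +++ reversepath (\<kappa> c \<circ> n')))
    (vertex_path (\<kappa> c z) +++ (epath as (\<kappa> c u) +++ reversepath (vertex_path (\<kappa> c z'))))"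
    by (rule homotopic_paths_join_from[OF homotopic_paths_sym[OF u(4)] homotopic_paths_join_from[OF homotopic_paths_sym[OF m(3)] rv km kn'] kn path_from_join[OF km kn']])
  have "homotopic_paths Q (\<kappa> c \<circ> l) (vertex_path (\<kappa> c z) +++ (epath as (\<kappa> c u) +++ reversepath (vertex_path (\<kappa> c z'))))"
    using homotopic_paths_trans[OF 1[unfolded path_compose_join path_compose_reversepath] 2] .
  then show ?thesis unfolding edgy_def using Q m(1) u(2) u'(2) by auto
qed

end

text \<open>The summands are open, so continuity can be tested on the product of each of them with
  \<open>Z\<close>.\<close>

lemma continuous_map_prod_sum_topology:
  assumes "\<And>i. i \<in> I \<Longrightarrow> continuous_map (prod_topology (X i) Z) Y (\<lambda>(x, z). f ((i, x), z))"
  shows "continuous_map (prod_topology (sum_topology X I) Z) Y f"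
  unfolding continuous_map_def
proof (intro conjI allI impI)
  show "f \<in> topspace (prod_topology (sum_topology X I) Z) \<rightarrow> topspace Y"
    using continuous_map_funspace[OF assms] by (fastforce simp: Pi_iff)
  fix U assume U: "openin Y U"
  let ?S = "{x \<in> topspace (prod_topology (sum_topology X I) Z). f x \<in> U}"
  show "openin (prod_topology (sum_topology X I) Z) ?S"
    unfolding openin_prod_topology_alt
  proof (intro allI impI)
    fix ix z assume "(ix, z) \<in> ?S"
    then obtain i x where x: "ix = (i, x)" "i \<in> I" "x \<in> topspace (X i)" "z \<in> topspace Z" "f ((i, x), z) \<in> U"
      by (cases ix) auto
    have "openin (prod_topology (X i) Z) {y \<in> topspace (prod_topology (X i) Z). (\<lambda>(x, z). f ((i, x), z)) y \<in> U}"
      using openin_continuous_map_preimage[OF assms[OF x(2)] U] .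
    moreover have "(x, z) \<in> {y \<in> topspace (prod_topology (X i) Z). (\<lambda>(x, z). f ((i, x), z)) y \<in> U}" using x by simp
    ultimately obtain A B where AB: "openin (X i) A" "openin Z B" "x \<in> A" "z \<in> B"
      "A \<times> B \<subseteq> {y \<in> topspace (prod_topology (X i) Z). (\<lambda>(x, z). f ((i, x), z)) y \<in> U}"
      unfolding openin_prod_topology_alt by meson
    have "openin (sum_topology X I) (Pair i ` A)"
      using open_map_component_injection[OF x(2), of X] AB(1) by (simp add: open_map_def)
    moreover have "Pair i ` A \<times> B \<subseteq> ?S" using AB(5) x(2) by auto
    ultimately show "\<exists>U V. openin (sum_topology X I) U \<and> openin Z V \<and> ix \<in> U \<and> z \<in> V \<and> U \<times> V \<subseteq> ?S"
      using AB x(1) by (intro exI[of _ "Pair i ` A"] exI[of _ B]) auto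
  qed
qed

section \<open>Contractible neighbourhoods\<close>

text \<open>
  The neighbourhood of a point \<open>x\<close> consists of the points that have coordinates close to those of
  a point representing \<open>x\<close> in some cube. It contracts to \<open>x\<close> along straight lines in cubes.
\<close>

locale cube_point = cube_complex Q C cdim \<kappa>
  for Q :: "'a::topological_space set" and C :: "'c set" and cdim \<kappa> +
  fixes x :: 'a and d0 :: 'c and w0 :: "nat \<Rightarrow> real" and \<epsilon> :: real
  assumes d0: "d0 \<in> C" and w0: "w0 \<in> open_cube (cdim d0)" and x: "x = \<kappa> d0 w0"
    and eps: "0 < \<epsilon>" "\<epsilon> \<le> 1/4" and eps': "k < cdim d0 \<Longrightarrow> 2 * \<epsilon> \<le> w0 k \<and> w0 k \<le> 1 - 2 * \<epsilon>"
begin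

definition nearby :: "'c \<Rightarrow> (nat \<Rightarrow> real) \<Rightarrow> (nat \<Rightarrow> real) \<Rightarrow> bool"
  where "nearby c z p \<longleftrightarrow> p \<in> cube (cdim c) \<and> \<kappa> c p = x \<and> (\<forall>j<cdim c. \<bar>z j - p j\<bar> < \<epsilon>)"

text \<open>By the normal form, each coordinate of a representative is 0, 1, or some
  \<open>w0 k\<close>, possibly reflected. The margin in \<open>eps'\<close> keeps the latter at
  least twice the radius away from 0 and 1, and the uniqueness arguments rest on this gap.\<close>

lemma representative_coordinates:
  assumes c: "c \<in> C" and p: "p \<in> cube (cdim c)" "\<kappa> c p = x" and j: "j < cdim c"
  shows "p j = 0 \<or> p j = 1 \<or> (2 * \<epsilon> \<le> p j \<and> p j \<le> 1 - 2 * \<epsilon>)"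
proof -
  obtain d P w where d: "is_face c d P" "w \<in> open_cube (cdim d)" "papp (cdim c) P w = p"
    using carrier_face[OF c p(1)] by metis
  then have "\<kappa> d w = \<kappa> d0 w0" using p(2) x open_cube_sub unfolding is_face_def by fastforce
  then have "d = d0" "w = w0" using kappa_inj[OF _ d0 d(2) w0] d(1) by (auto simp: is_face_def)
  moreover have "is_pat (cdim d) (cdim c) P" using d by (simp add: is_face_def)
  ultimately show ?thesis using papp_coordinate[of "cdim d0" "cdim c" P j w0] j d(3) eps' by fastforce
qed

lemma nearby_boundary:
  assumes c: "c \<in> C" and n: "nearby c z p" and j: "j < cdim c" and z: "z j = 0 \<or> z j = 1"
  shows "p j = z j"
proof -
  have "\<bar>z j - p j\<bar> < \<epsilon>" "p j = 0 \<or> p j = 1 \<or> (2 * \<epsilon> \<le> p j \<and> p j \<le> 1 - 2 * \<epsilon>)"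
    using representative_coordinates[OF c _ _ j, of p] n j by (auto simp: nearby_def)
  then show ?thesis using z eps by auto
qed

text \<open>Two representatives close to one point differ by less than \<open>2 * \<epsilon>\<close>
  in every coordinate. So they share their boundary coordinates and lie in the interior of one face,
  where \<open>\<kappa>\<close> is injective.\<close>

lemma nearby_unique:
  assumes c: "c \<in> C" and n: "nearby c z p" "nearby c z p'" shows "p = p'"
proof -
  have pc: "p \<in> cube (cdim c)" "\<kappa> c p = x" "p' \<in> cube (cdim c)" "\<kappa> c p' = x" using n by (auto simp: nearby_def)
  have same: "p' j = p j" if "j < cdim c" "p j = 0 \<or> p j = 1" for j
  proof -
    have "\<bar>z j - p j\<bar> < \<epsilon>" "\<bar>z j - p' j\<bar> < \<epsilon>" using n that by (auto simp: nearby_def)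
    then have "\<bar>p j - p' j\<bar> < 2 * \<epsilon>" by linarith
    then show ?thesis using representative_coordinates[OF c pc(3,4) that(1)] that(2) eps by auto
  qed
  have same': "p j = 0 \<or> p j = 1" if j: "j < cdim c" "p' j = 0 \<or> p' j = 1" for j
  proof -
    have "\<bar>z j - p j\<bar> < \<epsilon>" "\<bar>z j - p' j\<bar> < \<epsilon>" using n that by (auto simp: nearby_def)
    then have "\<bar>p j - p' j\<bar> < 2 * \<epsilon>" by linarith
    then show ?thesis using representative_coordinates[OF c pc(1,2) j(1)] j(2) eps by auto
  qed
  obtain d P w where d: "is_face c d P" "w \<in> open_cube (cdim d)" "papp (cdim c) P w = p"
    "\<And>j. j < cdim c \<Longrightarrow> (\<exists>kf. P j = Inl kf) \<longleftrightarrow> p j \<notin> {0, 1}"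
    using carrier_face[OF c pc(1)] by metis
  have dC: "d \<in> C" and pat: "is_pat (cdim d) (cdim c) P" and kd: "\<And>y. y \<in> cube (cdim d) \<Longrightarrow> \<kappa> c (papp (cdim c) P y) = \<kappa> d y"
    using d by (auto simp: is_face_def)
  have inr: "p' j = \<delta>" if "j < cdim c" "P j = Inr \<delta>" for j \<delta>
  proof -
    have "p j = \<delta>" using d(3) that by (auto simp: papp_def)
    moreover have "p j = 0 \<or> p j = 1" using d(4)[OF that(1)] that(2) by auto
    ultimately show ?thesis using same[OF that(1)] by simp
  qed
  obtain w' where w': "papp (cdim c) P w' = p'" "\<And>k. k \<ge> cdim d \<Longrightarrow> w' k = 0"
    "\<And>j k f. j < cdim c \<Longrightarrow> P j = Inl (k, f) \<Longrightarrow> w' k = (if f then 1 - p' j else p' j)"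
    by (rule papp_surj[OF pat, of p']) (use pc(3) inr in \<open>auto simp: cube_def\<close>)
  have "w' \<in> open_cube (cdim d)"
  proof -
    have "0 < w' k \<and> w' k < 1" if kd: "k < cdim d" for k
    proof -
      obtain j f where j: "j < cdim c" "P j = Inl (k, f)" using is_patD(3)[OF pat kd] by blast
      then have "p j \<notin> {0, 1}" using d(4) by blast
      then have "\<not> (p' j = 0 \<or> p' j = 1)" using same' j by auto
      moreover have "0 \<le> p' j" "p' j \<le> 1" using pc(3) j by (auto simp: cube_def)
      ultimately show ?thesis using w'(3)[OF j] by auto
    qed
    then show ?thesis using w'(2) by (simp add: open_cube_def)
  qed
  moreover have "\<kappa> d w' = \<kappa> d w"
    using kd[of w] kd[of w'] d(2,3) w'(1) pc \<open>w' \<in> _\<close> open_cube_sub by fastforce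
  ultimately have "w' = w" using kappa_inj dC d(2) by blast
  then show ?thesis using d(3) w'(1) by simp
qed

text \<open>The change of cube goes down to the common carrying face and up again. The way down is
  possible since \<open>p'\<close> agrees with \<open>z'\<close> in the boundary coordinates of
  \<open>z'\<close>, by \<open>nearby_boundary\<close>, so the whole segment lies in that
  face.\<close>

lemma nearby_transfer:
  assumes c: "c \<in> C" "c' \<in> C" and z: "z \<in> cube (cdim c)" "z' \<in> cube (cdim c')" and e: "\<kappa> c z = \<kappa> c' z'"
    and n: "nearby c' z' p'"
  shows "\<exists>p. nearby c z p \<and> (\<forall>t\<in>{0..1}. \<kappa> c (lerp t z p) = \<kappa> c' (lerp t z' p'))"
proof -
  have pc': "p' \<in> cube (cdim c')" "\<kappa> c' p' = x" using n by (auto simp: nearby_def)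
  obtain d P w where d: "is_face c d P" "w \<in> open_cube (cdim d)" "papp (cdim c) P w = z"
    using carrier_face[OF c(1) z(1)] by metis
  obtain d' P' w' where d': "is_face c' d' P'" "w' \<in> open_cube (cdim d')" "papp (cdim c') P' w' = z'"
    "\<And>j. j < cdim c' \<Longrightarrow> (\<exists>kf. P' j = Inl kf) \<longleftrightarrow> z' j \<notin> {0, 1}"
    using carrier_face[OF c(2) z(2)] by metis
  have wc: "w \<in> cube (cdim d)" "w' \<in> cube (cdim d')" using d d' open_cube_sub by blast+
  have "\<kappa> d w = \<kappa> d' w'" using d d' wc e unfolding is_face_def by fastforce
  then have dd: "d' = d" "w' = w" using kappa_inj[OF _ _ d(2) d'(2)] d d' by (auto simp: is_face_def)
  have pat: "is_pat (cdim d) (cdim c) P" and pat': "is_pat (cdim d) (cdim c') P'"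
    and kd: "\<And>y. y \<in> cube (cdim d) \<Longrightarrow> \<kappa> c (papp (cdim c) P y) = \<kappa> d y"
    and kd': "\<And>y. y \<in> cube (cdim d) \<Longrightarrow> \<kappa> c' (papp (cdim c') P' y) = \<kappa> d y"
    using d d' dd by (auto simp: is_face_def)
  have inr: "p' j = \<delta>" if "j < cdim c'" "P' j = Inr \<delta>" for j \<delta>
  proof -
    have "z' j = \<delta>" using d'(3) that by (auto simp: papp_def)
    moreover have "z' j = 0 \<or> z' j = 1" using d'(4)[OF that(1)] that(2) by auto
    ultimately show ?thesis using nearby_boundary[OF c(2) n that(1)] by simp
  qed
  obtain u where u: "papp (cdim c') P' u = p'" "\<And>k. k \<ge> cdim d \<Longrightarrow> u k = 0"
    "\<And>j k f. j < cdim c' \<Longrightarrow> P' j = Inl (k, f) \<Longrightarrow> u k = (if f then 1 - p' j else p' j)"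
    by (rule papp_surj[OF pat', of p']) (use pc' inr in \<open>auto simp: cube_def\<close>)
  have uw: "0 \<le> u k \<and> u k \<le> 1 \<and> \<bar>w k - u k\<bar> < \<epsilon>" if k: "k < cdim d" for k
  proof -
    obtain j f where j: "j < cdim c'" "P' j = Inl (k, f)" using is_patD(3)[OF pat' k] by blast
    have "z' j = (if f then 1 - w k else w k)" using d'(3) dd j by (auto simp: papp_def)
    moreover have "0 \<le> p' j" "p' j \<le> 1" "\<bar>z' j - p' j\<bar> < \<epsilon>" using pc' n j by (auto simp: cube_def nearby_def)
    ultimately show ?thesis using u(3)[OF j] by (auto split: if_splits)
  qed
  have uc: "u \<in> cube (cdim d)" using uw u(2) by (simp add: cube_def)
  let ?p = "papp (cdim c) P u"
  have "\<bar>z j - ?p j\<bar> < \<epsilon>" if j: "j < cdim c" for j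
  proof (cases "P j")
    case (Inl kf)
    then show ?thesis using uw[OF is_patD(1)[OF pat j Inl]] d(3) j by (auto simp: papp_def)
  next
    case (Inr \<delta>)
    then show ?thesis using d(3) j eps by (auto simp: papp_def)
  qed
  then have "nearby c z ?p"
    unfolding nearby_def using papp_cube[OF pat uc] kd[OF uc] kd'[OF uc] u(1) pc' by metis
  moreover have "\<kappa> c (lerp t z ?p) = \<kappa> c' (lerp t z' p')" if t: "t \<in> {0..1}" for t
  proof -
    have l: "lerp t w u \<in> cube (cdim d)" using lerp_cube[OF _ _ wc(1) uc] t by simp
    have "lerp t z ?p = papp (cdim c) P (lerp t w u)" using papp_lerp[OF pat] d(3) by simp
    moreover have "lerp t z' p' = papp (cdim c') P' (lerp t w u)" using papp_lerp[OF pat'] d'(3) u(1) dd by simp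
    ultimately show ?thesis using kd[OF l] kd'[OF l] by simp
  qed
  ultimately show ?thesis by blast
qed

definition nbhd_in :: "'c \<Rightarrow> (nat \<Rightarrow> real) set"
  where "nbhd_in c = {z \<in> cube (cdim c). \<exists>p. nearby c z p}"

definition nbhd :: "'a set" where "nbhd = (\<Union>c\<in>C. \<kappa> c ` nbhd_in c)"

definition foot :: "'c \<Rightarrow> (nat \<Rightarrow> real) \<Rightarrow> nat \<Rightarrow> real" where "foot c z = (THE p. nearby c z p)"

lemma foot_eq: "c \<in> C \<Longrightarrow> nearby c z p \<Longrightarrow> foot c z = p"
  unfolding foot_def using nearby_unique by blast

lemma foot: "c \<in> C \<Longrightarrow> z \<in> nbhd_in c \<Longrightarrow> nearby c z (foot c z)"
  using foot_eq unfolding nbhd_in_def by auto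

text \<open>Independence of the representative makes the preimage the union of the sets
  \<open>nbhd_in c\<close>, so openness in the quotient can be tested cube by cube.\<close>

lemma nbhd_saturated: "c \<in> C \<Longrightarrow> z \<in> cube (cdim c) \<Longrightarrow> \<kappa> c z \<in> nbhd \<longleftrightarrow> z \<in> nbhd_in c"
proof
  assume c: "c \<in> C" "z \<in> cube (cdim c)" and "\<kappa> c z \<in> nbhd"
  then obtain c' z' where z': "c' \<in> C" "z' \<in> nbhd_in c'" "\<kappa> c z = \<kappa> c' z'" by (auto simp: nbhd_def)
  then obtain p' where "z' \<in> cube (cdim c')" "nearby c' z' p'" by (auto simp: nbhd_in_def)
  then show "z \<in> nbhd_in c" using nearby_transfer[of c c' z z' p'] c z' by (auto simp: nbhd_in_def)
qed (auto simp: nbhd_def)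

lemma open_close_to: "open {z :: nat \<Rightarrow> real. \<forall>j<n. \<bar>z j - p j\<bar> < \<epsilon>}"
proof -
  have "{z :: nat \<Rightarrow> real. \<forall>j<n. \<bar>z j - p j\<bar> < \<epsilon>} = (\<Inter>j\<in>{..<n}. {z. \<bar>z j - p j\<bar> < \<epsilon>})" by auto
  moreover have "open {z :: nat \<Rightarrow> real. \<bar>z j - p j\<bar> < \<epsilon>}" for j
    by (intro open_Collect_less continuous_intros continuous_on_product_coordinates)
  ultimately show ?thesis by auto
qed

lemma openin_nbhd_in: "openin (top_of_set (cube (cdim c))) (nbhd_in c)"
proof -
  let ?U = "\<Union>p\<in>{p. p \<in> cube (cdim c) \<and> \<kappa> c p = x}. {z. \<forall>j<cdim c. \<bar>z j - p j\<bar> < \<epsilon>}"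
  have "nbhd_in c = cube (cdim c) \<inter> ?U" by (auto simp: nbhd_in_def nearby_def)
  moreover have "open ?U" using open_close_to by blast
  ultimately show ?thesis by (simp add: openin_open_Int)
qed

lemma nbhd_sub: "nbhd \<subseteq> Q"
  using kappa_continuous(2) by (fastforce simp: nbhd_def nbhd_in_def)

lemma preimage_nbhd:
  "{z \<in> topspace (sum_topology (\<lambda>c. top_of_set (cube (cdim c))) C). (\<lambda>(c, z). \<kappa> c z) z \<in> nbhd} = Sigma C nbhd_in"
  using nbhd_saturated by (auto simp: nbhd_in_def)

lemma openin_nbhd: "openin (top_of_set Q) nbhd"
proof -
  have "openin (sum_topology (\<lambda>c. top_of_set (cube (cdim c))) C) (Sigma C nbhd_in)"
    unfolding openin_disjoint_union using openin_nbhd_in by blast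
  then show ?thesis
    using quotient nbhd_sub unfolding quotient_map_def preimage_nbhd[symmetric] topspace_euclidean_subtopology
    by blast
qed

lemma x_in_nbhd: "x \<in> nbhd"
proof -
  have w: "w0 \<in> cube (cdim d0)" using w0 open_cube_sub by blast
  then have "nearby d0 w0 w0" unfolding nearby_def using x eps by simp
  then have "w0 \<in> nbhd_in d0" using w by (auto simp: nbhd_in_def)
  then show ?thesis unfolding nbhd_def using d0 x by blast
qed

definition contraction :: "'a \<times> real \<Rightarrow> 'a"
  where "contraction yt = (let cz = (SOME cz. fst cz \<in> C \<and> snd cz \<in> nbhd_in (fst cz) \<and> \<kappa> (fst cz) (snd cz) = fst yt)
     in \<kappa> (fst cz) (lerp (snd yt) (snd cz) (foot (fst cz) (snd cz))))"

text \<open>By \<open>nearby_transfer\<close>, the result does not depend on the representative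
  chosen in \<open>contraction\<close>.\<close>

lemma contraction_eq:
  assumes c: "c \<in> C" "z \<in> nbhd_in c" and t: "t \<in> {0..1}"
  shows "contraction (\<kappa> c z, t) = \<kappa> c (lerp t z (foot c z))"
proof -
  define cz where "cz = (SOME cz. fst cz \<in> C \<and> snd cz \<in> nbhd_in (fst cz) \<and> \<kappa> (fst cz) (snd cz) = \<kappa> c z)"
  have "\<exists>cz. fst cz \<in> C \<and> snd cz \<in> nbhd_in (fst cz) \<and> \<kappa> (fst cz) (snd cz) = \<kappa> c z"
    using c by (intro exI[of _ "(c, z)"]) simp
  from someI_ex[OF this] have s: "fst cz \<in> C" "snd cz \<in> nbhd_in (fst cz)" "\<kappa> (fst cz) (snd cz) = \<kappa> c z"
    by (auto simp: cz_def)
  have zc: "z \<in> cube (cdim c)" "snd cz \<in> cube (cdim (fst cz))" using c s by (auto simp: nbhd_in_def)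
  obtain p where "nearby c z p" "\<forall>t\<in>{0..1}. \<kappa> c (lerp t z p) = \<kappa> (fst cz) (lerp t (snd cz) (foot (fst cz) (snd cz)))"
    using nearby_transfer[OF c(1) s(1) zc s(3)[symmetric] foot[OF s(1,2)]] by blast
  then have "\<kappa> (fst cz) (lerp t (snd cz) (foot (fst cz) (snd cz))) = \<kappa> c (lerp t z (foot c z))"
    using foot_eq[OF c(1)] t by simp
  moreover have "contraction (\<kappa> c z, t) = \<kappa> (fst cz) (lerp t (snd cz) (foot (fst cz) (snd cz)))"
    by (simp add: contraction_def cz_def Let_def)
  ultimately show ?thesis by simp
qed

text \<open>The foot of \<open>z\<close> is, by uniqueness, also the foot of every point of the
  neighbourhood within the radius of it.\<close>

lemma foot_locally_constant: assumes c: "c \<in> C" shows "continuous_on (nbhd_in c) (foot c)"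
  unfolding continuous_on_topological
proof (intro ballI allI impI)
  fix z B assume z: "z \<in> nbhd_in c" "open B" "foot c z \<in> B"
  let ?A = "{z'. \<forall>j<cdim c. \<bar>z' j - foot c z j\<bar> < \<epsilon>}"
  have n: "nearby c z (foot c z)" using foot c z by blast
  then have "z \<in> ?A" by (simp add: nearby_def)
  moreover have "foot c z' \<in> B" if "z' \<in> ?A" for z'
    using foot_eq[OF c, of z' "foot c z"] n that z(3) by (simp add: nearby_def)
  ultimately show "\<exists>A. open A \<and> z \<in> A \<and> (\<forall>y\<in>nbhd_in c. y \<in> A \<longrightarrow> foot c y \<in> B)"
    using open_close_to by (intro exI[of _ ?A]) auto
qed

text \<open>Continuity is checked on the disjoint union of the cubes. This suffices because the
  product of the quotient map with the interval is again a quotient map, the interval being locally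
  compact and Hausdorff.\<close>

lemma contraction_continuous:
  "continuous_on (nbhd \<times> {0..1}) contraction" "contraction ` (nbhd \<times> {0..1}) \<subseteq> Q"
proof -
  let ?Z = "top_of_set {0..1::real}"
  let ?X = "\<lambda>c. subtopology (top_of_set (cube (cdim c))) (nbhd_in c)"
  have "quotient_map (subtopology (sum_topology (\<lambda>c. top_of_set (cube (cdim c))) C) (Sigma C nbhd_in))
      (subtopology (top_of_set Q) nbhd) (\<lambda>(c, z). \<kappa> c z)"
    using quotient_map_restriction[OF quotient preimage_nbhd] openin_nbhd by blast
  then have q: "quotient_map (sum_topology ?X C) (top_of_set nbhd) (\<lambda>(c, z). \<kappa> c z)"
    using nbhd_sub by (simp add: subtopology_sum_topology subtopology_subtopology Int_absorb1)
  have "compact_space ?Z" by (simp add: compact_space_subtopology)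
  then have "locally_compact_space ?Z" by (simp add: compact_imp_locally_compact_space)
  moreover have "Hausdorff_space ?Z" by (simp add: Hausdorff_space_subtopology)
  ultimately have qp: "quotient_map (prod_topology (sum_topology ?X C) ?Z) (prod_topology (top_of_set nbhd) ?Z)
      (\<lambda>(y, t). ((\<lambda>(c, z). \<kappa> c z) y, t))"
    using quotient_map_prod_left[OF _ _ q] by blast
  have "continuous_map (prod_topology (sum_topology ?X C) ?Z) (top_of_set Q)
     (contraction \<circ> (\<lambda>(y, t). ((\<lambda>(c, z). \<kappa> c z) y, t)))"
  proof (rule continuous_map_prod_sum_topology)
    fix c assume c: "c \<in> C"
    have sub: "nbhd_in c \<subseteq> cube (cdim c)" by (auto simp: nbhd_in_def)
    let ?f = "\<lambda>zt. lerp (snd zt) (fst zt) (foot c (fst zt))"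
    have 1: "continuous_on (nbhd_in c \<times> {0..1}) ?f"
    proof (rule continuous_on_coordinatewise_then_product)
      fix i
      have "continuous_on (nbhd_in c \<times> {0..1}) (\<lambda>zt. foot c (fst zt) i)"
        by (rule continuous_on_compose2[OF continuous_on_product_then_coordinatewise[OF foot_locally_constant[OF c]]])
          (auto intro: continuous_intros)
      moreover have "continuous_on (nbhd_in c \<times> {0..1}) (\<lambda>zt. fst zt i)"
        by (rule continuous_on_product_then_coordinatewise) (auto intro: continuous_intros)
      ultimately show "continuous_on (nbhd_in c \<times> {0..1}) (\<lambda>zt. ?f zt i)"
        unfolding lerp_def by (intro continuous_intros)
    qed
    have 2: "?f ` (nbhd_in c \<times> {0..1}) \<subseteq> cube (cdim c)"
      using foot[OF c] sub by (auto simp: nearby_def intro!: lerp_cube)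
    have "continuous_on (nbhd_in c \<times> {0..1}) (\<lambda>zt. \<kappa> c (?f zt))"
      by (rule continuous_on_compose2[OF kappa_continuous(1)[OF c] 1 2])
    moreover have e: "contraction (\<kappa> c (fst zt), snd zt) = \<kappa> c (?f zt)" if "zt \<in> nbhd_in c \<times> {0..1}" for zt
      using contraction_eq[OF c] that by auto
    ultimately have "continuous_on (nbhd_in c \<times> {0..1}) (\<lambda>zt. contraction (\<kappa> c (fst zt), snd zt))"
      by (simp cong: continuous_on_cong)
    moreover have "(\<lambda>zt. contraction (\<kappa> c (fst zt), snd zt)) ` (nbhd_in c \<times> {0..1}) \<subseteq> Q"
      using 2 e kappa_continuous(2)[OF c] by (smt (verit) image_subset_iff)
    ultimately have "continuous_map (top_of_set (nbhd_in c \<times> {0..1})) (top_of_set Q) (\<lambda>zt. contraction (\<kappa> c (fst zt), snd zt))"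
      by (auto simp: continuous_map_in_subtopology)
    then show "continuous_map (prod_topology (?X c) ?Z) (top_of_set Q)
        (\<lambda>(z, t). (contraction \<circ> (\<lambda>(y, t). ((\<lambda>(c, z). \<kappa> c z) y, t))) ((c, z), t))"
      using sub by (simp add: subtopology_subtopology Int_absorb1 prod_topology_subtopology_eu case_prod_unfold o_def)
  qed
  then have "continuous_map (prod_topology (top_of_set nbhd) ?Z) (top_of_set Q) contraction"
    using continuous_compose_quotient_map[OF qp] by blast
  then show "continuous_on (nbhd \<times> {0..1}) contraction" "contraction ` (nbhd \<times> {0..1}) \<subseteq> Q"
    by (auto simp: prod_topology_subtopology_eu continuous_map_in_subtopology)
qed

text \<open>The contraction moves \<open>g\<close> to the constant path at \<open>x\<close>. So
  \<open>g\<close> is homotopic to the track of its start followed by the reversed track of its end,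
  and each track stays in a single cube.\<close>

lemma path_in_nbhd_edgy:
  assumes g: "path g" "path_image g \<subseteq> nbhd" shows "edgy (pathstart g) (pathfinish g) g"
proof -
  let ?h = "\<lambda>st. contraction (g (fst st), snd st)"
  have gn: "g s \<in> nbhd" if "s \<in> {0..1}" for s using g(2) that by (auto simp: path_image_def)
  have "continuous_on ({0..1} \<times> {0..1}) (\<lambda>st. (g (fst st), snd st))"
    by (intro continuous_intros continuous_on_compose2[OF g(1)[unfolded path_def]]) auto
  then have "continuous_on ({0..1} \<times> {0..1}) ?h"
    by (rule continuous_on_compose2[OF contraction_continuous(1)]) (use gn in auto)
  moreover have "?h ` ({0..1} \<times> {0..1}) \<subseteq> Q" using contraction_continuous(2) gn by auto
  ultimately have sq: "homotopic_paths Q (\<lambda>s. ?h (s, 0))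
    ((\<lambda>t. ?h (0, t)) +++ (\<lambda>s. ?h (s, 1)) +++ reversepath (\<lambda>t. ?h (1, t)))"
    by (rule homotopic_paths_square)
  have line: "\<exists>c z. c \<in> C \<and> z \<in> nbhd_in c \<and> y = \<kappa> c z \<and> path_from (cube (cdim c)) z (foot c z) (\<lambda>t. lerp t z (foot c z)) \<and>
     \<kappa> c (foot c z) = x \<and> (\<forall>t\<in>{0..1}. contraction (y, t) = \<kappa> c (lerp t z (foot c z)))" if y: "y \<in> nbhd" for y
  proof -
    obtain c z where cz: "c \<in> C" "z \<in> nbhd_in c" "y = \<kappa> c z" using y by (auto simp: nbhd_def)
    then have "nearby c z (foot c z)" using foot by blast
    then have "foot c z \<in> cube (cdim c)" "\<kappa> c (foot c z) = x" by (auto simp: nearby_def)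
    then show ?thesis using cz contraction_eq lerp_path[of z "cdim c" "foot c z"] by (auto simp: nbhd_in_def)
  qed
  have line_edgy: "edgy y x (\<lambda>t. contraction (y, t)) \<and> edgy x y (reversepath (\<lambda>t. contraction (y, t))) \<and>
    path_from Q y x (\<lambda>t. contraction (y, t))" if y: "y \<in> nbhd" for y
  proof -
    obtain c z where cz: "c \<in> C" "z \<in> nbhd_in c" "y = \<kappa> c z" "path_from (cube (cdim c)) z (foot c z) (\<lambda>t. lerp t z (foot c z))"
     "\<kappa> c (foot c z) = x" "\<forall>t\<in>{0..1}. contraction (y, t) = \<kappa> c (lerp t z (foot c z))" using line[OF y] by blast
    let ?l = "\<lambda>t. lerp t z (foot c z)"
    note k = path_from_kappa[OF cz(1,4)]
    have e: "homotopic_paths Q (\<kappa> c \<circ> ?l) (\<lambda>t. contraction (y, t))"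
      by (rule homotopic_paths_pointwise) (use k cz(6) in \<open>auto simp: path_from_def\<close>)
    then have e': "homotopic_paths Q (reversepath (\<lambda>t. contraction (y, t))) (\<kappa> c \<circ> reversepath ?l)"
      using homotopic_paths_sym homotopic_paths_reversepath by (metis path_compose_reversepath)
    show ?thesis
      using edgy_homotopic[OF homotopic_paths_sym[OF e] edgy_cube[OF cz(1,4)]]
        edgy_homotopic[OF e' edgy_cube[OF cz(1) path_from_reverse[OF cz(4)]]]
        path_from_homotopic[OF e k] cz(3,5) by simp
  qed
  have top: "contraction (g s, 1) = x" if "s \<in> {0..1}" for s
    using line[OF gn[OF that]] by auto
  have bottom: "contraction (g s, 0) = g s" if "s \<in> {0..1}" for s
    using line[OF gn[OF that]] by auto
  have xQ: "x \<in> Q" using x_in_nbhd nbhd_sub by blast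
  have gQ: "path_image g \<subseteq> Q" using g nbhd_sub by blast
  let ?a = "\<lambda>t. contraction (g 0, t)" and ?b = "\<lambda>t. contraction (g 1, t)"
  have a: "path_from Q (g 0) x ?a" and b: "path_from Q (g 1) x ?b" using line_edgy gn by auto
  have "homotopic_paths Q g (\<lambda>s. ?h (s, 0))"
    by (rule homotopic_paths_pointwise[OF g(1) gQ]) (use bottom in simp)
  then have 1: "homotopic_paths Q g (?a +++ (\<lambda>s. ?h (s, 1)) +++ reversepath ?b)"
    using homotopic_paths_trans sq by fastforce
  have "homotopic_paths Q (\<lambda>s. x) (\<lambda>s. ?h (s, 1))"
    by (rule homotopic_paths_pointwise) (use path_from_const[OF xQ] top in \<open>auto simp: path_from_def\<close>)
  then have 2: "homotopic_paths Q ((\<lambda>s. ?h (s, 1)) +++ reversepath ?b) ((\<lambda>_. x) +++ reversepath ?b)"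
    using homotopic_paths_join_from[OF homotopic_paths_sym homotopic_paths_reflI[OF path_from_reverse[OF b]] _ path_from_reverse[OF b]]
      path_from_homotopic[OF _ path_from_const[OF xQ]] by blast
  have 3: "homotopic_paths Q ((\<lambda>_. x) +++ reversepath ?b) (reversepath ?b)"
    by (rule homotopic_paths_const_left) (use path_from_reverse[OF b] in \<open>auto simp: path_from_def\<close>)
  have 4: "homotopic_paths Q ((\<lambda>s. ?h (s, 1)) +++ reversepath ?b) (reversepath ?b)"
    using homotopic_paths_trans[OF 2 3] .
  have hb: "path_from Q x (g 1) ((\<lambda>s. ?h (s, 1)) +++ reversepath ?b)"
    using path_from_homotopic[OF homotopic_paths_sym[OF 4] path_from_reverse[OF b]] .
  have "homotopic_paths Q g (?a +++ reversepath ?b)"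
    using homotopic_paths_trans[OF 1 homotopic_paths_join_from[OF homotopic_paths_reflI[OF a] 4 a hb]] .
  moreover have "edgy (g 0) (g 1) (?a +++ reversepath ?b)"
    using edgy_join[of "g 0" x ?a "g 1" "reversepath ?b"] line_edgy[of "g 0"] line_edgy[of "g 1"] gn by simp
  ultimately show ?thesis using edgy_homotopic by (auto simp: pathstart_def pathfinish_def)
qed

end

context cube_complex
begin

lemma nbhd_exists:
  assumes "x \<in> Q"
  shows "\<exists>W. openin (top_of_set Q) W \<and> x \<in> W \<and>
    (\<forall>g. path g \<longrightarrow> path_image g \<subseteq> W \<longrightarrow> edgy (pathstart g) (pathfinish g) g)"
proof -
  obtain d w where dw: "d \<in> C" "w \<in> open_cube (cdim d)" "x = \<kappa> d w" using kappa_surj[OF assms] by blast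
  \<comment> \<open>The entry 1/4 keeps the set non-empty when \<open>x\<close> is a vertex and
    gives the general bound on the radius.\<close>
  define A where "A = insert (1/4) ((\<lambda>k. min (w k / 2) ((1 - w k) / 2)) ` {..<cdim d})"
  have A: "finite A" "A \<noteq> {}" "\<And>a. a \<in> A \<Longrightarrow> 0 < a" using dw(2) by (auto simp: A_def open_cube_def)
  define \<epsilon> where "\<epsilon> = Min A"
  have "0 < \<epsilon>" using A(3)[OF Min_in[OF A(1,2)]] by (simp add: \<epsilon>_def)
  moreover have "\<epsilon> \<le> 1/4" unfolding \<epsilon>_def by (rule Min_le[OF A(1)]) (simp add: A_def)
  moreover have "2 * \<epsilon> \<le> w k \<and> w k \<le> 1 - 2 * \<epsilon>" if "k < cdim d" for k
  proof -
    have "\<epsilon> \<le> min (w k / 2) ((1 - w k) / 2)" unfolding \<epsilon>_def by (rule Min_le) (use A that in \<open>auto simp: A_def\<close>)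
    then show ?thesis by simp
  qed
  ultimately interpret cube_point Q C cdim \<kappa> x d w \<epsilon>
    using dw by unfold_locales auto
  show ?thesis using openin_nbhd x_in_nbhd path_in_nbhd_edgy by blast
qed

text \<open>Bisection: the property passes from two adjacent intervals to their union, and it holds
  on short intervals, where the path stays in one contractible neighbourhood.\<close>

lemma path_edgy:
  assumes g: "path g" "path_image g \<subseteq> Q" shows "edgy (pathstart g) (pathfinish g) g"
proof -
  have gQ: "g s \<in> Q" if "s \<in> {0..1}" for s using g that by (auto simp: path_image_def)
  have sub: "homotopic_paths Q (g \<circ> f) (g \<circ> f')" if "homotopic_paths {0..1} f f'" for f f'
    using homotopic_paths_compose_unit[OF g that] .
  define P where "P u v \<longleftrightarrow> (0 \<le> u \<longrightarrow> v \<le> 1 \<longrightarrow> u \<le> v \<longrightarrow> edgy (g u) (g v) (g \<circ> linepath u v))" for u v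
  have "P 0 1"
  proof (rule Bolzano[where P = P])
    show "(0::real) \<le> 1" by simp
  next
    fix a b c :: real assume abc: "P a b" "P b c" "a \<le> b" "b \<le> c"
    show "P a c" unfolding P_def
    proof (intro impI)
      assume r: "0 \<le> a" "c \<le> 1" "a \<le> c"
      then have e: "edgy (g a) (g c) ((g \<circ> linepath a b) +++ (g \<circ> linepath b c))"
        using abc edgy_join[of "g a" "g b" "g \<circ> linepath a b" "g c"] by (simp add: P_def)
      have im: "path_image (linepath a b +++ linepath b c) \<subseteq> {0..1}" "path_image (linepath a c) \<subseteq> {0..1}"
        using r abc by (auto simp: path_image_join closed_segment_eq_real_ivl)
      have "homotopic_paths {0..1} (linepath a b +++ linepath b c) (linepath a c)"
      proof (rule homotopic_paths_linear)
        fix t :: real assume "t \<in> {0..1}"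
        then have "(linepath a b +++ linepath b c) t \<in> {0..1}" "linepath a c t \<in> {0..1}"
          using im unfolding path_image_def by blast+
        then show "closed_segment ((linepath a b +++ linepath b c) t) (linepath a c t) \<subseteq> {0..1}"
          by (intro closed_segment_subset) auto
      qed auto
      from sub[OF this] have "homotopic_paths Q ((g \<circ> linepath a b) +++ (g \<circ> linepath b c)) (g \<circ> linepath a c)"
        by (simp only: path_compose_join)
      then show "edgy (g a) (g c) (g \<circ> linepath a c)"
        using edgy_homotopic[OF homotopic_paths_sym e] by blast
    qed
  next
    fix s :: real assume s: "0 \<le> s" "s \<le> 1"
    then have "g s \<in> Q" using gQ by simp
    then obtain W where W: "openin (top_of_set Q) W" "g s \<in> W"
      "\<forall>g. path g \<longrightarrow> path_image g \<subseteq> W \<longrightarrow> edgy (pathstart g) (pathfinish g) g"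
      using nbhd_exists by blast
    then obtain U where U: "open U" "W = Q \<inter> U" by (auto simp: openin_open)
    have "continuous_on {0..1} g" using g by (simp add: path_def)
    then obtain A where A: "open A" "A \<inter> {0..1} = g -` U \<inter> {0..1}"
      using U(1) unfolding continuous_on_open_invariant by blast
    have "s \<in> g -` U \<inter> {0..1}" using W(2) U(2) s by simp
    then have "s \<in> A" using A(2) by blast
    then obtain d where d: "d > 0" "ball s d \<subseteq> A" using A(1) open_contains_ball by blast
    have "P a b" if ab: "a \<le> s" "s \<le> b" "b - a < d" for a b
      unfolding P_def
    proof (intro impI)
      assume r: "0 \<le> a" "b \<le> 1" "a \<le> b"
      have "g u \<in> W" if "u \<in> {a..b}" for u
      proof -
        have "u \<in> ball s d" using that ab by (auto simp: dist_real_def)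
        then have "u \<in> A \<inter> {0..1}" using d that r by auto
        then have "u \<in> g -` U" "u \<in> {0..1}" using A(2) by blast+
        then show ?thesis using U(2) gQ by simp
      qed
      moreover have "linepath a b ` {0..1} = {a..b}"
        using r by (simp add: linepath_image_01 closed_segment_eq_real_ivl)
      ultimately have "path_image (g \<circ> linepath a b) \<subseteq> W"
        unfolding path_image_def image_comp[symmetric] by auto
      moreover have "path (g \<circ> linepath a b)"
        using r g(1) by (intro path_continuous_image) (auto simp: path_def closed_segment_eq_real_ivl intro: continuous_on_subset)
      ultimately show "edgy (g a) (g b) (g \<circ> linepath a b)"
        using W(3) by (fastforce simp: pathstart_compose pathfinish_compose)
    qed
    then show "\<exists>d>0. \<forall>a b. a \<le> s \<and> s \<le> b \<and> b - a < d \<longrightarrow> P a b" using d(1) by blast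
  qed
  then show ?thesis by (simp add: P_def pathstart_def pathfinish_def path_eq_compose_linepath)
qed

end

section \<open>Continuous coordinates transverse to hyperplanes\<close>

section \<open>Coordinate functions of hyperplanes\<close>

text \<open>
  Both functions only depend on \<open>t\<close> modulo 1, and they are even and odd, so that they survive the
  identifications of faces and the reversal of directions.
\<close>

definition wave :: "real \<Rightarrow> real" where "wave t = \<bar>t - 1/2\<bar>"

definition owave :: "real \<Rightarrow> real"
  where "owave t = (if t \<le> 1/4 then t else if t \<le> 3/4 then 1/2 - t else t - 1)"

lemma wave_simps [simp]: "wave (1 - t) = wave t" "wave 0 = 1/2" "wave 1 = 1/2"
    "owave 0 = 0" "owave 1 = 0"
  by (auto simp: wave_def owave_def)

lemma owave_flip: "owave (1 - t) = - owave t"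
  by (auto simp: owave_def)

text \<open>Within 1/4 of the wall, \<open>owave\<close> is the signed distance to it, positive
  before the wall. Elsewhere it is only a continuation that vanishes at 0 and 1.\<close>

lemma wave_owave: "wave t < 1/4 \<Longrightarrow> owave t = 1/2 - t \<and> \<bar>owave t\<bar> = wave t"
proof -
  assume "wave t < 1/4"
  then have "1/4 < t" "t < 3/4" unfolding wave_def by linarith+
  then show ?thesis by (simp add: wave_def owave_def)
qed

lemma continuous_wave: "continuous_on S wave"
  unfolding wave_def by (intro continuous_intros)

lemma owave_eq: "owave t = max (min t (1/2 - t)) (t - 1)"
  by (auto simp: owave_def)

lemma continuous_owave: "continuous_on S owave"
  unfolding owave_eq by (intro continuous_intros)

context finite_special_cube_complex
begin

definition dlab :: "'c \<Rightarrow> nat \<Rightarrow> nat \<times> bool" where "dlab c i = lab (THE a. edge_at c (\<lambda>_. 0) i a)"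

lemma dlab_zero: assumes "edge_at c (\<lambda>_. 0) i a" shows "dlab c i = lab a"
proof -
  have "(THE a. edge_at c (\<lambda>_. 0) i a) = a" using assms edge_at_unique by blast
  then show ?thesis by (simp add: dlab_def)
qed

lemma dlab:
  assumes c: "c \<in> C" "i < cdim c" and v: "v \<in> cube_vertices (cdim c)" and a: "edge_at c v i a"
  shows "lab a = (if v i = 0 then dlab c i else linv (dlab c i))"
proof -
  obtain b where b: "edge_at c (\<lambda>_. 0) i b" using edge_at_exists c zero_vertex by (fastforce simp: corners_def)
  note o = edge_at_oriented[OF a] edge_at_oriented[OF b]
  show ?thesis
  proof (cases "v i = 0")
    case True
    then have "parallel a b" using parallel_in_cube'[OF c(1) v zero_vertex c(2) _ a b] by simp
    then show ?thesis using True dlab_zero[OF b] lab_eq_iff o by simp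
  next
    case False
    then have "v i = 1" using v c by (auto simp: cube_vertices_def)
    then have "edge_at c (v(i := 0)) i (edge_reverse a)" using edge_at_flip[OF a v c(2)] by simp
    moreover have "v(i := 0) \<in> cube_vertices (cdim c)" using v by (auto simp: cube_vertices_def)
    ultimately have "parallel (edge_reverse a) b"
      using parallel_in_cube'[OF c(1) _ zero_vertex c(2) _ _ b, of "v(i := 0)" "edge_reverse a"] by simp
    then have "lab (edge_reverse a) = lab b" using lab_eq_iff o by simp
    then have "linv (lab a) = dlab c i" using lab_reverse[OF o(1)] dlab_zero[OF b] by simp
    then show ?thesis using False by (metis linv_simps(1))
  qed
qed

lemma dlab_face:
  assumes f: "is_face c d P" and j: "j < cdim c" "P j = Inl (k, f)"
  shows "dlab c j = (if f then linv (dlab d k) else dlab d k)"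
proof -
  have cd: "c \<in> C" "d \<in> C" and pat: "is_pat (cdim d) (cdim c) P" using f by (auto simp: is_face_def)
  have k: "k < cdim d" using is_patD(1)[OF pat j] by simp
  obtain a where a: "edge_at d (\<lambda>_. 0) k a" using edge_at_exists cd k zero_vertex by (fastforce simp: corners_def)
  have a': "edge_at c (papp (cdim c) P (\<lambda>_. 0)) j a" using edge_at_face[OF f zero_vertex j] a by simp
  have "papp (cdim c) P (\<lambda>_. 0) j = (if f then 1 else 0)" using j by (simp add: papp_def)
  then have "lab a = (if f then linv (dlab c j) else dlab c j)"
    using dlab[OF cd(1) j(1) papp_vertices[OF pat zero_vertex] a'] by simp
  then show ?thesis using dlab_zero[OF a] by (metis linv_simps(1))
qed

lemma dlab_E0: assumes "c \<in> C" "i < cdim c" "j < cdim c" "i \<noteq> j" shows "{fst (dlab c i), fst (dlab c j)} \<in> E0"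
proof -
  have cor: "(c, \<lambda>_. 0) \<in> corners" using assms zero_vertex by (simp add: corners_def)
  obtain a b where ab: "edge_at c (\<lambda>_. 0) i a" "edge_at c (\<lambda>_. 0) j b" using edge_at_exists[OF cor] assms by metis
  then show ?thesis using spans_square_E0[OF spanning_edges[OF cor assms(2-4) ab]] dlab_zero by simp
qed

lemma dlab_inj: "c \<in> C \<Longrightarrow> i < cdim c \<Longrightarrow> j < cdim c \<Longrightarrow> fst (dlab c i) = fst (dlab c j) \<Longrightarrow> i = j"
  using dlab_E0[of c i j] pa.E0_distinct by fastforce

text \<open>The coordinate transverse to \<open>h\<close>, oriented like the representative edge; by
  embeddedness a cube has at most one such direction. The default 0 is harmless for functions that
  agree at 0 and 1, which is what passing to faces requires.\<close>

definition tval :: "nat \<Rightarrow> 'c \<Rightarrow> (nat \<Rightarrow> real) \<Rightarrow> real"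
  where "tval h c z = (if \<exists>i<cdim c. fst (dlab c i) = h
     then (let i = (THE i. i < cdim c \<and> fst (dlab c i) = h) in if snd (dlab c i) then z i else 1 - z i) else 0)"

lemma tval_eq:
  assumes "c \<in> C" "i < cdim c" "fst (dlab c i) = h"
  shows "tval h c z = (if snd (dlab c i) then z i else 1 - z i)"
proof -
  have "(THE i. i < cdim c \<and> fst (dlab c i) = h) = i" using assms dlab_inj by blast
  then show ?thesis using assms(2,3) by (auto simp: tval_def Let_def)
qed

lemma tval_none: "\<not> (\<exists>i<cdim c. fst (dlab c i) = h) \<Longrightarrow> tval h c z = 0"
  unfolding tval_def by (rule if_not_P)

definition hcoord :: "(real \<Rightarrow> real) \<Rightarrow> nat \<Rightarrow> 'a \<Rightarrow> real"
  where "hcoord F h y = F (tval h (fst (carrier_of y)) (snd (carrier_of y)))"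

text \<open>Passing to the carrying face either keeps the direction dual to \<open>h\<close>, up to
  a reflection that the sign of the label compensates, or freezes it at 0 or 1, where
  \<open>F\<close> takes its default value.\<close>

lemma hcoord_kappa:
  assumes F: "F 0 = F (1::real)" and c: "c \<in> C" "z \<in> cube (cdim c)"
  shows "hcoord F h (\<kappa> c z) = F (tval h c z)"
proof -
  obtain d P w where d: "is_face c d P" "w \<in> open_cube (cdim d)" "papp (cdim c) P w = z"
    "\<And>j. j < cdim c \<Longrightarrow> (\<exists>kf. P j = Inl kf) \<longleftrightarrow> z j \<notin> {0, 1}"
    using carrier_face[OF c] by metis
  have dC: "d \<in> C" and pat: "is_pat (cdim d) (cdim c) P" using d by (auto simp: is_face_def)
  have "\<kappa> c z = \<kappa> d w" using d open_cube_sub unfolding is_face_def by blast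
  then have car: "carrier_of (\<kappa> c z) = (d, w)" using carrier_of_kappa[OF dC d(2)] by simp
  have up: "\<exists>j<cdim c. (\<exists>f. P j = Inl (k, f)) \<and> fst (dlab c j) = fst (dlab d k)" if k: "k < cdim d" for k
  proof -
    obtain j f where j: "j < cdim c" "P j = Inl (k, f)" using is_patD(3)[OF pat k] by blast
    then show ?thesis using dlab_face[OF d(1) j] by (intro exI[of _ j]) auto
  qed
  have "F (tval h d w) = F (tval h c z)"
  proof (cases "\<exists>i<cdim c. fst (dlab c i) = h")
    case False
    then have "\<not> (\<exists>k<cdim d. fst (dlab d k) = h)" using up by metis
    then show ?thesis using False tval_none by simp
  next
    case True
    then obtain i where i: "i < cdim c" "fst (dlab c i) = h" by blast
    show ?thesis
    proof (cases "P i")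
      case (Inl kf)
      then have P: "P i = Inl (fst kf, snd kf)" by simp
      have k: "fst kf < cdim d" using is_patD(1)[OF pat i(1) Inl] .
      have l: "dlab c i = (if snd kf then linv (dlab d (fst kf)) else dlab d (fst kf))"
        using dlab_face[OF d(1) i(1) P] .
      then have "fst (dlab d (fst kf)) = h" using i(2) by (auto split: if_splits)
      moreover have "z i = (if snd kf then 1 - w (fst kf) else w (fst kf))" using d(3) i(1) Inl by (auto simp: papp_def)
      ultimately have "tval h d w = tval h c z"
        using tval_eq[OF dC k] tval_eq[OF c(1) i] l by (auto split: if_splits)
      then show ?thesis by simp
    next
      case (Inr \<delta>)
      have "\<not> (\<exists>k<cdim d. fst (dlab d k) = h)"
      proof
        assume "\<exists>k<cdim d. fst (dlab d k) = h"
        then obtain k where "k < cdim d" "fst (dlab d k) = h" by blast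
        then obtain j f where "j < cdim c" "P j = Inl (k, f)" "fst (dlab c j) = h" using up by metis
        then show False using dlab_inj[OF c(1) _ i(1), of j] i(2) Inr by simp
      qed
      then have "tval h d w = 0" by (rule tval_none)
      moreover have "z i = 0 \<or> z i = 1" using d(4)[OF i(1)] Inr by auto
      then have "tval h c z = 0 \<or> tval h c z = 1" using tval_eq[OF c(1) i, of z] by auto
      ultimately show ?thesis using F by auto
    qed
  qed
  then show ?thesis by (simp add: hcoord_def car)
qed

lemma hcoord_continuous:
  assumes F: "F 0 = F (1::real)" "continuous_on UNIV F"
  shows "continuous_on Q (hcoord F h)"
proof -
  let ?X = "\<lambda>c. top_of_set (cube (cdim c))"
  have "continuous_map (sum_topology ?X C) euclideanreal (hcoord F h \<circ> (\<lambda>(c, x). \<kappa> c x))"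
    unfolding continuous_map_def
  proof (intro conjI allI impI)
    fix U :: "real set" assume U: "openin euclideanreal U"
    have "openin (?X c) {x. (c, x) \<in> {y \<in> topspace (sum_topology ?X C). (hcoord F h \<circ> (\<lambda>(c, x). \<kappa> c x)) y \<in> U}}"
      if c: "c \<in> C" for c
    proof -
      have "continuous_on (cube (cdim c)) (\<lambda>z. F (tval h c z))"
      proof (cases "\<exists>i<cdim c. fst (dlab c i) = h")
        case True
        then obtain i where i: "i < cdim c" "fst (dlab c i) = h" by blast
        have zi: "continuous_on (cube (cdim c)) (\<lambda>z. z i)"
          by (rule continuous_on_subset[OF continuous_on_product_coordinates]) simp
        have "continuous_on (cube (cdim c)) (\<lambda>z. tval h c z)"
          unfolding tval_eq[OF c i] by (cases "snd (dlab c i)") (use zi in \<open>auto intro!: continuous_intros\<close>)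
        then show ?thesis using continuous_on_compose2[OF F(2)] by blast
      next
        case False
        then show ?thesis by (simp add: tval_none)
      qed
      then have "continuous_on (cube (cdim c)) (\<lambda>z. hcoord F h (\<kappa> c z))"
        using hcoord_kappa[OF F(1) c, of _ h] by (simp cong: continuous_on_cong)
      then have "openin (?X c) (cube (cdim c) \<inter> (\<lambda>z. hcoord F h (\<kappa> c z)) -` U)"
        using U by (auto intro: continuous_openin_preimage_gen)
      moreover have "cube (cdim c) \<inter> (\<lambda>z. hcoord F h (\<kappa> c z)) -` U =
         {x. (c, x) \<in> {y \<in> topspace (sum_topology ?X C). (hcoord F h \<circ> (\<lambda>(c, x). \<kappa> c x)) y \<in> U}}" using c by auto
      ultimately show ?thesis by simp
    qed
    then show "openin (sum_topology ?X C) {y \<in> topspace (sum_topology ?X C). (hcoord F h \<circ> (\<lambda>(c, x). \<kappa> c x)) y \<in> U}"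
      unfolding openin_sum_topology by auto
  qed simp
  then have "continuous_map (top_of_set Q) euclideanreal (hcoord F h)"
    using continuous_compose_quotient_map[OF quotient] by blast
  then show ?thesis by simp
qed

section \<open>Words of hyperplane crossings along sampled paths\<close>

section \<open>Holonomy\<close>

text \<open>
  A path is sampled finely. Whenever the coordinate of a hyperplane passes 1/2 between two samples,
  the corresponding letter is recorded. Letters recorded at the same time belong to a common cube,
  so they commute.
\<close>

abbreviation "hA \<equiv> hcoord wave"
abbreviation "hB \<equiv> hcoord owave"

lemma hA_hB: "hA h y < 1/4 \<Longrightarrow> \<bar>hB h y\<bar> = hA h y"
  using wave_owave[of "tval h (fst (carrier_of y)) (snd (carrier_of y))"] unfolding hcoord_def by blast

text \<open>The default value of \<open>hA\<close> is 1/2, so a small value forces the carrying cube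
  to have a direction dual to the hyperplane. Two directions of one cube cross.\<close>

lemma hA_small_commute:
  assumes "y \<in> Q" "hA h y < 1/4" "hA k y < 1/4" "h \<noteq> k" shows "{h, k} \<in> E0"
proof -
  obtain d w where dw: "d \<in> C" "w \<in> open_cube (cdim d)" "y = \<kappa> d w" using kappa_surj[OF assms(1)] by blast
  have "hA l y = wave (tval l d w)" for l using carrier_of_kappa[OF dw(1,2)] dw(3) by (simp add: hcoord_def)
  then have "\<exists>i<cdim d. fst (dlab d i) = l" if "hA l y < 1/4" for l
    using that tval_none[of d l w] by (cases "\<exists>i<cdim d. fst (dlab d i) = l") auto
  then obtain i j where "i < cdim d" "fst (dlab d i) = h" "j < cdim d" "fst (dlab d j) = k" using assms(2,3) by metis
  then show ?thesis using dlab_E0[OF dw(1), of i j] assms(4) by auto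
qed

definition near :: "'a \<Rightarrow> 'a \<Rightarrow> bool"
  where "near x y \<longleftrightarrow> (\<forall>h<nhyp. \<bar>hA h x - hA h y\<bar> < 1/8 \<and> \<bar>hB h x - hB h y\<bar> < 1/8)"

text \<open>\<open>owave\<close> also changes sign where 0 and 1 are identified, far from the wall;
  the bound 1/4 on \<open>hA\<close> discards these changes. A point on the wall counts as lying
  behind it in the direction of the representative edge.\<close>

definition crossing :: "'a \<Rightarrow> 'a \<Rightarrow> nat \<Rightarrow> nat group_word"
  where "crossing x y h = (if hA h x < 1/4 \<and> hA h y < 1/4 \<and> (hB h x \<le> 0 \<longleftrightarrow> \<not> hB h y \<le> 0)
     then [(2 * h, hB h y \<le> 0)] else [])"

definition cword :: "'a \<Rightarrow> 'a \<Rightarrow> nat group_word"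
  where "cword x y = concat (map (crossing x y) [0..<nhyp])"

lemma raag_graph_pa: "raag_graph pa.V pa.E"
proof
  show "finite pa.V" by (simp add: pa.V_def)
  show "pa.E \<subseteq> {{a, b} |a b. a \<in> pa.V \<and> b \<in> pa.V \<and> a \<noteq> b}"
    using pa.E0_distinct by (fastforce simp: pa.E_def)
qed

sublocale rg: raag_graph pa.V pa.E by (rule raag_graph_pa)

abbreviation weq2 (infix "\<cong>\<^sub>w" 50) where "u \<cong>\<^sub>w w \<equiv> word_eq pa.V (comm_rel pa.E) u w"

lemma cword_refl [simp]: "cword x x = []"
  by (simp add: cword_def crossing_def)

lemma even_letter_V: "h < nhyp \<Longrightarrow> 2 * h \<in> pa.V" by (simp add: pa.V_def)

lemma crossing_words: "h < nhyp \<Longrightarrow> l \<in> set (crossing x y h) \<Longrightarrow> fst l = 2 * h \<and> fst l \<in> pa.V"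
  by (auto simp: crossing_def even_letter_V split: if_splits)

lemma cword_words: "cword x y \<in> words pa.V"
  using crossing_words by (fastforce simp: cword_def)

text \<open>A change of sign by less than 1/8 puts \<open>x\<close> within 1/8 of the wall, hence
  every near point within 1/4. So if one of three mutually near points misses the threshold, no
  crossing is recorded between any two of them.\<close>

lemma crossing_near:
  assumes "crossing x y h \<noteq> []" "near x y" "near x z" "h < nhyp" shows "hA h z < 1/4"
proof -
  have c: "hA h x < 1/4" "hA h y < 1/4" "hB h x \<le> 0 \<longleftrightarrow> \<not> hB h y \<le> 0"
    using assms(1) by (auto simp: crossing_def split: if_splits)
  have "\<bar>hB h x - hB h y\<bar> < 1/8" using assms(2,4) by (simp add: near_def)
  then have "\<bar>hB h x\<bar> < 1/8" using c(3) by linarith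
  then have "hA h x < 1/8" using hA_hB[OF c(1)] by simp
  moreover have "\<bar>hA h x - hA h z\<bar> < 1/8" using assms(3,4) by (simp add: near_def)
  ultimately show ?thesis by linarith
qed

lemma near_sym: "near x y \<Longrightarrow> near y x" by (auto simp: near_def abs_minus_commute)
lemma crossing_cocycle:
  assumes n: "near x y" "near y z" "near x z" and h: "h < nhyp"
  shows "crossing x y h @ crossing y z h \<cong>\<^sub>w crossing x z h"
proof (cases "hA h x < 1/4 \<and> hA h y < 1/4 \<and> hA h z < 1/4")
  case True
  have V: "2 * h \<in> pa.V" using h by (rule even_letter_V)
  have "[(2 * h, b), (2 * h, \<not> b)] \<cong>\<^sub>w []" for b using word_eq.cancel[of "[]" pa.V "[]" "2 * h" "comm_rel pa.E" b] V by simp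
  from this[of True] this[of False] show ?thesis using True V by (auto simp: crossing_def)
next
  case False
  have "crossing x y h = []"
  proof (rule ccontr)
    assume c: "crossing x y h \<noteq> []"
    then have "hA h x < 1/4" "hA h y < 1/4" by (auto simp: crossing_def split: if_splits)
    then show False using False crossing_near[OF c n(1) n(3) h] by blast
  qed
  moreover have "crossing y z h = []"
  proof (rule ccontr)
    assume c: "crossing y z h \<noteq> []"
    then have "hA h y < 1/4" "hA h z < 1/4" by (auto simp: crossing_def split: if_splits)
    then show False using False crossing_near[OF c n(2) near_sym[OF n(1)] h] by blast
  qed
  moreover have "crossing x z h = []"
  proof (rule ccontr)
    assume c: "crossing x z h \<noteq> []"
    then have "hA h x < 1/4" "hA h z < 1/4" by (auto simp: crossing_def split: if_splits)
    then show False using False crossing_near[OF c n(3) n(1) h] by blast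
  qed
  ultimately show ?thesis by simp
qed

lemma words_commute:
  assumes "\<And>l m. l \<in> set u \<Longrightarrow> m \<in> set w \<Longrightarrow> {fst l, fst m} \<in> pa.E" "u \<in> words pa.V" "w \<in> words pa.V"
  shows "u @ w \<cong>\<^sub>w w @ u"
  using assms(1,3)
proof (induction w)
  case (Cons a w)
  have w: "w \<in> words pa.V" "fst a \<in> pa.V" using Cons.prems by auto
  have "u @ [a] \<cong>\<^sub>w [a] @ u" by (rule rg.letter_commutes_word) (use Cons.prems assms(2) w in auto)
  then have "(u @ [a]) @ w \<cong>\<^sub>w ([a] @ u) @ w" using w by (intro word_eq_append_right)
  moreover have "[a] @ (u @ w) \<cong>\<^sub>w [a] @ (w @ u)" using Cons w by (intro word_eq_append_left) auto
  ultimately show ?case by (auto intro: word_eq.trans)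
qed (use assms(2) in simp)

text \<open>All labels that occur lie in \<open>S\<close> and commute pairwise, so the two lists of
  letters can be interleaved.\<close>

lemma concat_merge:
  assumes "distinct hs" "\<And>h. h \<in> set hs \<Longrightarrow> h < nhyp"
    and "\<And>h l. h \<in> set hs \<Longrightarrow> l \<in> set (f h) \<union> set (g h) \<Longrightarrow> fst l = 2 * h \<and> h \<in> S"
    and S: "\<And>h k. h \<in> S \<Longrightarrow> k \<in> S \<Longrightarrow> h \<noteq> k \<Longrightarrow> {h, k} \<in> E0"
  shows "concat (map f hs) @ concat (map g hs) \<cong>\<^sub>w concat (map (\<lambda>h. f h @ g h) hs)"
  using assms(1-3)
proof (induction hs)
  case (Cons h hs)
  let ?F = "concat (map f hs)" and ?G = "concat (map g hs)"
  have V: "\<And>k l. k \<in> set (h # hs) \<Longrightarrow> l \<in> set (f k) \<union> set (g k) \<Longrightarrow> fst l \<in> pa.V"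
    using Cons.prems(2,3) even_letter_V by metis
  have w: "?F \<in> words pa.V" "?G \<in> words pa.V" "f h \<in> words pa.V" "g h \<in> words pa.V"
    using V by auto
  have IH: "?F @ ?G \<cong>\<^sub>w concat (map (\<lambda>h. f h @ g h) hs)" by (rule Cons.IH) (use Cons.prems in auto)
  have "?F @ g h \<cong>\<^sub>w g h @ ?F"
  proof (rule words_commute)
    fix l m assume l: "l \<in> set ?F" "m \<in> set (g h)"
    then obtain k where k: "k \<in> set hs" "l \<in> set (f k)" by auto
    then have "fst l = 2 * k" "k \<in> S" "fst m = 2 * h" "h \<in> S" using Cons.prems(3)[of k l] Cons.prems(3)[of h m] l by auto
    moreover have "h \<noteq> k" using Cons.prems(1) k by auto
    moreover have "2 * k \<in> pa.V" "2 * h \<in> pa.V" using even_letter_V Cons.prems(2) k by auto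
    ultimately show "{fst l, fst m} \<in> pa.E" using S[of k h] by (simp add: pa.E_iff)
  qed (use w in auto)
  then have "f h @ (?F @ g h) @ ?G \<cong>\<^sub>w f h @ (g h @ ?F) @ ?G"
    using w by (intro word_eq_append_left word_eq_append_right)
  moreover have "(f h @ g h) @ (?F @ ?G) \<cong>\<^sub>w (f h @ g h) @ concat (map (\<lambda>h. f h @ g h) hs)"
    using w by (intro word_eq_append_left[OF IH]) auto
  ultimately show ?case by (auto intro: word_eq.trans)
qed simp

lemma concat_cong: "(\<And>h. h \<in> set hs \<Longrightarrow> f h \<cong>\<^sub>w g h) \<Longrightarrow> concat (map f hs) \<cong>\<^sub>w concat (map g hs)"
  by (induction hs) (auto intro: word_eq_append)

text \<open>Every hyperplane crossed in one of the two steps is close to the middle point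
  \<open>y\<close>. So these labels commute by \<open>hA_small_commute\<close>, and the identity can
  be checked for each hyperplane separately.\<close>

lemma cword_cocycle:
  assumes n: "near x y" "near y z" "near x z" and y: "y \<in> Q"
  shows "cword x y @ cword y z \<cong>\<^sub>w cword x z"
proof -
  have "concat (map (crossing x y) [0..<nhyp]) @ concat (map (crossing y z) [0..<nhyp])
      \<cong>\<^sub>w concat (map (\<lambda>h. crossing x y h @ crossing y z h) [0..<nhyp])"
  proof (rule concat_merge[where S = "{h. hA h y < 1/4}"])
    fix h l assume "h \<in> set [0..<nhyp]" "l \<in> set (crossing x y h) \<union> set (crossing y z h)"
    then show "fst l = 2 * h \<and> h \<in> {h. hA h y < 1/4}" by (auto simp: crossing_def split: if_splits)
  qed (use hA_small_commute[OF y] in auto)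
  moreover have "concat (map (\<lambda>h. crossing x y h @ crossing y z h) [0..<nhyp]) \<cong>\<^sub>w concat (map (crossing x z) [0..<nhyp])"
    using crossing_cocycle[OF n] by (intro concat_cong) simp
  ultimately show ?thesis unfolding cword_def by (rule word_eq.trans)
qed

definition seqw :: "(nat \<Rightarrow> 'a) \<Rightarrow> nat \<Rightarrow> nat \<Rightarrow> nat group_word"
  where "seqw x a b = concat (map (\<lambda>i. cword (x i) (x (Suc i))) [a..<b])"

lemma seqw_simps [simp]: "seqw x a a = []" "a \<le> b \<Longrightarrow> seqw x a (Suc b) = seqw x a b @ cword (x b) (x (Suc b))"
  by (simp_all add: seqw_def)

lemma seqw_words: "seqw x a b \<in> words pa.V"
  using cword_words by (fastforce simp: seqw_def)

lemma seqw_append: "a \<le> b \<Longrightarrow> b \<le> c \<Longrightarrow> seqw x a c = seqw x a b @ seqw x b c"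
  using upt_add_eq_append[of a b "c - b"] by (simp add: seqw_def)

lemma seqw_near:
  assumes "a \<le> b" "\<And>i j. i \<in> {a..b} \<Longrightarrow> j \<in> {a..b} \<Longrightarrow> near (x i) (x j)" "\<And>i. i \<in> {a..b} \<Longrightarrow> x i \<in> Q"
  shows "seqw x a b \<cong>\<^sub>w cword (x a) (x b)"
  using assms
proof (induction b rule: dec_induct)
  case base
  show ?case by simp
next
  case (step b)
  have "seqw x a b @ cword (x b) (x (Suc b)) \<cong>\<^sub>w cword (x a) (x b) @ cword (x b) (x (Suc b))"
    using step cword_words by (intro word_eq_append_right) auto
  moreover have "cword (x a) (x b) @ cword (x b) (x (Suc b)) \<cong>\<^sub>w cword (x a) (x (Suc b))"
    using step by (intro cword_cocycle) auto
  ultimately show ?case using step(1) by (auto intro: word_eq.trans)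
qed

lemma seqw_refine:
  assumes "\<And>i j j'. i < m \<Longrightarrow> j \<in> {K * i..K * Suc i} \<Longrightarrow> j' \<in> {K * i..K * Suc i} \<Longrightarrow> near (x j) (x j')"
    and "\<And>j. j \<le> K * m \<Longrightarrow> x j \<in> Q"
  shows "seqw x 0 (K * m) \<cong>\<^sub>w seqw (\<lambda>i. x (K * i)) 0 m"
  using assms
proof (induction m)
  case (Suc m)
  have "seqw x 0 (K * m) \<cong>\<^sub>w seqw (\<lambda>i. x (K * i)) 0 m" 
  proof (rule Suc.IH)
    show "near (x j) (x j')" if "i < m" "j \<in> {K * i..K * Suc i}" "j' \<in> {K * i..K * Suc i}" for i j j'
      using Suc.prems(1)[of i j j'] that by simp
    show "x j \<in> Q" if "j \<le> K * m" for j using Suc.prems(2)[of j] that by simp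
  qed
  moreover have "seqw x (K * m) (K * Suc m) \<cong>\<^sub>w cword (x (K * m)) (x (K * Suc m))"
    by (rule seqw_near) (use Suc.prems in auto)
  ultimately have "seqw x 0 (K * m) @ seqw x (K * m) (K * Suc m) \<cong>\<^sub>w seqw (\<lambda>i. x (K * i)) 0 m @ cword (x (K * m)) (x (K * Suc m))"
    by (rule word_eq_append)
  moreover have "seqw x 0 (K * Suc m) = seqw x 0 (K * m) @ seqw x (K * m) (K * Suc m)"
    by (rule seqw_append) auto
  ultimately show ?case by simp
qed simp

lemma uniformly_near:
  fixes H :: "'m::metric_space \<Rightarrow> 'a"
  assumes "compact K" "continuous_on K H" "H ` K \<subseteq> Q"
  shows "\<exists>\<delta>>0. \<forall>s\<in>K. \<forall>t\<in>K. dist s t < \<delta> \<longrightarrow> near (H s) (H t)"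
proof -
  have one: "\<exists>\<delta>>0. \<forall>s\<in>K. \<forall>t\<in>K. dist s t < \<delta> \<longrightarrow> \<bar>hcoord F h (H s) - hcoord F h (H t)\<bar> < 1/8"
    if F: "F 0 = F (1::real)" "continuous_on UNIV F" for F h
  proof -
    have "continuous_on K (\<lambda>s. hcoord F h (H s))"
      by (rule continuous_on_compose2[OF hcoord_continuous[OF F] assms(2,3)])
    then have "uniformly_continuous_on K (\<lambda>s. hcoord F h (H s))" using compact_uniformly_continuous assms(1) by blast
    from this[unfolded uniformly_continuous_on_def, rule_format, of "1/8"]
    obtain \<delta> where "\<delta> > 0" "\<forall>t\<in>K. \<forall>s\<in>K. dist s t < \<delta> \<longrightarrow> dist (hcoord F h (H s)) (hcoord F h (H t)) < 1/8" by auto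
    then show ?thesis unfolding dist_real_def by blast
  qed
  have "\<exists>\<delta>>0. \<forall>s\<in>K. \<forall>t\<in>K. dist s t < \<delta> \<longrightarrow> (\<forall>h<n. \<bar>hA h (H s) - hA h (H t)\<bar> < 1/8 \<and> \<bar>hB h (H s) - hB h (H t)\<bar> < 1/8)" for n
  proof (induction n)
    case 0
    show ?case by (intro exI[of _ 1]) simp
  next
    case (Suc n)
    then obtain \<delta> where \<delta>: "\<delta> > 0" "\<forall>s\<in>K. \<forall>t\<in>K. dist s t < \<delta> \<longrightarrow> (\<forall>h<n. \<bar>hA h (H s) - hA h (H t)\<bar> < 1/8 \<and> \<bar>hB h (H s) - hB h (H t)\<bar> < 1/8)" by blast
    obtain \<delta>1 where \<delta>1: "\<delta>1 > 0" "\<forall>s\<in>K. \<forall>t\<in>K. dist s t < \<delta>1 \<longrightarrow> \<bar>hA n (H s) - hA n (H t)\<bar> < 1/8"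
      using one[of wave n] continuous_wave by auto
    obtain \<delta>2 where \<delta>2: "\<delta>2 > 0" "\<forall>s\<in>K. \<forall>t\<in>K. dist s t < \<delta>2 \<longrightarrow> \<bar>hB n (H s) - hB n (H t)\<bar> < 1/8"
      using one[of owave n] continuous_owave by auto
    show ?case using \<delta> \<delta>1 \<delta>2
      by (intro exI[of _ "min \<delta> (min \<delta>1 \<delta>2)"]) (auto simp: less_Suc_eq)
  qed
  then show ?thesis unfolding near_def by blast
qed

definition hw :: "(real \<Rightarrow> 'a) \<Rightarrow> nat \<Rightarrow> nat group_word"
  where "hw p M = seqw (\<lambda>i. p (real i / real M)) 0 M"

text \<open>Two sampling rates are compared through their product, which refines both; within one
  interval of the coarser sampling the refined word telescopes by the cocycle identity.\<close>

lemma hw_stable: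
  assumes p: "path p" "path_image p \<subseteq> Q"
  shows "\<exists>N>0. \<forall>M\<ge>N. \<forall>M'\<ge>N. hw p M \<cong>\<^sub>w hw p M'"
proof -
  have pQ: "p t \<in> Q" if "t \<in> {0..1}" for t using p that by (auto simp: path_image_def)
  obtain \<delta> where \<delta>: "\<delta> > 0" "\<forall>s\<in>{0..1}. \<forall>t\<in>{0..1}. dist s t < \<delta> \<longrightarrow> near (p s) (p t)"
    using uniformly_near[of "{0..1::real}" p] p by (auto simp: path_def path_image_def)
  obtain n where "inverse (real (Suc n)) < \<delta>" using reals_Archimedean[OF \<delta>(1)] by blast
  then obtain N where N: "N > 0" "1 / real N < \<delta>" by (metis inverse_eq_divide zero_less_Suc)
  have refine: "hw p (K * M) \<cong>\<^sub>w hw p M" if M: "M \<ge> N" and K: "K > 0" for K M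
  proof -
    let ?x = "\<lambda>i. p (real i / real (K * M))"
    have M0: "M > 0" using M N by simp
    have "1 / real M \<le> 1 / real N" using M N by (simp add: frac_le)
    then have d: "1 / real M < \<delta>" using N by simp
    have "seqw ?x 0 (K * M) \<cong>\<^sub>w seqw (\<lambda>i. ?x (K * i)) 0 M"
    proof (rule seqw_refine)
      fix i j j' assume i: "i < M" and j: "j \<in> {K * i..K * Suc i}" "j' \<in> {K * i..K * Suc i}"
      have "K * Suc i \<le> K * M" using i by (intro mult_le_mono2) simp
      then have jl: "j \<le> K * M" "j' \<le> K * M" using j by auto
      then have 01: "real j / real (K * M) \<in> {0..1}" "real j' / real (K * M) \<in> {0..1}"
        by (auto simp: divide_le_eq simp flip: of_nat_mult)
      have "\<bar>real j - real j'\<bar> \<le> real K" using j by auto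
      then have "\<bar>real j / real (K * M) - real j' / real (K * M)\<bar> \<le> real K / real (K * M)"
        unfolding diff_divide_distrib[symmetric] abs_divide by (simp only: abs_of_nat divide_right_mono of_nat_0_le_iff)
      also have "\<dots> = 1 / real M" using K by simp
      finally show "near (?x j) (?x j')" using \<delta>(2) 01 d by (simp add: dist_real_def)
    next
      fix j assume "j \<le> K * M"
      then show "?x j \<in> Q" using pQ by (auto simp: divide_le_eq simp flip: of_nat_mult)
    qed
    moreover have "(\<lambda>i. ?x (K * i)) = (\<lambda>i. p (real i / real M))" using K by simp
    ultimately show ?thesis by (simp add: hw_def)
  qed
  have "hw p M \<cong>\<^sub>w hw p M'" if "M \<ge> N" "M' \<ge> N" for M M'
  proof -
    have "M > 0" "M' > 0" using that N(1) by simp_all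
    then have "hw p (M' * M) \<cong>\<^sub>w hw p M" "hw p (M * M') \<cong>\<^sub>w hw p M'"
      using refine[where M = M and K = M'] refine[where M = M' and K = M] that by blast+
    then show ?thesis unfolding mult.commute[of M' M] by (meson word_eq.sym word_eq.trans)
  qed
  then show ?thesis using N by blast
qed

text \<open>Sample the homotopy on a grid and compare neighbouring rows. The endpoints are fixed, so
  the transverse words at both ends of the rows are empty.\<close>

lemma hw_homotopic:
  assumes "homotopic_paths Q p q" shows "\<exists>N. \<forall>M\<ge>N. hw p M \<cong>\<^sub>w hw q M"
proof -
  obtain H where H: "continuous_on ({0..1} \<times> {0..1}) H" "H \<in> {0..1} \<times> {0..1} \<rightarrow> Q"
    "\<And>x. x \<in> {0..1} \<Longrightarrow> H (0::real, x) = p x" "\<And>x. x \<in> {0..1} \<Longrightarrow> H (1, x) = q x"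
    "\<And>t. t \<in> {0..1} \<Longrightarrow> H (t, 0) = p 0 \<and> H (t, 1) = p 1"
  proof -
    obtain H where H: "continuous_on ({0..1} \<times> {0..1}) H" "H \<in> {0..1} \<times> {0..1} \<rightarrow> Q"
      "\<forall>x\<in>{0..1}. H (0::real, x) = p x" "\<forall>x\<in>{0..1}. H (1, x) = q x"
      "\<forall>t\<in>{0..1::real}. pathstart (H \<circ> Pair t) = pathstart p \<and> pathfinish (H \<circ> Pair t) = pathfinish p"
      using assms unfolding homotopic_paths by blast
    show thesis by (rule that[of H]) (use H in \<open>simp_all add: pathstart_def pathfinish_def\<close>)
  qed
  let ?K = "{0..1::real} \<times> {0..1::real}"
  obtain \<delta> where \<delta>: "\<delta> > 0" "\<forall>s\<in>?K. \<forall>t\<in>?K. dist s t < \<delta> \<longrightarrow> near (H s) (H t)"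
    using uniformly_near[of ?K H] H by (auto simp: compact_Times image_subset_iff Pi_iff)
  obtain n where "inverse (real (Suc n)) < \<delta> / 2" using reals_Archimedean[of "\<delta> / 2"] \<delta>(1) by auto
  then obtain N where N: "N > 0" "1 / real N < \<delta> / 2" by (metis inverse_eq_divide zero_less_Suc)
  have "hw p M \<cong>\<^sub>w hw q M" if M: "M \<ge> N" for M
  proof -
    have M0: "M > 0" using M N by simp
    have "1 / real M \<le> 1 / real N" using M N by (simp add: frac_le)
    then have d: "2 / real M < \<delta>" using N by simp
    define r where "r j i = H (real j / real M, real i / real M)" for j i :: nat
    have 01: "real j / real M \<in> {0..1}" if "j \<le> M" for j using that M0 by (auto simp: divide_le_eq)
    have rQ: "r j i \<in> Q" if "j \<le> M" "i \<le> M" for j i using H(2) 01 that unfolding r_def by blast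
    have rn: "near (r j i) (r j' i')"
      if b: "j \<le> M" "i \<le> M" "j' \<le> M" "i' \<le> M" "\<bar>real j - real j'\<bar> \<le> 1" "\<bar>real i - real i'\<bar> \<le> 1" for j i j' i'
    proof -
      have "dist (real j / real M) (real j' / real M) \<le> 1 / real M" "dist (real i / real M) (real i' / real M) \<le> 1 / real M"
        using b(5,6) M0 by (auto simp: dist_real_def divide_right_mono simp flip: diff_divide_distrib)
      moreover have "dist (real j / real M, real i / real M) (real j' / real M, real i' / real M)
         \<le> dist (real j / real M) (real j' / real M) + dist (real i / real M) (real i' / real M)"
        unfolding dist_Pair_Pair by (rule sqrt_sum_squares_le_sum) auto
      ultimately have "dist (real j / real M, real i / real M) (real j' / real M, real i' / real M) < \<delta>" using d by simp
      then show ?thesis unfolding r_def using \<delta>(2) 01 b by blast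
    qed
    \<comment> \<open>Each grid square is cut by a diagonal into two triangles; the cocycle identity
      on both equates the two ways around the square.\<close>
    have ladder: "seqw (r j) 0 i @ cword (r j i) (r (Suc j) i) \<cong>\<^sub>w cword (r j 0) (r (Suc j) 0) @ seqw (r (Suc j)) 0 i"
      if "Suc j \<le> M" "i \<le> M" for i j using that(2)
    proof (induction i)
      case 0
      show ?case using word_eq.refl[OF cword_words] by simp
    next
      case (Suc i)
      let ?A = "seqw (r j) 0 i" and ?B = "seqw (r (Suc j)) 0 i"
      have q: "j \<le> M" "Suc j \<le> M" "i \<le> M" "Suc i \<le> M" using that(1) Suc.prems by auto
      have 1: "cword (r j i) (r j (Suc i)) @ cword (r j (Suc i)) (r (Suc j) (Suc i)) \<cong>\<^sub>w cword (r j i) (r (Suc j) (Suc i))"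
        using q by (intro cword_cocycle rn rQ) auto
      have 2: "cword (r j i) (r (Suc j) i) @ cword (r (Suc j) i) (r (Suc j) (Suc i)) \<cong>\<^sub>w cword (r j i) (r (Suc j) (Suc i))"
        using q by (intro cword_cocycle rn rQ) auto
      have "?A @ (cword (r j i) (r j (Suc i)) @ cword (r j (Suc i)) (r (Suc j) (Suc i)))
         \<cong>\<^sub>w ?A @ (cword (r j i) (r (Suc j) i) @ cword (r (Suc j) i) (r (Suc j) (Suc i)))"
        by (rule word_eq_append_left[OF word_eq.trans[OF 1 word_eq.sym[OF 2]] seqw_words])
      moreover have "(?A @ cword (r j i) (r (Suc j) i)) @ cword (r (Suc j) i) (r (Suc j) (Suc i))
        \<cong>\<^sub>w (cword (r j 0) (r (Suc j) 0) @ ?B) @ cword (r (Suc j) i) (r (Suc j) (Suc i))"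
        using Suc by (intro word_eq_append_right cword_words) auto
      ultimately show ?case by (auto intro: word_eq.trans)
    qed
    have step: "seqw (r j) 0 M \<cong>\<^sub>w seqw (r (Suc j)) 0 M" if j: "Suc j \<le> M" for j
    proof -
      have "r j M = r (Suc j) M" "r j 0 = r (Suc j) 0"
        using H(5)[of "real j / real M"] H(5)[of "real (Suc j) / real M"] 01[of j] 01[of "Suc j"] j M0
        by (simp_all add: r_def)
      then show ?thesis using ladder[OF j order_refl] by simp
    qed
    have "seqw (r 0) 0 M \<cong>\<^sub>w seqw (r j) 0 M" if "j \<le> M" for j
      using that
    proof (induction j)
      case 0
      show ?case by (rule word_eq.refl[OF seqw_words])
    next
      case (Suc j)
      then show ?case using step[of j] by (auto intro: word_eq.trans)
    qed
    then have e: "seqw (r 0) 0 M \<cong>\<^sub>w seqw (r M) 0 M" by simp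
    have cong: "seqw x 0 M = seqw y 0 M" if "\<And>i. i \<le> M \<Longrightarrow> x i = y i" for x y
      unfolding seqw_def by (rule arg_cong[where f = concat], rule map_cong) (use that in auto)
    have "hw p M = seqw (r 0) 0 M" unfolding hw_def by (rule cong) (use H(3) 01 in \<open>auto simp: r_def\<close>)
    moreover have "hw q M = seqw (r M) 0 M" unfolding hw_def by (rule cong) (use H(4) 01 M0 in \<open>auto simp: r_def\<close>)
    ultimately show ?thesis using e by simp
  qed
  then show ?thesis by blast
qed

lemma hw_join:
  assumes "pathfinish p = pathstart q" "M > 0" shows "hw (p +++ q) (2 * M) = hw p M @ hw q M"
proof -
  let ?x = "\<lambda>i. (p +++ q) (real i / real (2 * M))"
  have cong: "seqw x a b = seqw y a' b'" if e: "b - a = b' - a'" "\<And>i. i \<le> b - a \<Longrightarrow> x (a + i) = y (a' + i)" for x y a b a' b'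
  proof -
    have m: "[c..<d] = map (\<lambda>i. c + i) [0..<d - c]" for c d by (rule nth_equalityI) auto
    have "map (\<lambda>i. cword (x (a + i)) (x (Suc (a + i)))) [0..<b - a] = map (\<lambda>i. cword (y (a' + i)) (y (Suc (a' + i)))) [0..<b - a]"
    proof (rule map_cong)
      fix i assume "i \<in> set [0..<b - a]"
      then show "cword (x (a + i)) (x (Suc (a + i))) = cword (y (a' + i)) (y (Suc (a' + i)))"
        using e(2)[of i] e(2)[of "Suc i"] by simp
    qed simp
    then show ?thesis unfolding seqw_def m[of a b] m[of a' b'] map_map o_def e(1) by (rule arg_cong)
  qed
  have "hw (p +++ q) (2 * M) = seqw ?x 0 M @ seqw ?x M (2 * M)" unfolding hw_def by (rule seqw_append) auto
  moreover have "seqw ?x 0 M = hw p M" unfolding hw_def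
  proof (rule cong)
    fix i assume "i \<le> M - 0"
    then have "real i / real (2 * M) \<le> 1/2" using assms(2) by (simp add: divide_simps)
    then show "?x (0 + i) = p (real (0 + i) / real M)" by (simp add: joinpaths_def)
  qed simp
  moreover have "seqw ?x M (2 * M) = hw q M" unfolding hw_def
  proof (rule cong)
    fix i assume "i \<le> 2 * M - M"
    have e: "2 * (real (M + i) / real (2 * M)) - 1 = real i / real M" using assms(2) by (simp add: field_simps)
    show "?x (M + i) = q (real (0 + i) / real M)"
    proof (cases "i = 0")
      case True
      then show ?thesis using assms by (simp add: joinpaths_def pathstart_def pathfinish_def)
    next
      case False
      then have "\<not> real (M + i) / real (2 * M) \<le> 1/2" using assms(2) by (simp add: divide_simps)
      then show ?thesis using e unfolding joinpaths_def by simp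
    qed
  qed simp
  ultimately show ?thesis by simp
qed

definition hol :: "(real \<Rightarrow> 'a) \<Rightarrow> nat group_word \<Rightarrow> bool"
  where "hol p w \<longleftrightarrow> (\<exists>N. \<forall>M\<ge>N. hw p M \<cong>\<^sub>w w)"

lemma hol_homotopic: assumes "homotopic_paths Q p q" "hol p u" "hol q w" shows "u \<cong>\<^sub>w w"
proof -
  obtain N1 N2 N3 where N: "\<forall>M\<ge>N1. hw p M \<cong>\<^sub>w hw q M" "\<forall>M\<ge>N2. hw p M \<cong>\<^sub>w u" "\<forall>M\<ge>N3. hw q M \<cong>\<^sub>w w"
    using hw_homotopic[OF assms(1)] assms(2,3) unfolding hol_def by blast
  let ?M = "max N1 (max N2 N3)"
  have "hw p ?M \<cong>\<^sub>w hw q ?M" "hw p ?M \<cong>\<^sub>w u" "hw q ?M \<cong>\<^sub>w w" using N by simp_all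
  then show ?thesis by (meson word_eq.sym word_eq.trans)
qed

text \<open>An even number of sampling intervals puts a sample at the junction, so the word for
  \<open>M\<close> is compared with the one for \<open>2 * M\<close>.\<close>

lemma hol_join:
  assumes "hol p u" "hol q w" and pq: "path_from Q x y p" "path_from Q y z q"
  shows "hol (p +++ q) (u @ w)"
proof -
  obtain N1 N2 where N: "\<forall>M\<ge>N1. hw p M \<cong>\<^sub>w u" "\<forall>M\<ge>N2. hw q M \<cong>\<^sub>w w"
    using assms(1,2) unfolding hol_def by blast
  obtain N3 where N3: "N3 > 0" "\<forall>M\<ge>N3. \<forall>M'\<ge>N3. hw (p +++ q) M \<cong>\<^sub>w hw (p +++ q) M'"
    using hw_stable path_from_join[OF pq] by (metis path_fromD(1,2))
  let ?N = "max N3 (max N1 N2)"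
  have "hw (p +++ q) M \<cong>\<^sub>w u @ w" if M: "M \<ge> ?N" for M
  proof -
    have "hw (p +++ q) M \<cong>\<^sub>w hw (p +++ q) (2 * M)" using N3 M by simp
    moreover have "hw (p +++ q) (2 * M) = hw p M @ hw q M" using pq M N3(1) by (intro hw_join) (auto simp: path_from_def)
    moreover have "hw p M @ hw q M \<cong>\<^sub>w u @ w" using N M by (intro word_eq_append) auto
    ultimately show ?thesis by (metis word_eq.trans)
  qed
  then show ?thesis unfolding hol_def by blast
qed

lemma hol_const: "hol (\<lambda>_. x) []"
proof -
  have "hw (\<lambda>_. x) M = []" for M by (simp add: hw_def seqw_def)
  then show ?thesis by (simp add: hol_def)
qed

definition enc :: "'c \<times> real \<Rightarrow> nat \<times> bool" where "enc a = (2 * fst (lab a), snd (lab a))"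

lemma tval_edge:
  assumes a: "a \<in> oriented_edges" and t: "t \<in> {0..1}"
  shows "\<exists>z. edge_point a t = \<kappa> (fst a) z \<and> fst a \<in> C \<and> z \<in> cube (cdim (fst a)) \<and>
    (\<forall>h. tval h (fst a) z = (if h = fst (lab a) then if snd (lab a) then t else 1 - t else 0))"
proof -
  let ?d = "fst a" and ?v = "(\<lambda>_::nat. 0::real)(0 := snd a)"
  let ?z = "(\<lambda>_::nat. 0::real)(0 := \<bar>snd a - t\<bar>)"
  note o = oriented_edgesD[OF a]
  have v: "?v \<in> cube_vertices (cdim ?d)" using o by (auto simp: cube_vertices_def)
  have "edge_at ?d ?v 0 a" using a by (auto simp: edge_at_def edge_point_def)
  then have l: "lab a = (if snd a = 0 then dlab ?d 0 else linv (dlab ?d 0))"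
    using dlab[of ?d 0 ?v a] o v by simp
  have "tval h ?d ?z = (if h = fst (lab a) then if snd (lab a) then t else 1 - t else 0)" for h
  proof (cases "h = fst (lab a)")
    case True
    then have "tval h ?d ?z = (if snd (dlab ?d 0) then \<bar>snd a - t\<bar> else 1 - \<bar>snd a - t\<bar>)"
      using tval_eq[of ?d 0 h ?z] o l by auto
    then show ?thesis using True l o t by (auto split: if_splits)
  next
    case False
    then have "\<not> (\<exists>i<cdim ?d. fst (dlab ?d i) = h)" using o l by auto
    then show ?thesis using False tval_none by simp
  qed
  moreover have "?z \<in> cube (cdim ?d)" using o t by (auto simp: cube_def)
  ultimately show ?thesis using o by (intro exI[of _ ?z]) (simp add: edge_point_def)
qed

lemma cword_single:
  assumes "h < nhyp" "\<And>k. k < nhyp \<Longrightarrow> k \<noteq> h \<Longrightarrow> crossing x y k = []" shows "cword x y = crossing x y h"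
proof -
  have "[0..<nhyp] = [0..<h] @ h # [Suc h..<nhyp]"
    using upt_add_eq_append[of 0 h "nhyp - h"] upt_conv_Cons[of h nhyp] assms(1) by simp
  moreover have "concat (map (crossing x y) [0..<h]) = []" "concat (map (crossing x y) [Suc h..<nhyp]) = []"
    using assms by (simp_all add: concat_eq_Nil_conv)
  ultimately show ?thesis unfolding cword_def by (metis append.right_neutral append_Nil concat.simps(2) concat_append list.simps(9) map_append)
qed

lemma hol_edge:
  assumes a: "a \<in> oriented_edges" shows "hol (edge_point a) [enc a]"
proof -
  define h b where "h = fst (lab a)" and "b = snd (lab a)"
  have h: "h < nhyp" using lab(1)[OF a] by (simp add: h_def)
  have co: "hcoord F k (edge_point a t) = F (if k = h then if b then t else 1 - t else 0)"
    if F: "F 0 = F 1" "t \<in> {0..1}" for F k t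
  proof -
    obtain z where "edge_point a t = \<kappa> (fst a) z" "fst a \<in> C" "z \<in> cube (cdim (fst a))"
      "\<forall>h. tval h (fst a) z = (if h = fst (lab a) then if snd (lab a) then t else 1 - t else 0)"
      using tval_edge[OF a F(2)] by blast
    then show ?thesis using hcoord_kappa[of F "fst a" z k] F(1) by (simp add: h_def b_def)
  qed
  \<comment> \<open>The convention for points on the wall follows the representative edge, so the
    midpoint of an edge with negative label is not yet past the wall.\<close>
  define past where "past t \<longleftrightarrow> (if b then t \<ge> 1/2 else t > (1/2::real))" for t
  have cw: "cword (edge_point a s) (edge_point a t) =
      (if wave s < 1/4 \<and> wave t < 1/4 \<and> past t \<noteq> past s then [(2 * h, past t = b)] else [])"
    if st: "s \<in> {0..1}" "t \<in> {0..1}" for s t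
  proof -
    have "cword (edge_point a s) (edge_point a t) = crossing (edge_point a s) (edge_point a t) h"
      by (rule cword_single[OF h]) (use st co[of wave] in \<open>simp add: crossing_def\<close>)
    moreover have A: "hA h (edge_point a u) = wave u" if "u \<in> {0..1}" for u using co[of wave u h] that by simp
    moreover have B: "hB h (edge_point a u) \<le> 0 \<longleftrightarrow> (past u = b)" if u: "u \<in> {0..1}" "wave u < 1/4" for u
      using co[of owave u h] u wave_owave[OF u(2)] owave_flip[of u] by (auto simp: past_def)
    ultimately show ?thesis using st by (auto simp: crossing_def)
  qed
  \<comment> \<open>From 9 intervals on the step is below 1/8, so the samples on either side of the
    midpoint meet the threshold 1/4 and the crossing is recorded exactly once.\<close>
  have "hw (edge_point a) M = [(2 * h, b)]" if M: "M \<ge> 9" for M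
  proof -
    have "seqw (\<lambda>i. edge_point a (real i / real M)) 0 i = (if past (real i / real M) then [(2 * h, b)] else [])"
      if "i \<le> M" for i using that
    proof (induction i)
      case 0
      show ?case by (simp add: past_def)
    next
      case (Suc i)
      let ?s = "real i / real M" and ?t = "real (Suc i) / real M"
      have M0: "real M > 0" using M by simp
      have 01: "?s \<in> {0..1}" "?t \<in> {0..1}" using Suc.prems M0 by (auto simp: divide_le_eq)
      have st: "?t = ?s + 1 / real M" by (simp add: add_divide_distrib)
      have small: "1 / real M < 1/8" "1 / real M > 0" using M by (auto simp: divide_simps)
      have "?s < ?t" unfolding st using small(2) by linarith
      moreover have "past s \<Longrightarrow> s < t \<Longrightarrow> past t" for s t unfolding past_def by (auto split: if_splits)
      ultimately have mono: "past ?s \<Longrightarrow> past ?t" by blast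
      have close: "wave ?s < 1/4 \<and> wave ?t < 1/4" if "past ?t" "\<not> past ?s"
      proof -
        have "wave s < 1/4 \<and> wave t < 1/4" if "past t" "\<not> past s" "t = s + e" "e < 1/8" "e > 0" for s t e
          using that unfolding past_def wave_def by (auto split: if_splits simp: abs_if)
        then show ?thesis using that st small by blast
      qed
      show ?case using Suc cw[OF 01] mono close by auto
    qed
    from this[of M] show ?thesis using M by (simp add: hw_def past_def)
  qed
  moreover have "[(2 * h, b)] \<in> words pa.V" using even_letter_V[OF h] by simp
  ultimately show ?thesis unfolding hol_def enc_def h_def[symmetric] b_def[symmetric]
    by (intro exI[of _ 9]) (auto simp del: in_words_iff intro: word_eq.refl)
qed

lemma hol_epath: "chain as x y \<Longrightarrow> x \<in> Q \<Longrightarrow> hol (epath as x) (map enc as)"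
proof (induction as arbitrary: x)
  case Nil
  then show ?case using hol_const by simp
next
  case (Cons a as)
  then have a: "a \<in> oriented_edges" "chain as (edge_end a) y" by auto
  note q = edge_ends_in_Q[OF a(1)]
  show ?case
    using hol_join[OF hol_edge[OF a(1)] Cons.IH[OF a(2) q(2)] path_from_edge[OF a(1)] path_from_epath[OF a(2) q(2)]] by simp
qed

lemma homotopic_epaths_word_eq:
  assumes "chain as x y" "chain bs x y" "x \<in> Q" "homotopic_paths Q (epath as x) (epath bs x)"
  shows "map enc as \<cong>\<^sub>w map enc bs"
  using hol_homotopic[OF assms(4) hol_epath[OF assms(1,3)] hol_epath[OF assms(2,3)]] .

end

section \<open>Edge loops, rewriting steps and homotopy classes\<close>

section \<open>The fundamental group as the fixed subgroup\<close>

lemma conjugate_homotopic: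
  assumes A: "path_from S x y A" and E: "path_from S y y E"
  shows "homotopic_paths S ((reversepath A +++ (A +++ (E +++ reversepath A))) +++ A) E"
proof -
  note rA = path_from_reverse[OF A] and T = path_from_join[OF E path_from_reverse[OF A]]
  have y: "y \<in> S" using A by (auto simp: path_from_def pathfinish_def path_image_def)
  note yy = path_from_const[OF y]
  have "homotopic_paths S (reversepath A +++ (A +++ (E +++ reversepath A))) ((reversepath A +++ A) +++ (E +++ reversepath A))"
    by (rule homotopic_paths_assoc_from[OF rA A T])
  moreover have rAA: "homotopic_paths S (reversepath A +++ A) (\<lambda>_. y)"
    using homotopic_paths_inv_left[of A S] A by (simp add: path_from_def)
  then have "homotopic_paths S ((reversepath A +++ A) +++ (E +++ reversepath A)) ((\<lambda>_. y) +++ (E +++ reversepath A))"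
    by (rule homotopic_paths_join_from[OF _ homotopic_paths_reflI[OF T] path_from_join[OF rA A] T])
  moreover have "homotopic_paths S ((\<lambda>_. y) +++ (E +++ reversepath A)) (E +++ reversepath A)"
    by (rule homotopic_paths_const_left) (use T in \<open>auto simp: path_from_def\<close>)
  ultimately have "homotopic_paths S (reversepath A +++ (A +++ (E +++ reversepath A))) (E +++ reversepath A)"
    by (meson homotopic_paths_trans)
  then have "homotopic_paths S ((reversepath A +++ (A +++ (E +++ reversepath A))) +++ A) ((E +++ reversepath A) +++ A)"
    by (rule homotopic_paths_join_from[OF _ homotopic_paths_reflI[OF A] path_from_join[OF rA path_from_join[OF A T]] A])
  moreover have "homotopic_paths S ((E +++ reversepath A) +++ A) (E +++ (reversepath A +++ A))"
    by (rule homotopic_paths_sym[OF homotopic_paths_assoc_from[OF E rA A]])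
  moreover have "homotopic_paths S (E +++ (reversepath A +++ A)) (E +++ (\<lambda>_. y))"
    by (rule homotopic_paths_join_from[OF homotopic_paths_reflI[OF E] rAA E path_from_join[OF rA A]])
  moreover have "homotopic_paths S (E +++ (\<lambda>_. y)) E"
    by (rule homotopic_paths_const_right) (use E in \<open>auto simp: path_from_def\<close>)
  ultimately show ?thesis by (meson homotopic_paths_trans)
qed

lemma conjugate_homotopicD:
  assumes A: "path_from S x y A" and E: "path_from S y y E" and F: "path_from S y y F"
    and h: "homotopic_paths S (A +++ (E +++ reversepath A)) (A +++ (F +++ reversepath A))"
  shows "homotopic_paths S E F"
proof -
  note rA = path_from_reverse[OF A]
  note AE = path_from_join[OF A path_from_join[OF E rA]]
  have "homotopic_paths S (reversepath A +++ (A +++ (E +++ reversepath A))) (reversepath A +++ (A +++ (F +++ reversepath A)))"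
    by (rule homotopic_paths_join_from[OF homotopic_paths_reflI[OF rA] h rA AE])
  then have "homotopic_paths S ((reversepath A +++ (A +++ (E +++ reversepath A))) +++ A) ((reversepath A +++ (A +++ (F +++ reversepath A))) +++ A)"
    by (rule homotopic_paths_join_from[OF _ homotopic_paths_reflI[OF A] path_from_join[OF rA AE] A])
  then show ?thesis using conjugate_homotopic[OF A E] conjugate_homotopic[OF A F]
    by (meson homotopic_paths_sym homotopic_paths_trans)
qed

definition path_class :: "'a::topological_space set \<Rightarrow> (real \<Rightarrow> 'a) \<Rightarrow> (real \<Rightarrow> 'a) set"
  where "path_class S f = {h. homotopic_paths S f h}"

lemma path_class_eqI: "homotopic_paths S f g \<Longrightarrow> path_class S f = path_class S g"
  unfolding path_class_def by (auto intro: homotopic_paths_trans homotopic_paths_sym)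

lemma path_class_eqD: "path_from S x y g \<Longrightarrow> path_class S f = path_class S g \<Longrightarrow> homotopic_paths S f g"
  unfolding path_class_def using homotopic_paths_reflI by blast

lemma loops_at_path_from: "loops_at S x = {f. path_from S x x f}"
  by (simp add: loops_at_def path_from_def)

lemma carrier_fundamental_group: "carrier (fundamental_group S x) = path_class S ` loops_at S x"
  by (auto simp: fundamental_group_def quotient_def path_class_def)

lemma mult_fundamental_group:
  assumes "path_from S x x f" "path_from S x x g"
  shows "path_class S f \<otimes>\<^bsub>fundamental_group S x\<^esub> path_class S g = path_class S (f +++ g)"
proof -
  have "path_class S (f' +++ g') = path_class S (f +++ g)" if "f' \<in> path_class S f" "g' \<in> path_class S g" for f' g'
    using path_class_eqI[OF homotopic_paths_join_from[OF _ _ assms]] that unfolding path_class_def by blast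
  then have "(\<Union>f'\<in>path_class S f. \<Union>g'\<in>path_class S g. path_class S (f' +++ g')) =
      (\<Union>f'\<in>path_class S f. \<Union>g'\<in>path_class S g. path_class S (f +++ g))" by simp
  moreover have "f \<in> path_class S f" "g \<in> path_class S g"
    using homotopic_paths_reflI[OF assms(1)] homotopic_paths_reflI[OF assms(2)] by (simp_all add: path_class_def)
  then have "(\<Union>f'\<in>path_class S f. \<Union>g'\<in>path_class S g. path_class S (f +++ g)) = path_class S (f +++ g)" by auto
  moreover have "path_class S f \<otimes>\<^bsub>fundamental_group S x\<^esub> path_class S g =
      (\<Union>f'\<in>path_class S f. \<Union>g'\<in>path_class S g. path_class S (f' +++ g'))"
    by (simp add: fundamental_group_def path_class_def)
  ultimately show ?thesis by simp
qed

context finite_special_cube_complex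
begin

lemma edge_with_own: "a \<in> oriented_edges \<Longrightarrow> edge_with (edge_start a) (lab a) a"
  by (simp add: edge_with_def)

lemma linv_enc: "a \<in> oriented_edges \<Longrightarrow> enc (edge_reverse a) = linv (enc a)"
  by (simp add: enc_def lab_reverse linv_def)

lemma enc_eq_iff: "enc a = enc b \<longleftrightarrow> lab a = lab b"
  by (auto simp: enc_def prod_eq_iff)

lemma enc_rchain: "chain as x y \<Longrightarrow> map enc (rchain as) = winv (map enc as)"
  by (induction as arbitrary: x) (auto simp: rchain_def linv_enc)

lemma enc_words: "chain as x y \<Longrightarrow> map enc as \<in> words pa.V"
  by (induction as arbitrary: x) (auto simp: enc_def even_letter_V[OF lab(1)])

lemma epath_cong:
  assumes c: "chain as x p" "chain ms p r" "chain ns p r" "chain bs r y" and x: "x \<in> Q"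
    and h: "homotopic_paths Q (epath ms p) (epath ns p)"
  shows "homotopic_paths Q (epath (as @ ms @ bs) x) (epath (as @ ns @ bs) x)"
proof -
  note A = path_from_epath[OF c(1) x]
  have p: "p \<in> Q" using A by (auto simp: path_from_def pathfinish_def path_image_def)
  note M = path_from_epath[OF c(2) p]
  have r: "r \<in> Q" using M by (auto simp: path_from_def pathfinish_def path_image_def)
  note B = path_from_epath[OF c(4) r]
  have split: "homotopic_paths Q (epath (as @ ms @ bs) x) (epath as x +++ (epath ms p +++ epath bs r))"
    if "chain ms p r" for ms
  proof -
    have "chain (ms @ bs) p y" using that c(4) chain_append by blast
    from epath_append[OF c(1) this x] path_from_epath[OF this p]
    show ?thesis using homotopic_paths_trans homotopic_paths_join_from[OF homotopic_paths_reflI[OF A]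
      epath_append[OF that c(4) p] A] by blast
  qed
  have "homotopic_paths Q (epath as x +++ (epath ms p +++ epath bs r)) (epath as x +++ (epath ns p +++ epath bs r))"
    by (rule homotopic_paths_join_from[OF homotopic_paths_reflI[OF A]
      homotopic_paths_join_from[OF h homotopic_paths_reflI[OF B] M B] A path_from_join[OF M B]])
  then show ?thesis using split[OF c(2)] split[OF c(3)] by (meson homotopic_paths_sym homotopic_paths_trans)
qed

lemma epath_pair:
  assumes "chain [a, b] x y" "x \<in> Q" shows "homotopic_paths Q (epath [a, b] x) (edge_point a +++ edge_point b)"
proof -
  have o: "a \<in> oriented_edges" "b \<in> oriented_edges" "edge_start b = edge_end a" "edge_start a = x" using assms by auto
  have "chain [b] (edge_end a) y" using assms by auto
  from homotopic_paths_join_from[OF homotopic_paths_reflI[OF path_from_edge[OF o(1)]] epath_single[OF o(2)]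
      path_from_edge[OF o(1)] path_from_epath[OF this edge_ends_in_Q(2)[OF o(1)]]]
  show ?thesis by simp
qed

lemma epath_back: assumes "a \<in> oriented_edges" "edge_start a = x" shows "homotopic_paths Q (epath [a, edge_reverse a] x) (\<lambda>_. x)"
proof -
  note P = path_from_edge[OF assms(1)]
  have c: "chain [a, edge_reverse a] x x" using assms by simp
  have x: "x \<in> Q" using edge_ends_in_Q(1)[OF assms(1)] assms(2) by simp
  have e: "edge_point (edge_reverse a) = reversepath (edge_point a)"
  proof
    fix t :: real
    have "\<bar>1 - snd a - t\<bar> = \<bar>snd a - (1 - t)\<bar>" by linarith
    then show "edge_point (edge_reverse a) t = reversepath (edge_point a) t"
      by (simp add: edge_point_def edge_reverse_def reversepath_def)
  qed
  have "homotopic_paths Q (edge_point a +++ edge_point (edge_reverse a)) (\<lambda>_. x)"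
    using homotopic_paths_inv_right[of "edge_point a" Q] P assms(2) by (simp add: e path_from_def)
  then show ?thesis using epath_pair[OF c x] by (meson homotopic_paths_trans)
qed

text \<open>The square is found at the middle vertex, where the reversal of \<open>a\<close> and the
  edge \<open>b\<close> both start; its other two sides form the exchanged path. Both paths run in
  this square, so they are homotopic.\<close>

lemma epath_swap:
  assumes c: "chain [a, b] x y" and e: "{fst (enc a), fst (enc b)} \<in> pa.E"
  shows "\<exists>a' b'. chain [b', a'] x y \<and> enc a' = enc a \<and> enc b' = enc b \<and>
    homotopic_paths Q (epath [a, b] x) (epath [b', a'] x)"
proof -
  have o: "a \<in> oriented_edges" "b \<in> oriented_edges" "edge_start b = edge_end a" "edge_start a = x" "edge_end b = y"
    using c by auto
  have x: "x \<in> Q" using edge_ends_in_Q(1)[OF o(1)] o(4) by simp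
  have E0: "{fst (linv (lab a)), fst (lab b)} \<in> E0" using e by (simp add: pa.E_iff enc_def)
  have "edge_with (edge_end a) (linv (lab a)) (edge_reverse a)" "edge_with (edge_end a) (lab b) b"
    using edge_with_reverse[OF edge_with_own[OF o(1)]] edge_with_own[OF o(2)] o(3) by simp_all
  then obtain d v i j a1 b1 where s: "(d, v) \<in> corners" "cdim d = 2" "i < 2" "j < 2" "i \<noteq> j"
    "edge_at d v i (edge_reverse a)" "edge_at d v j b"
    "edge_at d (v(j := 1 - v j)) i a1" "edge_at d (v(i := 1 - v i)) j b1"
    "edge_with (edge_end b) (linv (lab a)) a1" "edge_with (edge_end (edge_reverse a)) (lab b) b1" "edge_end a1 = edge_end b1"
    using complete_square[OF _ _ E0] by metis
  have d: "d \<in> C" and v: "v \<in> cube_vertices (cdim d)" and ij: "i < cdim d" "j < cdim d" using s by (auto simp: corners_def)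
  have vs: "v(i := 1 - v i) \<in> cube_vertices (cdim d)" "v(j := 1 - v j) \<in> cube_vertices (cdim d)"
    using v ij by (auto simp: cube_vertices_def)
  define w where "w = v(i := 1 - v i, j := 1 - v j)"
  have w: "w \<in> cube_vertices (cdim d)" using v ij by (auto simp: cube_vertices_def w_def)
  have o1: "a1 \<in> oriented_edges" "lab a1 = linv (lab a)" "edge_start a1 = y" "b1 \<in> oriented_edges" "lab b1 = lab b" "edge_start b1 = x"
    using s(10,11) o by (auto simp: edge_with_def)
  have c': "chain [b1, edge_reverse a1] x y" using o1 s(12) by simp
  have l: "path_from (cube (cdim d)) u u' (\<lambda>t. lerp t u u')" if "u \<in> cube_vertices (cdim d)" "u' \<in> cube_vertices (cdim d)" for u u'
    using that vertices_sub lerp_path by blast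
  have "edge_at d (v(i := 1 - v i)) i a" using edge_at_flip[OF s(6) v ij(1)] by simp
  from edge_at_lerp[OF this vs(1) ij(1)]
  have ha: "homotopic_paths Q (edge_point a) (\<kappa> d \<circ> (\<lambda>t. lerp t (v(i := 1 - v i)) v))" by simp
  have hb: "homotopic_paths Q (edge_point b) (\<kappa> d \<circ> (\<lambda>t. lerp t v (v(j := 1 - v j))))"
    by (rule edge_at_lerp[OF s(7) v ij(2)])
  have hb1: "homotopic_paths Q (edge_point b1) (\<kappa> d \<circ> (\<lambda>t. lerp t (v(i := 1 - v i)) w))"
    using edge_at_lerp[OF s(9) vs(1) ij(2)] s(5) by (simp add: w_def)
  have "(v(j := 1 - v j))(i := 1 - (v(j := 1 - v j)) i) = w" using s(5) by (auto simp: w_def fun_eq_iff)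
  moreover have "w(i := 1 - w i) = v(j := 1 - v j)" using s(5) by (auto simp: w_def fun_eq_iff)
  ultimately have "edge_at d w i (edge_reverse a1)" "w(i := 1 - w i) = v(j := 1 - v j)"
    using edge_at_flip[OF s(8) vs(2) ij(1)] by simp_all
  from edge_at_lerp[OF this(1) w ij(1)] this(2)
  have ha1: "homotopic_paths Q (edge_point (edge_reverse a1)) (\<kappa> d \<circ> (\<lambda>t. lerp t w (v(j := 1 - v j))))" by simp
  have pa: "path_from Q x (edge_end a) (edge_point a)" "path_from Q (edge_end a) y (edge_point b)"
    "path_from Q x (edge_end b1) (edge_point b1)" "path_from Q (edge_end b1) y (edge_point (edge_reverse a1))"
    using path_from_edge[OF o(1)] path_from_edge[OF o(2)] path_from_edge[OF o1(4)] path_from_edge[of "edge_reverse a1"] o o1 s(12) by auto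
  have "homotopic_paths Q (epath [a, b] x) (edge_point a +++ edge_point b)" by (rule epath_pair[OF c x])
  also have "homotopic_paths Q \<dots> (\<kappa> d \<circ> ((\<lambda>t. lerp t (v(i := 1 - v i)) v) +++ (\<lambda>t. lerp t v (v(j := 1 - v j)))))"
    unfolding path_compose_join by (rule homotopic_paths_join_from[OF ha hb pa(1,2)])
  also have "homotopic_paths Q \<dots> (\<kappa> d \<circ> ((\<lambda>t. lerp t (v(i := 1 - v i)) w) +++ (\<lambda>t. lerp t w (v(j := 1 - v j)))))"
    by (rule homotopic_kappa[OF d path_from_join[OF l l] path_from_join[OF l l]]) (use v vs w in auto)
  also have "homotopic_paths Q \<dots> (edge_point b1 +++ edge_point (edge_reverse a1))"
    unfolding path_compose_join by (rule homotopic_paths_sym[OF homotopic_paths_join_from[OF hb1 ha1 pa(3,4)]])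
  also have "homotopic_paths Q \<dots> (epath [b1, edge_reverse a1] x)" by (rule homotopic_paths_sym[OF epath_pair[OF c' x]])
  finally have "homotopic_paths Q (epath [a, b] x) (epath [b1, edge_reverse a1] x)" .
  moreover have "enc b1 = enc b" "enc (edge_reverse a1) = enc a"
    using o1 by (simp_all add: enc_eq_iff lab_reverse)
  ultimately show ?thesis using c' by blast
qed

text \<open>Labels determine edges: by \<open>edge_with_unique\<close> a cancelling pair of labels
  is an edge followed by its own reversal, and \<open>epath_swap\<close> realises a commutation. So
  each rewriting step lifts to a homotopy.\<close>

lemma rstep_epath:
  assumes "rg.rstep u w" "map enc as = u" "chain as x y" "x \<in> Q"
  shows "\<exists>bs. chain bs x y \<and> map enc bs = w \<and> homotopic_paths Q (epath as x) (epath bs x)"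
  using assms
proof (induction rule: rg.rstep.induct)
  case (swap u w l m)
  then obtain as1 a b as2 where as: "as = as1 @ [a, b] @ as2" "map enc as1 = u" "enc a = l" "enc b = m" "map enc as2 = w"
    by (auto simp: map_eq_append_conv Cons_eq_map_conv map_eq_Cons_conv)
  obtain p r where c: "chain as1 x p" "chain [a, b] p r" "chain as2 r y"
    using swap.prems(2) unfolding as(1) chain_append by blast
  obtain a' b' where n: "chain [b', a'] p r" "enc a' = l" "enc b' = m" "homotopic_paths Q (epath [a, b] p) (epath [b', a'] p)"
    using epath_swap[OF c(2)] swap.hyps(3) as(3,4) by metis
  have "chain (as1 @ [b', a'] @ as2) x y" using c n(1) unfolding chain_append by blast
  then show ?case using epath_cong[OF c(1,2) n(1) c(3) swap.prems(3) n(4)] as n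
    by (intro exI[of _ "as1 @ [b', a'] @ as2"]) simp
next
  case (del u w l)
  then obtain as1 a b as2 where as: "as = as1 @ [a, b] @ as2" "map enc as1 = u" "enc a = l" "enc b = linv l" "map enc as2 = w"
    by (auto simp: map_eq_append_conv Cons_eq_map_conv map_eq_Cons_conv)
  obtain p r where c: "chain as1 x p" "chain [a, b] p r" "chain as2 r y"
    using del.prems(2) unfolding as(1) chain_append by blast
  then have o: "a \<in> oriented_edges" "b \<in> oriented_edges" "edge_start b = edge_end a" "edge_start a = p" "edge_end b = r" by auto
  have "enc (edge_reverse a) = enc b" using as linv_enc[OF o(1)] by simp
  then have "edge_with (edge_end a) (linv (lab a)) b"
    using o lab_reverse[OF o(1)] enc_eq_iff by (simp add: edge_with_def)
  then have b: "b = edge_reverse a" using edge_with_unique edge_with_reverse[OF edge_with_own[OF o(1)]] by blast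
  then have r: "r = p" using o by simp
  have h: "homotopic_paths Q (epath [a, b] p) (epath [] p)" using epath_back[OF o(1,4)] unfolding b by simp
  have "chain [] p r" using r by simp
  from epath_cong[OF c(1,2) this c(3) del.prems(3) h] have "homotopic_paths Q (epath as x) (epath (as1 @ as2) x)" using as by simp
  moreover have "chain (as1 @ as2) x y" using c r chain_append by blast
  ultimately show ?case using as by (intro exI[of _ "as1 @ as2"]) simp
qed

lemma rsteps_epath:
  assumes "rg.rstep\<^sup>*\<^sup>* u w" "map enc as = u" "chain as x y" "x \<in> Q"
  shows "\<exists>bs. chain bs x y \<and> map enc bs = w \<and> homotopic_paths Q (epath as x) (epath bs x)"
  using assms
proof (induction rule: rtranclp_induct)
  case base
  then show ?case using homotopic_paths_reflI[OF path_from_epath] by blast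
next
  case (step v w)
  then obtain bs where bs: "chain bs x y" "map enc bs = v" "homotopic_paths Q (epath as x) (epath bs x)" by blast
  obtain cs where "chain cs x y" "map enc cs = w" "homotopic_paths Q (epath bs x) (epath cs x)"
    using rstep_epath[OF step.hyps(2) bs(2,1) step.prems(3)] by blast
  then show ?case using bs(3) homotopic_paths_trans by blast
qed

lemma trivial_epath:
  assumes "chain as x y" "x \<in> Q" "map enc as \<cong>\<^sub>w []"
  shows "homotopic_paths Q (epath as x) (epath [] x)"
  using rsteps_epath[OF rg.trivial_word_rsteps[OF assms(3)] HOL.refl assms(1,2)] by auto

text \<open>Equality is turned into triviality of closed paths, for which rewriting without
  insertions suffices: \<open>as\<close> followed by the reversal of \<open>bs\<close> contracts,
  and so does that reversal followed by \<open>bs\<close>.\<close>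

lemma word_eq_homotopic_epaths:
  assumes c: "chain as x y" "chain bs x y" "x \<in> Q" and e: "map enc as \<cong>\<^sub>w map enc bs"
  shows "homotopic_paths Q (epath as x) (epath bs x)"
proof -
  let ?r = "rchain bs"
  note r = chain_rchain[OF c(2)]
  have y: "y \<in> Q" using path_from_epath[OF c(1,3)] by (auto simp: path_from_def pathfinish_def path_image_def)
  note w = enc_words[OF c(1)] enc_words[OF c(2)]
  have "map enc (as @ ?r) \<cong>\<^sub>w []"
    using word_eq.trans[OF word_eq_append_right[OF e, of "winv (map enc bs)"] word_eq_winv_right[OF w(2)]] w
    by (simp add: enc_rchain[OF c(2)] winv_in_words del: in_words_iff)
  moreover have "chain (as @ ?r) x x" using c(1) r chain_append by blast
  ultimately have 1: "homotopic_paths Q (epath (as @ ?r) x) (epath [] x)" using trivial_epath c(3) by blast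
  have "map enc (?r @ bs) \<cong>\<^sub>w []"
    using word_eq_winv_left[OF w(2)] by (simp add: enc_rchain[OF c(2)])
  moreover have "chain (?r @ bs) y y" using c(2) r chain_append by blast
  ultimately have 2: "homotopic_paths Q (epath (?r @ bs) y) (epath [] y)" using trivial_epath y by blast
  have "homotopic_paths Q (epath ([] @ (as @ ?r) @ bs) x) (epath ([] @ [] @ bs) x)"
    by (rule epath_cong[OF _ _ _ c(2) c(3) 1]) (use c(1) r chain_append in auto)
  moreover have "homotopic_paths Q (epath (as @ (?r @ bs) @ []) x) (epath (as @ [] @ []) x)"
    by (rule epath_cong[OF c(1) _ _ _ c(3) 2]) (use c(2) r chain_append in auto)
  ultimately show ?thesis using homotopic_paths_sym homotopic_paths_trans by fastforce
qed

end

locale based_special_cube_complex = finite_special_cube_complex Q C cdim \<kappa>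
  for Q :: "'a::topological_space set" and C :: "'c set" and cdim \<kappa> +
  fixes q :: 'a
  assumes q: "q \<in> Q"
begin

abbreviation "base \<equiv> near_vertex q"

lemma base: "base \<in> vertices" by (rule near_vertex_vertex[OF q])
lemma base_Q: "base \<in> Q" by (rule vertex_in_Q[OF base])

sublocale au: automaton pa.V pa.E vertices base pa.step pa.subst 6
  by (rule pa.automaton[OF base])

lemma chain_run_trans:
  "chain as x y \<Longrightarrow> au.run x (map enc as) = y \<and> au.trans x (map enc as) = map enc as"
proof (induction as arbitrary: x)
  case (Cons a as)
  have p: "pst x (fst (lab a), snd (lab a)) = Some (edge_end a)"
    using edge_with_own[of a] Cons.prems unfolding prod.collapse pst_iff by (intro exI[of _ a]) auto
  have "pa.subst x (enc a) = enc a" unfolding pa.subst_fixed_iff enc_def using p by blast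
  moreover have "pa.step x (enc a) = edge_end a" unfolding enc_def by (rule pa.step_pst[OF p])
  ultimately show ?case using Cons by simp
qed simp

text \<open>By \<open>pa.subst_fixed_iff\<close> a fixed letter is the label of an actual edge at
  the current state, so the edge path is read off letter by letter.\<close>

lemma fixed_word_chain:
  "au.trans x w = w \<Longrightarrow> \<exists>as. chain as x (au.run x w) \<and> map enc as = w"
proof (induction w arbitrary: x)
  case Nil
  show ?case by (intro exI[of _ "[]"]) simp
next
  case (Cons l w)
  then have s: "pa.subst x l = l" and t: "au.trans (pa.step x l) w = w" by simp_all
  obtain h b y where l: "l = (2 * h, b)" "pst x (h, b) = Some y" using s unfolding pa.subst_fixed_iff by blast
  obtain a where a: "edge_with x (h, b) a" "edge_end a = y" using l(2) unfolding pst_iff by blast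
  have y: "pa.step x l = y" unfolding l(1) by (rule pa.step_pst[OF l(2)])
  obtain as where "chain as y (au.run y w)" "map enc as = w" using Cons.IH[OF t] y by auto
  then show ?case using a l(1) y by (intro exI[of _ "a # as"]) (auto simp: edge_with_def enc_def)
qed

abbreviation "chain_cls as \<equiv> rg.cls (map enc as)"

lemma fixed_points_eq: "fixed_points au.GR au.\<phi> = {chain_cls as | as. chain as base base}"
proof -
  have "(w \<in> words pa.V \<and> au.run base w = base \<and> au.trans base w = w) \<longleftrightarrow> (\<exists>as. chain as base base \<and> map enc as = w)" for w
  proof
    assume "w \<in> words pa.V \<and> au.run base w = base \<and> au.trans base w = w"
    then show "\<exists>as. chain as base base \<and> map enc as = w" using fixed_word_chain[of base w] by auto
  next
    assume "\<exists>as. chain as base base \<and> map enc as = w"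
    then obtain as where as: "chain as base base" "map enc as = w" by blast
    then show "w \<in> words pa.V \<and> au.run base w = base \<and> au.trans base w = w"
      using chain_run_trans[OF as(1)] enc_words[OF as(1)] unfolding as(2) by blast
  qed
  then have "{rg.cls w | w. w \<in> words pa.V \<and> au.run base w = base \<and> au.trans base w = w} =
      {rg.cls w | w. \<exists>as. chain as base base \<and> map enc as = w}" by (simp only:)
  also have "\<dots> = {chain_cls as | as. chain as base base}" by blast
  finally show ?thesis unfolding au.fixed_points_\<phi> .
qed

text \<open>The base point \<open>q\<close> need not be a vertex, so closed edge paths at
  \<open>base\<close> are conjugated by the connecting path.\<close>

definition loop_of :: "('c \<times> real) list \<Rightarrow> real \<Rightarrow> 'a"
  where "loop_of as = vertex_path q +++ (epath as base +++ reversepath (vertex_path q))"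

lemma path_from_loop_of: "chain as base base \<Longrightarrow> path_from Q q q (loop_of as)"
  unfolding loop_of_def using path_from_vertex_path[OF q] path_from_epath[OF _ base_Q]
  by (meson path_from_join path_from_reverse)

lemma loop_of_homotopic_iff:
  assumes "chain as base base" "chain bs base base"
  shows "homotopic_paths Q (loop_of as) (loop_of bs) \<longleftrightarrow> chain_cls as = chain_cls bs"
proof -
  note P = path_from_vertex_path[OF q] and E = path_from_epath[OF assms(1) base_Q] path_from_epath[OF assms(2) base_Q]
  note rP = path_from_reverse[OF P]
  have "homotopic_paths Q (loop_of as) (loop_of bs) \<longleftrightarrow> homotopic_paths Q (epath as base) (epath bs base)"
    using conjugate_homotopicD[OF P E] homotopic_paths_join_from[OF homotopic_paths_reflI[OF P]
      homotopic_paths_join_from[OF _ homotopic_paths_reflI[OF rP] E(1) rP] P path_from_join[OF E(1) rP]]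
    unfolding loop_of_def by blast
  then show ?thesis
    using homotopic_epaths_word_eq[OF assms base_Q] word_eq_homotopic_epaths[OF assms base_Q]
      rg.cls_eq_iff[OF enc_words[OF assms(2)]] by blast
qed

lemma loop_of_append:
  assumes "chain as base base" "chain bs base base"
  shows "homotopic_paths Q (loop_of (as @ bs)) (loop_of as +++ loop_of bs)"
proof -
  note P = path_from_vertex_path[OF q] and E = path_from_epath[OF assms(1) base_Q] path_from_epath[OF assms(2) base_Q]
  note rP = path_from_reverse[OF P]
  have "chain (as @ bs) base base" using assms chain_append by blast
  note EE = path_from_epath[OF this base_Q]
  have "homotopic_paths Q (loop_of (as @ bs)) (vertex_path q +++ ((epath as base +++ epath bs base) +++ reversepath (vertex_path q)))"
    unfolding loop_of_def by (rule homotopic_paths_join_from[OF homotopic_paths_reflI[OF P]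
      homotopic_paths_join_from[OF epath_append[OF assms base_Q] homotopic_paths_reflI[OF rP] EE rP] P path_from_join[OF EE rP]])
  moreover have "homotopic_paths Q (loop_of as +++ loop_of bs)
      (vertex_path q +++ ((epath as base +++ epath bs base) +++ reversepath (vertex_path q)))"
    unfolding loop_of_def by (rule homotopic_paths_splice[OF P E(1) P E(2) P])
  ultimately show ?thesis by (meson homotopic_paths_sym homotopic_paths_trans)
qed

text \<open>Well-definedness and injectivity are the two directions of
  \<open>loop_of_homotopic_iff\<close>, which come from lifting rewriting steps and from invariance
  of the holonomy, respectively. Surjectivity is \<open>path_edgy\<close>.\<close>

lemma fixed_points_iso:
  "raag pa.V pa.E\<lparr>carrier := fixed_points au.GR au.\<phi>\<rparr> \<cong> fundamental_group Q q" (is "?F \<cong> ?P")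
proof -
  define \<Psi> where "\<Psi> g = path_class Q (loop_of (SOME as. chain as base base \<and> chain_cls as = g))" for g
  have \<Psi>: "\<Psi> (chain_cls as) = path_class Q (loop_of as)" if "chain as base base" for as
  proof -
    let ?bs = "SOME bs. chain bs base base \<and> chain_cls bs = chain_cls as"
    have "chain ?bs base base \<and> chain_cls ?bs = chain_cls as" by (rule someI[of _ as]) (use that in simp)
    then show ?thesis unfolding \<Psi>_def using loop_of_homotopic_iff that by (intro path_class_eqI) blast
  qed
  have car: "carrier ?F = {chain_cls as | as. chain as base base}" using fixed_points_eq by simp
  have "\<Psi> \<in> hom ?F ?P"
  proof (rule homI)
    fix g assume "g \<in> carrier ?F"
    then obtain as where as: "chain as base base" "g = chain_cls as" unfolding car by blast
    show "\<Psi> g \<in> carrier ?P" unfolding as(2) \<Psi>[OF as(1)] carrier_fundamental_group loops_at_path_from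
      using path_from_loop_of[OF as(1)] by blast
    fix h assume "h \<in> carrier ?F"
    then obtain bs where bs: "chain bs base base" "h = chain_cls bs" unfolding car by blast
    have c: "chain (as @ bs) base base" using as bs chain_append by blast
    have "g \<otimes>\<^bsub>?F\<^esub> h = chain_cls (as @ bs)"
      using rg.cls_mult[OF enc_words[OF as(1)] enc_words[OF bs(1)]] as(2) bs(2) by simp
    then show "\<Psi> (g \<otimes>\<^bsub>?F\<^esub> h) = \<Psi> g \<otimes>\<^bsub>?P\<^esub> \<Psi> h"
      using \<Psi>[OF c] \<Psi>[OF as(1)] \<Psi>[OF bs(1)] as(2) bs(2) path_class_eqI[OF loop_of_append[OF as(1) bs(1)]]
        mult_fundamental_group[OF path_from_loop_of[OF as(1)] path_from_loop_of[OF bs(1)]] by simp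
  qed
  moreover have "inj_on \<Psi> (carrier ?F)"
  proof (rule inj_onI)
    fix g h assume "g \<in> carrier ?F" "h \<in> carrier ?F" and e: "\<Psi> g = \<Psi> h"
    then obtain as bs where s: "chain as base base" "g = chain_cls as" "chain bs base base" "h = chain_cls bs"
      unfolding car by blast
    have "homotopic_paths Q (loop_of as) (loop_of bs)"
      using e path_class_eqD[OF path_from_loop_of[OF s(3)]] unfolding s(2,4) \<Psi>[OF s(1)] \<Psi>[OF s(3)] by blast
    then show "g = h" using loop_of_homotopic_iff[OF s(1,3)] s(2,4) by simp
  qed
  moreover have "carrier ?P \<subseteq> \<Psi> ` carrier ?F"
  proof
    fix p assume "p \<in> carrier ?P"
    then obtain g where g: "path_from Q q q g" "p = path_class Q g" unfolding carrier_fundamental_group loops_at_path_from by blast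
    have "edgy q q g" using path_edgy[of g] g(1) by (simp add: path_from_def)
    then obtain as where as: "chain as base base" "homotopic_paths Q g (loop_of as)"
      unfolding edgy_def loop_of_def by blast
    have "p = \<Psi> (chain_cls as)" unfolding \<Psi>[OF as(1)] g(2) by (rule path_class_eqI[OF as(2)])
    then show "p \<in> \<Psi> ` carrier ?F" unfolding car using as(1) by blast
  qed
  ultimately have "\<Psi> \<in> iso ?F ?P" unfolding iso_def bij_betw_def hom_def by blast
  then show ?thesis unfolding is_iso_def by blast
qed

end

theorem proposition3:
  fixes Q :: "'a::topological_space set"
    and C :: "'c set"
    and cdim :: "'c \<Rightarrow> nat"
    and \<kappa> :: "'c \<Rightarrow> (nat \<Rightarrow> real) \<Rightarrow> 'a"
    and q :: 'a
  assumes "special_cube_complex Q C cdim \<kappa>"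
    and "compact Q"
    and "q \<in> Q"
  shows "\<exists>(V :: nat set) (E :: nat set set) R \<phi>.
    finite_simplicial_graph V E \<and>
    subgroup R (raag V E) \<and>
    finite (rcosets\<^bsub>raag V E\<^esub> R) \<and>
    \<phi> \<in> auto (raag V E\<lparr>carrier := R\<rparr>) \<and>
    (\<exists>n>0. \<phi> [^]\<^bsub>AutoGroup (raag V E\<lparr>carrier := R\<rparr>)\<^esub> (n::nat) =
       \<one>\<^bsub>AutoGroup (raag V E\<lparr>carrier := R\<rparr>)\<^esub>) \<and>
    coarse_median_preserving V E R \<phi> \<and>
    raag V E\<lparr>carrier := fixed_points (raag V E\<lparr>carrier := R\<rparr>) \<phi>\<rparr> \<cong> fundamental_group Q q"
proof -
  interpret special_cube_complex Q C cdim \<kappa> by (rule assms(1))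
  interpret based_special_cube_complex Q C cdim \<kappa> q
    by unfold_locales (use finite_cubes[OF assms(2)] assms(3) in auto)
  have "finite_simplicial_graph pa.V pa.E"
    using rg.finite_V rg.edges_sub unfolding finite_simplicial_graph_def by blast
  moreover have "\<exists>n>0. au.\<phi> [^]\<^bsub>AutoGroup au.GR\<^esub> (n::nat) = \<one>\<^bsub>AutoGroup au.GR\<^esub>"
    using au.\<phi>_finite_order by (intro exI[of _ 6]) simp
  ultimately show ?thesis
    using au.subgroup_R au.finite_rcosets_R au.\<phi>_auto au.\<phi>_coarse_median_preserving fixed_points_iso by blast
qed

end
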